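(* Let $\lambda$ be an uncountable regular cardinal, let $\mu>\lambda$ be inaccessible and let $\nu$ be any cardinal. Then $\mathrm{Col}(\lambda,{<}\mu)\times\mathrm{Add}(\lambda,\nu)$ forces that the game $G_\lambda(A)$ is determined for every subset $A$ of ${}^{\lambda}\lambda$ that is definable (by a first-order formula of set theory) from a parameter which is a function from $\lambda$ to $V$.
   Context: $\mathrm{Col}(\lambda,{<}\mu)$ is the Levy collapse (partial functions $p$ from $\mu\times\lambda$ to $\mu$ with $|p|<\lambda$ and $p(\alpha,\xi)<\alpha$, ordered by reverse inclusion). $\mathrm{Add}(\lambda,1)$ is the set of functions $p\colon\alpha\to\lambda$ with $\alpha<\lambda$, ordered by reverse inclusion, and $\mathrm{Add}(\lambda,\nu)$ is the ${<}\lambda$-support product of $\nu$ copies of it. The Banach–Mazur game $G_\lambda(A)$, for $A\subseteq{}^\lambda\lambda$: the players together build a strictly increasing (under $\subseteq$) sequence $\langle s_\alpha\mid\alpha<\lambda\rangle$ of elements of ${}^{<\lambda}\lambda$; player I plays $s_\alpha$ for even $\alpha$ (including $0$ and limit ordinals), player II plays $s_\alpha$ for odd $\alpha$. Player I wins if $\bigcup_{\alpha<\lambda}s_\alpha\in A$, otherwise player II wins. The game is determined if one of the players has a winning strategy. *)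

theory Defs
  imports Main
begin

section \<open>Formulas\<close>

text \<open>
  The formulas of the language of set theory, with de Bruijn indices for variables.  They are used
  for the axiom schemes and for definability, the two places where one quantifies over formulas.
\<close>

datatype fm =
    FMem nat nat
  | FEq nat nat
  | FNeg fm
  | FAnd fm fm
  | FAll fm

text \<open>
  Formulas whose free variables have been replaced by constants of type \<open>'v\<close>.  The constants are
  sets when such a formula is evaluated in the universe, and names when it is forced, so that
  \<open>'v form\<close> is the forcing language.  \<open>Ground x\<close> is its predicate ``\<open>x\<close> lies in the ground model
  \<open>V\<close>''; it is deliberately missing from \<open>fm\<close>.  Binding is by meta-level abstraction, which lets each
  set-theoretic notion be defined once and then be used both in \<open>V\<close> and in the forcing extension.
\<close>

datatype 'v form =
    Mem 'v 'v  (infix "\<^bold>\<in>" 50)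
  | Eq 'v 'v  (infix "\<^bold>=" 50)
  | Ground 'v
  | Neg "'v form"  ("\<^bold>\<not> _" [40] 40)
  | And "'v form" "'v form"  (infixr "\<^bold>\<and>" 35)
  | All "'v \<Rightarrow> 'v form"  (binder "\<^bold>\<forall>" 10)

definition Imp :: "'v form \<Rightarrow> 'v form \<Rightarrow> 'v form"  (infixr "\<^bold>\<longrightarrow>" 25) where
  "(\<phi> \<^bold>\<longrightarrow> \<psi>) = (\<^bold>\<not> (\<phi> \<^bold>\<and> \<^bold>\<not> \<psi>))"

definition Or :: "'v form \<Rightarrow> 'v form \<Rightarrow> 'v form"  (infixr "\<^bold>\<or>" 30) where
  "(\<phi> \<^bold>\<or> \<psi>) = (\<^bold>\<not> (\<^bold>\<not> \<phi> \<^bold>\<and> \<^bold>\<not> \<psi>))"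

definition Iff :: "'v form \<Rightarrow> 'v form \<Rightarrow> 'v form"  (infixr "\<^bold>\<longleftrightarrow>" 25) where
  "(\<phi> \<^bold>\<longleftrightarrow> \<psi>) = ((\<phi> \<^bold>\<longrightarrow> \<psi>) \<^bold>\<and> (\<psi> \<^bold>\<longrightarrow> \<phi>))"

definition Ex :: "('v \<Rightarrow> 'v form) \<Rightarrow> 'v form"  (binder "\<^bold>\<exists>" 10) where
  "(\<^bold>\<exists>x. \<phi> x) = (\<^bold>\<not> (\<^bold>\<forall>x. \<^bold>\<not> \<phi> x))"

primrec inst :: "fm \<Rightarrow> (nat \<Rightarrow> 'v) \<Rightarrow> 'v form" where
  "inst (FMem i j) e = (e i \<^bold>\<in> e j)"
| "inst (FEq i j) e = (e i \<^bold>= e j)"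
| "inst (FNeg \<phi>) e = (\<^bold>\<not> inst \<phi> e)"
| "inst (FAnd \<phi> \<psi>) e = (inst \<phi> e \<^bold>\<and> inst \<psi> e)"
| "inst (FAll \<phi>) e = (\<^bold>\<forall>x. inst \<phi> (case_nat x e))"

text \<open>Truth in the universe \<open>V\<close>, which is the type \<open>'v\<close> with membership relation \<open>E\<close>.\<close>

primrec sat :: "('v \<Rightarrow> 'v \<Rightarrow> bool) \<Rightarrow> 'v form \<Rightarrow> bool" where
  "sat E (x \<^bold>\<in> y) \<longleftrightarrow> E x y"
| "sat E (x \<^bold>= y) \<longleftrightarrow> x = y"
| "sat E (Ground x) \<longleftrightarrow> True"
| "sat E (\<^bold>\<not> \<phi>) \<longleftrightarrow> \<not> sat E \<phi>"
| "sat E (\<phi> \<^bold>\<and> \<psi>) \<longleftrightarrow> sat E \<phi> \<and> sat E \<psi>"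
| "sat E (All \<phi>) \<longleftrightarrow> (\<forall>x. sat E (\<phi> x))"

lemma sat_connectives [simp]:
  "sat E (\<phi> \<^bold>\<longrightarrow> \<psi>) \<longleftrightarrow> (sat E \<phi> \<longrightarrow> sat E \<psi>)"
  "sat E (\<phi> \<^bold>\<or> \<psi>) \<longleftrightarrow> (sat E \<phi> \<or> sat E \<psi>)"
  "sat E (\<phi> \<^bold>\<longleftrightarrow> \<psi>) \<longleftrightarrow> (sat E \<phi> \<longleftrightarrow> sat E \<psi>)"
  "sat E (Ex \<chi>) \<longleftrightarrow> (\<exists>x. sat E (\<chi> x))"
  by (auto simp: Imp_def Or_def Iff_def Ex_def)


section \<open>Models of ZFC\<close>

text \<open>
  Separation and Replacement are the first-order schemes, so \<open>E\<close> is an arbitrary (possibly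
  ill-founded) model of first-order ZFC.
\<close>

locale zfc_model =
  fixes E :: "'v \<Rightarrow> 'v \<Rightarrow> bool"  (infix "\<epsilon>" 50)
  assumes extensionality: "\<forall>x y. (\<forall>z. z \<epsilon> x \<longleftrightarrow> z \<epsilon> y) \<longrightarrow> x = y"
    and foundation: "\<forall>x. (\<exists>y. y \<epsilon> x) \<longrightarrow> (\<exists>y. y \<epsilon> x \<and> (\<forall>z. z \<epsilon> y \<longrightarrow> \<not> z \<epsilon> x))"
    and pairing: "\<forall>x y. \<exists>u. \<forall>z. z \<epsilon> u \<longleftrightarrow> z = x \<or> z = y"
    and union: "\<forall>x. \<exists>u. \<forall>z. z \<epsilon> u \<longleftrightarrow> (\<exists>y. y \<epsilon> x \<and> z \<epsilon> y)"
    and power_set: "\<forall>x. \<exists>u. \<forall>z. z \<epsilon> u \<longleftrightarrow> (\<forall>w. w \<epsilon> z \<longrightarrow> w \<epsilon> x)"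
    and infinity: "\<exists>x. (\<exists>y. y \<epsilon> x \<and> (\<forall>z. \<not> z \<epsilon> y)) \<and>
      (\<forall>y. y \<epsilon> x \<longrightarrow> (\<exists>u. u \<epsilon> x \<and> (\<forall>z. z \<epsilon> u \<longleftrightarrow> z \<epsilon> y \<or> z = y)))"
    and separation: "\<forall>\<phi> e x. \<exists>u. \<forall>z. z \<epsilon> u \<longleftrightarrow> z \<epsilon> x \<and> sat E (inst \<phi> (case_nat z e))"
    and replacement: "\<forall>\<phi> e x.
      (\<forall>z. z \<epsilon> x \<longrightarrow> (\<exists>!w. sat E (inst \<phi> (case_nat z (case_nat w e))))) \<longrightarrow>
      (\<exists>u. \<forall>w. w \<epsilon> u \<longleftrightarrow> (\<exists>z. z \<epsilon> x \<and> sat E (inst \<phi> (case_nat z (case_nat w e)))))"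
    and choice: "\<forall>x. (\<forall>y. y \<epsilon> x \<longrightarrow> (\<exists>z. z \<epsilon> y)) \<and>
      (\<forall>y y' z. y \<epsilon> x \<and> y' \<epsilon> x \<and> z \<epsilon> y \<and> z \<epsilon> y' \<longrightarrow> y = y') \<longrightarrow>
      (\<exists>c. \<forall>y. y \<epsilon> x \<longrightarrow> (\<exists>!z. z \<epsilon> y \<and> z \<epsilon> c))"


section \<open>Set-theoretic notions\<close>

definition Subset :: "'v \<Rightarrow> 'v \<Rightarrow> 'v form"  (infix "\<^bold>\<subseteq>" 50) where
  "(x \<^bold>\<subseteq> y) = (\<^bold>\<forall>z. z \<^bold>\<in> x \<^bold>\<longrightarrow> z \<^bold>\<in> y)"

definition StrictSubset :: "'v \<Rightarrow> 'v \<Rightarrow> 'v form"  (infix "\<^bold>\<subset>" 50) where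
  "(x \<^bold>\<subset> y) = (x \<^bold>\<subseteq> y \<^bold>\<and> \<^bold>\<not> x \<^bold>= y)"

definition NonEmpty :: "'v \<Rightarrow> 'v form" where
  "NonEmpty x = (\<^bold>\<exists>y. y \<^bold>\<in> x)"

definition IsUnorderedPair :: "'v \<Rightarrow> 'v \<Rightarrow> 'v \<Rightarrow> 'v form" where
  "IsUnorderedPair u x y = (\<^bold>\<forall>z. z \<^bold>\<in> u \<^bold>\<longleftrightarrow> z \<^bold>= x \<^bold>\<or> z \<^bold>= y)"

text \<open>\<open>u = (x, y) = {{x}, {x, y}}\<close>\<close>

definition IsPair :: "'v \<Rightarrow> 'v \<Rightarrow> 'v \<Rightarrow> 'v form" where
  "IsPair u x y = (\<^bold>\<forall>z. z \<^bold>\<in> u \<^bold>\<longleftrightarrow> IsUnorderedPair z x x \<^bold>\<or> IsUnorderedPair z x y)"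

text \<open>\<open>(x, y) \<in> r\<close>; for a function \<open>r\<close> this says \<open>r(x) = y\<close>.\<close>

definition PairIn :: "'v \<Rightarrow> 'v \<Rightarrow> 'v \<Rightarrow> 'v form" where
  "PairIn x y r = (\<^bold>\<exists>u. IsPair u x y \<^bold>\<and> u \<^bold>\<in> r)"

definition IsFunction :: "'v \<Rightarrow> 'v form" where
  "IsFunction f = ((\<^bold>\<forall>u. u \<^bold>\<in> f \<^bold>\<longrightarrow> (\<^bold>\<exists>x y. IsPair u x y)) \<^bold>\<and>
     (\<^bold>\<forall>x y y'. PairIn x y f \<^bold>\<and> PairIn x y' f \<^bold>\<longrightarrow> y \<^bold>= y'))"

definition FunctionOn :: "'v \<Rightarrow> 'v \<Rightarrow> 'v form" where
  "FunctionOn f a = (IsFunction f \<^bold>\<and> (\<^bold>\<forall>x. x \<^bold>\<in> a \<^bold>\<longleftrightarrow> (\<^bold>\<exists>y. PairIn x y f)))"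

definition FunctionTo :: "'v \<Rightarrow> 'v \<Rightarrow> 'v \<Rightarrow> 'v form" where
  "FunctionTo f a b = (FunctionOn f a \<^bold>\<and> (\<^bold>\<forall>x y. PairIn x y f \<^bold>\<longrightarrow> y \<^bold>\<in> b))"

definition Bijection :: "'v \<Rightarrow> 'v \<Rightarrow> 'v \<Rightarrow> 'v form" where
  "Bijection f a b = (FunctionTo f a b \<^bold>\<and>
     (\<^bold>\<forall>x x' y. PairIn x y f \<^bold>\<and> PairIn x' y f \<^bold>\<longrightarrow> x \<^bold>= x') \<^bold>\<and>
     (\<^bold>\<forall>y. y \<^bold>\<in> b \<^bold>\<longrightarrow> (\<^bold>\<exists>x. PairIn x y f)))"

definition Transitive :: "'v \<Rightarrow> 'v form" where
  "Transitive x = (\<^bold>\<forall>y. y \<^bold>\<in> x \<^bold>\<longrightarrow> y \<^bold>\<subseteq> x)"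

definition Ordinal :: "'v \<Rightarrow> 'v form" where
  "Ordinal x = (Transitive x \<^bold>\<and> (\<^bold>\<forall>y. y \<^bold>\<in> x \<^bold>\<longrightarrow> Transitive y))"

definition IsSuccessorOf :: "'v \<Rightarrow> 'v \<Rightarrow> 'v form" where
  "IsSuccessorOf y x = (\<^bold>\<forall>z. z \<^bold>\<in> y \<^bold>\<longleftrightarrow> z \<^bold>\<in> x \<^bold>\<or> z \<^bold>= x)"

definition LimitOrdinal :: "'v \<Rightarrow> 'v form" where
  "LimitOrdinal x = (Ordinal x \<^bold>\<and> NonEmpty x \<^bold>\<and> (\<^bold>\<forall>y. y \<^bold>\<in> x \<^bold>\<longrightarrow> (\<^bold>\<exists>z. z \<^bold>\<in> x \<^bold>\<and> y \<^bold>\<in> z)))"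

definition IsOmega :: "'v \<Rightarrow> 'v form" where
  "IsOmega w = (LimitOrdinal w \<^bold>\<and> (\<^bold>\<forall>x. x \<^bold>\<in> w \<^bold>\<longrightarrow> \<^bold>\<not> LimitOrdinal x))"

definition Cardinal :: "'v \<Rightarrow> 'v form" where
  "Cardinal k = (Ordinal k \<^bold>\<and> (\<^bold>\<forall>a. a \<^bold>\<in> k \<^bold>\<longrightarrow> \<^bold>\<not> (\<^bold>\<exists>f. Bijection f a k)))"

text \<open>\<open>|x| < k\<close>, for a cardinal \<open>k\<close>\<close>

definition SizeLess :: "'v \<Rightarrow> 'v \<Rightarrow> 'v form" where
  "SizeLess x k = (\<^bold>\<exists>a. a \<^bold>\<in> k \<^bold>\<and> (\<^bold>\<exists>f. Bijection f a x))"

definition Uncountable :: "'v \<Rightarrow> 'v form" where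
  "Uncountable k = (\<^bold>\<exists>w. IsOmega w \<^bold>\<and> w \<^bold>\<in> k)"

text \<open>A cardinal is infinite iff it is a limit ordinal.\<close>

definition RegularCardinal :: "'v \<Rightarrow> 'v form" where
  "RegularCardinal k = (Cardinal k \<^bold>\<and> LimitOrdinal k \<^bold>\<and>
     (\<^bold>\<forall>a f. a \<^bold>\<in> k \<^bold>\<and> FunctionTo f a k \<^bold>\<longrightarrow>
        (\<^bold>\<exists>b. b \<^bold>\<in> k \<^bold>\<and> (\<^bold>\<forall>x y. PairIn x y f \<^bold>\<longrightarrow> y \<^bold>\<in> b))))"

definition StrongLimit :: "'v \<Rightarrow> 'v form" where
  "StrongLimit m = (\<^bold>\<forall>k. k \<^bold>\<in> m \<^bold>\<and> Cardinal k \<^bold>\<longrightarrow>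
     (\<^bold>\<exists>u. (\<^bold>\<forall>z. z \<^bold>\<in> u \<^bold>\<longleftrightarrow> z \<^bold>\<subseteq> k) \<^bold>\<and> SizeLess u m))"

definition Inaccessible :: "'v \<Rightarrow> 'v form" where
  "Inaccessible m = (RegularCardinal m \<^bold>\<and> Uncountable m \<^bold>\<and> StrongLimit m)"

text \<open>\<open>s \<in> \<^sup><\<^sup>ll\<close>\<close>

definition ShortSequence :: "'v \<Rightarrow> 'v \<Rightarrow> 'v form" where
  "ShortSequence l s = (\<^bold>\<exists>a. a \<^bold>\<in> l \<^bold>\<and> FunctionTo s a l)"


section \<open>The forcing notions\<close>

text \<open>
  A forcing notion is a set \<open>P\<close> of conditions together with the set \<open>R\<close> of all pairs \<open>(q, p)\<close> of
  conditions such that \<open>q\<close> is stronger than or equal to \<open>p\<close>.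
\<close>

definition IsOrderOn :: "('v \<Rightarrow> 'v \<Rightarrow> 'v form) \<Rightarrow> 'v \<Rightarrow> 'v \<Rightarrow> 'v form" where
  "IsOrderOn le P R = (\<^bold>\<forall>u. u \<^bold>\<in> R \<^bold>\<longleftrightarrow> (\<^bold>\<exists>q p. IsPair u q p \<^bold>\<and> q \<^bold>\<in> P \<^bold>\<and> p \<^bold>\<in> P \<^bold>\<and> le q p))"

definition LevyCondition :: "'v \<Rightarrow> 'v \<Rightarrow> 'v \<Rightarrow> 'v form" where
  "LevyCondition l m p = (IsFunction p \<^bold>\<and>
     (\<^bold>\<forall>z b. PairIn z b p \<^bold>\<longrightarrow> b \<^bold>\<in> m \<^bold>\<and> (\<^bold>\<exists>a x. IsPair z a x \<^bold>\<and> a \<^bold>\<in> m \<^bold>\<and> x \<^bold>\<in> l \<^bold>\<and> b \<^bold>\<in> a)) \<^bold>\<and>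
     SizeLess p l)"

definition IsLevyCollapse :: "'v \<Rightarrow> 'v \<Rightarrow> 'v \<Rightarrow> 'v \<Rightarrow> 'v form" where
  "IsLevyCollapse l m P R = ((\<^bold>\<forall>p. p \<^bold>\<in> P \<^bold>\<longleftrightarrow> LevyCondition l m p) \<^bold>\<and>
     IsOrderOn (\<lambda>q p. p \<^bold>\<subseteq> q) P R)"

text \<open>
  The conditions of \<open>Add(l, 1)\<close> are the elements of \<open>\<^sup><\<^sup>ll\<close>, with the empty function as weakest condition;
  the support of \<open>p\<close> in the product consists of the \<open>i < n\<close> with \<open>p(i)\<close> nonempty.
\<close>

definition AddCondition :: "'v \<Rightarrow> 'v \<Rightarrow> 'v \<Rightarrow> 'v form" where
  "AddCondition l n p = (FunctionOn p n \<^bold>\<and> (\<^bold>\<forall>i s. PairIn i s p \<^bold>\<longrightarrow> ShortSequence l s) \<^bold>\<and>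
     (\<^bold>\<exists>S. (\<^bold>\<forall>i. i \<^bold>\<in> S \<^bold>\<longleftrightarrow> (\<^bold>\<exists>s. PairIn i s p \<^bold>\<and> NonEmpty s)) \<^bold>\<and> SizeLess S l))"

definition IsAdd :: "'v \<Rightarrow> 'v \<Rightarrow> 'v \<Rightarrow> 'v \<Rightarrow> 'v form" where
  "IsAdd l n P R = ((\<^bold>\<forall>p. p \<^bold>\<in> P \<^bold>\<longleftrightarrow> AddCondition l n p) \<^bold>\<and>
     IsOrderOn (\<lambda>q p. \<^bold>\<forall>i t s. PairIn i t q \<^bold>\<and> PairIn i s p \<^bold>\<longrightarrow> s \<^bold>\<subseteq> t) P R)"

definition IsProductForcing :: "'v \<Rightarrow> 'v \<Rightarrow> 'v \<Rightarrow> 'v \<Rightarrow> 'v \<Rightarrow> 'v \<Rightarrow> 'v form" where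
  "IsProductForcing P1 R1 P2 R2 P R =
     ((\<^bold>\<forall>p. p \<^bold>\<in> P \<^bold>\<longleftrightarrow> (\<^bold>\<exists>p1 p2. IsPair p p1 p2 \<^bold>\<and> p1 \<^bold>\<in> P1 \<^bold>\<and> p2 \<^bold>\<in> P2)) \<^bold>\<and>
      IsOrderOn (\<lambda>q p. \<^bold>\<exists>q1 q2 p1 p2. IsPair q q1 q2 \<^bold>\<and> IsPair p p1 p2 \<^bold>\<and>
        PairIn q1 p1 R1 \<^bold>\<and> PairIn q2 p2 R2) P R)"


section \<open>The forcing relation\<close>

text \<open>
  Every set \<open>x\<close> serves as a \<open>P\<close>-name: its interpretation by a generic \<open>G\<close> consists of the
  interpretations of those \<open>c\<close> for which \<open>(c, s) \<in> x\<close> for some \<open>s \<in> P \<inter> G\<close>; elements of \<open>x\<close> that are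
  not of this form are ignored.  The atomic case of the forcing relation is the usual recursion:

  \<^item> \<open>p\<close> forces \<open>x \<in> y\<close> iff the \<open>r\<close> such that \<open>r \<le> s\<close> and \<open>r\<close> forces \<open>x = c\<close>, for some \<open>(c, s) \<in> y\<close>,
    are dense below \<open>p\<close>;
  \<^item> \<open>p\<close> forces \<open>x \<subseteq> y\<close> iff every \<open>q \<le> p, s\<close> with \<open>(c, s) \<in> x\<close> forces \<open>c \<in> y\<close>.

  In the next three definitions \<open>X q u v\<close> stands for ``\<open>q\<close> forces \<open>u = v\<close>''.
\<close>

definition below :: "('v \<Rightarrow> 'v \<Rightarrow> bool) \<Rightarrow> 'v \<Rightarrow> 'v \<Rightarrow> 'v \<Rightarrow> 'v \<Rightarrow> bool" where
  "below E P R q p \<longleftrightarrow> E q P \<and> E p P \<and> sat E (PairIn q p R)"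

definition mem_step ::
  "('v \<Rightarrow> 'v \<Rightarrow> bool) \<Rightarrow> 'v \<Rightarrow> 'v \<Rightarrow> ('v \<Rightarrow> 'v \<Rightarrow> 'v \<Rightarrow> bool) \<Rightarrow> 'v \<Rightarrow> 'v \<Rightarrow> 'v \<Rightarrow> bool" where
  "mem_step E P R X p x y \<longleftrightarrow> (\<forall>q. below E P R q p \<longrightarrow>
     (\<exists>r c s. below E P R r q \<and> sat E (PairIn c s y) \<and> below E P R r s \<and> X r x c))"

definition subset_step ::
  "('v \<Rightarrow> 'v \<Rightarrow> bool) \<Rightarrow> 'v \<Rightarrow> 'v \<Rightarrow> ('v \<Rightarrow> 'v \<Rightarrow> 'v \<Rightarrow> bool) \<Rightarrow> 'v \<Rightarrow> 'v \<Rightarrow> 'v \<Rightarrow> bool" where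
  "subset_step E P R X p x y \<longleftrightarrow> (\<forall>q c s. below E P R q p \<and> sat E (PairIn c s x) \<and> below E P R q s \<longrightarrow>
     mem_step E P R X q c y)"

definition eq_step ::
  "('v \<Rightarrow> 'v \<Rightarrow> bool) \<Rightarrow> 'v \<Rightarrow> 'v \<Rightarrow> ('v \<Rightarrow> 'v \<Rightarrow> 'v \<Rightarrow> bool) \<Rightarrow> 'v \<Rightarrow> 'v \<Rightarrow> 'v \<Rightarrow> bool" where
  "eq_step E P R X p x y \<longleftrightarrow> subset_step E P R X p x y \<and> subset_step E P R X p y x"

definition TripleIn :: "'v \<Rightarrow> 'v \<Rightarrow> 'v \<Rightarrow> 'v \<Rightarrow> 'v form" where
  "TripleIn x y z r = (\<^bold>\<exists>u. IsPair u y z \<^bold>\<and> PairIn x u r)"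

text \<open>
  Since \<open>E\<close> may be ill-founded, the recursion has to take place inside \<open>V\<close>: \<open>F\<close> is a set which solves
  the recursion for all names in a transitive set \<open>T\<close>.
\<close>

definition forces_eq :: "('v \<Rightarrow> 'v \<Rightarrow> bool) \<Rightarrow> 'v \<Rightarrow> 'v \<Rightarrow> 'v \<Rightarrow> 'v \<Rightarrow> 'v \<Rightarrow> bool" where
  "forces_eq E P R p x y \<longleftrightarrow> (\<exists>T F. sat E (Transitive T) \<and> E x T \<and> E y T \<and>
     (\<forall>q u v. E q P \<and> E u T \<and> E v T \<longrightarrow>
        (sat E (TripleIn q u v F) \<longleftrightarrow> eq_step E P R (\<lambda>q u v. sat E (TripleIn q u v F)) q u v)) \<and>
     sat E (TripleIn p x y F))"

definition forces_mem :: "('v \<Rightarrow> 'v \<Rightarrow> bool) \<Rightarrow> 'v \<Rightarrow> 'v \<Rightarrow> 'v \<Rightarrow> 'v \<Rightarrow> 'v \<Rightarrow> bool" where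
  "forces_mem E P R = mem_step E P R (forces_eq E P R)"

text \<open>
  \<open>n\<close> is the canonical name of \<open>x\<close>, that is, the set of all \<open>(m, p)\<close> such that \<open>m\<close> is the canonical
  name of an element of \<open>x\<close> and \<open>p \<in> P\<close>.  Again the recursion takes place inside \<open>V\<close>.
\<close>

definition IsCheckName :: "'v \<Rightarrow> 'v \<Rightarrow> 'v \<Rightarrow> 'v form" where
  "IsCheckName P n x = (\<^bold>\<exists>T g. Transitive T \<^bold>\<and> x \<^bold>\<in> T \<^bold>\<and> FunctionOn g T \<^bold>\<and>
     (\<^bold>\<forall>y m. PairIn y m g \<^bold>\<longrightarrow>
        (\<^bold>\<forall>u. u \<^bold>\<in> m \<^bold>\<longleftrightarrow> (\<^bold>\<exists>z k p. z \<^bold>\<in> y \<^bold>\<and> PairIn z k g \<^bold>\<and> p \<^bold>\<in> P \<^bold>\<and> IsPair u k p))) \<^bold>\<and>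
     PairIn x n g)"

primrec forces :: "('v \<Rightarrow> 'v \<Rightarrow> bool) \<Rightarrow> 'v \<Rightarrow> 'v \<Rightarrow> 'v form \<Rightarrow> 'v \<Rightarrow> bool" where
  "forces E P R (x \<^bold>\<in> y) p \<longleftrightarrow> forces_mem E P R p x y"
| "forces E P R (x \<^bold>= y) p \<longleftrightarrow> forces_eq E P R p x y"
| "forces E P R (Ground x) p \<longleftrightarrow> (\<forall>q. below E P R q p \<longrightarrow>
     (\<exists>r a n. below E P R r q \<and> sat E (IsCheckName P n a) \<and> forces_eq E P R r x n))"
| "forces E P R (\<^bold>\<not> \<phi>) p \<longleftrightarrow> (\<forall>q. below E P R q p \<longrightarrow> \<not> forces E P R \<phi> q)"
| "forces E P R (\<phi> \<^bold>\<and> \<psi>) p \<longleftrightarrow> forces E P R \<phi> p \<and> forces E P R \<psi> p"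
| "forces E P R (All \<phi>) p \<longleftrightarrow> (\<forall>x. forces E P R (\<phi> x) p)"

text \<open>A forcing notion forces \<open>\<phi>\<close> if all of its conditions do (equivalently, its weakest one).\<close>

definition notion_forces :: "('v \<Rightarrow> 'v \<Rightarrow> bool) \<Rightarrow> 'v \<Rightarrow> 'v \<Rightarrow> 'v form \<Rightarrow> bool" where
  "notion_forces E P R \<phi> \<longleftrightarrow> (\<forall>p. E p P \<longrightarrow> forces E P R \<phi> p)"


section \<open>The Banach--Mazur game\<close>

text \<open>
  An ordinal \<open>a\<close> is even iff it belongs to the set \<open>e\<close> of even ordinals \<open>\<le> a\<close>, where \<open>b\<close> is even iff it
  is not the successor of an even ordinal (so \<open>0\<close> and limits are even).
\<close>

definition Even :: "'v \<Rightarrow> 'v form" where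
  "Even a = (\<^bold>\<exists>e. (\<^bold>\<forall>b. b \<^bold>\<in> a \<^bold>\<or> b \<^bold>= a \<^bold>\<longrightarrow>
       (b \<^bold>\<in> e \<^bold>\<longleftrightarrow> \<^bold>\<not> (\<^bold>\<exists>c. IsSuccessorOf b c \<^bold>\<and> c \<^bold>\<in> e))) \<^bold>\<and> a \<^bold>\<in> e)"

definition Odd :: "'v \<Rightarrow> 'v form" where
  "Odd a = (\<^bold>\<not> Even a)"

text \<open>\<open>t\<close> is a play of length \<open>a\<close>; runs of the game are the plays of length \<open>l\<close>.\<close>

definition Play :: "'v \<Rightarrow> 'v \<Rightarrow> 'v \<Rightarrow> 'v form" where
  "Play l a t = (FunctionOn t a \<^bold>\<and> (\<^bold>\<forall>b s. PairIn b s t \<^bold>\<longrightarrow> ShortSequence l s) \<^bold>\<and>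
     (\<^bold>\<forall>b c s s'. b \<^bold>\<in> c \<^bold>\<and> PairIn b s t \<^bold>\<and> PairIn c s' t \<^bold>\<longrightarrow> s \<^bold>\<subset> s'))"

definition LegalMove :: "'v \<Rightarrow> 'v \<Rightarrow> 'v \<Rightarrow> 'v form" where
  "LegalMove l t s = (ShortSequence l s \<^bold>\<and> (\<^bold>\<forall>b s'. PairIn b s' t \<^bold>\<longrightarrow> s' \<^bold>\<subset> s))"

text \<open>
  A strategy for the player who moves at the stages \<open>a\<close> with \<open>turn a\<close> assigns a legal move to every
  play of such a length.
\<close>

definition Strategy :: "'v \<Rightarrow> ('v \<Rightarrow> 'v form) \<Rightarrow> 'v \<Rightarrow> 'v form" where
  "Strategy l turn f = (IsFunction f \<^bold>\<and>
     (\<^bold>\<forall>t. (\<^bold>\<exists>s. PairIn t s f) \<^bold>\<longleftrightarrow> (\<^bold>\<exists>a. a \<^bold>\<in> l \<^bold>\<and> turn a \<^bold>\<and> Play l a t)) \<^bold>\<and>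
     (\<^bold>\<forall>t s. PairIn t s f \<^bold>\<longrightarrow> LegalMove l t s))"

definition IsRestriction :: "'v \<Rightarrow> 'v \<Rightarrow> 'v \<Rightarrow> 'v form" where
  "IsRestriction t r a = (\<^bold>\<forall>u. u \<^bold>\<in> t \<^bold>\<longleftrightarrow> u \<^bold>\<in> r \<^bold>\<and> (\<^bold>\<exists>b s. b \<^bold>\<in> a \<^bold>\<and> IsPair u b s))"

definition RunAccordingTo :: "'v \<Rightarrow> ('v \<Rightarrow> 'v form) \<Rightarrow> 'v \<Rightarrow> 'v \<Rightarrow> 'v form" where
  "RunAccordingTo l turn f r = (Play l l r \<^bold>\<and>
     (\<^bold>\<forall>a t s. a \<^bold>\<in> l \<^bold>\<and> turn a \<^bold>\<and> IsRestriction t r a \<^bold>\<and> PairIn a s r \<^bold>\<longrightarrow> PairIn t s f))"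

definition OutcomeIn :: "'v \<Rightarrow> 'v \<Rightarrow> 'v form" where
  "OutcomeIn A r = (\<^bold>\<exists>x. x \<^bold>\<in> A \<^bold>\<and> (\<^bold>\<forall>u. u \<^bold>\<in> x \<^bold>\<longleftrightarrow> (\<^bold>\<exists>a s. PairIn a s r \<^bold>\<and> u \<^bold>\<in> s)))"

definition PlayerIWins :: "'v \<Rightarrow> 'v \<Rightarrow> 'v form" where
  "PlayerIWins l A = (\<^bold>\<exists>f. Strategy l Even f \<^bold>\<and>
     (\<^bold>\<forall>r. RunAccordingTo l Even f r \<^bold>\<longrightarrow> OutcomeIn A r))"

definition PlayerIIWins :: "'v \<Rightarrow> 'v \<Rightarrow> 'v form" where
  "PlayerIIWins l A = (\<^bold>\<exists>f. Strategy l Odd f \<^bold>\<and>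
     (\<^bold>\<forall>r. RunAccordingTo l Odd f r \<^bold>\<longrightarrow> \<^bold>\<not> OutcomeIn A r))"

definition Determined :: "'v \<Rightarrow> 'v \<Rightarrow> 'v form" where
  "Determined l A = (PlayerIWins l A \<^bold>\<or> PlayerIIWins l A)"


section \<open>Definability\<close>

definition FunctionToGround :: "'v \<Rightarrow> 'v \<Rightarrow> 'v form" where
  "FunctionToGround f a = (FunctionOn f a \<^bold>\<and> (\<^bold>\<forall>x y. PairIn x y f \<^bold>\<longrightarrow> Ground y))"

text \<open>
  \<open>A = {x \<in> \<^sup>ll | \<phi>(x, f)}\<close>.  The variable with index \<open>0\<close> denotes \<open>x\<close> and all others denote \<open>f\<close>, so that
  no further parameters can enter.
\<close>

definition DefinedBy :: "fm \<Rightarrow> 'v \<Rightarrow> 'v \<Rightarrow> 'v \<Rightarrow> 'v form" where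
  "DefinedBy \<phi> f l A = (\<^bold>\<forall>x. x \<^bold>\<in> A \<^bold>\<longleftrightarrow> FunctionTo x l l \<^bold>\<and> inst \<phi> (case_nat x (\<lambda>_. f)))"

end

(* By the downward Loewenheim-Skolem theorem the model may be assumed countable, so that generic filters
   exist and forcing can be studied in extensions. Up to density the forcing notion is a poset of partial
   functions of size < lam with many columns, and a function f from lam to V has a name which involves only
   a set X of fewer than mu columns.

   Let A be defined from f. A name x for an element of A is free at q if q has an extension on the columns
   in X below which, for some s, every extension of s remains a possible initial segment of x, whatever is
   decided on X. If for no x there is a condition in the generic filter at all of whose extensions x is
   free, then player II wins: he can always play a sequence which a condition on X in the generic filter
   excludes as an initial segment of x.

   Otherwise fix such a name x, with support Y of size < mu, and such a condition. Player I uses a column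
   outside of Y to find conditions on Y that force x to extend the play so far, and encodes them into his
   moves. Suppose that a condition p2 forces the outcome of a run of this strategy not to be in A. The
   conditions which decide an initial segment of the run, together with the conditions encoded in that
   segment, form a lam-closed poset of size < mu, which has two projections to the given forcing. Another
   column absorbs this poset along both projections. This yields two generic filters with the same extension
   and the same part on X, one containing p2, such that the outcome of the run in the one is the value of x
   in the other. As f has the same value for both, the outcome is in A, a contradiction. *)
theory Submission
  imports Defs "HOL-Library.Countable_Set"
begin

section \<open>Definable classes\<close>

text \<open>The model may be ill-founded, so nothing can be done by recursion on \<open>E\<close>
  from outside: names are not evaluated, and the extension is the quotient of the names by forced
  equality. Separation, Replacement and genericity apply to definable classes only, so each class
  and each property of the extension comes with a definability proof (\<open>D\<close>,
  \<open>Dt\<close>, \<open>DG\<close>) derived from closure rules. ZFC is not verified in the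
  extension. Extensionality, pairing and comprehension over ground model sets are available there,
  but no choice; so every strategy selects its moves by their first code in a generic column. The
  conditions behind the moves of player I must be recoverable from the moves, or else segments of a
  run would not determine them; therefore each such move ends with the place of its code.
  Inaccessibility is used twice: over few columns there are few conditions (\<open>bd_FX\<close>),
  and outside any few columns there is one wide enough to code a given small set
  (\<open>many\<close>).\<close>

primrec ren :: "(nat => nat) => fm => fm" where
  "ren f (FMem i j) = FMem (f i) (f j)"
| "ren f (FEq i j) = FEq (f i) (f j)"
| "ren f (FNeg p) = FNeg (ren f p)"
| "ren f (FAnd p q) = FAnd (ren f p) (ren f q)"
| "ren f (FAll p) = FAll (ren (case_nat 0 (%i. Suc (f i))) p)"

lemma case_nat_ren: "(%i. case_nat x e (case_nat 0 (%i. Suc (f i)) i)) = case_nat x (%i. e (f i))"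
  by (auto split: nat.split)

lemma inst_ren: "inst (ren f p) e = inst p (%i. e (f i))"
  by (induction p arbitrary: f e) (simp_all add: case_nat_ren)

text \<open>The environment and the parameters are interleaved, so that a formula can refer to arbitrarily many of each.\<close>

definition mix :: "(nat => 'v) => (nat => 'v) => nat => 'v" where
  "mix e c i = (if even i then e (i div 2) else c (i div 2))"

text \<open>\<open>dfe\<close> is definability with parameters of predicates on environments; from \<open>D\<close> on the only context is a
  single element of the model, several variables being coded by iterated pairs.\<close>

definition dfe :: "('v => 'v => bool) => ((nat => 'v) => bool) => bool" where
  "dfe E Q = (EX p c. ALL e. Q e = sat E (inst p (mix e c)))"

lemma dfeI: "(!!e. Q e = sat E (inst p (mix e c))) ==> dfe E Q"
  unfolding dfe_def by blast

lemma dfe_mem: "dfe E (%e. E (e i) (e j))"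
  by (rule dfeI[where p = "FMem (2*i) (2*j)"]) (simp add: mix_def)

lemma dfe_eq: "dfe E (%e. e i = e j)"
  by (rule dfeI[where p = "FEq (2*i) (2*j)"]) (simp add: mix_def)

lemma dfe_not: "dfe E Q ==> dfe E (%e. ~ Q e)"
  unfolding dfe_def by (metis inst.simps(3) sat.simps(4))

text \<open>Two parameter sequences are interleaved into one, which \<open>mix\<close> interleaves
  with the environment: parameter \<open>k\<close> of the first then has index
  \<open>4 * k + 1\<close>, and of the second \<open>4 * k + 3\<close>.\<close>

lemma mix_l: "(%i. mix e (mix c d) (if even i then i else 4 * (i div 2) + 1)) = mix e c"
  by (auto simp: mix_def fun_eq_iff elim!: oddE)

lemma mix_r: "(%i. mix e (mix c d) (if even i then i else 4 * (i div 2) + 3)) = mix e d"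
proof -
  have "(4 * k + 3) div 2 = 2 * k + (1::nat)" "odd (4 * k + (3::nat))" for k by presburger+
  thus ?thesis by (auto simp: mix_def fun_eq_iff elim!: oddE)
qed

lemma dfe_and: assumes "dfe E Q" "dfe E R" shows "dfe E (%e. Q e & R e)"
proof -
  obtain p c q d where "ALL e. Q e = sat E (inst p (mix e c))" "ALL e. R e = sat E (inst q (mix e d))"
    using assms unfolding dfe_def by blast
  thus ?thesis
    by (intro dfeI[where p = "FAnd (ren (%i. if even i then i else 4 * (i div 2) + 1) p)
        (ren (%i. if even i then i else 4 * (i div 2) + 3) q)" and c = "mix c d"])
      (simp add: inst_ren mix_l mix_r)
qed

lemma dfe_all: assumes "dfe E Q" shows "dfe E (%e. ALL x. Q (case_nat x e))"
proof -
  obtain p c where p: "ALL e. Q e = sat E (inst p (mix e c))" using assms unfolding dfe_def by blast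
  \<comment> \<open>The bound variable moves every environment slot of \<open>mix\<close> up by two,
    but the whole interleaved sequence only by one. So slot \<open>2 * k\<close> with
    \<open>k > 0\<close> is renamed to \<open>2 * k - 1\<close>, and a parameter at an odd
    \<open>i\<close> to \<open>Suc i\<close>.\<close>
  have "(%i. case_nat x (mix e c) (if even i then i div 2 * 2 - (if i = 0 then 0 else 1) else Suc i)) = mix (case_nat x e) c" for x e
    by (auto simp: mix_def fun_eq_iff elim!: evenE oddE split: nat.split) (metis double_not_eq_Suc_double)
  thus ?thesis
    by (intro dfeI[where p = "FAll (ren (%i. if even i then i div 2 * 2 - (if i = 0 then 0 else 1) else Suc i) p)" and c = c])
      (simp add: p inst_ren)
qed

lemma dfe_eqc: "dfe E (%e. e i = a)"
  by (rule dfeI[where p = "FEq (2*i) 1" and c = "%_. a"]) (simp add: mix_def)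

lemma dfe_var: assumes "dfe E Q" shows "dfe E (%e. Q (%i. e (f i)))"
proof -
  obtain p c where p: "ALL e. Q e = sat E (inst p (mix e c))" using assms unfolding dfe_def by blast
  have "(%i. mix e c (if even i then 2 * f (i div 2) else i)) = mix (%i. e (f i)) c" for e
    by (auto simp: mix_def fun_eq_iff)
  thus ?thesis
    by (intro dfeI[where p = "ren (%i. if even i then 2 * f (i div 2) else i) p" and c = c]) (simp add: p inst_ren)
qed


lemma dfe_all': "dfe E (%e. B (e 0) (%i. e (Suc i))) ==> dfe E (%e. ALL x. B x e)"
  by (drule dfe_all) simp

lemma dfe_imp: "dfe E Q ==> dfe E R ==> dfe E (%e. Q e --> R e)"
  using dfe_not[OF dfe_and[OF _ dfe_not, of E Q R]] by simp

lemma dfe_or: "dfe E Q ==> dfe E R ==> dfe E (%e. Q e | R e)"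
  using dfe_imp[OF dfe_not, of E Q R] by (simp add: disj_imp)

lemma dfe_iff: "dfe E Q ==> dfe E R ==> dfe E (%e. Q e = R e)"
  using dfe_and[OF dfe_imp dfe_imp, of E Q R R Q] by (simp add: iff_conv_conj_imp)

lemma dfe_ex': assumes "dfe E (%e. B (e 0) (%i. e (Suc i)))" shows "dfe E (%e. EX x. B x e)"
  using dfe_not[OF dfe_all'[of E "%x e. ~ B x e"]] dfe_not[OF assms] by simp

lemmas dfes = dfe_mem dfe_eq dfe_eqc dfe_not dfe_and dfe_or dfe_imp dfe_iff dfe_all' dfe_ex'

section \<open>Pairs and functions\<close>

text \<open>Instantiated twice: with the model and with the generic extension, for which of the
  axioms only these two are established.\<close>

locale extp =
  fixes E :: "'v => 'v => bool" (infix "<:" 50)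
  assumes exten: "(!!z. z <: x = (z <: y)) ==> x = y"
    and pairax: "EX u. ALL z. z <: u = (z = x | z = y)"
begin

definition up :: "'v => 'v => 'v" where "up x y = (THE u. ALL z. z <: u = (z = x | z = y))"
definition pr :: "'v => 'v => 'v" where "pr x y = up (up x x) (up x y)"
definition pf :: "'v => 'v" where "pf p = (THE x. EX y. p = pr x y)"
definition ps :: "'v => 'v" where "ps p = (THE y. EX x. p = pr x y)"

lemma mem_up [simp]: "z <: up x y = (z = x | z = y)"
proof -
  obtain u where u: "ALL z. z <: u = (z = x | z = y)" using pairax by blast
  have "ALL z. z <: up x y = (z = x | z = y)"
    unfolding up_def by (rule theI[of _ u]) (use u exten in blast)+
  thus ?thesis by blast
qed

lemma sat_up [simp]: "sat E (IsUnorderedPair u x y) = (u = up x y)"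
  unfolding IsUnorderedPair_def by (auto intro: exten)

lemma sat_IsPair [simp]: "sat E (IsPair u x y) = (u = pr x y)"
  unfolding IsPair_def pr_def by (auto intro: exten)

lemma up_eq: "up x y = up a b ==> (x = a & y = b) | (x = b & y = a)"
  using mem_up[of x x y] mem_up[of y x y] mem_up[of a x y] mem_up[of b x y] by (auto simp del: mem_up simp: mem_up[of _ a b])

lemma pr_eq [simp]: "(pr x y = pr a b) = (x = a & y = b)"
  unfolding pr_def using up_eq[of "up x x" "up x y" "up a a" "up a b"] up_eq[of x x a a] up_eq[of x y a b]
    up_eq[of x x a b] up_eq[of x y a a] by auto

lemma pf_pr [simp]: "pf (pr x y) = x" and ps_pr [simp]: "ps (pr x y) = y"
  unfolding pf_def ps_def by auto

lemma sat_PairIn [simp]: "sat E (PairIn x y r) = (pr x y <: r)"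
  unfolding PairIn_def by simp

lemma sat_Subset [simp]: "sat E (Subset x y) = (ALL z. z <: x --> z <: y)"
  unfolding Subset_def by simp

lemma sat_StrictSubset [simp]: "sat E (StrictSubset x y) = ((ALL z. z <: x --> z <: y) & x ~= y)"
  unfolding StrictSubset_def by simp

lemma sat_NonEmpty [simp]: "sat E (NonEmpty x) = (EX z. z <: x)"
  unfolding NonEmpty_def by simp

definition isf :: "'v => bool" where
  "isf f = ((ALL u. u <: f --> (EX x y. u = pr x y)) & (ALL x y z. pr x y <: f --> pr x z <: f --> y = z))"

definition fon :: "'v => 'v => bool" where "fon f a = (isf f & (ALL x. x <: a = (EX y. pr x y <: f)))"

lemma sat_IsFunction [simp]: "sat E (IsFunction f) = isf f"
  unfolding IsFunction_def isf_def by auto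

lemma sat_FunctionOn [simp]: "sat E (FunctionOn f a) = fon f a"
  unfolding FunctionOn_def fon_def by auto

definition fto :: "'v => 'v => 'v => bool" where "fto f a b = (fon f a & (ALL x y. pr x y <: f --> y <: b))"

lemma sat_FunctionTo [simp]: "sat E (FunctionTo f a b) = fto f a b"
  unfolding FunctionTo_def fto_def by auto

definition bij :: "'v => 'v => 'v => bool" where
  "bij f a b = (fto f a b & (ALL x z y. pr x y <: f --> pr z y <: f --> x = z) & (ALL y. y <: b --> (EX x. pr x y <: f)))"

lemma sat_Bijection [simp]: "sat E (Bijection f a b) = bij f a b"
  unfolding Bijection_def bij_def by auto

text \<open>Uniqueness is part of the description, so that without it the value is the fixed
  \<open>THE y. False\<close>. In this guarded form descriptions are definable terms
  (\<open>Dt_The\<close>).\<close>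

definition ap :: "'v => 'v => 'v" where "ap f x = (THE y. (EX! w. pr x w <: f) & pr x y <: f)"

lemma isf_ap: "isf f ==> pr x y <: f ==> ap f x = y"
  unfolding ap_def isf_def by (rule the_equality) blast+

lemma isf_eq: "isf f ==> isf g ==> (!!x y. pr x y <: f = (pr x y <: g)) ==> f = g"
  unfolding isf_def by (rule exten) blast

lemma fon_ap: "fon f a ==> x <: a ==> pr x (ap f x) <: f"
  unfolding fon_def by (metis isf_ap)

lemma fon_iff: "fon f a ==> pr x y <: f = (x <: a & y = ap f x)"
  unfolding fon_def by (metis isf_ap)

lemma fon_eq: "fon f a ==> fon g a ==> (!!x. x <: a ==> ap f x = ap g x) ==> f = g"
proof (rule isf_eq)
  assume fg: "fon f a" "fon g a" and e: "!!x. x <: a ==> ap f x = ap g x"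
  show "isf f" "isf g" using fg unfolding fon_def by blast+
  show "pr x y <: f = (pr x y <: g)" for x y
    unfolding fon_iff[OF fg(1)] fon_iff[OF fg(2)] using e[of x] by auto
qed

end

section \<open>Set theory in a model\<close>

text \<open>Closure rules that derive definability by following the syntax of a predicate or term.
  They discharge the side conditions of Separation, Replacement, induction, recursion and
  choice.\<close>

named_theorems dfi

locale zf = zfc_model E for E :: "'v => 'v => bool" (infix "<:" 50)
begin

sublocale extp E
proof
  show "(!!z. z <: x = (z <: y)) ==> x = y" for x y using extensionality by blast
  show "EX u. ALL z. z <: u = (z = x | z = y)" for x y using pairing by blast
qed

abbreviation df :: "((nat => 'v) => bool) => bool" where "df == dfe E"

lemma dfe_pr: "df (%e. e i = pr (e j) (e k))"
proof -
  have "(u = pr x y) = (ALL z. z <: u = ((ALL w. w <: z = (w = x | w = x)) | (ALL w. w <: z = (w = x | w = y))))" for u x y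
    using sat_IsPair[of u x y] unfolding IsPair_def IsUnorderedPair_def by simp
  thus ?thesis by simp (intro dfes)
qed

lemma dfe_pf: "df (%e. e i = pf (e j))" and dfe_ps: "df (%e. e i = ps (e j))"
proof -
  have "(u = pf p) = ((EX y. p = pr u y) | ~ (EX x y. p = pr x y) & u = (THE x. False))"
    "(u = ps p) = ((EX x. p = pr x u) | ~ (EX x y. p = pr x y) & u = (THE x. False))" for u p
    by (cases "EX x y. p = pr x y"; auto simp: pf_def[of p] ps_def[of p])+
  thus "df (%e. e i = pf (e j))" "df (%e. e i = ps (e j))" by (simp_all only:) (intro dfes dfe_pr)+
qed

definition D :: "('v => bool) => bool" where "D Q = df (%e. Q (e 0))"
definition Dt :: "('v => 'v) => bool" where "Dt T = D (%p. ps p = T (pf p))"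

lemma dfe_D: "D Q ==> df (%e. Q (e i))"
  unfolding D_def by (drule dfe_var[where f = "%_. i"]) simp

lemma dfe_Dt: assumes "Dt T" shows "df (%e. e i = T (e j))"
proof -
  have "df (%e. EX p. p = pr (e j) (e i) & ps p = T (pf p))"
    using assms unfolding Dt_def by (intro dfes dfe_pr dfe_D[of "%p. ps p = T (pf p)"])
  thus ?thesis by simp
qed

lemma DtI0: assumes "df (%e. e 0 = T (e 1))" shows "Dt T"
proof -
  have "df (%e. EX x y. x = pf (e 0) & y = ps (e 0) & y = T x)"
    using dfe_var[OF assms, where f = "%i. if i = 0 then 0 else 1"] by (intro dfes dfe_pf dfe_ps) simp
  thus ?thesis unfolding Dt_def D_def by simp
qed

lemma D_comp: assumes "D Q" "Dt a" shows "D (%x. Q (a x))"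
proof -
  have "df (%e. EX u. u = a (e 0) & Q u)" by (intro dfes dfe_Dt dfe_D assms)
  thus ?thesis unfolding D_def by simp
qed

lemma D_mem [dfi]: assumes "Dt a" "Dt b" shows "D (%x. a x <: b x)"
proof -
  have "df (%e. EX u v. u = a (e 0) & v = b (e 0) & u <: v)" by (intro dfes dfe_Dt assms)
  thus ?thesis unfolding D_def by simp
qed

lemma D_eq [dfi]: assumes "Dt a" "Dt b" shows "D (%x. a x = b x)"
proof -
  have "df (%e. EX u v. u = a (e 0) & v = b (e 0) & u = v)" by (intro dfes dfe_Dt assms)
  thus ?thesis unfolding D_def by simp
qed

lemma D_not [dfi]: "D Q ==> D (%x. ~ Q x)"
  and D_and [dfi]: "D Q ==> D R ==> D (%x. Q x & R x)"
  and D_or [dfi]: "D Q ==> D R ==> D (%x. Q x | R x)"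
  and D_imp [dfi]: "D Q ==> D R ==> D (%x. Q x --> R x)"
  and D_iff [dfi]: "D Q ==> D R ==> D (%x. Q x = R x)"
  unfolding D_def by (intro dfes; assumption)+

lemma D_ex [dfi]: assumes "D (%p. Q (pf p) (ps p))" shows "D (%x. EX y. Q x y)"
proof -
  have "df (%e. EX y p. p = pr (e 0) y & Q (pf p) (ps p))"
    by (intro dfes dfe_pr dfe_D[OF assms])
  thus ?thesis unfolding D_def by simp
qed

lemma D_all [dfi]: assumes "D (%p. Q (pf p) (ps p))" shows "D (%x. ALL y. Q x y)"
  using D_not[OF D_ex[OF D_not[OF assms]]] by simp

lemma Dt_id [dfi]: "Dt (%x. x)" by (rule DtI0) (intro dfes)
lemma Dt_const [dfi]: "Dt (%x. c)" by (rule DtI0) (intro dfes)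
lemma D_const [dfi]: "D (%x. c)"
  by (cases c) (use D_eq[OF Dt_id Dt_id] D_not[OF D_eq[OF Dt_id Dt_id]] in simp_all)

lemma DtI: assumes "!!x y. (y = T x) = Q x y" "D (%p. Q (pf p) (ps p))" shows "Dt T"
  unfolding Dt_def using assms by simp

lemma Dt_comp: assumes "Dt T" "Dt a" shows "Dt (%x. T (a x))"
proof (rule DtI0)
  have "df (%e. EX u. u = a (e 1) & e 0 = T u)" by (intro dfes dfe_Dt assms)
  thus "df (%e. e 0 = T (a (e 1)))" by simp
qed

lemmas Dt_pf [dfi] = Dt_comp[OF DtI0[OF dfe_pf]] and Dt_ps [dfi] = Dt_comp[OF DtI0[OF dfe_ps]]

lemma Dt_pr [dfi]: assumes "Dt a" "Dt b" shows "Dt (%x. pr (a x) (b x))"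
proof (rule DtI0)
  have "df (%e. EX u v. u = a (e 1) & v = b (e 1) & e 0 = pr u v)" by (intro dfes dfe_Dt dfe_pr assms)
  thus "df (%e. e 0 = pr (a (e 1)) (b (e 1)))" by simp
qed

lemma Dt_comp2: "Dt (%p. T (pf p) (ps p)) ==> Dt a ==> Dt b ==> Dt (%x. T (a x) (b x))"
  using Dt_comp[OF _ Dt_pr, of "%p. T (pf p) (ps p)" a b] by simp

lemma D_comp2: "D (%p. R (pf p) (ps p)) ==> Dt a ==> Dt b ==> D (%x. R (a x) (b x))"
  using D_comp[OF _ Dt_pr, of "%p. R (pf p) (ps p)" a b] by simp

lemma D_comp3: "D (%p. R (pf p) (pf (ps p)) (ps (ps p))) ==> Dt a ==> Dt b ==> Dt c ==> D (%x. R (a x) (b x) (c x))"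
  using D_comp[OF _ Dt_pr[OF _ Dt_pr], of "%p. R (pf p) (pf (ps p)) (ps (ps p))" a b c] by simp

lemma D_if [dfi]: "D Q ==> D R ==> D S ==> D (%x. if Q x then R x else S x)"
  by (simp add: if_bool_eq_conj, intro dfi)

lemma Dt_if [dfi]: assumes "D Q" "Dt a" "Dt b" shows "Dt (%x. if Q x then a x else b x)"
proof (rule DtI)
  show "(y = (if Q x then a x else b x)) = (Q x & y = a x | ~ Q x & y = b x)" for x y by simp
qed (intro dfi D_comp[OF assms(1)] Dt_comp[OF assms(2)] Dt_comp[OF assms(3)])

section \<open>Sets of the model obtained from definable classes\<close>

definition isS :: "'v set => bool" where "isS X = (EX a. ALL z. z <: a = (z : X))"
definition St :: "'v set => 'v" where "St X = (THE a. ALL z. z <: a = (z : X))"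

lemma mem_St: assumes "isS X" shows "z <: St X = (z : X)"
proof -
  obtain u where u: "ALL z. z <: u = (z : X)" using assms unfolding isS_def by blast
  have "ALL z. z <: St X = (z : X)" unfolding St_def by (rule theI[of _ u]) (use u exten in blast)+
  thus ?thesis by blast
qed

lemma St_eq: "isS X ==> (y = St X) = (ALL z. z <: y = (z : X))"
  by (auto simp: mem_St intro: exten)

lemma isS_sep: assumes "D Q" shows "isS {x. x <: a & Q x}"
proof -
  obtain p c where p: "ALL e. Q (e 0) = sat E (inst p (mix e c))" using assms unfolding D_def dfe_def by blast
  have "mix (%i. if i = 0 then z else a) c = case_nat z (%i. mix (%_. a) c (Suc i))" for z
    by (auto simp: mix_def fun_eq_iff split: nat.split)
  hence "Q z = sat E (inst p (case_nat z (%i. mix (%_. a) c (Suc i))))" for z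
    using p[rule_format, of "%i. if i = 0 then z else a"] by simp
  thus ?thesis using separation unfolding isS_def by simp
qed

lemma isS_img: assumes T: "Dt T" shows "isS {T x | x. x <: a}"
proof -
  obtain p c where p: "ALL e. (e 1 = T (e 0)) = sat E (inst p (mix e c))"
    using dfe_Dt[OF T] unfolding dfe_def by blast
  \<comment> \<open>Replacement has the argument and the value at indices 0 and 1, whereas
    \<open>mix\<close> has them at the even indices 0 and 2; all other slots move up by two.\<close>
  let ?f = "%i. if i = 0 then 0 else if i = 2 then 1 else i + (2::nat)"
  let ?c = "%i. mix (%_. a) c i"
  have "(%i. case_nat z (case_nat w ?c) (?f i)) = mix (%i. if i = 0 then z else if i = 1 then w else a) c" for z w
    by (auto simp: mix_def fun_eq_iff split: nat.split)
  hence h: "sat E (inst (ren ?f p) (case_nat z (case_nat w ?c))) = (w = T z)" for z w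
    using p[rule_format, of "%i. if i = 0 then z else if i = 1 then w else a"] by (simp add: inst_ren)
  have "EX u. ALL w. w <: u = (EX z. z <: a & w = T z)"
    using replacement[rule_format, of a "ren ?f p" ?c] unfolding h by simp
  thus ?thesis unfolding isS_def by (simp add: Bex_def) blast
qed

definition emp :: 'v where "emp = St {}"
definition Uu :: "'v => 'v" where "Uu a = St {z. EX y. y <: a & z <: y}"
definition un :: "'v => 'v => 'v" where "un a b = St {z. z <: a | z <: b}"
definition Pw :: "'v => 'v" where "Pw a = St {z. ALL w. w <: z --> w <: a}"
definition Sp :: "'v => ('v => bool) => 'v" where "Sp a Q = St {z. z <: a & Q z}"
definition Im :: "'v => ('v => 'v) => 'v" where "Im a T = St {T x | x. x <: a}"
definition Lam :: "'v => ('v => 'v) => 'v" where "Lam a T = Im a (%x. pr x (T x))"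
definition prd :: "'v => 'v => 'v" where "prd a b = Uu (Im a (%x. Im b (pr x)))"

lemma mem_Sp: "D Q ==> z <: Sp a Q = (z <: a & Q z)" unfolding Sp_def by (simp add: mem_St isS_sep)
lemma mem_Im: "Dt T ==> z <: Im a T = (EX x. x <: a & z = T x)" unfolding Im_def by (simp add: mem_St isS_img) blast

lemma mem_emp [simp]: "~ z <: emp"
  unfolding emp_def using isS_sep[of "%x. False" z] by (simp add: mem_St D_const)

lemma mem_Un [simp]: "z <: Uu a = (EX y. y <: a & z <: y)"
proof -
  have "isS {z. EX y. y <: a & z <: y}" using union unfolding isS_def by simp
  thus ?thesis unfolding Uu_def by (simp add: mem_St)
qed

lemma mem_un [simp]: "z <: un a b = (z <: a | z <: b)"
proof -
  have "isS {z. z <: a | z <: b}" unfolding isS_def by (rule exI[of _ "Uu (up a b)"]) auto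
  thus ?thesis unfolding un_def by (simp add: mem_St)
qed

lemma mem_Pw [simp]: "z <: Pw a = (ALL w. w <: z --> w <: a)"
proof -
  have "isS {z. ALL w. w <: z --> w <: a}" using power_set unfolding isS_def by simp
  thus ?thesis unfolding Pw_def by (simp add: mem_St)
qed

lemma Dt_St: assumes "!!x. isS {z. Q x z}" "D (%p. Q (pf p) (ps p))" shows "Dt (%x. St {z. Q x z})"
proof (rule DtI)
  show "(y = St {z. Q x z}) = (ALL z. z <: y = Q x z)" for x y using St_eq[OF assms(1)] by simp
  show "D (%p. ALL z. z <: ps p = Q (pf p) z)"
    by (intro dfi D_comp2[of Q, OF assms(2)])
qed

lemma Dt_Sp [dfi]: assumes "Dt a" "D (%p. Q (pf p) (ps p))" shows "Dt (%x. Sp (a x) (Q x))"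
proof -
  have "D (Q x)" for x using D_comp2[of Q, OF assms(2) Dt_const[of x] Dt_id] .
  thus ?thesis unfolding Sp_def by (intro Dt_St dfi assms isS_sep Dt_comp[OF assms(1)])
qed

lemma Dt_Im [dfi]: assumes "Dt a" "Dt (%p. T (pf p) (ps p))" shows "Dt (%x. Im (a x) (T x))"
proof -
  have 1: "Dt (T x)" for x using Dt_comp2[of T, OF assms(2) Dt_const[of x] Dt_id] .
  have "D (%p. EX y. ps p = T (pf p) y & y <: a (pf p))" by (intro dfi Dt_comp2[of T, OF assms(2)] Dt_comp[OF assms(1)])
  thus ?thesis unfolding Im_def using isS_img[OF 1] by (intro Dt_St) auto
qed

lemma Dt_Un [dfi]: "Dt a ==> Dt (%x. Uu (a x))"
proof (rule Dt_comp[of Uu])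
  show "Dt Uu" by (rule DtI[where Q = "%x y. ALL z. z <: y = (EX w. w <: x & z <: w)"]) (auto intro: exten, intro dfi)
qed

lemma Dt_un [dfi]: "Dt a ==> Dt b ==> Dt (%x. un (a x) (b x))"
proof (rule Dt_comp2[of un])
  show "Dt (%p. un (pf p) (ps p))"
    by (rule DtI[where Q = "%x y. ALL z. z <: y = (z <: pf x | z <: ps x)"]) (auto intro: exten, intro dfi)
qed

lemma Dt_up [dfi]: "Dt a ==> Dt b ==> Dt (%x. up (a x) (b x))"
proof (rule Dt_comp2[of up])
  show "Dt (%p. up (pf p) (ps p))"
    by (rule DtI[where Q = "%x y. ALL z. z <: y = (z = pf x | z = ps x)"]) (auto intro: exten, intro dfi)
qed

lemma Dt_Lam [dfi]: "Dt a ==> Dt (%p. T (pf p) (ps p)) ==> Dt (%x. Lam (a x) (T x))"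
  unfolding Lam_def by (intro dfi)

lemma mem_Lam: "Dt T ==> z <: Lam a T = (EX x. x <: a & z = pr x (T x))"
  unfolding Lam_def by (rule mem_Im) (intro dfi)

lemma mem_prd [simp]: "z <: prd a b = (EX x y. x <: a & y <: b & z = pr x y)"
proof -
  have "Dt (pr x)" "Dt (%x. Im b (pr x))" for x by (intro dfi)+
  thus ?thesis unfolding prd_def by (auto simp: mem_Im)
qed

lemma Dt_prd [dfi]: "Dt a ==> Dt b ==> Dt (%x. prd (a x) (b x))"
  by (rule Dt_comp2[of prd], unfold prd_def, intro dfi, assumption+)

lemma D_isf [dfi]: "Dt a ==> D (%x. isf (a x))"
  by (rule D_comp[of isf], unfold isf_def, intro dfi)

lemma D_fon [dfi]: "Dt a ==> Dt b ==> D (%x. fon (a x) (b x))"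
  by (rule D_comp2[of fon], unfold fon_def, intro dfi, assumption+)

lemma D_fto [dfi]: "Dt a ==> Dt b ==> Dt c ==> D (%x. fto (a x) (b x) (c x))"
  by (rule D_comp3[of fto], unfold fto_def, intro dfi, assumption+)

lemma D_bij [dfi]: "Dt a ==> Dt b ==> Dt c ==> D (%x. bij (a x) (b x) (c x))"
  by (rule D_comp3[of bij], unfold bij_def, intro dfi, assumption+)

lemma Dt_The [dfi]: assumes "D (%p. Q (pf p) (ps p))" shows "Dt (%x. THE y. (EX! w. Q x w) & Q x y)"
proof (rule DtI)
  show "(y = (THE y. (EX! w. Q x w) & Q x y)) = (if EX w. Q x w & (ALL z. Q x z --> z = w) then Q x y else y = (THE y. False))" for x y
  proof (cases "EX! w. Q x w")
    case True
    hence "(THE y. (EX! w. Q x w) & Q x y) = (THE y. Q x y)" by simp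
    moreover have "EX w. Q x w & (ALL z. Q x z --> z = w)" using True by blast
    ultimately show ?thesis using theI'[OF True] True by auto
  next
    case False
    hence "(EX w. Q x w & (ALL z. Q x z --> z = w)) = False" "(EX! w. Q x w) = False" by blast+
    thus ?thesis by (simp only: if_False simp_thms)
  qed
qed (intro dfi D_comp2[of Q, OF assms])

lemma Dt_ap [dfi]: "Dt a ==> Dt b ==> Dt (%x. ap (a x) (b x))"
  by (rule Dt_comp2[of ap], unfold ap_def, intro dfi, assumption+)

section \<open>Domain, range and restriction\<close>

definition dm :: "'v => 'v" where "dm f = Sp (Uu (Uu f)) (%x. EX y. pr x y <: f)"
definition rg :: "'v => 'v" where "rg f = Sp (Uu (Uu f)) (%y. EX x. pr x y <: f)"
definition rs :: "'v => 'v => 'v" where "rs f a = Sp f (%u. EX x y. x <: a & u = pr x y)"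

lemma pr_UnUn: "pr x y <: f ==> x <: Uu (Uu f) & y <: Uu (Uu f)"
proof -
  have "up x y <: pr x y" "x <: up x y" "y <: up x y" unfolding pr_def by simp_all
  thus "pr x y <: f ==> ?thesis" unfolding mem_Un by blast
qed

lemma mem_dm [simp]: "x <: dm f = (EX y. pr x y <: f)" and mem_rg [simp]: "y <: rg f = (EX x. pr x y <: f)"
  unfolding dm_def rg_def using pr_UnUn by ((subst mem_Sp, intro dfi), blast)+

lemma mem_rs [simp]: "u <: rs f a = (u <: f & (EX x y. x <: a & u = pr x y))"
  unfolding rs_def by (subst mem_Sp, intro dfi) simp

lemma Dt_dm [dfi]: "Dt a ==> Dt (%x. dm (a x))" by (rule Dt_comp[of dm], unfold dm_def, intro dfi)
lemma Dt_rg [dfi]: "Dt a ==> Dt (%x. rg (a x))" by (rule Dt_comp[of rg], unfold rg_def, intro dfi)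
lemma Dt_rs [dfi]: "Dt a ==> Dt b ==> Dt (%x. rs (a x) (b x))"
  by (rule Dt_comp2[of rs], unfold rs_def, intro dfi, assumption+)

lemma fon_dm: "fon f a = (isf f & dm f = a)"
  unfolding fon_def by (auto intro: exten)

lemma pr_Lam: "Dt T ==> pr x y <: Lam a T = (x <: a & y = T x)"
  by (auto simp: mem_Lam)

lemma fon_Lam: assumes "Dt T" shows "fon (Lam a T) a"
  unfolding fon_def isf_def pr_Lam[OF assms] unfolding mem_Lam[OF assms] by blast

lemma ap_Lam: "Dt T ==> x <: a ==> ap (Lam a T) x = T x"
  using fon_Lam[of T a] pr_Lam[of T x "T x" a] unfolding fon_def by (intro isf_ap) simp_all

lemma fon_rs: "fon f a ==> (!!x. x <: b ==> x <: a) ==> fon (rs f b) b"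
  unfolding fon_def isf_def by simp blast

lemma ap_rs: "isf f ==> pr x y <: f ==> x <: b ==> ap (rs f b) x = y"
  by (rule isf_ap) (auto simp: isf_def)

end

section \<open>Induction and recursion on the membership relation\<close>

context zf begin

section \<open>Natural numbers of the model and transitive closures\<close>

definition suc :: "'v => 'v" where "suc x = un x (up x x)"
lemma mem_suc [simp]: "z <: suc x = (z <: x | z = x)" unfolding suc_def by simp
lemma Dt_suc [dfi]: "Dt a ==> Dt (%x. suc (a x))" by (rule Dt_comp[of suc], unfold suc_def, intro dfi)

lemma not_mem_self: "~ x <: x"
  using foundation[rule_format, of "up x x"] by auto

lemma not_mem_2: "x <: y ==> ~ y <: x"
  using foundation[rule_format, of "up x y"] by auto

lemma suc_eq: "suc x = suc y ==> x = y"
  using mem_suc[of x x] mem_suc[of y y] mem_suc[of x y] mem_suc[of y x] not_mem_2[of x y] by metis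

definition ind :: "'v => bool" where "ind J = (emp <: J & (ALL n. n <: J --> suc n <: J))"
lemma D_ind [dfi]: "Dt a ==> D (%x. ind (a x))" by (rule D_comp[of ind], unfold ind_def, intro dfi)

lemma ex_ind: "EX J. ind J"
proof -
  obtain J where J: "EX y. y <: J & (ALL z. ~ z <: y)" "ALL y. y <: J --> (EX u. u <: J & (ALL z. z <: u = (z <: y | z = y)))"
    using infinity by blast
  have "y = emp" if "ALL z. ~ z <: y" for y using that by (intro exten) simp
  moreover have "u = suc y" if "ALL z. z <: u = (z <: y | z = y)" for u y using that by (intro exten) simp
  ultimately show ?thesis unfolding ind_def using J by metis
qed

definition om :: 'v where "om = Sp (SOME J. ind J) (%n. ALL J. ind J --> n <: J)"

lemma mem_om: "n <: om = (ALL J. ind J --> n <: J)"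
  unfolding om_def by (subst mem_Sp, intro dfi) (use someI_ex[OF ex_ind] in blast)

lemma om0: "emp <: om" and om_suc: "n <: om ==> suc n <: om"
  unfolding mem_om by (simp_all add: ind_def)

text \<open>As \<open>om\<close> may be nonstandard, induction on it is restricted to definable
  classes: the elements with \<open>Q\<close> have to form an inductive set of the model.\<close>

lemma om_induct: assumes "D Q" "n <: om" "Q emp" "!!n. n <: om ==> Q n ==> Q (suc n)" shows "Q n"
proof -
  have "ind (Sp om Q)" unfolding ind_def mem_Sp[OF assms(1)] using assms om0 om_suc by blast
  thus ?thesis using assms(2) mem_Sp[OF assms(1)] unfolding mem_om by blast
qed

lemma om_trans: assumes "n <: om" "m <: n" shows "m <: om"
proof -
  have "ALL m. m <: n --> m <: om"
    by (rule om_induct[OF _ assms(1)], intro dfi) auto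
  thus ?thesis using assms(2) by blast
qed

lemma om_suc_mono: assumes "n <: om" "m <: n" shows "suc m <: suc n"
proof -
  have "ALL m. m <: n --> suc m <: suc n"
    by (rule om_induct[OF _ assms(1)], intro dfi) auto
  thus ?thesis using assms(2) by blast
qed

definition trs :: "'v => bool" where "trs T = (ALL y. y <: T --> (ALL z. z <: y --> z <: T))"
lemma D_trs [dfi]: "Dt a ==> D (%x. trs (a x))" by (rule D_comp[of trs], unfold trs_def, intro dfi)
lemma sat_Transitive [simp]: "sat E (Transitive x) = trs x" unfolding Transitive_def trs_def by simp

lemma trs_suc: "trs n ==> trs (suc n)"
  unfolding trs_def by auto

lemma om_trs: "n <: om ==> trs n"
  by (rule om_induct[of trs]) (simp_all add: D_trs Dt_id trs_suc, simp add: trs_def)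

text \<open>The recursion theorem itself relies on transitive sets, so the iterated unions of
  \<open>x\<close> are built by hand from finite approximations \<open>A f n\<close>, which exist
  and agree by induction on \<open>om\<close>.\<close>

lemma ex_trs: "EX T. trs T & (ALL y. y <: x --> y <: T)"
proof -
  define A where "A f n = (fon f (suc n) & ap f emp = x & (ALL m. m <: n --> ap f (suc m) = Uu (ap f m)))" for f n
  have DA: "Dt a ==> Dt b ==> D (%x. A (a x) (b x))" for a b
    by (rule D_comp2[of A], unfold A_def, intro dfi, assumption+)
  have ex: "EX f. A f n" if "n <: om" for n
  proof (rule om_induct[OF _ that])
    show "D (%n. EX f. A f n)" by (intro dfi DA)
    have "Dt (%_::'v. x)" by (rule dfi)
    thus "EX f. A f emp" unfolding A_def by (intro exI[of _ "Lam (suc emp) (%_. x)"]) (simp add: fon_Lam ap_Lam)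
    fix n assume n: "n <: om" and "EX f. A f n"
    then obtain f where f: "A f n" by blast
    let ?T = "%m. if m = suc n then Uu (ap f n) else ap f m"
    have T: "Dt ?T" by (intro dfi)
    have "suc m <: suc (suc n) & m <: suc (suc n) & m ~= suc n & (suc m = suc n --> m = n)" if "m <: suc n" for m
      using that om_suc_mono[OF om_suc[OF n] that] not_mem_self[of "suc n"] suc_eq by auto
    moreover have "ap f (suc m) = Uu (ap f m)" if "m <: suc n" "suc m ~= suc n" for m
      using f that unfolding A_def by auto
    moreover have "emp <: suc (suc n)" using om_induct[of "%n. emp <: suc n", OF _ om_suc[OF n]] by (simp add: dfi)
    moreover have "emp ~= suc n" by (metis mem_emp mem_suc)
    ultimately have "A (Lam (suc (suc n)) ?T) (suc n)"
      using f unfolding A_def by (simp add: fon_Lam[OF T] ap_Lam[OF T] del: mem_suc) (blast dest: suc_eq)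
    thus "EX f. A f (suc n)" by blast
  qed
  have un: "ALL f n g k. A f n --> A g k --> m <: suc n --> m <: suc k --> n <: om --> k <: om --> ap f m = ap g m" if "m <: om" for m
  proof (rule om_induct[OF _ that])
    show "D (%m. ALL f n g k. A f n --> A g k --> m <: suc n --> m <: suc k --> n <: om --> k <: om --> ap f m = ap g m)"
      by (intro dfi DA)
    show "ALL f n g k. A f n --> A g k --> emp <: suc n --> emp <: suc k --> n <: om --> k <: om --> ap f emp = ap g emp"
      unfolding A_def by simp
    fix m assume m: "m <: om" and IH: "ALL f n g k. A f n --> A g k --> m <: suc n --> m <: suc k --> n <: om --> k <: om --> ap f m = ap g m"
    have d: "m <: n" if "suc m <: suc n" "n <: om" for n
      using that om_trs[of n] mem_suc[of m m] unfolding mem_suc[of _ n] trs_def by blast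
    show "ALL f n g k. A f n --> A g k --> suc m <: suc n --> suc m <: suc k --> n <: om --> k <: om --> ap f (suc m) = ap g (suc m)"
    proof (intro allI impI)
      fix f n g k assume a: "A f n" "A g k" "suc m <: suc n" "suc m <: suc k" "n <: om" "k <: om"
      have mn: "m <: n" "m <: k" by (rule d[OF a(3,5)], rule d[OF a(4,6)])
      hence "ap f m = ap g m" using IH[rule_format, OF a(1,2) _ _ a(5,6)] by simp
      thus "ap f (suc m) = ap g (suc m)" using mn a(1,2) unfolding A_def by simp
    qed
  qed
  define U where "U n = (THE z. (EX! w. EX f. A f n & w = ap f n) & (EX f. A f n & z = ap f n))" for n
  have DU: "Dt U" unfolding U_def by (intro dfi DA)
  have U: "U n = ap f n" if "n <: om" "A f n" for n f
  proof -
    have "ap g n = ap f n" if "A g n" for g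
      using un[rule_format, OF \<open>n <: om\<close> that \<open>A f n\<close> _ _ \<open>n <: om\<close> \<open>n <: om\<close>] by simp
    hence "(EX g. A g n & w = ap g n) = (w = ap f n)" for w using \<open>A f n\<close> by metis
    thus ?thesis unfolding U_def by simp
  qed
  let ?T = "Uu (Im om U)"
  have "z <: ?T" if y: "n <: om" "y <: U n" "z <: y" for n y z
  proof -
    obtain f where f: "A f (suc n)" using ex om_suc y(1) by blast
    obtain g where g: "A g n" using ex y(1) by blast
    have "ap g n = ap f n" using un[rule_format, OF y(1) g f _ _ y(1) om_suc[OF y(1)]] by simp
    hence "U (suc n) = Uu (U n)" using U[OF om_suc[OF y(1)] f] U[OF y(1) g] f unfolding A_def by simp
    hence "z <: U (suc n)" using y by auto
    thus ?thesis unfolding mem_Un mem_Im[OF DU] using om_suc[OF y(1)] by blast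
  qed
  hence "trs ?T" unfolding trs_def mem_Un[of _ "Im om _"] mem_Im[OF DU] by blast
  moreover obtain f where "A f emp" using ex om0 by blast
  hence "U emp = x" using U[OF om0] unfolding A_def by simp
  hence "ALL y. y <: x --> y <: ?T" unfolding mem_Un mem_Im[OF DU] using om0 by metis
  ultimately show ?thesis by blast
qed

lemma ex_trs1: "EX T. trs T & x <: T"
  using ex_trs[of "up x x"] by auto

text \<open>Foundation speaks of sets only; it is applied to the counterexamples inside a transitive
  set that contains \<open>x\<close>.\<close>

lemma eps_induct: assumes "D Q" "!!x. (!!y. y <: x ==> Q y) ==> Q x" shows "Q x"
proof (rule ccontr)
  assume x: "~ Q x"
  obtain T where T: "trs T" "x <: T" using ex_trs1 by blast
  have m: "z <: Sp T (%x. ~ Q x) = (z <: T & ~ Q z)" for z using assms(1) by (intro mem_Sp dfi)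
  obtain y where "y <: T" "~ Q y" "ALL z. z <: y --> ~ (z <: T & ~ Q z)"
    using foundation[rule_format, of "Sp T (%x. ~ Q x)"] T x unfolding m by blast
  thus False using assms(2)[of y] T unfolding trs_def by blast
qed

definition att :: "('v => 'v => 'v) => 'v => 'v => bool" where
  "att H f T = (trs T & fon f T & (ALL y. y <: T --> ap f y = H y (rs f y)))"

definition Rec :: "('v => 'v => 'v) => 'v => 'v" where
  "Rec H x = (THE z. (EX! w. EX f T. att H f T & x <: T & w = ap f x) & (EX f T. att H f T & x <: T & z = ap f x))"

text \<open>An attempt is a solution on a transitive set. Attempts agree where both are defined;
  those for the elements of \<open>x\<close> are glued together and prolonged by one value at
  \<open>x\<close>.\<close>

lemma assumes H: "Dt (%p. H (pf p) (ps p))" shows Dt_Rec: "Dt (Rec H)" and Rec_eq: "Rec H x = H x (Lam x (Rec H))"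
proof -
  have DA: "Dt a ==> Dt b ==> D (%x. att H (a x) (b x))" for a b
    by (rule D_comp2[of "att H"], unfold att_def, intro dfi Dt_comp2[of H, OF H], assumption+)
  show R: "Dt (Rec H)" unfolding Rec_def by (intro dfi DA)
  have un: "ALL f T g S. att H f T --> att H g S --> x <: T --> x <: S --> ap f x = ap g x" (is "?Q x") for x
  proof (rule eps_induct[of ?Q])
    show "D ?Q" by (intro dfi DA)
  next
    fix x assume IH: "!!y. y <: x ==> ?Q y"
    show "?Q x"
    proof (intro allI impI)
    fix f T g S assume a: "att H f T" "att H g S" "x <: T" "x <: S"
    have sub: "y <: T" "y <: S" if "y <: x" for y using a that unfolding att_def trs_def by blast+
    have f: "fon f T" "fon g S" using a unfolding att_def by auto
    have "rs f x = rs g x"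
    proof (rule fon_eq)
      show "fon (rs f x) x" "fon (rs g x) x" using f sub by (auto intro: fon_rs)
      show "ap (rs f x) y = ap (rs g x) y" if "y <: x" for y
        using IH[OF that] a(1,2) sub[OF that] fon_ap[OF f(1)] fon_ap[OF f(2)] f that unfolding fon_def[of f] fon_def[of g]
        by (metis ap_rs)
    qed
    thus "ap f x = ap g x" using a unfolding att_def by simp
    qed
  qed
  have val: "Rec H x = ap f x" if "att H f T" "x <: T" for x f T
  proof -
    have "(EX g S. att H g S & x <: S & w = ap g x) = (w = ap f x)" for w using that un[of x] by metis
    thus ?thesis unfolding Rec_def by simp
  qed
  have rec: "Rec H y = H y (Lam y (Rec H))" if a: "att H f T" "y <: T" for y f T
  proof -
    have f: "fon f T" and sub: "z <: T" if "z <: y" for z using a that unfolding att_def trs_def by blast+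
    have f: "fon f T" using a unfolding att_def by blast
    have "rs f y = Lam y (Rec H)"
    proof (rule fon_eq)
      show "fon (rs f y) y" "fon (Lam y (Rec H)) y" using f sub by (auto intro: fon_rs fon_Lam R)
      show "ap (rs f y) z = ap (Lam y (Rec H)) z" if "z <: y" for z
        using ap_rs[OF _ fon_ap[OF f sub[OF that]] that] f that
        by (simp add: ap_Lam[OF R] val[OF a(1) sub[OF that]] fon_def)
    qed
    thus ?thesis using val[OF a] a unfolding att_def by simp
  qed
  have ex: "EX f T. att H f T & x <: T" (is "?Q x") for x
  proof (rule eps_induct[of ?Q])
    show "D ?Q" by (intro dfi DA)
  next
    fix x assume IH: "!!y. y <: x ==> ?Q y"
    show "?Q x"
    proof (rule ccontr)
    assume n: "~ (EX f T. att H f T & x <: T)"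
    obtain S where S: "trs S" "ALL y. y <: x --> y <: S" using ex_trs by blast
    \<comment> \<open>The points of \<open>S\<close> reached by some attempt form a transitive set;
      with \<open>x\<close> added on top it is the domain of the new attempt.\<close>
    let ?T = "Sp S (%y. EX f T. att H f T & y <: T)"
    have m: "y <: ?T = (y <: S & (EX f T. att H f T & y <: T))" for y by (intro mem_Sp dfi DA)
    have T: "trs ?T" using S unfolding trs_def[of ?T] m by (metis att_def trs_def)
    let ?T' = "un ?T (up x x)"
    have sub: "z <: ?T & z ~= x" if "y <: ?T'" "z <: y" for y z
    proof -
      have "z <: ?T" using that T IH S m unfolding trs_def mem_un mem_up by blast
      thus ?thesis using n m by blast
    qed
    let ?G = "%y. if y = x then H x (Lam x (Rec H)) else Rec H y"
    have G: "Dt ?G" by (intro dfi R)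
    have "H y (rs (Lam ?T' ?G) y) = ?G y" if y: "y <: ?T'" for y
    proof -
      have "rs (Lam ?T' ?G) y = Lam y (Rec H)"
      proof (rule fon_eq)
        show "fon (rs (Lam ?T' ?G) y) y" "fon (Lam y (Rec H)) y"
          using fon_rs[OF fon_Lam[OF G]] sub[OF y] fon_Lam[OF R] by simp_all
        fix z assume z: "z <: y"
        have "ap (rs (Lam ?T' ?G) y) z = ?G z"
          using sub[OF y z] fon_Lam[OF G, of ?T'] z by (intro ap_rs) (simp_all add: fon_def pr_Lam[OF G])
        thus "ap (rs (Lam ?T' ?G) y) z = ap (Lam y (Rec H)) z" using sub[OF y z] z by (simp add: ap_Lam[OF R])
      qed
      moreover have "H y (Lam y (Rec H)) = Rec H y" if "y ~= x"
      proof -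
        have "EX f T. att H f T & y <: T" using that y unfolding mem_un mem_up m by blast
        thus ?thesis using rec by fastforce
      qed
      ultimately show ?thesis by presburger
    qed
    moreover have "trs ?T'" unfolding trs_def using sub mem_un by blast
    ultimately have "att H (Lam ?T' ?G) ?T'" unfolding att_def using fon_Lam[OF G] ap_Lam[OF G] by simp
    moreover have "x <: ?T'" by simp
    ultimately show False using n by blast
    qed
  qed
  show "Rec H x = H x (Lam x (Rec H))" using ex rec by blast
qed
end

section \<open>Ordinals, choice and cardinality\<close>

context zf begin

lemma eps_min: assumes "D Q" "Q a" shows "EX b. Q b & (ALL c. c <: b --> ~ Q c)"
  using eps_induct[of "%x. ~ Q x" a] assms D_not by blast

definition od :: "'v => bool" where "od x = (trs x & (ALL y. y <: x --> trs y))"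
lemma D_od [dfi]: "Dt a ==> D (%x. od (a x))" by (rule D_comp[of od], unfold od_def, intro dfi)
lemma sat_Ordinal [simp]: "sat E (Ordinal x) = od x" unfolding Ordinal_def od_def by simp

lemma od_mem: "od x ==> y <: x ==> od y" unfolding od_def trs_def by blast
lemma od_trans: "od x ==> y <: x ==> z <: y ==> z <: x" unfolding od_def trs_def by blast

lemma od_tri: assumes "od x" "od y" shows "x <: y | x = y | y <: x"
proof -
  let ?Q = "%x. od x --> (ALL y. od y --> x <: y | x = y | y <: x)"
  have "?Q x"
  proof (rule eps_induct[of ?Q])
    show "D ?Q" by (intro dfi)
    fix x assume IH: "!!z. z <: x ==> ?Q z"
    show "?Q x"
    proof
      assume x: "od x"
      let ?R = "%y. od y --> x <: y | x = y | y <: x"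
      have "?R y" for y
      proof (rule eps_induct[of ?R])
        show "D ?R" by (intro dfi)
        fix y assume IH2: "!!z. z <: y ==> ?R z"
        show "?R y"
        proof (intro impI, rule ccontr)
          assume y: "od y" and n: "~ (x <: y | x = y | y <: x)"
          have "z <: x = (z <: y)" for z
          proof
            assume z: "z <: x"
            have "z <: y | z = y | y <: z" using IH[OF z] y od_mem[OF x z] by blast
            thus "z <: y" using n z od_trans[OF x z] by blast
          next
            assume z: "z <: y"
            have "x <: z | x = z | z <: x" using IH2[OF z] od_mem[OF y z] by blast
            thus "z <: x" using n z od_trans[OF y z] by blast
          qed
          thus False using n exten by blast
        qed
      qed
      thus "ALL y. ?R y" by blast
    qed
  qed
  thus ?thesis using assms by blast
qed

lemma od_suc: "od x ==> od (suc x)" using trs_suc[of x] unfolding od_def mem_suc by blast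
lemma od_sub: "od x ==> od y ==> (!!z. z <: x ==> z <: y) ==> x <: y | x = y"
  using od_tri not_mem_self by blast
lemma od_emp: "od x ==> x ~= emp ==> emp <: x"
  using od_tri[of emp x] mem_emp unfolding od_def trs_def by blast
lemma emp_eq: "x = emp = (ALL z. ~ z <: x)" by (auto intro: exten)
lemma od_suc_le: "od x ==> y <: x ==> suc y <: x | suc y = x"
  using od_tri[OF _ od_suc[OF od_mem], of x x y] not_mem_self not_mem_2 by auto

text \<open>The axiom is stated for families of disjoint sets, so each nonempty \<open>y\<close> is
  first replaced by its tagged copy \<open>prd (up y y) y\<close>.\<close>

lemma chf: "EX c. ALL y. y <: a --> (EX z. z <: y) --> ap c y <: y"
proof -
  let ?F = "Im (Sp a (%y. EX z. z <: y)) (%y. prd (up y y) y)"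
  have m: "u <: ?F = (EX y. y <: a & (EX z. z <: y) & u = prd (up y y) y)" for u
    by (subst mem_Im, intro dfi, subst mem_Sp, intro dfi) blast
  have "(ALL y. y <: ?F --> (EX z. z <: y)) & (ALL y y' z. y <: ?F & y' <: ?F & z <: y & z <: y' --> y = y')"
    unfolding m by auto
  then obtain c where c: "ALL y. y <: ?F --> (EX! z. z <: y & z <: c)" using choice[rule_format, of ?F] by blast
  let ?c = "Sp c (%u. EX y z. y <: a & z <: y & u = pr y z)"
  have mc: "u <: ?c = (u <: c & (EX y z. y <: a & z <: y & u = pr y z))" for u by (intro mem_Sp dfi)
  have u: "EX! z. z <: y & pr y z <: c" if y: "y <: a" "EX z. z <: y" for y
  proof -
    have "EX! u. u <: prd (up y y) y & u <: c" using c m y by blast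
    then obtain u where u: "u <: prd (up y y) y" "u <: c" "!!v. v <: prd (up y y) y ==> v <: c ==> v = u" by blast
    then obtain z where z: "z <: y" "u = pr y z" using u(1) unfolding mem_prd mem_up by blast
    have "w = z" if "w <: y" "pr y w <: c" for w using u(3)[of "pr y w"] that z by simp
    thus ?thesis using z u(2) by blast
  qed
  have "isf ?c" unfolding isf_def mc using u by auto
  have "ap ?c y <: y" if y: "y <: a" "EX z. z <: y" for y
  proof -
    obtain z where "z <: y" "pr y z <: ?c" using u[OF y] y(1) unfolding mc by blast
    thus ?thesis using isf_ap[OF \<open>isf ?c\<close>] by simp
  qed
  thus ?thesis by blast
qed

lemma AC: assumes "D (%p. Q (pf p) (ps p))" "!!x. x <: a ==> EX y. y <: b & Q x y"
  shows "EX f. fto f a b & (ALL x. x <: a --> Q x (ap f x))"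
proof -
  obtain c where c: "ALL y. y <: Pw b --> (EX z. z <: y) --> ap c y <: y" using chf by blast
  let ?T = "%x. ap c (Sp b (Q x))"
  have T: "Dt ?T" by (intro dfi assms)
  have m: "z <: Sp b (Q x) = (z <: b & Q x z)" for x z
    by (rule mem_Sp) (rule D_comp2[of Q, OF assms(1)], (rule dfi)+)
  have "?T x <: b & Q x (?T x)" if "x <: a" for x
    using c[rule_format, of "Sp b (Q x)"] assms(2)[OF that] unfolding mem_Pw m by blast
  thus ?thesis
    by (intro exI[of _ "Lam a ?T"]) (simp add: fto_def fon_Lam[OF T] ap_Lam[OF T] pr_Lam[OF T])
qed

lemma fto_ap: "fto f a b ==> x <: a ==> ap f x <: b" unfolding fto_def using fon_ap by blast

lemma fto_Lam: "Dt T ==> (!!x. x <: a ==> T x <: b) ==> fto (Lam a T) a b"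
  unfolding fto_def by (simp add: fon_Lam pr_Lam)

lemma bij_Lam: "Dt T ==> (!!x. x <: a ==> T x <: b) ==> (!!x y. x <: a ==> y <: a ==> T x = T y ==> x = y) ==>
    (!!y. y <: b ==> EX x. x <: a & T x = y) ==> bij (Lam a T) a b"
  unfolding bij_def by (simp add: fto_Lam pr_Lam) blast

lemma bijE: assumes "bij f a b"
  shows "!!x. x <: a ==> ap f x <: b" "!!x y. x <: a ==> y <: a ==> ap f x = ap f y ==> x = y"
    "!!y. y <: b ==> EX x. x <: a & ap f x = y"
proof -
  have f: "fto f a b" "fon f a" using assms unfolding bij_def fto_def by auto
  show "!!x. x <: a ==> ap f x <: b" using fto_ap[OF f(1)] .
  show "!!x y. x <: a ==> y <: a ==> ap f x = ap f y ==> x = y"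
    using assms unfolding bij_def fon_iff[OF f(2)] by metis
  show "!!y. y <: b ==> EX x. x <: a & ap f x = y"
    using assms unfolding bij_def fon_iff[OF f(2)] by metis
qed

lemma wellorder: "EX f d. od d & bij f d a"
proof -
  obtain c where c: "ALL y. y <: Pw a --> (EX z. z <: y) --> ap c y <: y" using chf by blast
  define R where "R g = Sp a (%x. ~ (EX d. pr d x <: g))" for g
  define H where "H b g = (if EX x. x <: R g then ap c (R g) else a)" for b g :: 'v
  have DR: "Dt d ==> Dt (%x. R (d x))" for d by (rule Dt_comp[of R], unfold R_def, intro dfi)
  have DH: "Dt (%p. H (pf p) (ps p))" unfolding H_def by (intro dfi DR)
  define G where "G = Rec H"
  have DG: "Dt G" unfolding G_def by (rule Dt_Rec[OF DH])
  have G: "G b = H b (Lam b G)" for b unfolding G_def by (rule Rec_eq[OF DH])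
  have mR: "x <: R (Lam b G) = (x <: a & (ALL d. d <: b --> G d ~= x))" for x b
    unfolding R_def by (subst mem_Sp, intro dfi) (auto simp: pr_Lam[OF DG])
  have G1: "(ALL x. x <: a --> (EX d. d <: b & G d = x)) & G b = a | G b <: a & (ALL d. d <: b --> G d ~= G b)" for b
  proof (cases "EX x. x <: R (Lam b G)")
    case True
    hence "G b <: R (Lam b G)"
      using c[rule_format, of "R (Lam b G)"] G[of b] unfolding mem_Pw mR H_def by auto
    thus ?thesis unfolding mR by blast
  qed (use G[of b] in \<open>auto simp: mR H_def\<close>)
  have "EX b. od b & G b = a"
  proof (rule ccontr)
    assume n: "~ ?thesis"
    hence G2: "G b <: a" "d <: b ==> G d ~= G b" if "od b" for b d using G1[of b] that by blast+
    have inj: "b = d" if "od b" "od d" "G b = G d" for b d using od_tri[OF that(1,2)] G2 that by metis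
    define T where "T x = (THE b. (EX! b. od b & G b = x) & (od b & G b = x))" for x
    have DT: "Dt T" unfolding T_def by (intro dfi DG Dt_comp[OF DG])
    have "T (G b) = b" if "od b" for b
    proof -
      have "(od d & G d = G b) = (d = b)" for d using inj that by blast
      thus ?thesis unfolding T_def by simp
    qed
    hence m: "x <: Sp (Im a T) od = od x" for x
      using G2(1)[of x] by (subst mem_Sp, intro dfi) (auto simp: mem_Im[OF DT] intro: sym)
    have "od (Sp (Im a T) od)" unfolding od_def[of "Sp _ _"] trs_def[of "Sp _ _"] m using od_mem unfolding od_def by blast
    thus False using m not_mem_self by blast
  qed
  moreover have "D (%b. od b & G b = a)" by (intro dfi DG)
  ultimately obtain b where b: "od b" "G b = a" "ALL d. d <: b --> ~ (od d & G d = a)" using eps_min[of "%b. od b & G b = a"] by blast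
  have nb: "G d <: a" "e <: d ==> G e ~= G d" if "d <: b" for d e using b that od_mem G1[of d] by blast+
  have "bij (Lam b G) b a"
  proof (rule bij_Lam[OF DG])
    show "EX d. d <: b & G d = y" if "y <: a" for y using G1[of b] that b(2) not_mem_self by blast
    show "d = e" if "d <: b" "e <: b" "G d = G e" for d e
      using od_tri[OF od_mem[OF b(1) that(1)] od_mem[OF b(1) that(2)]] nb(2)[OF that(1), of e] nb(2)[OF that(2), of d] that(3) by metis
  qed (rule nb)
  thus ?thesis using b(1) by blast
qed

text \<open>Cantor-Bernstein: \<open>C\<close> is the least set that contains the points outside the
  range of \<open>G\<close> and is closed under \<open>F\<close> followed by \<open>G\<close>. The
  bijection is \<open>F\<close> on \<open>C\<close> and the inverse of \<open>G\<close>
  elsewhere.\<close>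

lemma CB: assumes F: "Dt F" and G: "Dt G" and Fb: "!!x. x <: a ==> F x <: b" and Ga: "!!x. x <: b ==> G x <: a"
    and Fi: "!!x y. x <: a ==> y <: a ==> F x = F y ==> x = y" and Gi: "!!x y. x <: b ==> y <: b ==> G x = G y ==> x = y"
  shows "EX h. bij h a b"
proof -
  define cl where "cl S = (ALL y. y <: a --> ((ALL z. z <: b --> G z ~= y) --> y <: S) & (y <: S --> G (F y) <: S))" for S
  have Dcl: "D cl" unfolding cl_def by (intro dfi Dt_comp[OF F] Dt_comp[OF G])
  define C where "C = Sp a (%x. ALL S. cl S --> x <: S)"
  have C: "x <: C = (x <: a & (ALL S. cl S --> x <: S))" for x
    unfolding C_def by (intro mem_Sp dfi D_comp[OF Dcl])
  have C1: "y <: C" if "y <: a" "ALL z. z <: b --> G z ~= y" for y using that unfolding C cl_def by blast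
  have C2: "G (F y) <: C" if "y <: C" for y using that Fb Ga unfolding C cl_def by blast
  have C3: "EX x. x <: C & y = F x" if y: "y <: b" "G y <: C" for y
  proof (rule ccontr)
    assume n: "~ ?thesis"
    have m: "z <: Sp C (%z. z ~= G y) = (z <: C & z ~= G y)" for z by (intro mem_Sp dfi)
    have "cl (Sp C (%z. z ~= G y))" unfolding cl_def m using C1 C2 y n Gi Fb C by metis
    thus False using y(2) m unfolding C by blast
  qed
  define I where "I x = (THE z. (EX! z. z <: b & G z = x) & (z <: b & G z = x))" for x
  have DI: "Dt I" unfolding I_def by (intro dfi Dt_comp[OF G])
  have I: "I (G z) = z" if "z <: b" for z
  proof -
    have "(y <: b & G y = G z) = (y = z)" for y using Gi that by blast
    thus ?thesis unfolding I_def by simp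
  qed
  have nC: "EX z. z <: b & x = G z & I x = z" if "x <: a" "~ x <: C" for x using C1[of x] that I by metis
  let ?h = "%x. if x <: C then F x else I x"
  have "bij (Lam a ?h) a b"
  proof (rule bij_Lam)
    show "Dt ?h" by (intro dfi F DI)
    show "?h x <: b" if "x <: a" for x using Fb nC that by (cases "x <: C") auto
    show "EX x. x <: a & ?h x = y" if "y <: b" for y
    proof (cases "G y <: C")
      case True thus ?thesis using C3[OF that] C by auto
    next
      case False thus ?thesis using I[OF that] Ga[OF that] by auto
    qed
    have *: "x <: a ==> z <: a ==> x <: C ==> ~ z <: C ==> F x ~= I z" for x z using nC C2 by metis
    show "x = z" if "x <: a" "z <: a" "?h x = ?h z" for x z
      using that *[of x z] *[of z x] Fi nC[of x] nC[of z] by (auto split: if_splits)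
  qed
  thus ?thesis by blast
qed

text \<open>For regular \<open>k\<close> this is equivalent to \<open>x\<close> having fewer than
  \<open>k\<close> elements (\<open>sat_SizeLess\<close>), but it passes to images, unions and
  products without any work with bijections.\<close>

definition bd :: "'v => 'v => bool" where
  "bd k x = (ALL f. fto f x k --> (EX b. b <: k & (ALL y. y <: x --> ap f y <: b)))"
lemma D_bd [dfi]: "Dt a ==> Dt b ==> D (%x. bd (a x) (b x))"
  by (rule D_comp2[of bd], unfold bd_def, intro dfi, assumption+)

definition rc :: "'v => bool" where
  "rc k = (od k & emp <: k & (ALL y. y <: k --> suc y <: k) & (ALL a. a <: k --> bd k a))"

lemma rc_od: "rc k ==> od k" and rc_emp: "rc k ==> emp <: k" and rc_suc: "rc k ==> y <: k ==> suc y <: k"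
  and rc_bd: "rc k ==> a <: k ==> bd k a" unfolding rc_def by auto

lemma bd_I: "bd k x ==> Dt T ==> (!!y. y <: x ==> T y <: k) ==> EX b. b <: k & (ALL y. y <: x --> T y <: b)"
  unfolding bd_def using fto_Lam[of T x k] ap_Lam[of T _ x] by metis

lemma bd_Im: assumes "bd k x" "Dt T" shows "bd k (Im x T)"
  unfolding bd_def
proof (intro allI impI)
  fix f assume f: "fto f (Im x T) k"
  have "Dt (%y. ap f (T y))" by (intro dfi assms)
  moreover have "ap f (T y) <: k" if "y <: x" for y using fto_ap[OF f] that mem_Im[OF assms(2)] by blast
  ultimately show "EX b. b <: k & (ALL y. y <: Im x T --> ap f y <: b)"
    using bd_I[OF assms(1), of "%y. ap f (T y)"] unfolding mem_Im[OF assms(2)] by blast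
qed

lemma bd_sub: assumes "emp <: k" "bd k x" "!!z. z <: y ==> z <: x" shows "bd k y"
  unfolding bd_def
proof (intro allI impI)
  fix f assume f: "fto f y k"
  let ?T = "%z. if z <: y then ap f z else emp"
  have "Dt ?T" by (intro dfi)
  moreover have "?T z <: k" for z using fto_ap[OF f] assms(1) by simp
  ultimately obtain b where b: "b <: k" "ALL z. z <: x --> ?T z <: b" using bd_I[OF assms(2), of ?T] by blast
  have "ap f z <: b" if "z <: y" for z using b(2)[rule_format, OF assms(3)[OF that]] that by simp
  thus "EX b. b <: k & (ALL z. z <: y --> ap f z <: b)" using b by blast
qed

lemma bd_Uu: assumes "od k" "bd k a" "!!x. x <: a ==> bd k x" shows "bd k (Uu a)"
  unfolding bd_def
proof (intro allI impI)
  fix f assume f: "fto f (Uu a) k"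
  have "EX b. b <: k & (ALL y. y <: x --> ap f y <: b)" if "x <: a" for x
  proof (rule bd_I[OF assms(3)[OF that]])
    show "Dt (ap f)" by (intro dfi)
  qed (use fto_ap[OF f] that in auto)
  then obtain g where g: "fto g a k" "ALL x. x <: a --> (ALL y. y <: x --> ap f y <: ap g x)"
    using AC[of "%x b. ALL y. y <: x --> ap f y <: b" a k] by (simp add: dfi) blast
  then obtain c where c: "c <: k" "ALL x. x <: a --> ap g x <: c" using assms(2) unfolding bd_def by blast
  have "ap f y <: c" if "y <: Uu a" for y
    using that g(2) c od_trans[OF od_mem[OF assms(1) c(1)]] unfolding mem_Un by blast
  thus "EX b. b <: k & (ALL y. y <: Uu a --> ap f y <: b)" using c(1) by blast
qed

lemma bd_up: assumes "rc k" shows "bd k (up a b)"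
  unfolding bd_def
proof (intro allI impI)
  fix f assume f: "fto f (up a b) k"
  hence m: "ap f a <: k" "ap f b <: k" by (auto intro: fto_ap)
  hence "ap f a <: suc (ap f b) | ap f b <: suc (ap f a)"
    using od_tri[OF od_mem od_mem, OF rc_od[OF assms] _ rc_od[OF assms]] by auto
  thus "EX c. c <: k & (ALL y. y <: up a b --> ap f y <: c)"
    using rc_suc[OF assms m(1)] rc_suc[OF assms m(2)] mem_suc unfolding mem_up by blast
qed

lemma bd_un: assumes "rc k" "bd k a" "bd k b" shows "bd k (un a b)"
proof -
  have "un a b = Uu (up a b)" by (rule exten) auto
  thus ?thesis using bd_Uu[OF rc_od[OF assms(1)] bd_up[OF assms(1)], of a b] assms by auto
qed

lemma bd_prd: assumes "rc k" "bd k a" "bd k b" shows "bd k (prd a b)"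
proof -
  have d: "Dt (pr x)" "Dt (%x. Im b (pr x))" for x by (intro dfi)+
  show ?thesis unfolding prd_def
    by (intro bd_Uu rc_od assms bd_Im d) (auto simp: mem_Im d intro!: bd_Im assms)
qed

text \<open>For the direction from \<open>bd\<close>: well-order \<open>x\<close>. Were its order
  type not below \<open>k\<close>, the inverse of the enumeration would map \<open>x\<close> onto
  all of \<open>k\<close> and be unbounded.\<close>

lemma sat_SizeLess: assumes "rc k" shows "sat E (SizeLess x k) = bd k x"
proof -
  have "bd k x" if "a <: k" "bij f a x" for a f
  proof -
    have d: "Dt (ap f)" by (intro dfi)
    have "bd k (Im a (ap f))" by (intro bd_Im rc_bd assms that d)
    moreover have "z <: Im a (ap f)" if "z <: x" for z using bijE(3)[OF \<open>bij f a x\<close> that] by (auto simp: mem_Im d)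
    ultimately show ?thesis using bd_sub rc_emp assms by blast
  qed
  moreover have "EX a f. a <: k & bij f a x" if x: "bd k x"
  proof -
    obtain f a where a: "od a" "bij f a x" using wellorder by blast
    have "a <: k"
    proof (rule ccontr)
      assume "~ a <: k"
      hence ka: "b <: a" if "b <: k" for b using od_tri[OF a(1) rc_od[OF assms]] od_trans[OF a(1)] that by blast
      \<comment> \<open>The inverse of \<open>f\<close> on \<open>k\<close>: the set is the
        singleton of the preimage, whose union is the preimage itself. Points without a preimage are
        sent to \<open>emp\<close>.\<close>
      define T where "T y = Uu (Sp k (%b. ap f b = y))" for y
      have DT: "Dt T" unfolding T_def by (intro dfi)
      have m: "b <: Sp k (%b. ap f b = y) = (b <: k & ap f b = y)" for b y by (intro mem_Sp dfi)
      have T: "T (ap f b) = b" if "b <: k" for b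
        unfolding T_def by (rule exten) (use bijE(2)[OF a(2)] ka that in \<open>auto simp: m\<close>)
      have "T y <: k" if "y <: x" for y
      proof (cases "EX b. b <: k & ap f b = y")
        case False
        hence "T y = emp" unfolding T_def by (intro exten) (auto simp: m)
        thus ?thesis using rc_emp[OF assms] by simp
      qed (use T in auto)
      then obtain b where "b <: k" "ALL y. y <: x --> T y <: b" using bd_I[OF x DT] by blast
      thus False using T bijE(1)[OF a(2) ka] not_mem_self by metis
    qed
    thus ?thesis using a by blast
  qed
  ultimately show ?thesis unfolding SizeLess_def by auto
qed

lemma rc_RegularCardinal: assumes "sat E (RegularCardinal k)" shows "rc k"
proof -
  have k: "od k" "EX y. y <: k" "ALL y. y <: k --> (EX z. z <: k & y <: z)"
    using assms unfolding RegularCardinal_def LimitOrdinal_def by auto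
  have e: "emp <: k" using od_emp k emp_eq by blast
  have s: "suc y <: k" if y: "y <: k" for y
  proof -
    obtain z where z: "z <: k" "y <: z" using k y by blast
    thus ?thesis using od_suc_le[OF od_mem[OF k(1) z(1)] z(2)] od_trans[OF k(1)] by metis
  qed
  have R: "ALL a f. a <: k & fto f a k --> (EX b. b <: k & (ALL x y. pr x y <: f --> y <: b))"
    using assms unfolding RegularCardinal_def by simp
  have "EX b. b <: k & (ALL x. x <: a --> ap f x <: b)" if f: "a <: k" "fto f a k" for a f
  proof -
    obtain b where "b <: k" "ALL x y. pr x y <: f --> y <: b" using R f by blast
    thus ?thesis using f fon_ap unfolding fto_def by blast
  qed
  thus ?thesis using k e s unfolding rc_def bd_def by blast
qed

text \<open>\<open>StrongLimit\<close> speaks of cardinals, so \<open>x\<close> is replaced by the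
  least ordinal in bijection with it; the power set of \<open>x\<close> is an image of the power set
  of that cardinal.\<close>

lemma bd_Pw: assumes k: "sat E (Inaccessible k)" and x: "bd k x" shows "bd k (Pw x)"
proof -
  have rc: "rc k" using k unfolding Inaccessible_def by (simp add: rc_RegularCardinal)
  let ?Q = "%a. a <: k & (EX f. bij f a x)"
  have "EX a. ?Q a" using x sat_SizeLess[OF rc, of x] unfolding SizeLess_def by simp
  moreover have "D ?Q" by (intro dfi)
  ultimately obtain a where a: "?Q a" "ALL b. b <: a --> ~ ?Q b" using eps_min[of ?Q] by blast
  then obtain f where f: "bij f a x" by blast
  have "~ bij g b a" if b: "b <: a" for b g
  proof
    assume g: "bij g b a"
    have "bij (Lam b (%z. ap f (ap g z))) b x"
      by (rule bij_Lam) (intro dfi, (use bijE[OF f] bijE[OF g] in metis)+)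
    thus False using a od_trans[OF rc_od[OF rc]] b by blast
  qed
  hence "sat E (Cardinal a)" using a od_mem[OF rc_od[OF rc]] unfolding Cardinal_def by simp
  then obtain u where u: "ALL z. z <: u = (ALL w. w <: z --> w <: a)" "bd k u"
    using k a sat_SizeLess[OF rc] unfolding Inaccessible_def StrongLimit_def by auto
  let ?T = "%s. Im s (ap f)"
  have T: "Dt ?T" "Dt (ap f)" by (intro dfi)+
  have "z <: Im u ?T" if z: "z <: Pw x" for z
  proof -
    let ?s = "Sp a (%w. ap f w <: z)"
    have m: "w <: ?s = (w <: a & ap f w <: z)" for w by (intro mem_Sp dfi)
    have "z = ?T ?s"
      by (rule exten) (use z bijE(3)[OF f] in \<open>auto simp: mem_Im T(2) m\<close>)
    thus ?thesis unfolding mem_Im[OF T(1)] using u(1) m by blast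
  qed
  thus ?thesis using bd_sub[OF rc_emp[OF rc] bd_Im[OF u(2) T(1)]] by blast
qed

end

section \<open>The forcing relation for atomic formulas\<close>

context zf begin

definition tc :: "'v => 'v" where "tc = Rec (%x g. un x (Uu (rg g)))"

lemma Dt_tc [dfi]: "Dt a ==> Dt (%x. tc (a x))"
  by (rule Dt_comp[of tc], unfold tc_def, rule Dt_Rec, intro dfi)

lemma mem_tc: "y <: tc x = (y <: x | (EX z. z <: x & y <: tc z))"
proof -
  have "tc x = un x (Uu (rg (Lam x tc)))" unfolding tc_def by (rule Rec_eq) (intro dfi)
  moreover have "Dt tc" by (intro dfi)
  ultimately show ?thesis by (auto simp: pr_Lam)
qed

lemma tc_induct: assumes "D Q" "!!x. (!!y. y <: tc x ==> Q y) ==> Q x" shows "Q x"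
proof -
  let ?Q = "%x. ALL y. y <: tc x --> Q y"
  have "?Q x" for x
  proof (rule eps_induct[of ?Q])
    show "D ?Q" by (intro dfi D_comp[OF assms(1)])
    fix x assume "!!z. z <: x ==> ?Q z"
    thus "?Q x" using assms(2) mem_tc[of _ x] by metis
  qed
  thus ?thesis using assms(2) by blast
qed

lemma pr_tc: "pr c s <: x ==> c <: tc x"
proof -
  have "up c c <: pr c s" unfolding pr_def by simp
  thus "pr c s <: x ==> c <: tc x" using mem_tc[of c] mem_up[of c c c] by blast
qed

lemma name_induct: assumes "D Q" "!!x. (!!c s. pr c s <: x ==> Q c) ==> Q x" shows "Q x"
proof (rule tc_induct[OF assms(1)])
  show "Q x" if "!!y. y <: tc x ==> Q y" for x using assms(2)[of x] pr_tc[of _ _ x] that by blast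
qed

lemma sat_TripleIn [simp]: "sat E (TripleIn x y z r) = (pr x (pr y z) <: r)"
  unfolding TripleIn_def by simp

end

locale forcing = zf E for E :: "nat => nat => bool" (infix "<:" 50) +
  fixes P R :: nat
  assumes R_refl: "p <: P ==> pr p p <: R"
    and R_trans: "pr p q <: R ==> pr q r <: R ==> p <: P ==> q <: P ==> r <: P ==> pr p r <: R"
    and P_ne: "EX p. p <: P"
begin

definition le :: "nat => nat => bool" where "le q p = (q <: P & p <: P & pr q p <: R)"
lemma below [simp]: "below E P R = le" unfolding below_def le_def by (simp add: fun_eq_iff)
lemma D_le [dfi]: "Dt a ==> Dt b ==> D (%x. le (a x) (b x))" unfolding le_def by (intro dfi)
lemma le_refl: "p <: P ==> le p p" unfolding le_def using R_refl by blast
lemma le_trans: "le p q ==> le q r ==> le p r" unfolding le_def using R_trans by blast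
lemma le_P: "le q p ==> q <: P" "le q p ==> p <: P" unfolding le_def by auto

abbreviation ms :: "(nat => nat => nat => bool) => nat => nat => nat => bool" where "ms == mem_step E P R"
abbreviation ss :: "(nat => nat => nat => bool) => nat => nat => nat => bool" where "ss == subset_step E P R"
abbreviation es :: "(nat => nat => nat => bool) => nat => nat => nat => bool" where "es == eq_step E P R"
abbreviation fe :: "nat => nat => nat => bool" where "fe == forces_eq E P R"
abbreviation fm :: "nat => nat => nat => bool" where "fm == forces_mem E P R"

lemma ms: "ms X p x y = (ALL q. le q p --> (EX r c s. le r q & pr c s <: y & le r s & X r x c))"
  unfolding mem_step_def by simp
lemma ss: "ss X p x y = (ALL q c s. le q p --> pr c s <: x --> le q s --> ms X q c y)"
  unfolding subset_step_def by (simp add: imp_conjL)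
lemma es: "es X p x y = (ss X p x y & ss X p y x)" unfolding eq_step_def ..

definition tri :: "nat => nat => nat => nat => bool" where "tri F q u v = (pr q (pr u v) <: F)"

definition sol :: "nat => nat => bool" where
  "sol T F = (trs T & (ALL q u v. q <: P & u <: T & v <: T --> tri F q u v = es (tri F) q u v))"

lemma D_sol: "Dt a ==> Dt b ==> D (%x. sol (a x) (b x))"
  by (rule D_comp2[of sol], unfold sol_def es ss ms tri_def, intro dfi, assumption+)

lemma fe_def: "fe p x y = (EX T F. sol T F & x <: T & y <: T & tri F p x y)"
  unfolding forces_eq_def sol_def tri_def by auto

lemma D_fe [dfi]: "Dt a ==> Dt b ==> Dt c ==> D (%x. fe (a x) (b x) (c x))"
  by (rule D_comp3[of fe], unfold fe_def tri_def, intro dfi D_sol, assumption+)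

lemma ms_cong: assumes "!!r c s. pr c s <: y ==> r <: P ==> X r x c ==> Y r x c" shows "ms X p x y ==> ms Y p x y"
  unfolding ms using assms le_P by meson

lemma es_mono: assumes "!!r c d. r <: P ==> c <: tc x & d <: tc y | d <: tc x & c <: tc y ==> X r c d ==> Y r c d"
  shows "es X p x y ==> es Y p x y"
proof -
  have "ms X q c y ==> ms Y q c y" if "pr c s <: x" for q c s
    using ms_cong[of y X c Y q] assms pr_tc[OF that] pr_tc[of _ _ y] by blast
  moreover have "ms X q c x ==> ms Y q c x" if "pr c s <: y" for q c s
    using ms_cong[of x X c Y q] assms pr_tc[OF that] pr_tc[of _ _ x] by blast
  ultimately show "es X p x y ==> es Y p x y" unfolding es ss by meson
qed

lemma trs_tc: "trs T ==> x <: T ==> y <: tc x ==> y <: T"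
proof -
  let ?Q = "%x. ALL y. trs T & x <: T & y <: tc x --> y <: T"
  have "?Q x"
  proof (rule eps_induct[of ?Q], intro dfi)
    fix x assume "!!z. z <: x ==> ?Q z"
    thus "?Q x" using mem_tc[of _ x] unfolding trs_def by metis
  qed
  thus "trs T ==> x <: T ==> y <: tc x ==> y <: T" by blast
qed

text \<open>\<open>eq_step\<close> is monotone in the relation, so the union of all sets of triples
  that are contained in their own step is a fixed point, as in the Knaster-Tarski theorem.\<close>

lemma ex_sol: assumes T: "trs T" shows "EX F. sol T F"
proof -
  define ok where "ok Z = (ALL w. w <: Z --> (EX q u v. w = pr q (pr u v) & q <: P & u <: T & v <: T & es (tri Z) q u v))" for Z
  define F where "F = Sp (prd P (prd T T)) (%w. EX Z. w <: Z & ok Z)"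
  have Dok: "D ok" unfolding ok_def es ss ms tri_def by (intro dfi)
  have "D (%w. EX Z. w <: Z & ok Z)" by (intro dfi D_comp[OF Dok])
  hence "w <: F = (w <: prd P (prd T T) & (EX Z. w <: Z & ok Z))" for w unfolding F_def by (rule mem_Sp)
  hence F: "w <: F = (EX Z. w <: Z & ok Z)" for w unfolding ok_def by auto
  have 1: "es (tri F) q u v" if "tri F q u v" for q u v
  proof -
    obtain Z where Z: "pr q (pr u v) <: Z" "ok Z" using \<open>tri F q u v\<close> unfolding tri_def F by blast
    hence "es (tri Z) q u v" unfolding ok_def by (metis pr_eq)
    moreover have "tri F r c d" if "tri Z r c d" for r c d using Z(2) that unfolding tri_def F by blast
    ultimately show ?thesis by (blast intro: es_mono)
  qed
  have 2: "tri F q u v" if a: "es (tri F) q u v" "q <: P" "u <: T" "v <: T" for q u v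
  proof -
    let ?w = "pr q (pr u v)" let ?Z = "un F (up ?w ?w)"
    have m: "tri F r c d ==> tri ?Z r c d" for r c d unfolding tri_def by simp
    have "ok ?Z" unfolding ok_def
    proof (intro allI impI)
      fix w assume w: "w <: ?Z"
      have "EX q u v. w = pr q (pr u v) & q <: P & u <: T & v <: T & es (tri F) q u v"
      proof (cases "w = ?w")
        case False
        then obtain Z where "w <: Z" "ok Z" using w F by auto
        then obtain q u v where "w = pr q (pr u v) & q <: P & u <: T & v <: T" unfolding ok_def by blast
        thus ?thesis using 1 w False unfolding tri_def by auto
      qed (use a in blast)
      then obtain q' u' v' where w': "w = pr q' (pr u' v') & q' <: P & u' <: T & v' <: T" "es (tri F) q' u' v'" by blast
      hence "es (tri ?Z) q' u' v'" using es_mono[of u' v' "tri F" "tri ?Z" q'] m by blast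
      thus "EX q u v. w = pr q (pr u v) & q <: P & u <: T & v <: T & es (tri ?Z) q u v" using w' by blast
    qed
    thus ?thesis unfolding tri_def F by (intro exI[of _ ?Z]) simp
  qed
  show ?thesis unfolding sol_def using T 1 2 by blast
qed

text \<open>Unfolding an equation leads to pairs of names with the sides in either order, whence the
  symmetric statement. Induction on \<open>x\<close> alone suffices, because one side always
  descends from \<open>x\<close>.\<close>

lemma sol_unique: assumes "sol T F" "sol S H"
  shows "ALL y q. x <: T & x <: S & y <: T & y <: S & q <: P --> tri F q x y = tri H q x y & tri F q y x = tri H q y x"
    (is "?Q x")
proof (rule tc_induct[of ?Q])
  show "D ?Q" unfolding tri_def by (intro dfi)
  fix x assume IH: "!!c. c <: tc x ==> ?Q c"
  show "?Q x"
  proof (intro allI impI)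
    fix y q assume a: "x <: T & x <: S & y <: T & y <: S & q <: P"
    have "tri F r c d = tri H r c d & tri F r d c = tri H r d c" if "r <: P" "c <: tc x" "d <: tc y" for r c d
      using IH[OF that(2)] that a assms trs_tc unfolding sol_def by metis
    hence "es (tri F) q x y = es (tri H) q x y" "es (tri F) q y x = es (tri H) q y x"
      using es_mono[of x y "tri F" "tri H"] es_mono[of x y "tri H" "tri F"]
        es_mono[of y x "tri F" "tri H"] es_mono[of y x "tri H" "tri F"] by meson+
    thus "tri F q x y = tri H q x y & tri F q y x = tri H q y x" using a assms unfolding sol_def by metis
  qed
qed

lemma fe_sol: assumes "sol T F" "x <: T" "y <: T" "q <: P" shows "fe q x y = tri F q x y"
  unfolding fe_def using assms sol_unique by blast

lemma fe_rec: assumes "p <: P" shows "fe p x y = es fe p x y"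
proof -
  obtain T where T: "trs T" "x <: T" "y <: T" using ex_trs[of "up x y"] by auto
  obtain F where F: "sol T F" using ex_sol[OF T(1)] by blast
  have "fe p x y = es (tri F) p x y" using fe_sol[OF F T(2,3) assms] F T assms unfolding sol_def by blast
  moreover have "fe r c d = tri F r c d" if "r <: P" "c <: tc x & d <: tc y | d <: tc x & c <: tc y" for r c d
    using fe_sol[OF F _ _ that(1)] that(2) trs_tc[OF T(1)] T by blast
  ultimately show ?thesis using es_mono[of x y "tri F" fe] es_mono[of x y fe "tri F"] by meson
qed

lemma fe_sym: "p <: P ==> fe p x y ==> fe p y x"
  using fe_rec[of p x y] fe_rec[of p y x] unfolding es by blast

lemma ms_le: "ms X p x y ==> le q p ==> ms X q x y" unfolding ms using le_trans by blast

lemma ss_le: "ss X p x y ==> le q p ==> ss X q x y" unfolding ss using le_trans by blast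

lemma fe_le: "fe p x y ==> le q p ==> fe q x y"
  using fe_rec[of p x y] fe_rec[of q x y] le_P[of q p] ss_le[of fe p x y q] ss_le[of fe p y x q] unfolding es by blast

lemma fe_refl: "ALL p. p <: P --> fe p x x" (is "?Q x")
proof (rule name_induct[of ?Q], intro dfi)
  fix x assume IH: "!!c s. pr c s <: x ==> ?Q c"
  have "ms fe q c x" if "pr c s <: x" "le q s" for q c s
    unfolding ms using that IH le_refl le_trans le_P by meson
  thus "?Q x" using fe_rec unfolding es ss by meson
qed

lemma fe_trans: "ALL y z p. p <: P --> fe p x y --> fe p y z --> fe p x z" (is "?Q x")
proof (rule name_induct[of ?Q], intro dfi)
  fix x assume IH: "!!c s. pr c s <: x ==> ?Q c"
  show "?Q x"
  proof (intro allI impI)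
    fix y z p assume p: "p <: P" and xy: "fe p x y" and yz: "fe p y z"
    have e: "ss fe p x y" "ss fe p y z" "ss fe p z y" "ss fe p y x"
      using xy yz fe_rec[OF p] unfolding es by blast+
    have "ms fe q c z" if c: "le q p" "pr c s <: x" "le q s" for q c s
      unfolding ms
    proof (intro allI impI)
      fix q' assume q': "le q' q"
      then obtain r d t where r: "le r q'" "pr d t <: y" "le r t" "fe r c d" using e(1) c unfolding ss ms by blast
      have "le r p" using r q' c le_trans by blast
      then obtain r' b t' where b: "le r' r" "pr b t' <: z" "le r' t'" "fe r' d b"
        using e(2) r le_refl le_P unfolding ss ms by meson
      have "fe r' c b" using IH[OF c(2)] b(4) fe_le[OF r(4) b(1)] le_P(1)[OF b(1)] by blast
      thus "EX r c' s. le r q' & pr c' s <: z & le r s & fe r c c'" using b le_trans[OF b(1) r(1)] by blast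
    qed
    moreover have "ms fe q b x" if c: "le q p" "pr b s <: z" "le q s" for q b s
      unfolding ms
    proof (intro allI impI)
      fix q' assume q': "le q' q"
      then obtain r d t where r: "le r q'" "pr d t <: y" "le r t" "fe r b d" using e(3) c unfolding ss ms by blast
      have "le r p" using r q' c le_trans by blast
      then obtain r' c t' where b: "le r' r" "pr c t' <: x" "le r' t'" "fe r' d c"
        using e(4) r le_refl le_P unfolding ss ms by meson
      have "fe r' c b" using IH[OF b(2)] fe_sym[OF _ b(4)] fe_sym[OF _ fe_le[OF r(4) b(1)]] le_P(1)[OF b(1)] by blast
      hence "fe r' b c" using fe_sym le_P(1)[OF b(1)] by blast
      thus "EX r c' s. le r q' & pr c' s <: x & le r s & fe r b c'" using b le_trans[OF b(1) r(1)] by blast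
    qed
    ultimately show "fe p x z" unfolding fe_rec[OF p] es ss by blast
  qed
qed

definition chk :: "nat => nat" where "chk = Rec (%x g. prd (rg g) P)"

lemma Dt_chk [dfi]: "Dt a ==> Dt (%x. chk (a x))"
  by (rule Dt_comp[of chk], unfold chk_def, rule Dt_Rec, intro dfi)

lemma mem_chk: "u <: chk x = (EX z p. z <: x & p <: P & u = pr (chk z) p)"
proof -
  have "chk x = prd (rg (Lam x chk)) P" unfolding chk_def by (rule Rec_eq) (intro dfi)
  moreover have "Dt chk" by (intro dfi)
  ultimately show ?thesis by (auto simp: pr_Lam)
qed

lemma sat_IsCheckName [simp]: "sat E (IsCheckName P n x) = (n = chk x)"
proof
  have d: "Dt chk" by (intro dfi)
  assume "sat E (IsCheckName P n x)"
  hence "EX T g. trs T & x <: T & fon g T & (ALL y m. pr y m <: g -->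
      (ALL u. u <: m = (EX z k p. z <: y & pr z k <: g & p <: P & u = pr k p))) & pr x n <: g"
    unfolding IsCheckName_def by simp
  then obtain T g where T: "trs T" "x <: T" "fon g T" "pr x n <: g"
    and g: "ALL y m. pr y m <: g --> (ALL u. u <: m = (EX z k p. z <: y & pr z k <: g & p <: P & u = pr k p))" by blast
  have "y <: T --> ap g y = chk y" (is "?Q y") for y
  proof (rule eps_induct[of ?Q], intro dfi, intro impI)
    fix y assume IH: "!!z. z <: y ==> ?Q z" and y: "y <: T"
    have "pr z k <: g = (k = chk z)" if "z <: y" for z k
    proof -
      have "z <: T" using T(1) y that unfolding trs_def by blast
      thus ?thesis using fon_iff[OF T(3), of z k] IH[OF that] by auto
    qed
    thus "ap g y = chk y" using g[rule_format, OF fon_ap[OF T(3) y]] by (intro exten) (auto simp: mem_chk)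
  qed
  thus "n = chk x" using T fon_iff[OF T(3)] by simp
next
  have d: "Dt chk" by (intro dfi)
  assume n: "n = chk x"
  obtain T where T: "trs T" "x <: T" using ex_trs1 by blast
  have "u <: chk y = (EX z k p. z <: y & (z <: T & k = chk z) & p <: P & u = pr k p)" if "y <: T" for y u
    using that T(1) unfolding mem_chk trs_def by blast
  thus "sat E (IsCheckName P n x)" unfolding IsCheckName_def using T n
    by (simp, intro exI[of _ T] conjI exI[of _ "Lam T chk"]) (simp_all add: fon_Lam[OF d] pr_Lam[OF d])
qed

lemma fe_chk: "ALL y p. p <: P --> fe p (chk x) (chk y) --> x = y" (is "?Q x")
proof (rule eps_induct[of ?Q], intro dfi)
  fix x assume IH: "!!z. z <: x ==> ?Q z"
  show "?Q x"
  proof (intro allI impI)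
    fix y p assume p: "p <: P" "fe p (chk x) (chk y)"
    have s: "ss fe p (chk x) (chk y)" "ss fe p (chk y) (chk x)" using p fe_rec unfolding es by blast+
    have "z <: y" if z: "z <: x" for z
    proof -
      have "ms fe p (chk z) (chk y)" using s(1) z p le_refl mem_chk unfolding ss by blast
      then obtain r w where "le r p" "w <: y" "fe r (chk z) (chk w)" using le_refl[OF p(1)] unfolding ms mem_chk by (metis pr_eq)
      thus ?thesis using IH[OF z] le_P by blast
    qed
    moreover have "w <: x" if w: "w <: y" for w
    proof -
      have "ms fe p (chk w) (chk x)" using s(2) w p le_refl mem_chk unfolding ss by blast
      then obtain r z where "le r p" "z <: x" "fe r (chk w) (chk z)" using le_refl[OF p(1)] unfolding ms mem_chk by (metis pr_eq)
      thus ?thesis using IH[of z] le_P(1) fe_sym by metis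
    qed
    ultimately show "x = y" using exten by blast
  qed
qed

end

section \<open>Generic filters and the truth lemma\<close>

context forcing begin

definition comp :: "nat => nat => bool" where "comp p q = (EX r. le r p & le r q)"
lemma D_comp' [dfi]: "Dt a ==> Dt b ==> D (%x. comp (a x) (b x))"
  by (rule D_comp2[of comp], unfold comp_def, intro dfi, assumption+)

definition gen :: "nat set => bool" where
  "gen G = ((ALL p:G. p <: P) & (ALL p q. p : G --> le p q --> q : G) & (ALL p:G. ALL q:G. EX r:G. le r p & le r q) &
     (EX p. p : G) & (ALL d. (ALL p. p <: P --> (EX q. le q p & q <: d)) --> (EX q:G. q <: d)))"

lemma gen_P: "gen G ==> p : G ==> p <: P" and gen_up: "gen G ==> p : G ==> le p q ==> q : G"
  and gen_dir: "gen G ==> p : G ==> q : G ==> EX r:G. le r p & le r q" and gen_ne: "gen G ==> EX p. p : G"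
  unfolding gen_def by blast+

text \<open>Every set of the model is a natural number. Step \<open>n\<close> of the descending
  sequence enters the set \<open>n\<close> if this is possible below the current condition, so each
  dense set has its turn.\<close>

lemma ex_gen: assumes "p <: P" shows "EX G. gen G & p : G"
proof -
  define f where "f = rec_nat p (%n q. if EX r. le r q & r <: n then SOME r. le r q & r <: n else q)"
  have f0: "f 0 = p" unfolding f_def by simp
  have fS: "f (Suc n) = (if EX r. le r (f n) & r <: n then SOME r. le r (f n) & r <: n else f n)" for n
    unfolding f_def by simp
  have fd: "le (f (Suc n)) (f n) & f (Suc n) <: n" if "EX r. le r (f n) & r <: n" for n
    using someI_ex[OF that] that unfolding fS by simp
  have fP: "f n <: P" for n
  proof (induction n)
    case (Suc n) thus ?case using fd[of n] le_P unfolding fS by (cases "EX r. le r (f n) & r <: n") (auto simp: fS)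
  qed (simp add: f0 assms)
  have f1: "le (f (Suc n)) (f n)" for n
    using fd[of n] le_refl[OF fP, of n] by (cases "EX r. le r (f n) & r <: n") (auto simp: fS)
  have fm: "le (f (n + k)) (f n)" for n k
    by (induction k) (use le_refl[OF fP] in simp, metis add_Suc_right f1 le_trans)
  have fm: "le (f m) (f n)" if "n <= m" for m n using fm[of n "m - n"] that by simp
  let ?G = "{q. EX n. le (f n) q}"
  have "gen ?G" unfolding gen_def
  proof (intro conjI ballI allI impI)
    fix a b assume "a : ?G" "b : ?G"
    then obtain m n where mn: "le (f m) a" "le (f n) b" by blast
    have "le (f (m + n)) a & le (f (m + n)) b" using le_trans[OF fm[of m "m + n"] mn(1)] le_trans[OF fm[of n "m + n"] mn(2)] by simp
    thus "EX r:?G. le r a & le r b" using le_refl[OF fP] by blast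
  next
    fix d assume "ALL p. p <: P --> (EX q. le q p & q <: d)"
    hence "f (Suc d) <: d" using fd fP by blast
    thus "EX q:?G. q <: d" using le_refl[OF fP] by blast
  qed (use le_P le_trans le_refl[OF fP] in blast)+
  moreover have "p : ?G" using f0 le_refl[OF assms] by (auto intro!: exI[of _ 0])
  ultimately show ?thesis by blast
qed

text \<open>\<open>gen\<close> is about dense sets of the model. The class \<open>Q\<close>, dense
  only below \<open>p\<close>, is cut down to conditions and completed by those incompatible with
  \<open>p\<close>.\<close>

lemma gen_dense: assumes "gen G" "D Q" "p : G" "!!q. le q p ==> EX r. le r q & Q r" shows "EX r. r : G & Q r"
proof -
  let ?d = "Sp P (%r. Q r | ~ comp r p)"
  have m: "r <: ?d = (r <: P & (Q r | ~ comp r p))" for r by (intro mem_Sp dfi assms)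
  have "EX q. le q a & q <: ?d" if a: "a <: P" for a
  proof (cases "comp a p")
    case True
    then obtain b where "le b a" "le b p" unfolding comp_def by blast
    thus ?thesis using assms(4)[of b] le_trans le_P unfolding m by blast
  qed (use le_refl[OF a] a m in blast)
  then obtain q where q: "q : G" "q <: ?d" using assms(1) unfolding gen_def by meson
  moreover obtain r where "r : G" "le r p" "le r q" using gen_dir[OF assms(1,3) q(1)] by blast
  ultimately have "comp q p" unfolding comp_def by blast
  thus ?thesis using q unfolding m by blast
qed

text \<open>Truth of atomic statements is read off from the forcing relation, as names cannot be
  evaluated by recursion along an ill-founded \<open>E\<close>. The clauses of such a recursion are
  then theorems.\<close>

definition memG :: "nat set => nat => nat => bool" where "memG G x y = (EX p. p : G & fm p x y)"
definition eqG :: "nat set => nat => nat => bool" where "eqG G x y = (EX p. p : G & fe p x y)"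

lemma fm_def: "fm p x y = ms fe p x y" unfolding forces_mem_def ..
lemma D_fm [dfi]: "Dt a ==> Dt b ==> Dt c ==> D (%x. fm (a x) (b x) (c x))"
  by (rule D_comp3[of fm], unfold fm_def ms, intro dfi, assumption+)

lemma memG: assumes G: "gen G" shows "memG G x y = (EX c s. pr c s <: y & s : G & eqG G x c)"
proof
  assume "memG G x y"
  then obtain p where p: "p : G" "ms fe p x y" unfolding memG_def fm_def by blast
  have "D (%r. EX c s. pr c s <: y & le r s & fe r x c)" by (intro dfi)
  then obtain r where "r : G" "EX c s. pr c s <: y & le r s & fe r x c"
    using gen_dense[OF G _ p(1), of "%r. EX c s. pr c s <: y & le r s & fe r x c"] p(2) unfolding ms by meson
  thus "EX c s. pr c s <: y & s : G & eqG G x c" unfolding eqG_def using gen_up[OF G] by blast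
next
  assume "EX c s. pr c s <: y & s : G & eqG G x c"
  then obtain c s q where c: "pr c s <: y" "s : G" "q : G" "fe q x c" unfolding eqG_def by blast
  then obtain r where r: "r : G" "le r s" "le r q" using gen_dir[OF G] by blast
  have "ms fe r x y" unfolding ms using c(1) r(2,3) le_trans le_refl le_P fe_le[OF c(4)] by meson
  thus "memG G x y" using r unfolding memG_def fm_def by blast
qed

lemma eqG_sub: assumes "gen G" "p : G" "ss fe p x y" "pr c s <: x" "s : G" shows "memG G c y"
proof -
  obtain q where "q : G" "le q p" "le q s" using gen_dir assms by blast
  thus ?thesis using assms unfolding memG_def fm_def ss by blast
qed

lemma eqG: assumes G: "gen G"
  shows "eqG G x y = ((ALL c s. pr c s <: x --> s : G --> memG G c y) & (ALL c s. pr c s <: y --> s : G --> memG G c x))"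
proof
  assume "eqG G x y"
  then obtain p where "p : G" "fe p x y" unfolding eqG_def by blast
  thus "(ALL c s. pr c s <: x --> s : G --> memG G c y) & (ALL c s. pr c s <: y --> s : G --> memG G c x)"
    using fe_rec[OF gen_P[OF G]] eqG_sub[OF G] unfolding es by meson
next
  assume a: "(ALL c s. pr c s <: x --> s : G --> memG G c y) & (ALL c s. pr c s <: y --> s : G --> memG G c x)"
  \<comment> \<open>\<open>B x y p\<close>: some \<open>(c, s)\<close> in \<open>x\<close> with
    \<open>p\<close> below \<open>s\<close> is forced out of \<open>y\<close>. Such conditions exist
    below every \<open>p\<close> that does not force the inclusion, but none of them lies in
    \<open>G\<close>.\<close>
  define B where "B x y p = (EX c s. pr c s <: x & le p s & (ALL r. le r p --> ~ fm r c y))" for x y p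
  have B: "EX q. le q p & B x y q" if ns: "~ ss fe p x y" for p x y
  proof -
    obtain q c s where q: "le q p" "pr c s <: x" "le q s" "~ ms fe q c y" using ns unfolding ss by blast
    then obtain q' where q': "le q' q" "ALL r d t. le r q' & pr d t <: y & le r t --> ~ fe r c d" unfolding ms by blast
    have "~ fm r c y" if "le r q'" for r
      using q'(2) that le_trans le_refl le_P unfolding fm_def ms by meson
    moreover have "le q' p" "le q' s" using q q' le_trans by blast+
    ultimately show ?thesis using q(2) unfolding B_def by blast
  qed
  have nB: "~ B x y p" if xy: "ALL c s. pr c s <: x --> s : G --> memG G c y" "p : G" for x y p
  proof
    assume "B x y p"
    then obtain c s where c: "pr c s <: x" "le p s" "ALL r. le r p --> ~ fm r c y" unfolding B_def by blast
    then obtain q where q: "q : G" "fm q c y" using xy gen_up[OF G] unfolding memG_def by blast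
    then obtain r where "le r q" "le r p" using gen_dir[OF G q(1) xy(2)] by blast
    thus False using c q ms_le unfolding fm_def by blast
  qed
  let ?Q = "%p. fe p x y | B x y p | B y x p"
  have "D ?Q" unfolding B_def by (intro dfi)
  moreover have "EX r. le r q & ?Q r" if q: "q <: P" for q
  proof (cases "fe q x y")
    case False
    hence "~ ss fe q x y | ~ ss fe q y x" unfolding fe_rec[OF q] es by blast
    thus ?thesis using B by blast
  qed (use le_refl[OF q] in blast)
  moreover obtain p where "p : G" using gen_ne[OF G] by blast
  ultimately obtain r where "r : G" "?Q r" using gen_dense[OF G, of ?Q p] le_P by blast
  thus "eqG G x y" using nB a unfolding eqG_def by blast
qed

lemma eqG_refl: "gen G ==> eqG G x x"
  unfolding eqG_def using fe_refl gen_ne gen_P by blast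

lemma eqG_sym: "gen G ==> eqG G x y ==> eqG G y x"
  unfolding eqG_def using fe_sym gen_P by blast

lemma eqG_trans: assumes G: "gen G" and "eqG G x y" "eqG G y z" shows "eqG G x z"
proof -
  obtain p q where pq: "p : G" "fe p x y" "q : G" "fe q y z" using assms unfolding eqG_def by blast
  then obtain r where r: "r : G" "le r p" "le r q" using gen_dir[OF G] by blast
  have "fe r x z" using fe_trans fe_le[OF pq(2) r(2)] fe_le[OF pq(4) r(3)] gen_P[OF G r(1)] by blast
  thus ?thesis using r unfolding eqG_def by blast
qed

lemma memG_eq1: "gen G ==> eqG G x x' ==> memG G x y ==> memG G x' y"
  using memG eqG_trans eqG_sym by blast

lemma memG_eq2: "gen G ==> eqG G y y' ==> memG G x y ==> memG G x y'"
  using memG[of G x y] eqG[of G y y'] memG_eq1 eqG_sym by blast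

lemma memG_I: "gen G ==> pr c s <: y ==> s : G ==> memG G c y"
  using memG eqG_refl by blast

lemma eqG_ext: "gen G ==> (!!z. memG G z x = memG G z y) ==> eqG G x y"
  unfolding eqG using memG_I by blast

lemma memG_chk: assumes "gen G" shows "memG G y (chk x) = (EX z. z <: x & eqG G y (chk z))"
  unfolding memG[OF assms] mem_chk using gen_ne[OF assms] gen_P[OF assms] by (simp; blast)

lemma eqG_chk: "gen G ==> eqG G (chk x) (chk y) = (x = y)"
  unfolding eqG_def using fe_chk gen_P eqG_refl[unfolded eqG_def] by blast

text \<open>The properties that obey a truth lemma: they hold iff a condition in \<open>G\<close>
  has a property definable in the ground model. Closure under the connectives and quantifiers takes
  the place of writing out formulas of the forcing language.\<close>

definition DG :: "(nat set => nat => bool) => bool" where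
  "DG Q = (EX F. D (%c. F (pf c) (ps c)) & (ALL G x. gen G --> Q G x = (EX p. p : G & F p x)))"

lemma DGI: "D (%c. F (pf c) (ps c)) ==> (!!G x. gen G ==> Q G x = (EX p. p : G & F p x)) ==> DG Q"
  unfolding DG_def by (rule exI[of _ F]) simp

lemma DGE: assumes "DG Q" obtains F where "D (%c. F (pf c) (ps c))" "ALL G x. gen G --> Q G x = (EX p. p : G & F p x)"
  using assms unfolding DG_def by (elim exE conjE)

lemma DG_D: assumes "D Q" shows "DG (%G. Q)"
  unfolding DG_def by (rule exI[of _ "%p. Q"]) (use gen_ne in \<open>auto intro!: D_comp[OF assms] dfi\<close>)

lemma DG_in [dfi]: assumes "Dt a" shows "DG (%G x. a x : G)"
  unfolding DG_def by (rule exI[of _ "%p x. p = a x"]) (auto intro!: dfi Dt_comp[OF assms])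

lemma DG_comp: assumes "DG Q" "Dt a" shows "DG (%G x. Q G (a x))"
proof -
  obtain F where F: "D (%c. F (pf c) (ps c))" "ALL G x. gen G --> Q G x = (EX p. p : G & F p x)" using DGE[OF assms(1)] .
  have "D (%c. F (pf c) (a (ps c)))" by (intro D_comp2[OF F(1)] dfi Dt_comp[OF assms(2)])
  thus ?thesis unfolding DG_def using F(2) by (intro exI[of _ "%p x. F p (a x)"]) simp
qed

text \<open>Witnesses for the negation are the conditions incompatible with all witnesses for
  \<open>Q\<close>; together with the extensions of the latter they are dense.\<close>

lemma DG_not [dfi]: assumes "DG Q" shows "DG (%G x. ~ Q G x)"
proof -
  obtain F where F: "D (%c. F (pf c) (ps c))" "ALL G x. gen G --> Q G x = (EX p. p : G & F p x)" using DGE[OF assms] .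
  note DF = D_comp2[OF F(1)]
  let ?F = "%p x. ALL q. F q x --> ~ comp p q"
  have "(~ Q G x) = (EX p. p : G & ?F p x)" if G: "gen G" for G x
  proof
    assume "~ Q G x"
    hence n: "~ F p x" if "p : G" for p using F(2) G that by blast
    let ?Q = "%p. ?F p x | (EX q. F q x & le p q)"
    have "D ?Q" by (intro dfi DF)
    moreover have "EX r. le r q & ?Q r" if q: "q <: P" for q
      using le_refl[OF q] unfolding comp_def by blast
    moreover obtain p where "p : G" using gen_ne[OF G] by blast
    ultimately obtain r where "r : G" "?Q r" using gen_dense[OF G, of ?Q p] le_P by blast
    thus "EX p. p : G & ?F p x" using n gen_up[OF G] by blast
  next
    assume "EX p. p : G & ?F p x"
    thus "~ Q G x" using F(2) G gen_dir[OF G] unfolding comp_def by blast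
  qed
  moreover have "D (%c. ?F (pf c) (ps c))" by (intro dfi DF)
  ultimately show ?thesis by (intro DGI[of ?F])
qed

lemma DG_and [dfi]: assumes "DG Q" "DG S" shows "DG (%G x. Q G x & S G x)"
proof -
  obtain F where F: "D (%c. F (pf c) (ps c))" "ALL G x. gen G --> Q G x = (EX p. p : G & F p x)" using DGE[OF assms(1)] .
  obtain H where H: "D (%c. H (pf c) (ps c))" "ALL G x. gen G --> S G x = (EX p. p : G & H p x)" using DGE[OF assms(2)] .
  let ?F = "%p x. EX q r. F q x & H r x & le p q & le p r"
  have "(Q G x & S G x) = (EX p. p : G & ?F p x)" if G: "gen G" for G x
    using F(2) H(2) G gen_dir[OF G] gen_up[OF G] by blast
  moreover have "D (%c. ?F (pf c) (ps c))" by (intro dfi D_comp2[OF F(1)] D_comp2[OF H(1)])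
  ultimately show ?thesis by (intro DGI[of ?F])
qed

lemma DG_or [dfi]: "DG Q ==> DG S ==> DG (%G x. Q G x | S G x)"
  using DG_not[OF DG_and[OF DG_not DG_not, of Q S]] by simp

lemma DG_imp [dfi]: "DG Q ==> DG S ==> DG (%G x. Q G x --> S G x)"
  using DG_not[OF DG_and[OF _ DG_not, of Q S]] by simp

lemma DG_iff [dfi]: "DG Q ==> DG S ==> DG (%G x. Q G x = S G x)"
  using DG_and[OF DG_imp DG_imp, of Q S S Q] by (simp add: iff_conv_conj_imp)

lemma DG_ex [dfi]: assumes "DG (%G c. Q G (pf c) (ps c))" shows "DG (%G x. EX y. Q G x y)"
proof -
  obtain F where F: "D (%c. F (pf c) (ps c))" "ALL G x. gen G --> Q G (pf x) (ps x) = (EX p. p : G & F p x)" using DGE[OF assms] .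
  have "D (%c. EX y. F (pf c) (pr (ps c) y))" by (intro dfi D_comp2[OF F(1)])
  moreover have "(EX y. Q G x y) = (EX p. p : G & (EX y. F p (pr x y)))" if "gen G" for G x
    using F(2)[rule_format, OF that, of "pr x _"] by auto
  ultimately show ?thesis by (intro DGI[of "%p x. EX y. F p (pr x y)"])
qed

lemma DG_all [dfi]: "DG (%G c. Q G (pf c) (ps c)) ==> DG (%G x. ALL y. Q G x y)"
  using DG_not[OF DG_ex[OF DG_not, of Q]] by simp

lemma DG_memG [dfi]: assumes "Dt a" "Dt b" shows "DG (%G x. memG G (a x) (b x))"
  unfolding DG_def memG_def
  by (rule exI[of _ "%p x. fm p (a x) (b x)"]) (auto intro!: dfi Dt_comp[OF assms(1)] Dt_comp[OF assms(2)])

lemma DG_eqG [dfi]: assumes "Dt a" "Dt b" shows "DG (%G x. eqG G (a x) (b x))"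
  unfolding DG_def eqG_def
  by (rule exI[of _ "%p x. fe p (a x) (b x)"]) (auto intro!: dfi Dt_comp[OF assms(1)] Dt_comp[OF assms(2)])

lemmas DG_basic [dfi] = D_mem[THEN DG_D] D_eq[THEN DG_D] D_const[THEN DG_D] D_le[THEN DG_D] D_isf[THEN DG_D] D_fon[THEN DG_D]
  D_fto[THEN DG_D] D_od[THEN DG_D] D_bd[THEN DG_D]

definition Frc :: "nat => (nat set => bool) => bool" where
  "Frc p Q = (p <: P & (ALL G. gen G --> p : G --> Q G))"

text \<open>\<open>Frc\<close> quantifies over filters outside of the model. It is definable because
  failure in some filter through \<open>p\<close> means that \<open>p\<close> is compatible with a
  witness for the negation.\<close>

lemma D_Frc [dfi]: assumes "DG Q" "Dt a" shows "D (%x. Frc (a x) (%G. Q G x))"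
proof -
  obtain F where F: "D (%c. F (pf c) (ps c))" "ALL G x. gen G --> (~ Q G x) = (EX p. p : G & F p x)"
    using DGE[OF DG_not[OF assms(1)]] .
  have e: "Frc p (%G. Q G x) = (p <: P & (ALL q. F q x --> ~ comp p q))" for p x
  proof -
    have "EX G. gen G & p : G & ~ Q G x" if "F q x" "comp p q" for q
      using that F(2) ex_gen gen_up unfolding comp_def by (meson le_P)
    moreover have "EX q. F q x & comp p q" if "gen G" "p : G" "~ Q G x" for G
      using that F(2) gen_dir[OF that(1,2)] unfolding comp_def by blast
    ultimately show ?thesis unfolding Frc_def by blast
  qed
  show ?thesis unfolding e by (intro dfi D_comp2[OF F(1)] assms(2) Dt_comp[OF assms(2)])
qed

lemma truth: "gen G ==> DG Q ==> Q G x ==> EX p. p : G & Frc p (%G. Q G x)"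
  unfolding DG_def Frc_def using gen_P by blast

lemma Frc_le: "Frc p Q ==> le q p ==> Frc q Q"
  unfolding Frc_def using gen_up le_P by blast

lemma Frc_D: "Frc p Q ==> gen G ==> p : G ==> Q G" unfolding Frc_def by blast

section \<open>Truth lemma for the forcing language\<close>

primrec TG :: "nat set => nat form => bool" where
  "TG G (Mem x y) = memG G x y"
| "TG G (Eq x y) = eqG G x y"
| "TG G (Ground x) = (EX a. eqG G x (chk a))"
| "TG G (Neg q) = (~ TG G q)"
| "TG G (And q r) = (TG G q & TG G r)"
| "TG G (All q) = (ALL x. TG G (q x))"

abbreviation fc :: "nat form => nat => bool" where "fc == forces E P R"

text \<open>A \<open>form\<close> may contain arbitrary functions of the metalanguage, so the
  forcing theorem is restricted to families with this property. The four parts are proved together: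
  negation uses persistence under stronger conditions, and the quantifier uses density.\<close>

definition DF :: "(nat => nat form) => bool" where
  "DF f = (D (%c. fc (f (pf c)) (ps c)) & (ALL G x. gen G --> TG G (f x) = (EX p. p : G & fc (f x) p)) &
     (ALL x p q. fc (f x) p --> le q p --> fc (f x) q) &
     (ALL x p. p <: P --> (ALL q. le q p --> (EX r. le r q & fc (f x) r)) --> fc (f x) p))"

lemma DFI: "D (%c. fc (f (pf c)) (ps c)) ==> (ALL G x. gen G --> TG G (f x) = (EX p. p : G & fc (f x) p)) ==>
    (ALL x p q. fc (f x) p --> le q p --> fc (f x) q) ==>
    (ALL x p. p <: P --> (ALL q. le q p --> (EX r. le r q & fc (f x) r)) --> fc (f x) p) ==> DF f"
  unfolding DF_def by (intro conjI)

lemma DF_D1: "DF f ==> D (%c. fc (f (pf c)) (ps c))"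
  and DF_D2 [rule_format]: "DF f ==> (ALL G x. gen G --> TG G (f x) = (EX p. p : G & fc (f x) p))"
  and DF_D3 [rule_format]: "DF f ==> (ALL x p q. fc (f x) p --> le q p --> fc (f x) q)"
  and DF_D4 [rule_format]: "DF f ==> (ALL x p. p <: P --> (ALL q. le q p --> (EX r. le r q & fc (f x) r)) --> fc (f x) p)"
  unfolding DF_def by (elim conjE, assumption)+

lemma DF_Mem: assumes "Dt a" "Dt b" shows "DF (%x. Mem (a x) (b x))"
proof -
  have "D (%c. fm (ps c) (a (pf c)) (b (pf c)))" by (intro dfi Dt_comp[OF assms(1)] Dt_comp[OF assms(2)])
  moreover have "ms fe p x y" if "ALL q. le q p --> (EX r. le r q & ms fe r x y)" for p x y
    unfolding ms using that le_refl le_P le_trans unfolding ms by meson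
  ultimately show ?thesis by (intro DFI) (simp_all add: memG_def fm_def, use ms_le in blast)
qed

lemma DF_Eq: assumes "Dt a" "Dt b" shows "DF (%x. Eq (a x) (b x))"
proof -
  have "D (%c. fe (ps c) (a (pf c)) (b (pf c)))" by (intro dfi Dt_comp[OF assms(1)] Dt_comp[OF assms(2)])
  moreover have "fe p x y" if p: "p <: P" and a: "ALL q. le q p --> (EX r. le r q & fe r x y)" for p x y
  proof -
    have "ss fe p u v" if b: "!!r. r <: P ==> fe r x y ==> ss fe r u v" for u v
      unfolding ss
    proof (intro allI impI)
      fix q c s assume q: "le q p" "pr c s <: u" "le q s"
      show "ms fe q c v" unfolding ms
      proof (intro allI impI)
        fix q' assume q': "le q' q"
        then obtain r where r: "le r q'" "fe r x y" using a q le_trans by blast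
        have "ms fe r c v" using b[OF le_P(1)[OF r(1)] r(2)] q q' r le_trans le_refl le_P unfolding ss by meson
        thus "EX r c' s. le r q' & pr c' s <: v & le r s & fe r c c'"
          using r(1) le_refl[OF le_P(1)[OF r(1)]] le_trans unfolding ms by meson
      qed
    qed
    thus ?thesis unfolding fe_rec[OF p] es using fe_rec unfolding es by blast
  qed
  ultimately show ?thesis unfolding DF_def by (simp add: eqG_def) (use fe_le in blast)
qed

lemma DF_Ground: assumes "Dt a" shows "DF (%x. Ground (a x))"
proof -
  have F: "fc (Ground x) p = (ALL q. le q p --> (EX r a. le r q & fe r x (chk a)))" for x p by simp
  have "D (%c. fc (Ground (a (pf c))) (ps c))" unfolding F by (intro dfi Dt_comp[OF assms])
  moreover have "(EX a. eqG G x (chk a)) = (EX p. p : G & fc (Ground x) p)" if G: "gen G" for G x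
  proof
    assume "EX a. eqG G x (chk a)"
    then obtain a p where p: "p : G" "fe p x (chk a)" unfolding eqG_def by blast
    thus "EX p. p : G & fc (Ground x) p" unfolding F using fe_le le_refl le_P by meson
  next
    assume "EX p. p : G & fc (Ground x) p"
    then obtain p where p: "p : G" "fc (Ground x) p" by blast
    have "D (%r. EX a. fe r x (chk a))" by (intro dfi)
    then obtain r where "r : G & (EX a. fe r x (chk a))"
      using gen_dense[OF G _ p(1), of "%r. EX a. fe r x (chk a)"] p(2) unfolding F by blast
    thus "EX a. eqG G x (chk a)" unfolding eqG_def by blast
  qed
  ultimately show ?thesis unfolding DF_def TG.simps F using le_trans le_refl le_P by meson
qed

lemma DF_Neg: assumes "DF f" shows "DF (%x. Neg (f x))"
proof -
  note f = DF_D1[OF assms] DF_D2[OF assms] DF_D3[OF assms]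
  have "D (%c. ALL q. le q (ps c) --> ~ fc (f (pf c)) q)"
    by (intro dfi D_comp2[of "%x p. fc (f x) p", OF f(1)])
  moreover have "(~ TG G (f x)) = (EX p. p : G & (ALL q. le q p --> ~ fc (f x) q))" if G: "gen G" for G x
  proof
    assume n: "~ TG G (f x)"
    let ?Q = "%p. fc (f x) p | (ALL q. le q p --> ~ fc (f x) q)"
    have "D ?Q" by (intro dfi D_comp2[of "%x p. fc (f x) p", OF f(1)])
    moreover have "EX r. le r q & ?Q r" if "q <: P" for q using le_refl[OF that] by blast
    moreover obtain p where "p : G" using gen_ne[OF G] by blast
    ultimately obtain r where "r : G" "?Q r" using gen_dense[OF G, of ?Q p] le_P by blast
    thus "EX p. p : G & (ALL q. le q p --> ~ fc (f x) q)" using n f(2)[OF G] by blast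
  next
    assume "EX p. p : G & (ALL q. le q p --> ~ fc (f x) q)"
    thus "~ TG G (f x)" unfolding f(2)[OF G] using gen_dir[OF G] f(3) by blast
  qed
  ultimately show ?thesis unfolding DF_def by (simp, use f(3) le_trans le_refl le_P in meson)
qed

lemma DF_And: assumes "DF f" "DF g" shows "DF (%x. And (f x) (g x))"
proof -
  note f = DF_D1[OF assms(1)] DF_D2[OF assms(1)] DF_D3[OF assms(1)]
  note g = DF_D1[OF assms(2)] DF_D2[OF assms(2)] DF_D3[OF assms(2)]
  have "D (%c. fc (f (pf c)) (ps c) & fc (g (pf c)) (ps c))" by (intro dfi f(1) g(1))
  moreover have "(TG G (f x) & TG G (g x)) = (EX p. p : G & fc (f x) p & fc (g x) p)" if G: "gen G" for G x
    unfolding f(2)[OF G] g(2)[OF G] using gen_dir[OF G] f(3) g(3) by blast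
  hence "ALL G x. gen G --> (TG G (f x) & TG G (g x)) = (EX p. p : G & fc (f x) p & fc (g x) p)" by blast
  moreover have "ALL x p. p <: P --> (ALL q. le q p --> (EX r. le r q & fc (f x) r & fc (g x) r)) --> fc (f x) p & fc (g x) p"
    using DF_D4[OF assms(1)] DF_D4[OF assms(2)] by (intro allI impI conjI) blast+
  moreover have "ALL x p q. fc (f x) p & fc (g x) p --> le q p --> fc (f x) q & fc (g x) q" using f(3) g(3) by blast
  ultimately show ?thesis apply - apply (rule DFI) apply (unfold forces.simps TG.simps) apply assumption+ done
qed

lemma DF_All: assumes "DF (%c. f (pf c) (ps c))" shows "DF (%x. All (f x))"
proof -
  have f2: "TG G (f x y) = (EX p. p : G & fc (f x y) p)" if "gen G" for G x y using DF_D2[OF assms that, of "pr x y"] by simp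
  have f3: "fc (f x y) q" if "fc (f x y) p" "le q p" for x y p q using DF_D3[OF assms, of "pr x y" p q] that by simp
  have f4: "fc (f x y) p" if "p <: P" "ALL q. le q p --> (EX r. le r q & fc (f x y) r)" for x y p
    using DF_D4[OF assms that(1), of "pr x y"] that(2) by simp
  note f = DF_D1[OF assms] f2 f3 f4
  have d: "Dt a ==> Dt b ==> Dt c ==> D (%x. fc (f (a x) (b x)) (c x))" for a b c
    using D_comp[OF f(1), of "%x. pr (pr (a x) (b x)) (c x)"] by (simp add: dfi)
  have "D (%c. ALL y. fc (f (pf c) y) (ps c))" by (intro dfi d)
  moreover have "(ALL y. TG G (f x y)) = (EX p. p : G & (ALL y. fc (f x y) p))" if G: "gen G" for G x
  proof
    assume n: "ALL y. TG G (f x y)"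
    let ?Q = "%p. (ALL y. fc (f x y) p) | (EX y. ALL q. le q p --> ~ fc (f x y) q)"
    have "D ?Q" by (intro dfi d)
    moreover have "EX r. le r q & ?Q r" if q: "q <: P" for q
      using f(4)[OF q] le_refl[OF q] by blast
    moreover obtain p where "p : G" using gen_ne[OF G] by blast
    ultimately obtain r where r: "r : G" "?Q r" using gen_dense[OF G, of ?Q p] le_P by blast
    have "EX q. le q r & fc (f x y) q" for y using n gen_dir[OF G r(1)] f(3) unfolding f(2)[OF G] by blast
    thus "EX p. p : G & (ALL y. fc (f x y) p)" using r by blast
  qed (use f(2)[OF G] in blast)
  hence "ALL G x. gen G --> (ALL y. TG G (f x y)) = (EX p. p : G & (ALL y. fc (f x y) p))" by blast
  moreover have "ALL x p. p <: P --> (ALL q. le q p --> (EX r. le r q & (ALL y. fc (f x y) r))) --> (ALL y. fc (f x y) p)"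
    using f(4) by (intro allI impI) blast
  moreover have "ALL x p q. (ALL y. fc (f x y) p) --> le q p --> (ALL y. fc (f x y) q)" using f(3) by blast
  ultimately show ?thesis apply - apply (rule DFI) apply (unfold forces.simps TG.simps) apply assumption+ done
qed

lemmas DFs = DF_Mem DF_Eq DF_Ground DF_Neg DF_And DF_All

lemma DF_inst: "(!!i. Dt (e i)) ==> DF (%x. inst f (%i. e i x))"
proof (induction f arbitrary: e)
  case (FAll f)
  have "DF (%c. inst f (%i. (case_nat ps (%i c. e i (pf c)) i) c))"
    by (rule FAll.IH) (auto split: nat.split intro!: dfi Dt_comp[OF FAll.prems])
  moreover have "(%i. (case_nat ps (%i c. e i (pf c)) i) c) = case_nat (ps c) (%i. e i (pf c))" for c
    by (auto split: nat.split)
  ultimately show ?case by (simp, intro DF_All) simp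
qed (auto intro!: DFs)

lemma DF_DG: "DF f ==> DG (%G x. TG G (f x))"
  unfolding DF_def DG_def
  by (intro exI[of _ "%p x. fc (f x) p"]) (auto intro: D_comp2[of "%x p. fc (f x) p", OF _ Dt_ps[OF Dt_id] Dt_pf[OF Dt_id]])

lemma DF_forces: assumes "DF f" "!!G. gen G ==> p : G ==> TG G (f x)" "p <: P" shows "fc (f x) p"
proof -
  have "EX r. le r q & fc (f x) r" if q: "le q p" for q
  proof -
    obtain G where G: "gen G" "q : G" using ex_gen le_P q by blast
    have "TG G (f x)" using assms(2) gen_up[OF G q] G by blast
    then obtain r where "r : G" "fc (f x) r" using DF_D2[OF assms(1) G(1)] by blast
    thus ?thesis using gen_dir[OF G] DF_D3[OF assms(1)] by blast
  qed
  thus ?thesis using DF_D4[OF assms(1,3)] by blast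
qed

end

section \<open>The generic extension as a structure\<close>

context forcing begin

definition rep :: "nat set => nat => nat" where "rep G x = (SOME y. eqG G x y)"
text \<open>The classes of names are renumbered by all natural numbers, so that the quantifiers of
  \<open>sat\<close>, which range over the type, range exactly over the extension.\<close>

definition val :: "nat set => nat => nat" where "val G x = to_nat_on (range (rep G)) (rep G x)"
definition EN :: "nat set => nat => nat => bool" where "EN G a b = (EX x y. val G x = a & val G y = b & memG G x y)"
abbreviation j :: "nat set => nat => nat" where "j G a == val G (chk a)"

lemma val_eq: assumes "gen G" shows "(val G x = val G y) = eqG G x y"
proof -
  have r: "eqG G x (rep G x)" for x unfolding rep_def using someI[of "eqG G x" x] eqG_refl[OF assms] by blast
  have "rep G x = rep G y" if "eqG G x y"
  proof -
    have "eqG G x = eqG G y" using that eqG_trans[OF assms] eqG_sym[OF assms] by blast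
    thus ?thesis unfolding rep_def by simp
  qed
  moreover have "val G x = val G y ==> rep G x = rep G y" unfolding val_def by simp
  ultimately show ?thesis using r eqG_trans[OF assms] eqG_sym[OF assms] by (metis val_def)
qed

lemma val_surj: assumes "gen G" shows "EX x. val G x = a"
proof -
  have "inj (j G)" by (rule injI) (simp add: val_eq[OF assms] eqG_chk[OF assms])
  hence "infinite (range (val G))" using infinite_iff_countable_subset by (metis finite_subset image_subset_iff range_eqI)
  moreover have "range (val G) = to_nat_on (range (rep G)) ` range (rep G)" unfolding val_def by auto
  ultimately have "infinite (range (rep G))" by auto
  hence "to_nat_on (range (rep G)) ` range (rep G) = UNIV" using to_nat_on_infinite[OF countableI_type] unfolding bij_betw_def by blast
  thus ?thesis unfolding val_def by (metis UNIV_I imageE)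
qed

lemma EN_val: "gen G ==> EN G (val G x) (val G y) = memG G x y"
  unfolding EN_def using val_eq memG_eq1 memG_eq2 eqG_sym by (metis)

lemma DG_comprehension: assumes "DG Q"
  shows "EX r. (ALL z p. pr z p <: r --> z <: a & p <: P) & (ALL G. gen G --> (ALL z. (EX p. pr z p <: r & p : G) = (z <: a & Q G z)))"
proof -
  let ?r = "Sp (prd a P) (%u. Frc (ps u) (%G. Q G (pf u)))"
  have m: "u <: ?r = (u <: prd a P & Frc (ps u) (%G. Q G (pf u)))" for u
    by (intro mem_Sp D_Frc DG_comp[OF assms] dfi)
  have d: "DG (%G z. Q G z)" using assms .
  have "(EX p. pr z p <: ?r & p : G) = (z <: a & Q G z)" if G: "gen G" for G z
    unfolding m using truth[OF G assms, of z] Frc_D[OF _ G] gen_P[OF G] by auto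
  thus ?thesis using m by (intro exI[of _ ?r]) auto
qed

text \<open>Induction in the ground model on the definable statement that every condition forces
  \<open>Q\<close>.\<close>

lemma DG_induct: assumes "DG Q" "!!G x. gen G ==> (!!c. c <: tc x ==> Q G c) ==> Q G x" "gen G" shows "Q G x"
proof -
  let ?Q = "%x. ALL p. p <: P --> Frc p (%G. Q G x)"
  have "?Q x"
  proof (rule tc_induct[of ?Q])
    show "D ?Q" by (intro dfi DG_comp[OF assms(1)])
    show "?Q x" if "!!c. c <: tc x ==> ?Q c" for x
      using that assms(2)[of _ x] gen_P unfolding Frc_def by meson
  qed
  thus ?thesis using assms(3) gen_ne gen_P Frc_D by blast
qed

text \<open>If \<open>p\<close> forces that there is no minimal element, take \<open>b\<close>
  minimal such that some extension of \<open>p\<close> forces \<open>Q\<close> of it. A filter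
  through that extension provides a smaller \<open>c\<close>, contradicting the choice of
  \<open>b\<close>.\<close>

lemma DG_min: assumes "gen G" "DG Q" "Q G a" shows "EX b. Q G b & (ALL c. c <: b --> ~ Q G c)"
proof (rule ccontr)
  assume "~ ?thesis"
  hence n: "ALL b. Q G b --> (EX c. c <: b & Q G c)" by blast
  have "DG (%G _::nat. ALL b. Q G b --> (EX c. c <: b & Q G c))" by (intro dfi DG_comp[OF assms(2)])
  then obtain p where p: "p : G" "Frc p (%G. ALL b. Q G b --> (EX c. c <: b & Q G c))"
    using truth[OF assms(1), of "%G _. ALL b. Q G b --> (EX c. c <: b & Q G c)"] n by blast
  obtain q where q: "q : G" "Frc q (%G. Q G a)" using truth[OF assms] by blast
  obtain r where r: "le r p" "le r q" using gen_dir[OF assms(1) p(1) q(1)] by blast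
  let ?S = "%b. EX q. le q p & Frc q (%G. Q G b)"
  have "D ?S" by (intro dfi DG_comp[OF assms(2)])
  moreover have "?S a" using Frc_le q r by blast
  ultimately obtain b where b: "?S b" "ALL c. c <: b --> ~ ?S c" using eps_min[of ?S] by blast
  then obtain q where q: "le q p" "Frc q (%G. Q G b)" by blast
  obtain G' where G': "gen G'" "q : G'" using ex_gen le_P q by blast
  have pG: "p : G'" using gen_up[OF G'] q by blast
  obtain c where c: "c <: b" "Q G' c" using Frc_D[OF p(2) G'(1) pG] Frc_D[OF q(2) G'] by blast
  then obtain s where "s : G'" "Frc s (%G. Q G c)" using truth[OF G'(1) assms(2)] by blast
  moreover obtain t where "le t s" "le t p" using gen_dir[OF G'(1) \<open>s : G'\<close> pG] by blast
  ultimately show False using b(2) c(1) Frc_le by blast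
qed

text \<open>A condition forces a given name \<open>c\<close> to equal at most one canonical name.
  Replacement along the pairs \<open>(c, p)\<close> collects all candidates.\<close>

lemma name_bound: "EX B. ALL G u. gen G --> memG G (chk u) x --> u <: B"
proof -
  define T where "T w = (THE u. (EX! u. Frc (ps w) (%G. eqG G (chk u) (pf w))) & Frc (ps w) (%G. eqG G (chk u) (pf w)))" for w
  have dg: "DG (%G c. eqG G (chk (ps c)) (pf (pf c)))" "DG (%G c. eqG G (chk (pf c)) (ps c))" by (intro dfi)+
  have T: "Dt T" unfolding T_def by (intro dfi)
  have "u <: Im (prd (tc x) P) T" if G: "gen G" and u: "memG G (chk u) x" for G u
  proof -
    obtain c s where c: "pr c s <: x" "eqG G (chk u) c" using u memG[OF G] by blast
    then obtain p where p: "p : G" "Frc p (%G. eqG G (chk u) c)"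
      using truth[OF G dg(2), of "pr u c"] by auto
    have "v = u" if "Frc p (%G. eqG G (chk v) c)" for v
      using Frc_D[OF p(2) G p(1)] Frc_D[OF that G p(1)] eqG_trans[OF G] eqG_sym[OF G] eqG_chk[OF G] by blast
    hence "Frc p (%G. eqG G (chk v) c) = (v = u)" for v using p(2) by blast
    hence "T (pr c p) = u" unfolding T_def by simp
    thus ?thesis unfolding mem_Im[OF T] mem_prd using pr_tc[OF c(1)] gen_P[OF G p(1)] by blast
  qed
  thus ?thesis by blast
qed

definition nm :: "nat => nat" where "nm r = Im r (%u. pr (chk (pf u)) (ps u))"

lemma memG_nm: assumes "gen G" "!!u. u <: r ==> EX z p. u = pr z p"
  shows "memG G y (nm r) = (EX z p. pr z p <: r & p : G & eqG G y (chk z))"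
proof -
  have "Dt (%u. pr (chk (pf u)) (ps u))" by (intro dfi)
  hence m: "u <: nm r = (EX z p. pr z p <: r & u = pr (chk z) p)" for u
    unfolding nm_def using assms(2) by (fastforce simp: mem_Im)
  show ?thesis unfolding memG[OF assms(1), of y] m by auto
qed

end

locale generic = forcing +
  fixes G assumes G: "gen G"
begin

abbreviation v where "v == val G"
abbreviation jj where "jj == j G"
abbreviation M :: "nat => nat => bool" where "M == EN G"

lemmas surj = val_surj[OF G] and EN = EN_val[OF G] and v_eq = val_eq[OF G]

sublocale N: extp M
proof
  show "x = y" if xy: "!!z. M z x = M z y" for x y
  proof -
    obtain a b where a: "v a = x" "v b = y" using surj by blast
    have "eqG G a b" by (rule eqG_ext[OF G]) (use xy EN a in metis)
    thus ?thesis using a v_eq by blast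
  qed
  show "EX u. ALL z. M z u = (z = x | z = y)" for x y
  proof -
    obtain a b where a: "v a = x" "v b = y" using surj by blast
    have "M z (v (prd (up a b) P)) = (z = x | z = y)" for z
    proof -
      obtain c where c: "v c = z" using surj by blast
      have "memG G c (prd (up a b) P) = (eqG G c a | eqG G c b)"
        unfolding memG[OF G] using gen_ne[OF G] gen_P[OF G] by auto
      thus ?thesis unfolding c[symmetric] EN by (simp add: a[symmetric] v_eq)
    qed
    thus ?thesis by blast
  qed
qed

lemma j_eq [simp]: "(jj a = jj b) = (a = b)" unfolding v_eq by (rule eqG_chk[OF G])

lemma M_j: "M y (jj b) = (EX a. a <: b & y = jj a)"
proof -
  obtain c where "v c = y" using surj by blast
  thus ?thesis using EN[of c "chk b"] memG_chk[OF G, of c b] v_eq by metis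
qed

lemma j_mem [simp]: "M (jj a) (jj b) = (a <: b)" unfolding M_j by auto

lemma j_up [simp]: "N.up (jj a) (jj b) = jj (up a b)"
  by (rule N.exten) (auto simp: M_j)

lemma j_pr [simp]: "N.pr (jj a) (jj b) = jj (pr a b)" unfolding N.pr_def pr_def by simp

lemma pr_j: assumes "N.pr x y = jj u" shows "EX a b. x = jj a & y = jj b & u = pr a b"
proof -
  have "M (N.up x y) (jj u)" unfolding assms[symmetric] N.pr_def by simp
  then obtain w where "N.up x y = jj w" unfolding M_j by blast
  hence "M x (jj w)" "M y (jj w)" by (metis N.mem_up)+
  then obtain a b where "x = jj a" "y = jj b" unfolding M_j by blast
  thus ?thesis using assms by auto
qed

lemma pr_M_j: "M (N.pr x y) (jj f) = (EX a b. x = jj a & y = jj b & pr a b <: f)"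
  unfolding M_j using pr_j by (metis j_pr)

lemma j_isf [simp]: "N.isf (jj f) = isf f"
proof -
  have "(ALL u. M u (jj f) --> (EX x y. u = N.pr x y)) = (ALL u. u <: f --> (EX x y. u = pr x y))"
    unfolding M_j using pr_j by (metis j_pr)
  moreover have "(ALL x y z. M (N.pr x y) (jj f) --> M (N.pr x z) (jj f) --> y = z) = (ALL x y z. pr x y <: f --> pr x z <: f --> y = z)"
    unfolding pr_M_j by (rule iffI) (metis j_eq)+
  ultimately show ?thesis unfolding N.isf_def isf_def by argo
qed

lemma j_fon [simp]: "N.fon (jj f) (jj a) = fon f a"
proof -
  have "(EX y. M (N.pr x y) (jj f)) = (EX c. (EX y. pr c y <: f) & x = jj c)" for x unfolding pr_M_j by blast
  moreover have "(ALL x. (EX c. A c & x = jj c) = (EX c. B c & x = jj c)) = (ALL c. A c = B c)" for A B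
    by (rule iffI, rule allI, erule_tac x = "jj c" in allE) simp_all
  ultimately show ?thesis unfolding N.fon_def fon_def j_isf M_j by simp
qed

lemma j_fto [simp]: "N.fto (jj f) (jj a) (jj b) = fto f a b"
  unfolding N.fto_def fto_def pr_M_j j_fon unfolding M_j by (metis j_eq)

lemma comprehension: assumes "DG Q" shows "EX n. ALL y. M y n = (EX x. x <: a & Q G x & y = jj x)"
proof -
  obtain r where r: "ALL z p. pr z p <: r --> z <: a & p <: P" "ALL z. (EX p. pr z p <: r & p : G) = (z <: a & Q G z)"
  proof -
    obtain r where "ALL z p. pr z p <: r --> z <: a & p <: P"
      "ALL G. gen G --> (ALL z. (EX p. pr z p <: r & p : G) = (z <: a & Q G z))"
      using DG_comprehension[OF assms, of a] by (elim exE conjE)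
    thus thesis using G by (intro that) blast+
  qed
  let ?r = "Sp r (%u. EX z p. u = pr z p)"
  have m: "u <: ?r = (u <: r & (EX z p. u = pr z p))" for u by (intro mem_Sp dfi)
  have "M y (v (nm ?r)) = (EX x. x <: a & Q G x & y = jj x)" for y
  proof -
    obtain c where c: "v c = y" using surj by blast
    have "memG G c (nm ?r) = (EX z p. pr z p <: r & p : G & eqG G c (chk z))"
      by (subst memG_nm[OF G]) (auto simp: m)
    also have "... = (EX z. (z <: a & Q G z) & eqG G c (chk z))" using r(2) by blast
    finally show ?thesis using c EN[of c "nm ?r"] v_eq by auto
  qed
  thus ?thesis by blast
qed

text \<open>With binding by abstraction, values cannot simply be substituted for names. Instead the
  two instances of a notion are related connective by connective.\<close>

definition lf :: "nat form => nat form => bool" where "lf p q = (TG G p = sat M q)"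

lemma lf_intros:
  "lf (Mem x y) (Mem (v x) (v y))" "lf (Eq x y) (Eq (v x) (v y))" "lf p q ==> lf (Neg p) (Neg q)"
  "lf p q ==> lf p' q' ==> lf (And p p') (And q q')" "(!!x. lf (f x) (g (v x))) ==> lf (All f) (All g)"
  unfolding lf_def by (simp_all add: EN v_eq) (metis surj)

lemmas lf_defs = Imp_def Or_def Iff_def Ex_def Subset_def StrictSubset_def NonEmpty_def IsUnorderedPair_def IsPair_def
  PairIn_def IsFunction_def FunctionOn_def FunctionTo_def

lemma TG_FunctionOn: "TG G (FunctionOn x y) = N.fon (v x) (v y)"
  and TG_FunctionTo: "TG G (FunctionTo x y z) = N.fto (v x) (v y) (v z)"
  and TG_PairIn: "TG G (PairIn x y z) = M (N.pr (v x) (v y)) (v z)"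
proof -
  have "lf (FunctionOn x y) (FunctionOn (v x) (v y))" "lf (FunctionTo x y z) (FunctionTo (v x) (v y) (v z))"
    "lf (PairIn x y z) (PairIn (v x) (v y) (v z))"
    unfolding lf_defs by (intro lf_intros)+
  thus "TG G (FunctionOn x y) = N.fon (v x) (v y)" "TG G (FunctionTo x y z) = N.fto (v x) (v y) (v z)"
    "TG G (PairIn x y z) = M (N.pr (v x) (v y)) (v z)" unfolding lf_def by simp_all
qed

lemma TG_Determined: "TG G (Determined l A) = sat M (Determined (v l) (v A))"
proof -
  have "lf (Determined l A) (Determined (v l) (v A))"
    unfolding lf_defs IsSuccessorOf_def ShortSequence_def Even_def Odd_def Play_def LegalMove_def Strategy_def IsRestriction_def
      RunAccordingTo_def OutcomeIn_def PlayerIWins_def PlayerIIWins_def Determined_def by (intro lf_intros)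
  thus ?thesis unfolding lf_def .
qed

lemma TG_FunctionToGround: "TG G (FunctionToGround f l) =
    (N.fon (v f) (v l) & (ALL x y. M (N.pr x y) (v f) --> (EX a. y = jj a)))"
proof -
  have "(ALL x y. M (N.pr x y) (v f) --> (EX a. y = jj a)) = (ALL x y. M (N.pr (v x) (v y)) (v f) --> (EX a. v y = jj a))"
    using surj by metis
  thus ?thesis unfolding FunctionToGround_def Imp_def by (auto simp: TG_FunctionOn TG_PairIn v_eq)
qed

end

section \<open>Transfer between dense subposets\<close>

context zf begin

text \<open>Recursion along the transitive closure, reduced to \<open>Rec\<close>: the value of the auxiliary function at \<open>x\<close> is the
  graph of \<open>TRec H\<close> on the transitive closure of \<open>{x}\<close>.\<close>

definition TRec :: "('v => 'v => 'v) => 'v => 'v" where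
  "TRec H x = H x (Uu (Im x (Rec (%x g. un (Uu (rg g)) (up (pr x (H x (Uu (rg g)))) (pr x (H x (Uu (rg g)))))))))"

lemma assumes H: "Dt (%p. H (pf p) (ps p))"
  shows Dt_TRec: "Dt (TRec H)" and TRec_eq: "TRec H x = H x (Lam (tc x) (TRec H))"
proof -
  note DH = Dt_comp2[of H, OF H]
  define F where "F = Rec (%x g. un (Uu (rg g)) (up (pr x (H x (Uu (rg g)))) (pr x (H x (Uu (rg g))))))"
  have DF: "Dt F" unfolding F_def by (intro Dt_Rec dfi DH)
  have T: "TRec H x = H x (Uu (Im x F))" for x unfolding TRec_def F_def ..
  show DT: "Dt (TRec H)" unfolding T by (intro DH dfi Dt_comp[OF DF])
  have "F x = (let g = Lam x F in un (Uu (rg g)) (up (pr x (H x (Uu (rg g)))) (pr x (H x (Uu (rg g))))))" for x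
    unfolding F_def Let_def by (rule Rec_eq) (intro dfi DH)
  moreover have "rg (Lam x F) = Im x F" for x by (rule exten) (auto simp: pr_Lam[OF DF] mem_Im[OF DF])
  ultimately have F: "u <: F x = (u <: Uu (Im x F) | u = pr x (TRec H x))" for x u unfolding T by (simp add: Let_def)
  let ?Q = "%x. ALL u. u <: F x = (EX c. (c <: tc x | c = x) & u = pr c (TRec H c))"
  have "?Q x" for x
  proof (rule eps_induct[of ?Q])
    show "D ?Q" by (intro dfi Dt_comp[OF DF] Dt_comp[OF DT])
    fix x assume IH: "!!y. y <: x ==> ?Q y"
    have "u <: Uu (Im x F) = (EX c. c <: tc x & u = pr c (TRec H c))" for u
      unfolding mem_Un mem_Im[OF DF] mem_tc[of _ x] using IH by blast
    thus "?Q x" unfolding F by blast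
  qed
  hence "u <: Uu (Im x F) = (EX c. c <: tc x & u = pr c (TRec H c))" for u
    unfolding mem_Un mem_Im[OF DF] mem_tc[of _ x] by blast
  hence "Uu (Im x F) = Lam (tc x) (TRec H)" by (intro exten) (simp add: mem_Lam[OF DT])
  thus "TRec H x = H x (Lam (tc x) (TRec H))" using T by simp
qed

end

lemma sat_iso: assumes h: "!!x y. E1 x y = E2 (h x) (h y)" "bij h"
  shows sat_iso_inst: "sat E1 (inst q e) = sat E2 (inst q (%i. h (e i)))"
    and sat_iso_Determined: "sat E1 (Determined l A) = sat E2 (Determined (h l) (h A))"
    and sat_iso_FunctionOn: "sat E1 (FunctionOn x y) = sat E2 (FunctionOn (h x) (h y))"
    and sat_iso_FunctionTo: "sat E1 (FunctionTo x y z) = sat E2 (FunctionTo (h x) (h y) (h z))"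
    and sat_iso_PairIn: "sat E1 (PairIn x y z) = sat E2 (PairIn (h x) (h y) (h z))"
proof -
  define lf where "lf p q = (sat E1 p = sat E2 q)" for p q
  have lf: "lf (Mem x y) (Mem (h x) (h y))" "lf (Eq x y) (Eq (h x) (h y))" "lf p q ==> lf (Neg p) (Neg q)"
    "lf p q ==> lf p' q' ==> lf (And p p') (And q q')" "(!!x. lf (f x) (g (h x))) ==> lf (All f) (All g)" for x y p q p' q' f g
    unfolding lf_def using h(1) bij_is_inj[OF h(2)] bij_is_surj[OF h(2)] by (simp_all add: inj_eq) (metis surjD)
  have "lf (FunctionOn x y) (FunctionOn (h x) (h y))" "lf (FunctionTo x y z) (FunctionTo (h x) (h y) (h z))"
    "lf (PairIn x y z) (PairIn (h x) (h y) (h z))"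
    unfolding Imp_def Or_def Iff_def Ex_def IsUnorderedPair_def IsPair_def PairIn_def IsFunction_def FunctionOn_def FunctionTo_def
    by (intro lf)+
  thus "sat E1 (FunctionOn x y) = sat E2 (FunctionOn (h x) (h y))" "sat E1 (FunctionTo x y z) = sat E2 (FunctionTo (h x) (h y) (h z))"
    "sat E1 (PairIn x y z) = sat E2 (PairIn (h x) (h y) (h z))" unfolding lf_def .
  have "lf (Determined l A) (Determined (h l) (h A))"
    unfolding Imp_def Or_def Iff_def Ex_def Subset_def StrictSubset_def NonEmpty_def IsUnorderedPair_def IsPair_def
      PairIn_def IsFunction_def FunctionOn_def FunctionTo_def
      IsSuccessorOf_def ShortSequence_def Even_def Odd_def Play_def LegalMove_def Strategy_def IsRestriction_def
      RunAccordingTo_def OutcomeIn_def PlayerIWins_def PlayerIIWins_def Determined_def by (intro lf)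
  thus "sat E1 (Determined l A) = sat E2 (Determined (h l) (h A))" unfolding lf_def .
  have "lf (inst q e) (inst q (%i. h (e i)))"
  proof (induction q arbitrary: e)
    case (FAll q)
    have "(%i. h (case_nat x e i)) = case_nat (h x) (%i. h (e i))" for x by (auto split: nat.split)
    thus ?case using FAll[of "case_nat _ e"] by (simp, intro lf) simp
  qed (simp_all add: lf)
  thus "sat E1 (inst q e) = sat E2 (inst q (%i. h (e i)))" unfolding lf_def .
qed

context generic begin

lemma TG_inst: "TG G (inst q e) = sat M (inst q (%i. v (e i)))"
proof -
  have "lf (inst q e) (inst q (%i. v (e i)))"
  proof (induction q arbitrary: e)
    case (FAll q)
    have "(%i. v (case_nat x e i)) = case_nat (v x) (%i. v (e i))" for x by (auto split: nat.split)
    thus ?case using FAll[of "case_nat _ e"] by (simp, intro lf_intros) simp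
  qed (simp_all add: lf_intros)
  thus ?thesis unfolding lf_def .
qed

lemma TG_DefinedBy: "TG G (DefinedBy q f l A) =
    (ALL x. M x (v A) = (N.fto x (v l) (v l) & sat M (inst q (case_nat x (%_. v f)))))"
proof -
  have "(%i. v (case_nat x (%_. f) i)) = case_nat (v x) (%_. v f)" for x by (auto split: nat.split)
  hence "TG G (DefinedBy q f l A) = (ALL x. M (v x) (v A) = (N.fto (v x) (v l) (v l) & sat M (inst q (case_nat (v x) (%_. v f)))))"
    unfolding DefinedBy_def Iff_def Imp_def by (auto simp: TG_FunctionTo TG_inst EN)
  thus ?thesis using surj by metis
qed

end

text \<open>\<open>e1\<close> and \<open>e2\<close> map one preorder \<open>W\<close> into two
  forcing notions, preserving incompatibility and dense below each condition in their range. Hence a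
  filter on the second that contains some \<open>e2 w\<close> induces a filter on the first with the
  same extension.\<close>

locale transfer = A: forcing E P1 R1 + B: forcing E P2 R2
  for E :: "nat => nat => bool" (infix "<:" 50) and P1 R1 P2 R2 +
  fixes W :: nat and wl :: "nat => nat => bool" and e1 e2 :: "nat => nat"
  assumes Dwl: "A.D (%p. wl (A.pf p) (A.ps p))" and De1: "A.Dt e1" and De2: "A.Dt e2"
    and wl_W: "wl w w' ==> w <: W & w' <: W" and wl_refl: "w <: W ==> wl w w" and wl_trans: "wl u w ==> wl w x ==> wl u x"
    and m1: "wl w w' ==> A.le (e1 w) (e1 w')" and m2: "wl w w' ==> B.le (e2 w) (e2 w')"
    and d1: "w <: W ==> A.le p (e1 w) ==> EX u. wl u w & A.le (e1 u) p"
    and d2: "w <: W ==> B.le p (e2 w) ==> EX u. wl u w & B.le (e2 u) p"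
    and c1: "w <: W ==> u <: W ==> A.comp (e1 w) (e1 u) ==> EX x. wl x w & wl x u"
    and c2: "w <: W ==> u <: W ==> B.comp (e2 w) (e2 u) ==> EX x. wl x w & wl x u"
begin

definition GW :: "nat set => nat set" where "GW G = {w. w <: W & e2 w : G}"
definition G1 :: "nat set => nat set" where "G1 G = {p. EX w. w : GW G & A.le (e1 w) p}"
text \<open>The usual translation of names along dense embeddings. It recurses along the transitive
  closure because \<open>c\<close> is not an element of a name that contains
  \<open>(c, s)\<close>.\<close>

definition tr :: "nat => nat" where
  "tr = A.TRec (%x g. A.Im (A.Sp (A.prd x W) (%u. (EX c s. A.pf u = A.pr c s & A.le (e1 (A.ps u)) s)))
    (%u. A.pr (A.ap g (A.pf (A.pf u))) (e2 (A.ps u))))"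

lemma Dt_tr: "A.Dt a ==> A.Dt (%x. tr (a x))"
  by (rule A.Dt_comp[of tr], unfold tr_def, rule A.Dt_TRec, intro dfi A.Dt_comp[OF De1] A.Dt_comp[OF De2])

lemma mem_tr: "A.pr d t <: tr x = (EX c s w. A.pr c s <: x & w <: W & A.le (e1 w) s & d = tr c & t = e2 w)"
proof -
  let ?H = "%x g. A.Im (A.Sp (A.prd x W) (%u. (EX c s. A.pf u = A.pr c s & A.le (e1 (A.ps u)) s)))
    (%u. A.pr (A.ap g (A.pf (A.pf u))) (e2 (A.ps u)))"
  have "A.Dt (%p. ?H (A.pf p) (A.ps p))" by (intro dfi A.Dt_comp[OF De1] A.Dt_comp[OF De2])
  hence e: "tr x = ?H x (A.Lam (A.tc x) tr)" unfolding tr_def by (rule A.TRec_eq)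
  have ds: "A.D (%u. (EX c s. A.pf u = A.pr c s & A.le (e1 (A.ps u)) s))" by (intro dfi A.Dt_comp[OF De1])
  have di: "A.Dt (%u. A.pr (A.ap (A.Lam (A.tc x) tr) (A.pf (A.pf u))) (e2 (A.ps u)))"
    by (intro dfi A.Dt_comp[OF De2] Dt_tr)
  have "A.ap (A.Lam (A.tc x) tr) c = tr c" if "A.pr c s <: x" for c s
    using A.ap_Lam[of tr] Dt_tr[OF A.Dt_id] A.pr_tc[OF that] by simp
  thus ?thesis unfolding e A.mem_Im[OF di] A.mem_Sp[OF ds] by fastforce
qed

lemma GW_up: "B.gen G ==> w : GW G ==> wl w u ==> u : GW G"
  unfolding GW_def using wl_W m2 B.gen_up by blast

lemma GW_dense: assumes "B.gen G" "w : GW G" "A.D Q" "!!u. wl u w ==> EX x. wl x u & Q x" shows "EX u. u : GW G & wl u w & Q u"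
proof -
  let ?Q = "%r. EX u. wl u w & Q u & B.le r (e2 u)"
  have w: "w <: W" "e2 w : G" using assms(2) unfolding GW_def by auto
  have "A.D ?Q" by (intro dfi A.D_comp2[OF Dwl] A.D_comp[OF assms(3)] A.Dt_comp[OF De2])
  moreover have "EX r. B.le r q & ?Q r" if q: "B.le q (e2 w)" for q
  proof -
    obtain u where u: "wl u w" "B.le (e2 u) q" using d2 w q by blast
    then obtain x where x: "wl x u" "Q x" using assms(4) by blast
    hence "B.le (e2 x) q" "wl x w" using u m2 B.le_trans wl_trans by blast+
    thus ?thesis using x(2) B.le_refl B.le_P(1) by blast
  qed
  ultimately obtain r where "r : G" "?Q r" using B.gen_dense[OF assms(1) _ w(2), of ?Q] by blast
  thus ?thesis unfolding GW_def using wl_W B.gen_up[OF assms(1)] by blast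
qed

lemma GW_dir: assumes "B.gen G" "w : GW G" "u : GW G" shows "EX x. x : GW G & wl x w & wl x u"
proof -
  let ?Q = "%r. EX x. wl x w & wl x u & B.le r (e2 x)"
  have w: "w <: W" "e2 w : G" "u <: W" "e2 u : G" using assms unfolding GW_def by auto
  then obtain p where p: "p : G" "B.le p (e2 w)" "B.le p (e2 u)" using B.gen_dir[OF assms(1)] by blast
  have "A.D ?Q" by (intro dfi A.D_comp2[OF Dwl] A.Dt_comp[OF De2])
  moreover have "EX r. B.le r q & ?Q r" if q: "B.le q p" for q
  proof -
    obtain x where x: "wl x w" "B.le (e2 x) q" using d2[OF w(1)] p(2) q B.le_trans by blast
    have "B.comp (e2 x) (e2 u)" unfolding B.comp_def using x(2) q p(3) B.le_trans B.le_refl B.le_P(1) by meson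
    then obtain y where y: "wl y x" "wl y u" using c2 wl_W x(1) w(3) by blast
    hence "B.le (e2 y) q" "wl y w" using x m2 B.le_trans wl_trans by blast+
    thus ?thesis using y(2) B.le_refl B.le_P(1) by blast
  qed
  ultimately obtain r where "r : G" "?Q r" using B.gen_dense[OF assms(1) _ p(1), of ?Q] by blast
  thus ?thesis unfolding GW_def using wl_W B.gen_up[OF assms(1)] by blast
qed

lemma gen_G1: assumes G: "B.gen G" and w0: "w0 : GW G" shows "A.gen (G1 G)"
  unfolding A.gen_def
proof (intro conjI ballI allI impI)
  show "p <: P1" if "p : G1 G" for p using that A.le_P unfolding G1_def by blast
  show "q : G1 G" if "p : G1 G" "A.le p q" for p q using that A.le_trans unfolding G1_def by blast
  have e: "e1 w : G1 G" if "w : GW G" for w using that m1[OF wl_refl] unfolding G1_def GW_def by blast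
  show "EX p. p : G1 G" using e w0 by blast
  show "EX r:G1 G. A.le r p & A.le r q" if pq: "p : G1 G" "q : G1 G" for p q
  proof -
    obtain w u where w: "w : GW G" "A.le (e1 w) p" "u : GW G" "A.le (e1 u) q" using pq unfolding G1_def by blast
    obtain x where "x : GW G" "wl x w" "wl x u" using GW_dir[OF G w(1,3)] by blast
    thus ?thesis using e w m1 A.le_trans by blast
  qed
  fix d assume d: "ALL p. p <: P1 --> (EX q. A.le q p & q <: d)"
  let ?Q = "%w. EX q. q <: d & A.le (e1 w) q"
  have "A.D ?Q" by (intro dfi A.Dt_comp[OF De1])
  moreover have "EX x. wl x u & ?Q x" if u: "wl u w0" for u
  proof -
    have uW: "u <: W" using wl_W u by blast
    obtain q where "A.le q (e1 u)" "q <: d" using d A.le_P(1)[OF m1[OF u]] by blast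
    thus ?thesis using d1[OF uW] by blast
  qed
  ultimately obtain u where "u : GW G" "?Q u" using GW_dense[OF G w0, of ?Q] by blast
  thus "EX q:G1 G. q <: d" unfolding G1_def by blast
qed

text \<open>Closing upwards in \<open>G1\<close> adds no further image of an element of
  \<open>W\<close>: by \<open>c1\<close>, the elements below \<open>w\<close> are dense below the
  given member of \<open>GW G\<close>.\<close>

lemma GW_e1: assumes G: "B.gen G" and "w <: W" "e1 w : G1 G" shows "w : GW G"
proof -
  obtain u where u: "u : GW G" "A.le (e1 u) (e1 w)" using assms(3) unfolding G1_def by blast
  have "EX y. wl y x & wl y w" if x: "wl x u" for x
  proof (rule c1)
    show "A.comp (e1 x) (e1 w)" unfolding A.comp_def using m1[OF x] u(2) A.le_trans A.le_refl A.le_P(1) by meson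
  qed (use x wl_W assms(2) in blast)+
  moreover have "A.D (%y. wl y w)" by (intro A.D_comp2[OF Dwl] dfi)
  ultimately obtain y where "y : GW G" "wl y w" using GW_dense[OF G u(1), of "%y. wl y w"] by blast
  thus ?thesis using GW_up[OF G] by blast
qed

lemma GW_below: assumes G: "B.gen G" and "w0 : GW G" "r : G" shows "EX w. w : GW G & B.le (e2 w) r"
proof -
  have w: "w0 <: W" "e2 w0 : G" using assms(2) unfolding GW_def by auto
  then obtain p where p: "p : G" "B.le p (e2 w0)" "B.le p r" using B.gen_dir[OF G _ assms(3)] by blast
  let ?Q = "%q. EX w. w <: W & B.le (e2 w) r & B.le q (e2 w)"
  have "A.D ?Q" by (intro dfi A.Dt_comp[OF De2])
  moreover have "EX x. B.le x q & ?Q x" if q: "B.le q p" for q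
  proof -
    obtain x where x: "wl x w0" "B.le (e2 x) q" using d2[OF w(1)] p(2) q B.le_trans by blast
    moreover have "B.le (e2 x) r" using x(2) q p(3) B.le_trans by blast
    ultimately show ?thesis using wl_W B.le_refl B.le_P(1) by blast
  qed
  ultimately obtain q where "q : G" "?Q q" using B.gen_dense[OF G _ p(1), of ?Q] by blast
  thus ?thesis unfolding GW_def using B.gen_up[OF G] by blast
qed

context
  fixes w0 assumes w0: "w0 <: W"
begin

text \<open>\<open>G1 G\<close> is definable from \<open>G\<close>, so the claim is a
  \<open>DG\<close> property of the second notion and the induction over names of the first can be
  carried out there.\<close>

lemma eq_tr: assumes G: "B.gen G" "e2 w0 : G" shows "A.eqG (G1 G) x y = B.eqG G (tr x) (tr y)"
proof -
  let ?Q = "%G x. ALL y. e2 w0 : G --> A.eqG (G1 G) x y = B.eqG G (tr x) (tr y)"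
  have "?Q G x"
  proof (rule B.DG_induct[of ?Q, OF _ _ G(1)])
    show "B.DG ?Q" unfolding A.eqG_def G1_def GW_def mem_Collect_eq
      by (intro dfi Dt_tr A.Dt_comp[OF De1] A.Dt_comp[OF De2] A.D_le[THEN B.DG_D] A.D_fe[THEN B.DG_D])
    fix G x assume G: "B.gen G" and IH: "!!c. c <: A.tc x ==> ?Q G c"
    show "?Q G x"
    proof (intro allI impI)
      fix y assume w: "e2 w0 : G"
      have G1: "A.gen (G1 G)" using gen_G1[OF G] w w0 unfolding GW_def by blast
      have t: "(EX d t. A.pr d t <: tr y & t : G & Q d) = (EX c s. A.pr c s <: y & s : G1 G & Q (tr c))" for y Q
        unfolding mem_tr G1_def GW_def by blast
      have ih: "A.eqG (G1 G) c d = B.eqG G (tr c) (tr d)" "A.eqG (G1 G) d c = B.eqG G (tr d) (tr c)" if "A.pr c s <: x" for c s d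
        using IH[OF A.pr_tc[OF that]] w A.eqG_sym[OF G1] B.eqG_sym[OF G] by blast+
      have m: "A.memG (G1 G) c y = B.memG G (tr c) (tr y)" if "A.pr c s <: x" for c s
        unfolding A.memG[OF G1] B.memG[OF G] t[of y "B.eqG G (tr c)"] using ih[OF that] by blast
      have m': "A.memG (G1 G) d x = B.memG G (tr d) (tr x)" for d
        unfolding A.memG[OF G1] B.memG[OF G] t[of x "B.eqG G (tr d)"] using ih by blast
      have t': "(ALL d t. A.pr d t <: tr y --> t : G --> Q d) = (ALL c s. A.pr c s <: y --> s : G1 G --> Q (tr c))" for y Q
        using t[of y "%d. ~ Q d"] by blast
      show "A.eqG (G1 G) x y = B.eqG G (tr x) (tr y)"
        unfolding A.eqG[OF G1] B.eqG[OF G] t' using m m' by blast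
    qed
  qed
  thus ?thesis using G(2) by blast
qed

lemma mem_tr_G: assumes G: "B.gen G" "e2 w0 : G" shows "A.memG (G1 G) x y = B.memG G (tr x) (tr y)"
proof -
  have "A.gen (G1 G)" using gen_G1[OF G(1)] G(2) w0 unfolding GW_def by blast
  thus ?thesis unfolding A.memG[OF \<open>A.gen (G1 G)\<close>] B.memG[OF G(1)] mem_tr eq_tr[OF G] unfolding G1_def GW_def by blast
qed

text \<open>The locale is symmetric in the two notions; translating \<open>y\<close> to the first
  and back again does not change its value.\<close>

lemma tr_surj: assumes G: "B.gen G" "e2 w0 : G" shows "EX x. B.eqG G (tr x) y"
proof -
  interpret sw: transfer E P2 R2 P1 R1 W wl e2 e1
    by unfold_locales (use Dwl De1 De2 wl_W wl_refl wl_trans m1 m2 d1 d2 c1 c2 in blast)+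
  let ?Q = "%G y. e2 w0 : G --> B.eqG G (tr (sw.tr y)) y"
  have "?Q G y"
  proof (rule B.DG_induct[of ?Q, OF _ _ G(1)])
    show "B.DG ?Q" by (intro dfi Dt_tr sw.Dt_tr A.Dt_comp[OF De2])
    fix G y assume G: "B.gen G" and IH: "!!c. c <: A.tc y ==> ?Q G c"
    show "?Q G y"
    proof
      assume w: "e2 w0 : G"
      have e: "B.eqG G (tr (sw.tr b)) b" if "A.pr b r <: y" for b r using IH[OF A.pr_tc[OF that]] w by blast
      have "B.memG G d y" if d: "A.pr d t <: tr (sw.tr y)" "t : G" for d t
      proof -
        obtain c s w where c: "A.pr c s <: sw.tr y" "w <: W" "A.le (e1 w) s" "d = tr c" "t = e2 w" using d(1) unfolding mem_tr by blast
        then obtain b r u where b: "A.pr b r <: y" "u <: W" "B.le (e2 u) r" "c = sw.tr b" "s = e1 u" unfolding sw.mem_tr by blast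
        have "w : GW G" using c d unfolding GW_def by blast
        hence "u : GW G" using GW_e1[OF G b(2)] c(3) b(5) unfolding G1_def by blast
        hence "r : G" using b(3) B.gen_up[OF G] unfolding GW_def by blast
        hence "B.memG G b y" using b(1) B.memG_I[OF G] by blast
        thus ?thesis using e[OF b(1)] B.memG_eq1[OF G] B.eqG_sym[OF G] b(4) c(4) by blast
      qed
      moreover have "B.memG G b (tr (sw.tr y))" if b: "A.pr b r <: y" "r : G" for b r
      proof -
        have "w0 : GW G" using w w0 unfolding GW_def by blast
        then obtain u where u: "u : GW G" "B.le (e2 u) r" using GW_below[OF G _ b(2)] by blast
        hence uW: "u <: W" "e2 u : G" unfolding GW_def by auto
        hence "A.pr (sw.tr b) (e1 u) <: sw.tr y" unfolding sw.mem_tr using b(1) u(2) by blast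
        hence "A.pr (tr (sw.tr b)) (e2 u) <: tr (sw.tr y)" unfolding mem_tr using uW m1[OF wl_refl] by blast
        thus ?thesis using B.memG_I[OF G] uW(2) e[OF b(1)] B.memG_eq1[OF G] by blast
      qed
      ultimately show "B.eqG G (tr (sw.tr y)) y" unfolding B.eqG[OF G] by blast
    qed
  qed
  thus ?thesis using G(2) by blast
qed

lemma tr_chk: assumes G: "B.gen G" "e2 w0 : G" shows "B.eqG G (tr (A.chk a)) (B.chk a)"
proof -
  let ?Q = "%G a. e2 w0 : G --> B.eqG G (tr (A.chk a)) (B.chk a)"
  have "?Q G a"
  proof (rule B.DG_induct[of ?Q, OF _ _ G(1)])
    show "B.DG ?Q" by (intro dfi Dt_tr A.Dt_comp[OF De2])
    fix G a assume G: "B.gen G" and IH: "!!c. c <: A.tc a ==> ?Q G c"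
    show "?Q G a"
    proof
      assume w: "e2 w0 : G"
      have e: "B.eqG G (tr (A.chk z)) (B.chk z)" if "z <: a" for z using IH w that A.mem_tc by blast
      have "B.memG G d (B.chk a)" if d: "A.pr d t <: tr (A.chk a)" for d t
        using d e unfolding mem_tr A.mem_chk B.memG_chk[OF G] by auto
      moreover have "B.memG G b (tr (A.chk a))" if b: "A.pr b r <: B.chk a" for b r
      proof -
        obtain z where z: "z <: a" "b = B.chk z" using b unfolding B.mem_chk by auto
        have p: "e1 w0 <: P1" using m1[OF wl_refl[OF w0]] A.le_P by blast
        hence "A.pr (tr (A.chk z)) (e2 w0) <: tr (A.chk a)"
          unfolding mem_tr A.mem_chk using z w0 A.le_refl[OF p] by auto
        thus ?thesis using B.memG_I[OF G] w z e B.memG_eq1[OF G] by blast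
      qed
      ultimately show "B.eqG G (tr (A.chk a)) (B.chk a)" unfolding B.eqG[OF G] by blast
    qed
  qed
  thus ?thesis using G(2) by blast
qed

lemma iso: assumes G: "B.gen G" "e2 w0 : G"
  shows "EX h. bij h & (ALL x y. A.EN (G1 G) x y = B.EN G (h x) (h y)) & (ALL x. h (A.val (G1 G) x) = B.val G (tr x))"
proof -
  have g: "A.gen (G1 G)" using gen_G1[OF G(1)] G(2) w0 unfolding GW_def by blast
  let ?a = "A.val (G1 G)" let ?b = "B.val G"
  have e: "(?a x = ?a y) = (?b (tr x) = ?b (tr y))" for x y
    unfolding A.val_eq[OF g] B.val_eq[OF G(1)] by (rule eq_tr[OF G])
  define h where "h a = ?b (tr (SOME x. ?a x = a))" for a
  have h: "h (?a x) = ?b (tr x)" for x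
    unfolding h_def using someI[of "%y. ?a y = ?a x" x] e by blast
  have "bij h"
  proof (rule bijI)
    show "inj h" by (rule injI) (metis A.val_surj[OF g] e h)
    show "surj h" using B.val_surj[OF G(1)] tr_surj[OF G] h unfolding surj_def by (metis B.val_eq[OF G(1)])
  qed
  moreover have "A.EN (G1 G) x y = B.EN G (h x) (h y)" for x y
  proof -
    obtain a b where "?a a = x" "?a b = y" using A.val_surj[OF g] by blast
    thus ?thesis using A.EN_val[OF g, of a b] B.EN_val[OF G(1), of "tr a" "tr b"] h mem_tr_G[OF G] by metis
  qed
  ultimately show ?thesis using h by blast
qed

lemma TG_tr_inst: assumes G: "B.gen G" "e2 w0 : G" shows "A.TG (G1 G) (inst q e) = B.TG G (inst q (%i. tr (e i)))"
proof -
  obtain h where h: "bij h" "ALL x y. A.EN (G1 G) x y = B.EN G (h x) (h y)" "ALL x. h (A.val (G1 G) x) = B.val G (tr x)"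
    using iso[OF G] by blast
  interpret A: generic E P1 R1 "G1 G" by unfold_locales (use gen_G1[OF G(1)] G(2) w0 in \<open>auto simp: GW_def\<close>)
  interpret B: generic E P2 R2 G by unfold_locales (rule G)
  show ?thesis unfolding A.TG_inst B.TG_inst using sat_iso_inst[of "A.EN (G1 G)" "B.EN G" h] h by simp
qed

text \<open>The statement contains \<open>Ground\<close> and is no instance of an \<open>fm\<close>.
  It is carried over by the isomorphism, which respects canonical names by
  \<open>tr_chk\<close>.\<close>

lemma TG_tr_statement: assumes G: "B.gen G" "e2 w0 : G"
    and A: "A.TG (G1 G) (All (%f. All (%A. Imp (And (FunctionToGround f (A.chk l)) (DefinedBy q f (A.chk l) A)) (Determined (A.chk l) A))))"
  shows "B.TG G (All (%f. All (%A. Imp (And (FunctionToGround f (B.chk l)) (DefinedBy q f (B.chk l) A)) (Determined (B.chk l) A))))"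
proof -
  obtain h where h: "bij h" "ALL x y. A.EN (G1 G) x y = B.EN G (h x) (h y)" "ALL x. h (A.val (G1 G) x) = B.val G (tr x)"
    using iso[OF G] by blast
  interpret A: generic E P1 R1 "G1 G" by unfold_locales (use gen_G1[OF G(1)] G(2) w0 in \<open>auto simp: GW_def\<close>)
  interpret B: generic E P2 R2 G by unfold_locales (rule G)
  have hj: "h (A.jj a) = B.jj a" for a using h(3) tr_chk[OF G] B.v_eq by metis
  have hM: "A.M x y = B.M (h x) (h y)" for x y using h(2) by blast
  have f1: "A.N.fon x y = B.N.fon (h x) (h y)" for x y using sat_iso_FunctionOn[of A.M B.M h, OF hM h(1)] by simp
  have f2: "A.N.fto x y z = B.N.fto (h x) (h y) (h z)" for x y z using sat_iso_FunctionTo[of A.M B.M h, OF hM h(1)] by simp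
  have f3: "A.M (A.N.pr x y) z = B.M (B.N.pr (h x) (h y)) (h z)" for x y z using sat_iso_PairIn[of A.M B.M h, OF hM h(1)] by simp
  have f4: "sat A.M (inst q (case_nat x (%_. y))) = sat B.M (inst q (case_nat (h x) (%_. h y)))" for x y
  proof -
    have "(%i. h (case_nat x (%_. y) i)) = case_nat (h x) (%_. h y)" by (auto split: nat.split)
    thus ?thesis using sat_iso_inst[of A.M B.M h, OF hM h(1), of q "case_nat x (%_. y)"] by simp
  qed
  have f5: "sat A.M (Determined x y) = sat B.M (Determined (h x) (h y))" for x y by (rule sat_iso_Determined[of A.M B.M h, OF hM h(1)])
  have hi: "(h x = h y) = (x = y)" for x y using bij_is_inj[OF h(1)] by (simp add: inj_eq)
  have hs: "EX a. B.v y = h (A.v a)" for y using tr_surj[OF G, of y] h(3) B.v_eq by metis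
  have hs': "EX a. y = h a" for y using bij_is_surj[OF h(1)] by (metis surjD)
  have "sat B.M (Determined (B.jj l) (B.v x))"
    if x: "B.TG G (FunctionToGround f (B.chk l))" "B.TG G (DefinedBy q f (B.chk l) x)" for f x
  proof -
    obtain g y where g: "B.v f = h (A.v g)" "B.v x = h (A.v y)" using hs by blast
    have "A.TG (G1 G) (FunctionToGround g (A.chk l))" unfolding A.TG_FunctionToGround
      using x(1) unfolding B.TG_FunctionToGround f1 f3 g(1) hj[symmetric] hi using hs' hi by metis
    moreover have "A.TG (G1 G) (DefinedBy q g (A.chk l) y)" unfolding A.TG_DefinedBy
      using x(2) unfolding B.TG_DefinedBy g hj[symmetric] f2 f4 hM by blast
    ultimately have "A.TG (G1 G) (Determined (A.chk l) y)" using A unfolding Imp_def by simp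
    thus ?thesis unfolding A.TG_Determined f5 hj g(2) .
  qed
  thus ?thesis unfolding Imp_def by (simp add: B.TG_Determined)
qed

end
end

section \<open>Posets of short partial functions\<close>

context zf begin

definition sb :: "'v => 'v => bool" where "sb a b = (ALL z. z <: a --> z <: b)"
lemma D_sb [dfi]: "Dt a ==> Dt b ==> D (%x. sb (a x) (b x))"
  by (rule D_comp2[of sb], unfold sb_def, intro dfi, assumption+)
lemma sb_refl [simp]: "sb a a" and sb_un [simp]: "sb (un a b) c = (sb a c & sb b c)"
  and sb_un1 [simp]: "sb a (un a b)" and sb_un2 [simp]: "sb b (un a b)" and sb_emp [simp]: "sb emp a"
  unfolding sb_def by auto
lemma sb_trans: "sb a b ==> sb b c ==> sb a c" and sbD: "sb a b ==> z <: a ==> z <: b"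
  unfolding sb_def by auto
lemma sb_Uu: "c <: C ==> sb c (Uu C)" and Uu_sb: "(!!c. c <: C ==> sb c d) ==> sb (Uu C) d"
  unfolding sb_def by auto
lemma sb_unI: "sb a b ==> sb a (un b c)" "sb a c ==> sb a (un b c)" unfolding sb_def by auto
lemma un_absorb: "sb a b ==> un a b = b" by (rule exten) (auto simp: sb_def)
lemma sb_antisym: "sb a b ==> sb b a ==> a = b" unfolding sb_def using exten by blast
lemma isf_sb: "isf f ==> sb g f ==> isf g" unfolding isf_def sb_def by blast
lemma isf_D: "isf f ==> pr x y <: f ==> pr x z <: f ==> y = z" unfolding isf_def by blast

definition sg :: "'v => 'v" where "sg x = up x x"
lemma mem_sg [simp]: "z <: sg x = (z = x)" unfolding sg_def by simp
lemma Dt_sg [dfi]: "Dt a ==> Dt (%x. sg (a x))" unfolding sg_def by (intro dfi)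
lemma sb_sg [simp]: "sb (sg x) a = (x <: a)" unfolding sb_def by simp

text \<open>\<open>l\<close>-closure. All posets concerned consist of sets ordered by inclusion,
  with unions as lower bounds of chains.\<close>

definition shc :: "'v => 'v => bool" where
  "shc l W = (ALL C. (EX c. c <: C) --> (ALL c. c <: C --> c <: W) --> (ALL c d. c <: C --> d <: C --> sb c d | sb d c) -->
    bd l C --> Uu C <: W)"

definition Lim :: "('v => 'v) => 'v => 'v => 'v" where "Lim h w i = un w (Uu (Im i h))"

lemma mem_Lim: "Dt h ==> z <: Lim h w i = (z <: w | (EX k. k <: i & z <: h k))"
  unfolding Lim_def by (auto simp: mem_Im)

lemma sb_Lim: "Dt h ==> k <: i ==> sb (h k) (Lim h w i)" "Dt h ==> sb w (Lim h w i)"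
  unfolding sb_def by (auto simp: mem_Lim)

text \<open>Dependent choice of length \<open>a\<close>: \<open>AC\<close> fixes one function for
  all possible steps, and the recursion along \<open>a\<close> applies it to the union of the
  earlier stages.\<close>

lemma short_chain: assumes l: "rc l" and W: "shc l W" and w: "w <: W" and a: "a <: l"
    and S: "D (%p. S (pf p) (pf (ps p)) (ps (ps p)))"
    and step: "!!i x. i <: a ==> x <: W ==> sb w x ==> EX y. y <: W & sb x y & S i x y"
  shows "EX h. Dt h & (ALL i. i <: a --> Lim h w i <: W & h i <: W & sb (Lim h w i) (h i) & S i (Lim h w i) (h i)) & Lim h w a <: W"
proof -
  have oa: "od a" using od_mem[OF rc_od[OF l] a] .
  let ?Q = "%u y. sb w (ps u) --> sb (ps u) y & S (pf u) (ps u) y"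
  have "D (%p. ?Q (pf p) (ps p))" by (intro dfi D_comp3[of S, OF S])
  moreover have "EX y. y <: W & ?Q u y" if "u <: prd a W" for u using that step w by (cases "sb w (ps u)") auto
  ultimately obtain f where f: "fto f (prd a W) W" "ALL u. u <: prd a W --> ?Q u (ap f u)"
    using AC[of ?Q "prd a W" W] by blast
  define h where "h = Rec (%i g. ap f (pr i (un w (Uu (rg g)))))"
  have Dh: "Dt h" unfolding h_def by (intro Dt_Rec dfi)
  have "rg (Lam i h) = Im i h" for i by (rule exten) (auto simp: pr_Lam[OF Dh] mem_Im[OF Dh])
  moreover have "h i = ap f (pr i (un w (Uu (rg (Lam i h)))))" for i unfolding h_def by (rule Rec_eq) (intro dfi)
  ultimately have h: "h i = ap f (pr i (Lim h w i))" for i unfolding Lim_def by simp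
  have hW: "h i <: W & sb (Lim h w i) (h i) & S i (Lim h w i) (h i)" if "i <: a" "Lim h w i <: W" for i
    using f(2)[rule_format, of "pr i (Lim h w i)"] fto_ap[OF f(1), of "pr i (Lim h w i)"] that sb_Lim(2)[OF Dh] unfolding h[of i] by auto
  have L: "i <: suc a --> Lim h w i <: W" (is "?R i") for i
  proof (rule eps_induct[of ?R])
    show "D ?R" unfolding Lim_def by (intro dfi Dt_comp[OF Dh])
    fix i assume IH: "!!k. k <: i ==> ?R k"
    show "?R i"
    proof
      assume i: "i <: suc a"
      have ia: "k <: a" if "k <: i" for k using i that od_trans[OF oa] by auto
      have oi: "od i" using od_mem[OF od_suc[OF oa] i] .
      have H: "h k <: W & sb (Lim h w k) (h k)" if "k <: i" for k using hW IH ia that by simp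
      let ?C = "un (sg w) (Im i h)"
      have c: "sb (h k) (h m)" if "k <: m" "m <: i" for k m using sb_trans[OF sb_Lim(1)[OF Dh that(1)]] H[OF that(2)] by blast
      have c0: "sb w (h k)" if "k <: i" for k using sb_trans[OF sb_Lim(2)[OF Dh]] H[OF that] by blast
      have "bd l i" using i rc_bd[OF l] a od_trans[OF rc_od[OF l] a] by auto
      hence "bd l ?C" unfolding sg_def by (intro bd_un bd_up bd_Im l Dh)
      moreover have "sb x y | sb y x" if "x <: ?C" "y <: ?C" for x y
        using that c c0 od_tri[OF od_mem[OF oi] od_mem[OF oi]] unfolding mem_un mem_Im[OF Dh] mem_sg by (metis sb_refl)
      moreover have "x <: W" if "x <: ?C" for x using that H w unfolding mem_un mem_Im[OF Dh] mem_sg by blast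
      moreover have "w <: ?C" by simp
      ultimately have "Uu ?C <: W" using W unfolding shc_def by blast
      moreover have "Uu ?C = Lim h w i" unfolding Lim_def by (rule exten) auto
      ultimately show "Lim h w i <: W" by simp
    qed
  qed
  show ?thesis using Dh hW L by (intro exI[of _ h]) auto
qed

lemma bd_mono: assumes "rc k" "rc m" "k <: m" "bd k x" shows "bd m x"
proof -
  obtain a f where "a <: k" "bij f a x" using sat_SizeLess[OF assms(1), of x] assms(4) unfolding SizeLess_def by auto
  moreover have "a <: m" using \<open>a <: k\<close> od_trans[OF rc_od[OF assms(2)] assms(3)] by blast
  ultimately show ?thesis using sat_SizeLess[OF assms(2), of x] unfolding SizeLess_def by auto
qed

end

text \<open>Column \<open>k\<close> of the poset adds a generic function from \<open>lam\<close> to \<open>bb k\<close>.  By the last assumption there is, outside any small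
  set of columns, one whose values can code the elements of a given small set; this is where the
  inaccessibility of \<open>mu\<close> enters.\<close>

locale columns = zf E for E :: "nat => nat => bool" (infix "<:" 50) +
  fixes lam mu IX :: nat and bb :: "nat => nat"
  assumes rcl: "rc lam" and oml: "om <: lam" and rcm: "rc mu" and lm: "lam <: mu" and pwm: "bd mu x ==> bd mu (Pw x)"
    and Dbb: "Dt bb" and bbs: "k <: IX ==> bd mu (bb k)" and bbne: "k <: IX ==> EX v. v <: bb k"
    and many: "bd mu Z ==> bd mu S ==> s <: S ==> EX k c. k <: IX & ~ k <: Z &
      (ALL x v. x <: S --> v <: bb k --> ap c (pr x v) <: bb k) &
      (ALL x v y w. x <: S --> v <: bb k --> y <: S --> w <: bb k --> ap c (pr x v) = ap c (pr y w) --> x = y & v = w)"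
begin

definition cond :: "nat => bool" where
  "cond u = (isf u & (ALL z v. pr z v <: u --> (EX k x. z = pr k x & k <: IX & x <: lam & v <: bb k)) & bd lam u)"
lemma D_cond [dfi]: "Dt a ==> D (%x. cond (a x))" by (rule D_comp[of cond], unfold cond_def, intro dfi Dt_comp[OF Dbb])

definition FF :: nat where "FF = Sp (Pw (prd (prd IX lam) (Uu (Im IX bb)))) cond"
definition RF :: nat where "RF = Sp (prd FF FF) (%w. sb (ps w) (pf w))"

lemma FF: "u <: FF = cond u"
proof -
  have "w <: prd (prd IX lam) (Uu (Im IX bb))" if w: "cond u" "w <: u" for w
  proof -
    obtain z v where "w = pr z v" using w unfolding cond_def isf_def by blast
    moreover then obtain k x where "z = pr k x" "k <: IX" "x <: lam" "v <: bb k" using w unfolding cond_def by blast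
    ultimately show ?thesis unfolding mem_prd mem_Un mem_Im[OF Dbb] by blast
  qed
  thus ?thesis unfolding FF_def by (subst mem_Sp, intro dfi) auto
qed

lemma RF: "pr q p <: RF = (q <: FF & p <: FF & sb p q)"
  unfolding RF_def by (subst mem_Sp, intro dfi) auto

lemma cond_sub: "cond q ==> sb p q ==> cond p"
  unfolding cond_def using isf_sb bd_sub[OF rc_emp[OF rcl]] unfolding sb_def by blast

lemma cond_un: "cond p ==> cond q ==> isf (un p q) ==> cond (un p q)"
  unfolding cond_def using bd_un[OF rcl] by auto

lemma isf_un: assumes "isf p" "isf q" "!!z v w. pr z v <: p ==> pr z w <: q ==> v = w" shows "isf (un p q)"
  using assms unfolding isf_def mem_un by metis

lemma isf_Uu: assumes "!!c. c <: C ==> isf c" "!!c d. c <: C ==> d <: C ==> isf (un c d)" shows "isf (Uu C)"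
proof -
  have "y = z" if "c <: C" "d <: C" "pr x y <: c" "pr x z <: d" for c d x y z
    using isf_D[OF assms(2)[OF that(1,2)], of x y z] that(3,4) by simp
  thus ?thesis unfolding isf_def[of "Uu C"] mem_Un using assms(1) unfolding isf_def by blast
qed

lemma cond_Uu: assumes "!!c. c <: C ==> cond c" "!!c d. c <: C ==> d <: C ==> isf (un c d)" "bd lam C" shows "cond (Uu C)"
proof -
  have "isf (Uu C)" using isf_Uu[OF _ assms(2)] assms(1) unfolding cond_def by blast
  moreover have "bd lam (Uu C)" using bd_Uu[OF rc_od[OF rcl] assms(3)] assms(1) unfolding cond_def by blast
  ultimately show ?thesis using assms(1) unfolding cond_def mem_Un by blast
qed

lemma cond_emp: "cond emp"
proof -
  have "bd lam emp" unfolding bd_def using rc_emp[OF rcl] by auto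
  thus ?thesis unfolding cond_def isf_def by simp
qed

sublocale F: forcing E FF RF
proof
  show "EX p. p <: FF" using cond_emp FF by blast
qed (use RF sb_trans FF in auto)

lemma le: "F.le q p = (q <: FF & p <: FF & sb p q)" unfolding F.le_def RF by blast

lemma comp: "p <: FF ==> q <: FF ==> F.comp p q = isf (un p q)"
proof
  assume "p <: FF" "q <: FF" "F.comp p q"
  then obtain r where "r <: FF" "sb (un p q) r" unfolding F.comp_def le by auto
  thus "isf (un p q)" using isf_sb unfolding FF cond_def by blast
next
  assume "p <: FF" "q <: FF" "isf (un p q)"
  thus "F.comp p q" unfolding F.comp_def le FF using cond_un by (intro exI[of _ "un p q"]) auto
qed

lemma shc_FF: "shc lam FF"
  unfolding shc_def FF
proof (intro allI impI)
  fix C assume "EX c. c <: C" "ALL c. c <: C --> cond c" and c: "ALL c d. c <: C --> d <: C --> sb c d | sb d c" "bd lam C"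
  moreover have "isf (un c d)" if "c <: C" "d <: C" for c d
    using c(1)[rule_format, OF that]
  proof
    assume "sb d c" hence "un c d = c" by (intro exten) (auto simp: sb_def)
    thus ?thesis using that calculation(2) unfolding cond_def by simp
  qed (use that calculation(2) un_absorb in \<open>auto simp: cond_def\<close>)
  ultimately show "cond (Uu C)" by (intro cond_Uu) blast+
qed

lemma G_FF: "F.gen G ==> p : G ==> p <: FF" by (rule F.gen_P)

lemma G_sub: "F.gen G ==> p : G ==> sb q p ==> q : G"
  using F.gen_up[of G p q] F.gen_P[of G p] cond_sub unfolding le FF by blast

lemma G_isf: "F.gen G ==> p : G ==> q : G ==> isf (un p q)"
  using F.gen_dir[of G p q] comp[of p q] F.gen_P unfolding F.comp_def by blast

lemma G_un: assumes "F.gen G" "p : G" "q : G" shows "un p q : G"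
proof -
  obtain r where "r : G" "sb (un p q) r" using F.gen_dir[OF assms] unfolding le by auto
  thus ?thesis using G_sub assms(1) by blast
qed

text \<open>It is dense that a condition contains all of \<open>C\<close> or is incompatible with a
  member of \<open>C\<close>, and the latter cannot happen inside \<open>G\<close>.\<close>

lemma G_Uu: assumes G: "F.gen G" and C: "!!c. c <: C ==> c : G" "bd lam C" shows "Uu C : G"
proof -
  let ?Q = "%r. sb (Uu C) r | (EX c. c <: C & ~ F.comp c r)"
  have "D ?Q" by (intro dfi)
  moreover have "EX r. F.le r p & ?Q r" if p: "p <: FF" for p
  proof (cases "EX c. c <: C & ~ F.comp c p")
    case False
    have cc: "cond (Uu C)" using C G_FF[OF G] G_isf[OF G] unfolding FF by (intro cond_Uu) blast+
    have "isf (un (Uu C) p)"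
    proof (rule isf_un)
      fix z v w assume zv: "pr z v <: Uu C" "pr z w <: p"
      then obtain c where c: "c <: C" "pr z v <: c" by auto
      hence "isf (un c p)" using False comp[OF G_FF[OF G C(1)] p] by blast
      thus "v = w" using isf_D[of "un c p" z v w] c zv by simp
    qed (use cc p in \<open>auto simp: FF cond_def\<close>)
    hence "cond (un (Uu C) p)" using cc p cond_un unfolding FF by blast
    thus ?thesis using p unfolding le FF by (intro exI[of _ "un (Uu C) p"]) simp
  qed (use p F.le_refl in blast)
  moreover obtain p where "p : G" using F.gen_ne[OF G] by blast
  ultimately obtain r where r: "r : G" "?Q r" using F.gen_dense[OF G, of ?Q p] F.le_P by blast
  moreover have "F.comp c r" if "c <: C" for c using F.gen_dir[OF G C(1)[OF that] r(1)] unfolding F.comp_def by blast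
  ultimately show ?thesis using G_sub[OF G] by blast
qed

lemma gen_dense_sb: assumes "F.gen G" "D Q" "p : G" "!!q. q <: FF ==> sb p q ==> EX r. r <: FF & sb q r & Q r"
  shows "EX r. r : G & sb p r & Q r"
proof -
  have "D (%r. sb p r & Q r)" by (intro dfi assms(2))
  thus ?thesis using F.gen_dense[OF assms(1) _ assms(3), of "%r. sb p r & Q r"] assms(4) sb_trans unfolding le by blast
qed

lemma gen_ex: "cond p ==> EX G. F.gen G & p : G" using F.ex_gen FF by blast

lemma F_truth: assumes "F.gen G" "F.DG Q" "Q G x" "p : G"
  shows "EX q. q : G & sb p q & F.Frc q (%G. Q G x)"
proof -
  obtain r where r: "r : G" "F.Frc r (%G. Q G x)" using F.truth[OF assms(1,2,3)] by blast
  have "un p r : G" using G_un[OF assms(1,4) r(1)] .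
  thus ?thesis using F.Frc_le[OF r(2), of "un p r"] G_FF[OF assms(1)] r(1) unfolding le by auto
qed

text \<open>Distributivity: the values are decided one after the other along a chain of length
  \<open>a\<close>, so that \<open>h\<close> is found in the ground model.\<close>

lemma F_dist: assumes G: "F.gen G" and Q: "F.DG Q" and a: "a <: lam" and ex: "!!x. x <: a ==> EX y. y <: B & Q G (pr x y)"
  shows "EX h. fto h a B & (ALL x. x <: a --> Q G (pr x (ap h x)))"
proof -
  let ?E = "%G _. ALL x. x <: a --> (EX y. y <: B & Q G (pr x y))"
  have "F.DG ?E" by (intro dfi F.DG_comp[OF Q])
  moreover obtain e where e: "e : G" using F.gen_ne[OF G] by blast
  ultimately obtain p where p: "p : G" "F.Frc p (%G. ?E G a)" using F_truth[OF G, of ?E a e] ex by blast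
  let ?R = "%r. EX h. fto h a B & (ALL x. x <: a --> F.Frc r (%G. Q G (pr x (ap h x))))"
  have "D ?R" by (intro dfi F.DG_comp[OF Q])
  moreover have "EX r. r <: FF & sb q r & ?R r" if q: "q <: FF" "sb p q" for q
  proof -
    let ?S = "%x w w'. EX y. y <: B & F.Frc w' (%G. Q G (pr x y))"
    have dS: "D (%p. ?S (pf p) (pf (ps p)) (ps (ps p)))" by (intro dfi F.DG_comp[OF Q])
    have "EX w'. w' <: FF & sb w w' & ?S x w w'" if x: "x <: a" and w: "w <: FF" "sb q w" for x w
    proof -
      obtain H where H: "F.gen H" "w : H" using gen_ex w FF by blast
      have "p : H" using G_sub[OF H] w(2) q(2) sb_trans by blast
      then obtain y where y: "y <: B" "Q H (pr x y)" using F.Frc_D[OF p(2) H(1)] x by blast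
      obtain w' where "w' : H" "sb w w'" "F.Frc w' (%G. Q G (pr x y))" using F_truth[OF H(1) Q y(2) H(2)] by blast
      thus ?thesis using y G_FF[OF H(1)] by blast
    qed
    then obtain h where h: "Dt h" "Lim h q a <: FF" "ALL x. x <: a --> h x <: FF & ?S x (Lim h q x) (h x)"
      using short_chain[OF rcl shc_FF q(1) a dS] by blast
    have "F.le (Lim h q a) (h x)" if "x <: a" for x using h that sb_Lim(1)[OF h(1) that] unfolding le by blast
    hence "EX y. y <: B & F.Frc (Lim h q a) (%G. Q G (pr x y))" if "x <: a" for x
      using h(3) that F.Frc_le by blast
    moreover have "D (%p. F.Frc (Lim h q a) (%G. Q G (pr (pf p) (ps p))))" by (intro dfi F.DG_comp[OF Q])
    ultimately have "?R (Lim h q a)" using AC[of "%x y. F.Frc (Lim h q a) (%G. Q G (pr x y))" a B] by blast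
    thus ?thesis using h(2) sb_Lim(2)[OF h(1)] by blast
  qed
  ultimately obtain r where "r : G" "?R r" using gen_dense_sb[OF G _ p(1), of ?R] by blast
  thus ?thesis using F.Frc_D[OF _ G] by blast
qed

section \<open>Conditions supported by a set of columns\<close>

definition FX :: "nat => nat" where "FX X = Sp FF (%q. ALL k x v. pr (pr k x) v <: q --> k <: X)"
lemma FX: "q <: FX X = (cond q & (ALL k x v. pr (pr k x) v <: q --> k <: X))"
  unfolding FX_def by (subst mem_Sp, intro dfi) (simp add: FF)
lemma Dt_FX [dfi]: "Dt a ==> Dt (%x. FX (a x))" by (rule Dt_comp[of FX], unfold FX_def, intro dfi)

definition rt :: "nat => nat => nat" where "rt q X = Sp q (%u. pf (pf u) <: X)"
lemma Dt_rt [dfi]: "Dt a ==> Dt b ==> Dt (%x. rt (a x) (b x))" by (rule Dt_comp2[of rt], unfold rt_def, intro dfi, assumption+)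
lemma mem_rt: "u <: rt q X = (u <: q & pf (pf u) <: X)" unfolding rt_def by (intro mem_Sp dfi)

lemma cond_pr: "cond q ==> u <: q ==> EX k x v. u = pr (pr k x) v & k <: IX & x <: lam & v <: bb k"
  unfolding cond_def isf_def by metis

lemma sb_rt: "sb (rt q X) q" unfolding sb_def mem_rt by blast
lemma rt_mono: "sb p q ==> sb (rt p X) (rt q X)" unfolding sb_def mem_rt by blast
lemma rt_un: "rt (un p q) X = un (rt p X) (rt q X)" by (rule exten) (auto simp: mem_rt)
lemma rt_FX: "cond q ==> rt q X <: FX X" unfolding FX using cond_sub[OF _ sb_rt] by (auto simp: mem_rt)
lemma FXD: "q <: FX X ==> pr (pr k x) v <: q ==> k <: X" unfolding FX by blast
lemma FX_cond: "q <: FX X ==> cond q" unfolding FX by blast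
lemma FX_un: "p <: FX X ==> q <: FX X ==> isf (un p q) ==> un p q <: FX X" unfolding FX using cond_un[of p q] by (simp; blast)
lemma FX_mono: "q <: FX X ==> sb X Y ==> q <: FX Y" unfolding FX sb_def by blast
lemma rt_id: "q <: FX X ==> sb X Y ==> rt q Y = q"
proof (rule exten)
  fix u assume a: "q <: FX X" "sb X Y"
  have "pf (pf u) <: Y" if u: "u <: q"
  proof -
    obtain k x v where "u = pr (pr k x) v" using cond_pr[OF FX_cond[OF a(1)] u] by blast
    thus ?thesis using a u unfolding FX sb_def by auto
  qed
  thus "u <: rt q Y = (u <: q)" unfolding mem_rt by blast
qed
lemma rt_rt: "sb X Y ==> rt (rt q Y) X = rt q X" by (rule exten) (auto simp: mem_rt sb_def)
lemma rt_emp: "q <: FX X ==> (!!k. k <: X ==> ~ k <: Y) ==> rt q Y = emp"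
  unfolding emp_eq mem_rt FX using cond_pr by fastforce
lemma sb_rt_FX: "r <: FX X ==> sb r q ==> sb r (rt q X)"
  using rt_mono[of r q X] rt_id[of r X X] by simp

text \<open>A conflict with \<open>p\<close> can occur only in the columns of
  \<open>X\<close>.\<close>

lemma FX_isf: assumes "p <: FX X" "cond q" "isf (un p (rt q X))" shows "isf (un p q)"
proof (rule isf_un)
  fix z v w assume a: "pr z v <: p" "pr z w <: q"
  obtain k x where "z = pr k x" "k <: X" using cond_pr[OF FX_cond[OF assms(1)] a(1)] FXD[OF assms(1)] a(1) by (metis pr_eq)
  hence "pr z w <: rt q X" using a unfolding mem_rt by simp
  thus "v = w" using isf_D[OF assms(3), of z v w] a(1) by simp
qed (use assms in \<open>auto simp: FX cond_def\<close>)

lemma rt_cond: "q <: FX X ==> rt q Y <: FX Y" using rt_FX FX_cond by blast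

text \<open>There are fewer than \<open>mu\<close> possible entries over \<open>X\<close>, and a
  condition is a set of entries. \<open>X\<close> is intersected with \<open>IX\<close> because
  \<open>bb\<close> is bounded only there.\<close>

lemma bd_FX: assumes "bd mu X" shows "bd mu (FX X)"
proof -
  let ?X = "Sp X (%k. k <: IX)"
  have m: "k <: ?X = (k <: X & k <: IX)" for k by (intro mem_Sp dfi)
  let ?S = "Pw (prd (prd X lam) (Uu (Im ?X bb)))"
  have e: "emp <: mu" using rc_emp[OF rcm] .
  have "bd mu ?X" by (rule bd_sub[OF e assms]) (simp add: m)
  hence "bd mu (Uu (Im ?X bb))"
    by (intro bd_Uu rc_od rcm bd_Im Dbb) (auto simp: mem_Im[OF Dbb] m intro: bbs)
  hence S: "bd mu ?S" using bd_prd[OF rcm] assms rc_bd[OF rcm lm] by (intro pwm) blast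
  have "q <: ?S" if q: "q <: FX X" for q
  proof -
    have "u <: prd (prd X lam) (Uu (Im ?X bb))" if "u <: q" for u
    proof -
      obtain k x v where k: "u = pr (pr k x) v" "k <: IX" "x <: lam" "v <: bb k" using cond_pr[OF FX_cond[OF q] \<open>u <: q\<close>] by blast
      moreover have "k <: X" using FXD[OF q] \<open>u <: q\<close> k(1) by blast
      ultimately show ?thesis unfolding mem_prd mem_Un mem_Im[OF Dbb] m by blast
    qed
    thus ?thesis by simp
  qed
  thus ?thesis using bd_sub[OF e S] by blast
qed

definition supp :: "nat => nat" where "supp q = Im q (%u. pf (pf u))"
lemma mem_supp: "k <: supp q = (EX u. u <: q & k = pf (pf u))" unfolding supp_def by (intro mem_Im dfi)
lemma Dt_supp [dfi]: "Dt a ==> Dt (%x. supp (a x))" by (rule Dt_comp[of supp], unfold supp_def, intro dfi)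
lemma bd_supp: "cond q ==> bd mu (supp q)"
  unfolding supp_def cond_def by (intro bd_Im bd_mono[OF rcl rcm lm] dfi) blast
lemma FX_supp: "cond q ==> sb (supp q) X ==> q <: FX X" unfolding FX sb_def mem_supp by fastforce
lemma supp_FX: "q <: FX X ==> sb (supp q) X" unfolding sb_def mem_supp FX using cond_pr by fastforce

text \<open>Iterating a Skolem function \<open>lam\<close> many times and using that conditions are smaller than \<open>lam\<close>.\<close>

lemma capture: assumes S: "D (%p. S (pf p) (ps p))" and X0: "bd mu X0"
    and ex: "!!i q. i <: lam ==> cond q ==> sb p q ==> EX r. cond r & sb q r & S i r"
  shows "EX X. bd mu X & sb X0 X & (ALL i q. i <: lam --> q <: FX X --> sb p q --> (EX r. r <: FX X & sb q r & S i r))"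
proof -
  let ?Q = "%u r. sb p (ps u) --> sb (ps u) r & S (pf u) r"
  have "D (%p. ?Q (pf p) (ps p))" by (intro dfi D_comp2[of S, OF S])
  moreover have "EX r. r <: FF & ?Q u r" if "u <: prd lam FF" for u
    using that ex[of "pf u" "ps u"] cond_emp by (cases "sb p (ps u)") (auto simp: FF)
  ultimately obtain c where c: "fto c (prd lam FF) FF" "ALL u. u <: prd lam FF --> ?Q u (ap c u)"
    using AC[of ?Q "prd lam FF" FF] by blast
  define st where "st X = un X (Uu (Im (prd lam (FX X)) (%u. supp (ap c u))))" for X
  have Dst: "Dt st" unfolding st_def by (intro dfi)
  define X where "X = Rec (%i g. un X0 (Uu (Im (rg g) st)))"
  have DX: "Dt X" unfolding X_def by (intro Dt_Rec dfi Dt_comp[OF Dst])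
  have Dstx: "Dt (%k. st (X k))" by (intro Dt_comp[OF Dst] DX)
  have X: "X i = un X0 (Uu (Im i (%k. st (X k))))" for i
  proof -
    have "X i = un X0 (Uu (Im (rg (Lam i X)) st))" unfolding X_def by (rule Rec_eq) (intro dfi Dt_comp[OF Dst])
    also have "Im (rg (Lam i X)) st = Im i (%k. st (X k))"
      by (rule exten) (auto simp: mem_Im[OF Dst] mem_Im[OF Dstx] pr_Lam[OF DX])
    finally show ?thesis .
  qed
  have mX: "z <: X i = (z <: X0 | (EX k. k <: i & z <: st (X k)))" for z i
    by (subst X) (auto simp: mem_Im[OF Dstx])
  have ds: "Dt (%u. supp (ap c u))" by (intro dfi)
  have sm: "bd mu (st Y)" if "bd mu Y" for Y
  proof -
    have "bd mu (supp (ap c u))" if "u <: prd lam (FX Y)" for u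
      using that fto_ap[OF c(1), of u] FX FF bd_supp by auto
    thus ?thesis unfolding st_def using that bd_prd[OF rcm rc_bd[OF rcm lm] bd_FX[OF that]]
      by (intro bd_un bd_Uu rcm rc_od bd_Im ds) (auto simp: mem_Im[OF ds])
  qed
  have small: "i <: suc lam --> bd mu (X i)" (is "?R i") for i
  proof (rule eps_induct[of ?R])
    show "D ?R" by (intro dfi Dt_comp[OF DX])
    fix i assume IH: "!!k. k <: i ==> ?R k"
    show "?R i"
    proof
      assume i: "i <: suc lam"
      hence sub: "k <: suc lam" if "k <: i" for k using that od_trans[OF od_suc[OF rc_od[OF rcl]]] by blast
      have "bd mu i" using i rc_bd[OF rcm] lm od_trans[OF rc_od[OF rcm] lm] by auto
      thus "bd mu (X i)" by (subst X)
        (intro bd_un bd_Uu rcm rc_od bd_Im Dstx X0; auto simp: mem_Im[OF Dstx] intro!: sm IH[rule_format] sub)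
    qed
  qed
  have "EX r. r <: FX (X lam) & sb q r & S i r" if i: "i <: lam" and q: "q <: FX (X lam)" "sb p q" for i q
  proof -
    have cq: "cond q" "bd lam q" using q(1) unfolding FX cond_def by auto
    have "EX k. k <: lam & (pf (pf u) <: X0 | pf (pf u) <: st (X k))" if "u <: q" for u
    proof -
      have "pf (pf u) <: X lam" using sbD[OF supp_FX[OF q(1)]] that unfolding mem_supp by blast
      thus ?thesis using rc_emp[OF rcl] unfolding mX[of _ lam] by blast
    qed
    moreover have "D (%p. pf (pf (pf p)) <: X0 | pf (pf (pf p)) <: st (X (ps p)))" by (intro dfi Dt_comp[OF Dstx])
    ultimately obtain f where f: "fto f q lam" "ALL u. u <: q --> pf (pf u) <: X0 | pf (pf u) <: st (X (ap f u))"
      using AC[of "%u k. pf (pf u) <: X0 | pf (pf u) <: st (X k)" q lam] by blast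
    then obtain b where b: "b <: lam" "ALL u. u <: q --> ap f u <: b" using cq(2) unfolding bd_def by blast
    have "sb (supp q) (X b)" unfolding sb_def mem_supp mX using f(2) b(2) by blast
    hence qb: "q <: FX (X b)" using FX_supp cq by blast
    let ?r = "ap c (pr i q)"
    have m: "pr i q <: prd lam FF" "pr i q <: prd lam (FX (X b))" using i cq(1) qb FF by auto
    have "k <: st (X b)" if "k <: supp ?r" for k
      unfolding st_def mem_un mem_Un mem_Im[OF ds] using m(2) that by blast
    hence "sb (supp ?r) (X lam)" unfolding sb_def mX using b(1) by blast
    hence "?r <: FX (X lam)" using FX_supp fto_ap[OF c(1) m(1)] FF by blast
    thus ?thesis using c(2)[rule_format, OF m(1)] q(2) by auto
  qed
  moreover have "sb X0 (X lam)" unfolding sb_def mX by blast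
  ultimately show ?thesis using small by (intro exI[of _ "X lam"]) simp
qed

end

section \<open>Plays and strategies in the generic extension\<close>

context zf begin

text \<open>Parity as a recursion with the values \<open>suc emp\<close> for even and
  \<open>emp\<close> for odd; zero and limits fall under the default.\<close>

definition Ev :: "'v => bool" where
  "Ev a = (Rec (%b g. if EX c. b = suc c & ap g c = suc emp then emp else suc emp) a = suc emp)"

lemma D_Ev [dfi]: "Dt a ==> D (%x. Ev (a x))" unfolding Ev_def
  by (rule D_comp[of "%a. Rec _ a = suc emp"], intro dfi Dt_Rec)

lemma Ev: "Ev b = (~ (EX c. b = suc c & Ev c))"
proof -
  let ?H = "%b g. if EX c. b = suc c & ap g c = suc emp then emp else suc emp"
  have d: "Dt (%p. ?H (pf p) (ps p))" by (intro dfi)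
  have n: "emp ~= suc emp" using mem_suc[of emp emp] mem_emp by metis
  have "(ap (Lam b (Rec ?H)) c = suc emp) = Ev c" if "b = suc c" for c
    using that ap_Lam[OF Dt_Rec[OF d], of c b] unfolding Ev_def by simp
  hence "(EX c. b = suc c & ap (Lam b (Rec ?H)) c = suc emp) = (EX c. b = suc c & Ev c)" by blast
  thus ?thesis unfolding Ev_def[of b] Rec_eq[OF d, of b] using n by simp
qed

lemma Ev_suc: "Ev (suc a) = (~ Ev a)"
  using Ev[of "suc a"] suc_eq by blast

lemma suc_sub: "od a ==> od b ==> a <: b ==> suc a <: suc b" using od_suc_le[of b a] by auto

end

context columns begin

text \<open>Ground model versions of the notions of the game. By \<open>short_ground\<close>, short
  sequences and plays of length below \<open>lam\<close> in the extension are all of this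
  kind.\<close>

definition sseq :: "nat => bool" where "sseq s = (EX a. a <: lam & fto s a lam)"
lemma D_sseq [dfi]: "Dt a ==> D (%x. sseq (a x))" by (rule D_comp[of sseq], unfold sseq_def, intro dfi)
definition Sq :: nat where "Sq = Sp (Pw (prd lam lam)) sseq"
lemma Sq: "s <: Sq = sseq s"
proof -
  have "s <: Pw (prd lam lam)" if "sseq s"
    using that od_trans[OF rc_od[OF rcl]] unfolding sseq_def fto_def fon_def isf_def mem_Pw mem_prd by (metis pr_eq)
  thus ?thesis unfolding Sq_def by (subst mem_Sp, intro dfi) blast
qed
lemma oda: "a <: lam ==> od a" using od_mem rc_od[OF rcl] by blast
lemma lam_trans: "a <: lam ==> b <: a ==> b <: lam" using od_trans rc_od[OF rcl] by blast
lemma lam_suc: "a <: lam ==> suc a <: lam" using rc_suc[OF rcl] .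

definition play :: "nat => nat => bool" where
  "play a t = (fon t a & (ALL b. b <: a --> sseq (ap t b)) & (ALL b c. c <: a --> b <: c --> sb (ap t b) (ap t c) & ap t b ~= ap t c))"
lemma D_play [dfi]: "Dt a ==> Dt b ==> D (%x. play (a x) (b x))"
  by (rule D_comp2[of play], unfold play_def, intro dfi, assumption+)
definition legal :: "nat => nat => bool" where
  "legal t s = (sseq s & (ALL b. b <: dm t --> sb (ap t b) s & ap t b ~= s))"
lemma D_legal [dfi]: "Dt a ==> Dt b ==> D (%x. legal (a x) (b x))"
  by (rule D_comp2[of legal], unfold legal_def, intro dfi, assumption+)
lemma play_dm: "play a t ==> dm t = a" unfolding play_def fon_dm by blast

text \<open>\<open>seg G n t\<close>: in the extension by \<open>G\<close>, the play \<open>t\<close> is an initial segment of the run with name \<open>n\<close>.\<close>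

definition seg :: "nat set => nat => nat => bool" where
  "seg G n t = (EX a. a <: lam & play a t & (ALL b. b <: a --> F.memG G (F.chk (pr b (ap t b))) n))"
lemma DG_seg [dfi]: assumes "Dt a" "Dt b" shows "F.DG (%G x. seg G (a x) (b x))"
  unfolding seg_def by (intro dfi D_play[THEN F.DG_D] Dt_comp[OF assms(1)] Dt_comp[OF assms(2)])

text \<open>What is retained of a run named \<open>n\<close> in which the player who moves at the
  stages in \<open>T\<close> follows \<open>Q\<close>. Only initial segments occur, so that this is
  a \<open>DG\<close> property and conditions can force it.\<close>

definition run :: "(nat => bool) => (nat set => nat => bool) => nat set => nat => bool" where
  "run T Q G n = ((ALL a. a <: lam --> (EX t. play a t & seg G n t)) &
    (ALL b s s'. F.memG G (F.chk (pr b s)) n --> F.memG G (F.chk (pr b s')) n --> s = s') &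
    (ALL t. seg G n t --> T (dm t) --> (EX s. F.memG G (F.chk (pr (dm t) s)) n & Q G (pr t s))))"
lemma DG_run: assumes "D T" "F.DG Q" "Dt a" shows "F.DG (%G x. run T Q G (a x))"
  unfolding run_def by (intro dfi D_play[THEN F.DG_D] F.DG_D[OF D_comp[OF assms(1)]] F.DG_comp[OF assms(2)] Dt_comp[OF assms(3)])

definition outc :: "nat set => nat => nat => bool" where "outc G n z = (EX t b. seg G n t & b <: dm t & z <: ap t b)"
lemma DG_outc [dfi]: assumes "Dt a" "Dt b" shows "F.DG (%G x. outc G (a x) (b x))"
  unfolding outc_def by (intro dfi Dt_comp[OF assms(1)] Dt_comp[OF assms(2)])

text \<open>\<open>C\<close> holds of codes of triples \<open>(t, i, s)\<close>, with at most one \<open>s\<close> for given \<open>t\<close> and \<open>i\<close>; choosing the least \<open>i\<close> turns it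
  into a strategy without an appeal to choice in the extension.\<close>

definition least :: "(nat set => nat => bool) => nat set => nat => bool" where
  "least C G u = (EX i. i <: lam & C G (pr (pf u) (pr i (ps u))) & (ALL k. k <: i --> (ALL s. ~ C G (pr (pf u) (pr k s)))))"
lemma DG_least: assumes "F.DG C" shows "F.DG (least C)"
  unfolding least_def by (intro dfi F.DG_comp[OF assms])

lemma least_ex: assumes "F.gen G" "F.DG C" "i <: lam" "C G (pr t (pr i s))" shows "EX s. least C G (pr t s)"
proof -
  let ?Q = "%G i. i <: lam & (EX s. C G (pr t (pr i s)))"
  have "F.DG ?Q" by (intro dfi F.DG_comp[OF assms(2)])
  then obtain k where "?Q G k" "ALL c. c <: k --> ~ ?Q G c" using F.DG_min[OF assms(1), of ?Q i] assms(3,4) by blast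
  moreover then obtain s where "C G (pr t (pr k s))" by blast
  ultimately show ?thesis unfolding least_def by (intro exI[of _ s] exI[of _ k]) (use lam_trans in auto)
qed

lemma least_unique: assumes "!!i s s'. C G (pr t (pr i s)) ==> C G (pr t (pr i s')) ==> s = s'"
    "least C G (pr t s)" "least C G (pr t s')" shows "s = s'"
proof -
  obtain i k where i: "i <: lam" "C G (pr t (pr i s))" "ALL k. k <: i --> (ALL s. ~ C G (pr t (pr k s)))"
    "k <: lam" "C G (pr t (pr k s'))" "ALL i. i <: k --> (ALL s. ~ C G (pr t (pr i s)))"
    using assms(2,3) unfolding least_def by auto
  hence "i = k" using od_tri[OF oda oda] by blast
  thus ?thesis using i assms(1) by blast
qed

end

locale colgen = columns + fixes G assumes genG: "F.gen G"
begin

sublocale generic E FF RF G by unfold_locales (rule genG)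

text \<open>\<open>name_bound\<close> confines the possible values to a set of the ground model, and
  then \<open>F_dist\<close> applies.\<close>

lemma short_ground: assumes a: "a <: lam" and f: "N.fon f (jj a)" "!!x y. M (N.pr x y) f ==> EX c. y = jj c"
  shows "EX h. f = jj h & fon h a"
proof -
  obtain n where n: "v n = f" using surj by blast
  obtain B where B: "ALL G u. F.gen G --> F.memG G (F.chk u) n --> u <: B" using F.name_bound by blast
  let ?Q = "%G u. F.memG G (F.chk u) n"
  have m: "M (jj u) f = ?Q G u" for u using EN n by metis
  have "F.DG ?Q" by (intro dfi)
  moreover have "EX y. y <: Uu (Uu B) & ?Q G (pr x y)" if x: "x <: a" for x
  proof -
    have "M (jj x) (jj a)" using x by simp
    then obtain y where "M (N.pr (jj x) y) f" using f(1) unfolding N.fon_def by blast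
    then obtain c where "M (jj (pr x c)) f" using f(2) by (metis j_pr)
    hence "?Q G (pr x c)" using m by blast
    thus ?thesis using B genG pr_UnUn by blast
  qed
  ultimately obtain h where h: "fto h a (Uu (Uu B))" "ALL x. x <: a --> ?Q G (pr x (ap h x))"
    using F_dist[OF genG, of ?Q a] a by blast
  have fh: "fon h a" using h(1) unfolding fto_def by blast
  have "f = jj h"
  proof (rule N.isf_eq)
    show "N.isf f" "N.isf (jj h)" using f fh unfolding N.fon_def fon_def by auto
    fix x y
    have 1: "M (N.pr (jj b) (jj (ap h b))) f" if "b <: a" for b using h(2) that m by simp
    show "M (N.pr x y) f = M (N.pr x y) (jj h)"
    proof
      assume p: "M (N.pr x y) f"
      then obtain b where b: "b <: a" "x = jj b" using f(1) unfolding N.fon_def M_j by blast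
      hence "y = jj (ap h b)" using 1[OF b(1)] p f(1) unfolding N.fon_def N.isf_def by blast
      thus "M (N.pr x y) (jj h)" using b fon_ap[OF fh b(1)] by simp
    next
      assume "M (N.pr x y) (jj h)"
      then obtain b c where "x = jj b" "y = jj c" "pr b c <: h" unfolding pr_M_j by blast
      thus "M (N.pr x y) f" using 1 fon_iff[OF fh] by auto
    qed
  qed
  thus ?thesis using fh by blast
qed

lemma sat_sseq [simp]: "sat M (ShortSequence (jj lam) s) = (EX t. s = jj t & sseq t)"
proof
  assume "sat M (ShortSequence (jj lam) s)"
  then obtain a where a: "a <: lam" "N.fto s (jj a) (jj lam)" unfolding ShortSequence_def by (auto simp: M_j)
  then obtain h where "s = jj h" using short_ground[OF a(1)] unfolding N.fto_def M_j by metis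
  thus "EX t. s = jj t & sseq t" using a unfolding sseq_def by auto
qed (auto simp: ShortSequence_def sseq_def M_j)

lemma j_sub: "(ALL z. M z (jj a) --> M z (jj b)) = sb a b"
  unfolding sb_def by (auto simp: M_j)

lemma sat_Play: "sat M (Play (jj lam) A T) = (N.fon T A & (ALL b s. M (N.pr b s) T --> (EX t. s = jj t & sseq t)) &
    (ALL b c s s'. M b c & M (N.pr b s) T & M (N.pr c s') T --> (ALL z. M z s --> M z s') & s ~= s'))"
  unfolding Play_def by simp

lemma sat_Play_j: assumes "od a" shows "sat M (Play (jj lam) (jj a) (jj t)) = play a t"
proof (cases "fon t a")
  case True
  have p: "M (N.pr b s) (jj t) = (EX c. b = jj c & s = jj (ap t c) & c <: a)" for b s
    unfolding pr_M_j fon_iff[OF True] by blast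
  have "(ALL b c s s'. M b c & M (N.pr b s) (jj t) & M (N.pr c s') (jj t) --> (ALL z. M z s --> M z s') & s ~= s')
      = (ALL b c. c <: a --> b <: c --> sb (ap t b) (ap t c) & ap t b ~= ap t c)" (is "?A = ?B")
  proof
    assume A: ?A
    show ?B
    proof (intro allI impI)
      fix b c assume "c <: a" "b <: c"
      thus "sb (ap t b) (ap t c) & ap t b ~= ap t c"
        using A[rule_format, of "jj b" "jj c" "jj (ap t b)" "jj (ap t c)"] fon_ap[OF True] od_trans[OF assms] by (simp add: j_sub)
    qed
  next
    assume B: ?B
    show ?A
    proof (intro allI impI, elim conjE)
      fix b c s s' assume "M b c" "M (N.pr b s) (jj t)" "M (N.pr c s') (jj t)"
      then obtain b' c' where "b = jj b'" "c = jj c'" "s = jj (ap t b')" "s' = jj (ap t c')" "c' <: a" unfolding p by blast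
      thus "(ALL z. M z s --> M z s') & s ~= s'" using B \<open>M b c\<close> by (simp add: j_sub)
    qed
  qed
  moreover have "(ALL b s. M (N.pr b s) (jj t) --> (EX u. s = jj u & sseq u)) = (ALL b. b <: a --> sseq (ap t b))"
    unfolding p by (metis j_eq)
  ultimately show ?thesis unfolding sat_Play play_def using True by simp
qed (auto simp: sat_Play play_def)

lemma sat_Play_short: assumes "a <: lam" shows "sat M (Play (jj lam) (jj a) T) = (EX t. T = jj t & play a t)"
proof
  assume p: "sat M (Play (jj lam) (jj a) T)"
  then obtain t where "T = jj t" using short_ground[OF assms, of T] unfolding sat_Play by blast
  thus "EX t. T = jj t & play a t" using p sat_Play_j[OF oda[OF assms]] by blast
qed (use sat_Play_j[OF oda[OF assms]] in blast)

text \<open>A witness \<open>e\<close> for \<open>Even\<close> is a set of the extension; it agrees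
  with \<open>Ev\<close> up to \<open>a\<close> by considering a minimal counterexample, which
  \<open>DG_min\<close> provides.\<close>

lemma sat_Even: assumes "a <: lam" shows "sat M (Even (jj a)) = Ev a"
proof -
  have sc: "sat M (IsSuccessorOf (jj b) x) = (EX c. x = jj c & b = suc c)" for b x
  proof
    assume s: "sat M (IsSuccessorOf (jj b) x)"
    then obtain c where c: "x = jj c" unfolding IsSuccessorOf_def by (auto simp: M_j)
    have "b = suc c" by (rule exten) (use s c in \<open>auto simp: IsSuccessorOf_def dest: spec[of _ "jj _"]\<close>)
    thus "EX c. x = jj c & b = suc c" using c by blast
  qed (auto simp: IsSuccessorOf_def M_j)
  have ev: "sat M (Even (jj a)) = (EX e. (ALL b. b <: suc a --> M (jj b) e = (~ (EX c. b = suc c & M (jj c) e))) & M (jj a) e)"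
  proof -
    have "(ALL b. M b (jj a) | b = jj a --> M b e = (~ (EX c. sat M (IsSuccessorOf b c) & M c e)))
      = (ALL b. b <: suc a --> M (jj b) e = (~ (EX c. b = suc c & M (jj c) e)))" for e
    proof -
      have e: "(M b (jj a) | b = jj a) = (EX b'. b = jj b' & b' <: suc a)" for b by (auto simp: M_j)
      have 1: "(ALL b. M b (jj a) | b = jj a --> X b) = (ALL b. b <: suc a --> X (jj b))" for X unfolding e by blast
      have 2: "(EX c. sat M (IsSuccessorOf (jj b) c) & M c e) = (EX c. b = suc c & M (jj c) e)" for b unfolding sc by blast
      show ?thesis unfolding 1 2 ..
    qed
    thus ?thesis unfolding Even_def by simp
  qed
  show ?thesis
  proof
    let ?e = "Sp (suc a) Ev"
    have m: "b <: ?e = (b <: suc a & Ev b)" for b by (intro mem_Sp dfi)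
    have t: "c <: suc a" if "b <: suc a" "b = suc c" for b c
      using od_trans[OF od_suc[OF oda[OF assms]] that(1)] that(2) by simp
    assume "Ev a"
    hence "a <: ?e" unfolding m by simp
    moreover have "(b <: ?e) = (~ (EX c. b = suc c & c <: ?e))" if "b <: suc a" for b
      using Ev[of b] t[OF that] that unfolding m by blast
    ultimately show "sat M (Even (jj a))" unfolding ev by (intro exI[of _ "jj ?e"]) (simp only: j_mem, blast)
  next
    assume "sat M (Even (jj a))"
    then obtain e where e: "ALL b. b <: suc a --> M (jj b) e = (~ (EX c. b = suc c & M (jj c) e))" "M (jj a) e" unfolding ev by blast
    obtain n where n: "v n = e" using surj by blast
    show "Ev a"
    proof (rule ccontr)
      assume na: "~ Ev a"
      let ?Q = "%G b. b <: suc a & F.memG G (F.chk b) n ~= Ev b"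
      have m: "F.memG G (F.chk b) n = M (jj b) e" for b using EN n by metis
      have "F.DG ?Q" by (intro dfi D_Ev[THEN F.DG_D])
      then obtain b where b: "?Q G b" "ALL c. c <: b --> ~ ?Q G c"
        using F.DG_min[OF genG, of ?Q a] na e(2) m by auto
      have "M (jj c) e = Ev c" if "b = suc c" for c
        using b that od_trans[OF od_suc[OF oda[OF assms]], of b c] m by auto
      thus False using b(1) e(1) Ev[of b] m by blast
    qed
  qed
qed

text \<open>Positions and moves belong to the ground model, so a strategy is a subset of a ground
  model set and \<open>comprehension\<close> produces it from \<open>Q\<close>.\<close>

lemma strategy: assumes T: "D T" "!!a. a <: lam ==> sat M (TF (jj a)) = T a" and Q: "F.DG Q"
    and tot: "!!a t. a <: lam ==> T a ==> play a t ==> EX s. legal t s & Q G (pr t s)"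
    and uniq: "!!t s s'. Q G (pr t s) ==> Q G (pr t s') ==> s = s'"
  shows "EX f. sat M (Strategy (jj lam) TF f) & (ALL r n. sat M (RunAccordingTo (jj lam) TF f r) --> r = v n --> run T Q G n)"
proof -
  let ?P = "%G u. (EX a. a <: lam & T a & play a (pf u)) & legal (pf u) (ps u) & Q G u"
  have "F.DG ?P" by (intro dfi D_play[THEN F.DG_D] D_legal[THEN F.DG_D] F.DG_D[OF D_comp[OF T(1)]] F.DG_comp[OF Q])
  then obtain f where f: "!!y. M y f = (EX x. x <: prd (Pw (prd lam Sq)) Sq & ?P G x & y = jj x)"
    using comprehension[of ?P] by blast
  have PL: "t <: Pw (prd lam Sq)" if "a <: lam" "play a t" for a t
  proof -
    have t: "fon t a" "ALL b. b <: a --> sseq (ap t b)" using that(2) unfolding play_def by auto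
    have "EX x y. w = pr x y & x <: a & y = ap t x" if "w <: t" for w
      using t(1) that fon_iff[OF t(1)] unfolding fon_def isf_def by metis
    thus ?thesis using lam_trans[OF that(1)] t(2) unfolding mem_Pw mem_prd Sq by metis
  qed
  have mf: "M (N.pr x y) f = (EX t s a. x = jj t & y = jj s & a <: lam & T a & play a t & legal t s & Q G (pr t s))" for x y
  proof
    assume "M (N.pr x y) f"
    then obtain u where u: "N.pr x y = jj u" "?P G u" unfolding f by blast
    then obtain a b where "x = jj a" "y = jj b" "u = pr a b" using pr_j by blast
    thus "EX t s a. x = jj t & y = jj s & a <: lam & T a & play a t & legal t s & Q G (pr t s)" using u(2) by auto
  next
    assume "EX t s a. x = jj t & y = jj s & a <: lam & T a & play a t & legal t s & Q G (pr t s)"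
    then obtain t s a where "x = jj t" "y = jj s" "a <: lam" "T a" "play a t" "legal t s" "Q G (pr t s)" by blast
    moreover have "pr t s <: prd (Pw (prd lam Sq)) Sq"
      using calculation PL unfolding legal_def mem_prd Sq by blast
    ultimately show "M (N.pr x y) f" unfolding f by (intro exI[of _ "pr t s"]) auto
  qed
  have isf: "N.isf f" unfolding N.isf_def
  proof (intro conjI allI impI)
    show "EX x y. u = N.pr x y" if u: "M u f" for u
    proof -
      obtain t s where "u = jj (pr t s)" using u unfolding f by auto
      thus ?thesis by (metis j_pr)
    qed
    show "y = z" if "M (N.pr x y) f" "M (N.pr x z) f" for x y z using that uniq unfolding mf by auto
  qed
  have lm: "sat M (LegalMove (jj lam) x y)" if m: "M (N.pr x y) f" for x y
  proof -
    obtain t s a where t: "x = jj t" "y = jj s" "play a t" "legal t s" using m unfolding mf by blast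
    have dt: "b <: dm t & s' = ap t b" if "pr b s' <: t" for b s'
      using that t(3) fon_iff[of t a b s'] unfolding play_def fon_dm by auto
    have "(ALL z. M z s' --> M z (jj s)) & s' ~= jj s" if m: "M (N.pr b s') (jj t)" for b s'
    proof -
      obtain c d where c: "b = jj c" "s' = jj d" "pr c d <: t" using m unfolding pr_M_j by blast
      thus ?thesis using dt[OF c(3)] t(4) unfolding legal_def by (simp add: j_sub)
    qed
    thus ?thesis using t(4) unfolding LegalMove_def t(1,2) legal_def by simp
  qed
  have "sat M (Strategy (jj lam) TF f)"
    unfolding Strategy_def
  proof (simp add: isf lm, intro allI)
    fix x
    have "(EX s. M (N.pr x s) f) = (EX t a. x = jj t & a <: lam & T a & play a t)"
    proof
      assume "EX t a. x = jj t & a <: lam & T a & play a t"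
      then obtain t a where t: "x = jj t" "a <: lam" "T a" "play a t" by blast
      then obtain s where "legal t s" "Q G (pr t s)" using tot by blast
      thus "EX s. M (N.pr x s) f" unfolding mf using t by blast
    qed (unfold mf, blast)
    also have "... = (EX a. M a (jj lam) & sat M (TF a) & sat M (Play (jj lam) a x))"
      unfolding M_j using T(2) sat_Play_short by blast
    finally show "(EX s. M (N.pr x s) f) = (EX a. M a (jj lam) & sat M (TF a) & sat M (Play (jj lam) a x))" .
  qed
  moreover have "run T Q G n" if r: "sat M (RunAccordingTo (jj lam) TF f r)" "r = v n" for r n
  proof -
    have pl: "N.fon r (jj lam)" "!!b s. M (N.pr b s) r ==> EX t. s = jj t & sseq t"
      "!!b c s s'. M b c ==> M (N.pr b s) r ==> M (N.pr c s') r ==> (ALL z. M z s --> M z s') & s ~= s'"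
    proof -
      have "sat M (Play (jj lam) (jj lam) r)" using r(1) unfolding RunAccordingTo_def by simp
      note P = this[unfolded sat_Play, THEN conjunct1] this[unfolded sat_Play, THEN conjunct2, THEN conjunct1]
        this[unfolded sat_Play, THEN conjunct2, THEN conjunct2]
      show "N.fon r (jj lam)" using P(1) .
      show "M (N.pr b s) r ==> EX t. s = jj t & sseq t" for b s using P(2) by blast
      show "M b c ==> M (N.pr b s) r ==> M (N.pr c s') r ==> (ALL z. M z s --> M z s') & s ~= s'" for b c s s' using P(3) by blast
    qed
    have m: "M (N.pr (jj b) (jj s)) r = F.memG G (F.chk (pr b s)) n" for b s using EN r(2) by simp
    have u: "s = s'" if "F.memG G (F.chk (pr b s)) n" "F.memG G (F.chk (pr b s')) n" for b s s'
      using that pl(1) unfolding m[symmetric] N.fon_def N.isf_def by (metis j_eq)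
    have "EX t. play a t & seg G n t" if a: "a <: lam" for a
    proof -
      let ?S = "%G u. F.memG G (F.chk u) n"
      have "EX s. s <: Sq & ?S G (pr b s)" if "b <: a" for b
      proof -
        have "M (jj b) (jj lam)" using lam_trans[OF a that] by simp
        then obtain s where "M (N.pr (jj b) s) r" using pl(1) unfolding N.fon_def by blast
        thus ?thesis using pl(2) m Sq by metis
      qed
      moreover have "F.DG ?S" by (intro dfi)
      ultimately obtain h where h: "fto h a Sq" "ALL b. b <: a --> ?S G (pr b (ap h b))"
        using F_dist[OF genG, of ?S a] a by blast
      have "sb (ap h b) (ap h c) & ap h b ~= ap h c" if "c <: a" "b <: c" for b c
        using pl(3)[of "jj b" "jj c" "jj (ap h b)" "jj (ap h c)"] h(2) m that od_trans[OF oda[OF a] that] j_sub by auto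
      hence "play a h" unfolding play_def using h(1) fto_ap[OF h(1)] Sq unfolding fto_def by blast
      thus ?thesis unfolding seg_def using h(2) a by blast
    qed
    moreover have "EX s. F.memG G (F.chk (pr (dm t) s)) n & Q G (pr t s)" if t: "seg G n t" "T (dm t)" for t
    proof -
      obtain a where a: "a <: lam" "play a t" "ALL b. b <: a --> F.memG G (F.chk (pr b (ap t b))) n" using t(1) unfolding seg_def by blast
      have at: "dm t = a" "fon t a" using play_dm a(2) unfolding play_def by auto
      obtain s where s: "M (N.pr (jj a) s) r" using pl(1) a(1) unfolding N.fon_def M_j by blast
      have "sat M (IsRestriction (jj t) r (jj a))"
      proof -
        have "M u (jj t) = (M u r & (EX b s. M b (jj a) & u = N.pr b s))" for u
        proof
          assume "M u (jj t)"
          then obtain w where w: "w <: t" "u = jj w" unfolding M_j by blast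
          then obtain b where "w = pr b (ap t b)" "b <: a" using fon_iff[OF at(2)] at(2) unfolding fon_def isf_def by metis
          thus "M u r & (EX b s. M b (jj a) & u = N.pr b s)" using w a(3) m by (metis j_mem j_pr)
        next
          assume "M u r & (EX b s. M b (jj a) & u = N.pr b s)"
          then obtain b s where b: "b <: a" "u = N.pr (jj b) s" "M u r" unfolding M_j by blast
          hence "s = jj (ap t b)" using a(3) m pl(1) unfolding N.fon_def N.isf_def by metis
          thus "M u (jj t)" using b fon_ap[OF at(2) b(1)] by simp
        qed
        thus ?thesis unfolding IsRestriction_def by simp
      qed
      moreover have "M (jj a) (jj lam)" "sat M (TF (jj a))" using a(1) T(2) t(2) at by simp_all
      moreover have "ALL x t s. M x (jj lam) & sat M (TF x) & sat M (IsRestriction t r x) & M (N.pr x s) r --> M (N.pr t s) f"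
        using r(1) unfolding RunAccordingTo_def by simp
      ultimately have "M (N.pr (jj t) s) f" using s by blast
      thus ?thesis using s m at unfolding mf by auto
    qed
    ultimately show ?thesis unfolding run_def using u by blast
  qed
  ultimately show ?thesis by blast
qed

text \<open>Strict inclusion makes the lengths of the moves grow, which is why the outcome of a run
  is defined on all of \<open>lam\<close>.\<close>

lemma play_length: assumes "play a t" "b <: a" "a <: lam" shows "sb b (dm (ap t b))"
proof -
  have oa: "od a" using oda assms by blast
  let ?Q = "%b. b <: a --> sb b (dm (ap t b))"
  have "?Q b"
  proof (rule eps_induct[of ?Q])
    show "D ?Q" by (intro dfi)
    fix b assume IH: "!!c. c <: b ==> ?Q c"
    show "?Q b"
    proof
      assume b: "b <: a"
      have "c <: dm (ap t b)" if c: "c <: b" for c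
      proof -
        have ca: "c <: a" using od_trans[OF oa b c] .
        have s: "sseq (ap t c)" "sseq (ap t b)" "sb (ap t c) (ap t b)" "ap t c ~= ap t b"
          using assms(1) ca b c unfolding play_def by blast+
        obtain x y where xy: "fto (ap t c) x lam" "x <: lam" "fto (ap t b) y lam" "y <: lam" using s(1,2) unfolding sseq_def by blast
        hence d: "dm (ap t c) = x" "dm (ap t b) = y" "fon (ap t c) x" "fon (ap t b) y" unfolding fto_def fon_dm by auto
        have xy': "z <: y & ap (ap t c) z = ap (ap t b) z" if "z <: x" for z
          using sbD[OF s(3) fon_ap[OF d(3) that]] fon_iff[OF d(4)] by auto
        have "x ~= y" using fon_eq[OF d(3)] d(4) xy' s(4) by blast
        hence "x <: y" using od_sub[OF oda oda] xy xy' by blast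
        moreover have "c <: x | c = x" using od_sub[OF od_mem[OF oa ca] oda[OF xy(2)]] IH[OF c] ca d(1) unfolding sb_def by blast
        ultimately show ?thesis using od_trans[OF oda[OF xy(4)]] d(2) by auto
      qed
      thus "sb b (dm (ap t b))" unfolding sb_def by blast
    qed
  qed
  thus ?thesis using assms by blast
qed

lemma seg_sub: assumes r: "run T Q G n" and "seg G n t" "seg G n u" "b <: dm t" "b <: dm u" shows "ap t b = ap u b"
  using assms play_dm unfolding run_def seg_def by metis

lemma outcome: assumes r: "run T Q G n"
  shows "EX x. N.fto (v x) (jj lam) (jj lam) & (ALL y. M y (v x) = (EX z. outc G n z & y = jj z))"
    "outc G n z ==> EX i k. i <: lam & k <: lam & z = pr i k"
proof -
  have R1: "EX t. play a t & seg G n t" if "a <: lam" for a using r that unfolding run_def by blast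
  have o1: "EX s i k. z = pr i k & z <: s & i <: lam & k <: lam & sseq s" if o: "outc G n z" for z
  proof -
    obtain t a b where t: "play a t" "b <: a" "z <: ap t b" using o play_dm unfolding outc_def seg_def by blast
    then obtain c where c: "c <: lam" "fto (ap t b) c lam" "sseq (ap t b)" unfolding play_def sseq_def by blast
    then obtain i k where "z = pr i k" using t(3) unfolding fto_def fon_def isf_def by blast
    thus ?thesis using c t(3) lam_trans[OF c(1)] unfolding fto_def fon_def by blast
  qed
  thus "outc G n z ==> EX i k. i <: lam & k <: lam & z = pr i k" by blast
  let ?Q = "%G z. outc G n z"
  have "F.DG ?Q" by (intro dfi)
  then obtain w where w: "ALL y. M y w = (EX z. z <: prd lam lam & ?Q G z & y = jj z)" using comprehension[of ?Q] by blast
  obtain x where "v x = w" using surj by blast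
  moreover have "outc G n z ==> z <: prd lam lam" for z using o1 unfolding mem_prd by blast
  ultimately have x: "M y (v x) = (EX z. outc G n z & y = jj z)" for y using w by blast
  have px: "M (N.pr p q) (v x) = (EX i k. p = jj i & q = jj k & outc G n (pr i k))" for p q
    unfolding x using pr_j by (metis j_pr)
  have two: "EX t b c. seg G n t & b <: dm t & c <: dm t & z <: ap t b & z' <: ap t c & od (dm t) & play (dm t) t" if o: "outc G n z" "outc G n z'" for z z'
  proof -
    obtain t b where t0: "seg G n t" "b <: dm t" "z <: ap t b" using o(1) unfolding outc_def by blast
    obtain u c where u0: "seg G n u" "c <: dm u" "z' <: ap u c" using o(2) unfolding outc_def by blast
    obtain a where a: "play a t" "a <: lam" using t0(1) unfolding seg_def by blast
    obtain d where d: "play d u" "d <: lam" using u0(1) unfolding seg_def by blast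
    have t: "seg G n t" "play a t" "b <: a" "z <: ap t b" "a <: lam" "seg G n u" "play d u" "c <: d" "z' <: ap u c" "d <: lam"
      using t0 u0 a d play_dm by auto
    have d: "dm t = a" "dm u = d" "od a" "od d" using t play_dm oda by auto
    show ?thesis
    proof (cases "b <: d")
      case True
      hence "z <: ap u b" using seg_sub[OF r t(1,6)] t d by auto
      thus ?thesis using t True d by blast
    next
      case False
      hence "d <: a" using od_tri[OF d(3,4)] t(3) by (metis od_trans d(4) d(3))
      hence "c <: a" using t(8) od_trans[OF d(3)] by blast
      moreover have "z' <: ap t c" using seg_sub[OF r t(1,6)] calculation t d by auto
      ultimately show ?thesis using t d by blast
    qed
  qed
  have fn: "k = k'" if o: "outc G n (pr i k)" "outc G n (pr i k')" for i k k'
  proof -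
    obtain t b c where t: "b <: dm t" "c <: dm t" "pr i k <: ap t b" "pr i k' <: ap t c" "od (dm t)" "play (dm t) t" using two[OF o] by blast
    have f: "isf (ap t b)" "isf (ap t c)" using t unfolding play_def sseq_def fto_def fon_def by blast+
    have "b <: c | b = c | c <: b" using od_tri[OF od_mem[OF t(5,1)] od_mem[OF t(5,2)]] .
    hence "sb (ap t b) (ap t c) | sb (ap t c) (ap t b)" using t unfolding play_def by (metis sb_refl)
    thus ?thesis using t f isf_D sbD by metis
  qed
  have dom: "EX k. outc G n (pr i k)" if i: "i <: lam" for i
  proof -
    obtain t where t: "play (suc (suc i)) t" "seg G n t" using R1 lam_suc i by blast
    have "suc i <: suc (suc i)" by simp
    hence "i <: dm (ap t (suc i))" using play_length[OF t(1) _ lam_suc[OF lam_suc[OF i]], of "suc i"] unfolding sb_def by simp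
    then obtain k where "pr i k <: ap t (suc i)" by auto
    thus ?thesis unfolding outc_def using t play_dm[OF t(1)] by (intro exI[of _ k] exI[of _ t] exI[of _ "suc i"]) simp
  qed
  have "N.isf (v x)" unfolding N.isf_def px unfolding x using o1 fn by (auto, metis j_pr)
  moreover have "M p (jj lam) = (EX q. M (N.pr p q) (v x))" for p
    unfolding px M_j using dom o1 by (metis pr_eq)
  moreover have "M q (jj lam)" if "M (N.pr p q) (v x)" for p q using that o1 unfolding px M_j by (metis pr_eq)
  ultimately have "N.fto (v x) (jj lam) (jj lam)" unfolding N.fto_def N.fon_def by blast
  thus "EX x. N.fto (v x) (jj lam) (jj lam) & (ALL y. M y (v x) = (EX z. outc G n z & y = jj z))" using x by blast
qed

lemma OutcomeIn: assumes r: "sat M (Play (jj lam) (jj lam) (v n))" "run T Q G n"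
    and x: "!!y. M y (v x) = (EX z. outc G n z & y = jj z)"
  shows "sat M (OutcomeIn A (v n)) = M (v x) A"
proof -
  have "M u (v x) = (EX a s. M (N.pr a s) (v n) & M u s)" for u
  proof
    assume "M u (v x)"
    then obtain t b a z where t: "u = jj z" "play a t" "b <: a" "z <: ap t b" "ALL b. b <: a --> F.memG G (F.chk (pr b (ap t b))) n"
      using x play_dm unfolding outc_def seg_def by blast
    hence "M (N.pr (jj b) (jj (ap t b))) (v n)" using EN by simp
    thus "EX a s. M (N.pr a s) (v n) & M u s" using t j_mem by blast
  next
    assume "EX a s. M (N.pr a s) (v n) & M u s"
    then obtain a s where as: "M (N.pr a s) (v n)" "M u s" by blast
    then obtain b s' where b: "a = jj b" "b <: lam" "s = jj s'" using r(1) unfolding sat_Play N.fon_def M_j[of _ lam] by metis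
    have "M u (jj s')" using as(2) b(3) by simp
    then obtain z where z: "u = jj z" "z <: s'" unfolding M_j by blast
    obtain t where t: "play (suc b) t" "seg G n t" using r(2) lam_suc[OF b(2)] unfolding run_def by blast
    hence "F.memG G (F.chk (pr b (ap t b))) n" using play_dm unfolding seg_def by (metis mem_suc)
    moreover have "F.memG G (F.chk (pr b s')) n" using as(1) b EN by (simp flip: j_pr EN)
    ultimately have "ap t b = s'" using r(2) unfolding run_def by blast
    thus "M u (v x)" unfolding x outc_def using z t play_dm[OF t(1)] mem_suc by metis
  qed
  hence "(ALL u. M u x' = (EX a s. M (N.pr a s) (v n) & M u s)) = (x' = v x)" for x' using N.exten by metis
  thus ?thesis unfolding OutcomeIn_def by simp
qed

lemma winsI: assumes "D T" "T = Ev" "F.DG Q"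
    and "!!a t. a <: lam ==> T a ==> play a t ==> EX s. legal t s & Q G (pr t s)"
    and "!!t s s'. Q G (pr t s) ==> Q G (pr t s') ==> s = s'"
    and w: "!!n x. run T Q G n ==> N.fto (v x) (jj lam) (jj lam) ==> (!!y. M y (v x) = (EX z. outc G n z & y = jj z)) ==> M (v x) A"
  shows "sat M (PlayerIWins (jj lam) A)"
proof -
  obtain f where f: "sat M (Strategy (jj lam) Even f)" "ALL r n. sat M (RunAccordingTo (jj lam) Even f r) --> r = v n --> run T Q G n"
    using strategy[of T Even Q] assms(1-5) sat_Even by blast
  have "sat M (OutcomeIn A r)" if r: "sat M (RunAccordingTo (jj lam) Even f r)" for r
  proof -
    obtain n where n: "r = v n" using surj by metis
    have R: "run T Q G n" using f(2) r n by blast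
    obtain x where x: "N.fto (v x) (jj lam) (jj lam)" "ALL y. M y (v x) = (EX z. outc G n z & y = jj z)" using outcome(1)[OF R] by blast
    show ?thesis using OutcomeIn[OF _ R, of x A] w[OF R x(1)] x(2) r n unfolding RunAccordingTo_def by simp
  qed
  thus ?thesis unfolding PlayerIWins_def using f(1) by auto
qed

lemma winsII: assumes "D T" "T = (%a. ~ Ev a)" "F.DG Q"
    and "!!a t. a <: lam ==> T a ==> play a t ==> EX s. legal t s & Q G (pr t s)"
    and "!!t s s'. Q G (pr t s) ==> Q G (pr t s') ==> s = s'"
    and w: "!!n x. run T Q G n ==> N.fto (v x) (jj lam) (jj lam) ==> (!!y. M y (v x) = (EX z. outc G n z & y = jj z)) ==> ~ M (v x) A"
  shows "sat M (PlayerIIWins (jj lam) A)"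
proof -
  have "sat M (Odd (jj a)) = T a" if "a <: lam" for a unfolding Odd_def using sat_Even[OF that] assms(2) by simp
  then obtain f where f: "sat M (Strategy (jj lam) Odd f)" "ALL r n. sat M (RunAccordingTo (jj lam) Odd f r) --> r = v n --> run T Q G n"
    using strategy[of T Odd Q] assms(1,3-5) by blast
  have "~ sat M (OutcomeIn A r)" if r: "sat M (RunAccordingTo (jj lam) Odd f r)" for r
  proof -
    obtain n where n: "r = v n" using surj by metis
    have R: "run T Q G n" using f(2) r n by blast
    obtain x where x: "N.fto (v x) (jj lam) (jj lam)" "ALL y. M y (v x) = (EX z. outc G n z & y = jj z)" using outcome(1)[OF R] by blast
    show ?thesis using OutcomeIn[OF _ R, of x A] w[OF R x(1)] x(2) r n unfolding RunAccordingTo_def by simp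
  qed
  thus ?thesis unfolding PlayerIIWins_def using f(1) by auto
qed

end

section \<open>When player II wins\<close>

lemma (in zf) un_absorb2: "sb b a ==> un a b = a" by (rule exten) (auto simp: sb_def)

context columns begin

text \<open>The extra entry makes a move a strict extension of the position; for player I it also
  names a place in the coding column.\<close>

definition snoc :: "nat => nat => nat" where "snoc s i = un s (sg (pr (dm s) i))"
lemma Dt_snoc [dfi]: "Dt a ==> Dt b ==> Dt (%x. snoc (a x) (b x))"
  by (rule Dt_comp2[of snoc], unfold snoc_def, intro dfi, assumption+)

lemma sseq_fto: "sseq s ==> fto s (dm s) lam & dm s <: lam & isf s"
  unfolding sseq_def fto_def fon_dm by metis

lemma snoc: assumes "sseq s" "i <: lam"
  shows "sseq (snoc s i)" "sb s (snoc s i)" "snoc s i ~= s" "dm (snoc s i) = suc (dm s)" "ap (snoc s i) (dm s) = i"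
proof -
  note s = sseq_fto[OF assms(1)]
  have n: "~ pr (dm s) y <: s" for y using not_mem_self[of "dm s"] by auto
  have f: "isf (snoc s i)" unfolding snoc_def using n s by (intro isf_un) (auto simp: isf_def)
  show d: "dm (snoc s i) = suc (dm s)" by (rule exten) (auto simp: snoc_def)
  show "ap (snoc s i) (dm s) = i" by (rule isf_ap[OF f]) (simp add: snoc_def)
  show "sb s (snoc s i)" unfolding snoc_def by simp
  show "snoc s i ~= s" using n[of i] unfolding snoc_def by (metis mem_sg mem_un)
  have "fto (snoc s i) (suc (dm s)) lam" unfolding fto_def fon_dm using f d s assms(2) unfolding snoc_def fto_def by auto
  thus "sseq (snoc s i)" unfolding sseq_def using lam_suc s by blast
qed

lemma bd_Sq: "bd mu Sq" unfolding Sq_def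
proof (rule bd_sub[OF rc_emp[OF rcm]])
  show "bd mu (Pw (prd lam lam))" using pwm bd_prd[OF rcm] rc_bd[OF rcm lm] by blast
  show "z <: Sp (Pw (prd lam lam)) sseq ==> z <: Pw (prd lam lam)" for z using mem_Sp[of sseq z] D_sseq[OF Dt_id] by blast
qed

lemma sseq_emp: "sseq emp"
proof -
  have "fto emp emp lam" unfolding fto_def fon_def isf_def by simp
  thus ?thesis unfolding sseq_def using rc_emp[OF rcl] by blast
qed

lemma seq_Uu: assumes "bd lam C" "!!c. c <: C ==> isf c & dm c <: lam" "!!c d. c <: C ==> d <: C ==> sb c d | sb d c"
  shows "isf (Uu C)" "dm (Uu C) <: lam"
proof -
  have d: "Dt dm" by (intro dfi)
  obtain b where b: "b <: lam" "ALL c. c <: C --> dm c <: b" using bd_I[OF assms(1) d] assms(2) by blast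
  have i: "isf (un c e)" if "c <: C" "e <: C" for c e
  proof -
    have "un c e = e | un c e = c" using assms(3)[OF that] un_absorb un_absorb2 by blast
    thus ?thesis using assms(2) that by metis
  qed
  show "isf (Uu C)" using assms(2) i by (intro isf_Uu) blast+
  have m: "x <: dm (Uu C) = (EX c. c <: C & x <: dm c)" for x by auto
  have "od (dm (Uu C))" unfolding od_def trs_def m using assms(2) oda unfolding od_def trs_def by blast
  moreover have "x <: b" if "x <: dm (Uu C)" for x using that b od_trans[OF oda[OF b(1)]] unfolding m by blast
  ultimately show "dm (Uu C) <: lam" using od_sub[OF _ oda[OF b(1)]] b(1) lam_trans[OF b(1)] by blast
qed

lemma sseq_Uu: assumes "bd lam C" "!!c. c <: C ==> sseq c" "!!c d. c <: C ==> d <: C ==> sb c d | sb d c" shows "sseq (Uu C)"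
proof -
  have "isf c & dm c <: lam" if "c <: C" for c using sseq_fto assms(2) that by blast
  note q = seq_Uu[OF assms(1) this assms(3)]
  have "fto (Uu C) (dm (Uu C)) lam" unfolding fto_def fon_dm using q(1) assms(2) unfolding sseq_def fto_def by auto
  thus ?thesis unfolding sseq_def using q(2) by blast
qed

lemma play_Uu: assumes "play a t" "a <: lam" shows "sseq (Uu (rg t))" "b <: a ==> sb (ap t b) (Uu (rg t))"
proof -
  have f: "fon t a" using assms(1) unfolding play_def by blast
  have r: "x <: rg t = (EX b. b <: a & x = ap t b)" for x unfolding mem_rg fon_iff[OF f] ..
  show "b <: a ==> sb (ap t b) (Uu (rg t))" using r by (intro sb_Uu) blast
  have d: "Dt (ap t)" by (intro dfi)
  have "rg t = Im a (ap t)" by (rule exten) (unfold r mem_Im[OF d], rule refl)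
  hence "bd lam (rg t)" using bd_Im[OF rc_bd[OF rcl assms(2)] d] by simp
  moreover have "sb c e | sb e c" if ce: "c <: rg t" "e <: rg t" for c e
  proof -
    obtain b d where b: "b <: a" "c = ap t b" "d <: a" "e = ap t d" using ce unfolding r by blast
    have "b <: d | b = d | d <: b" using od_tri[OF od_mem[OF oda[OF assms(2)] b(1)] od_mem[OF oda[OF assms(2)] b(3)]] .
    thus ?thesis using assms(1) b unfolding play_def by (metis sb_refl)
  qed
  moreover have "sseq c" if "c <: rg t" for c using that assms(1) unfolding r play_def by blast
  ultimately show "sseq (Uu (rg t))" by (intro sseq_Uu)
qed

lemma legal_snoc: assumes "play a t" "a <: lam" "sseq s" "sb (Uu (rg t)) s" "i <: lam" shows "legal t (snoc s i)"
  using snoc[OF assms(3,5)] play_Uu(2)[OF assms(1,2)] assms(4) sb_trans sb_antisym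
  unfolding legal_def play_dm[OF assms(1)] by metis

text \<open>\<open>dx x q s\<close>: the condition \<open>q\<close> forces \<open>s \<subseteq> x\<close>.  \<open>good X Y x q s\<close>: below \<open>q\<close> and \<open>s\<close> the name \<open>x\<close> is independent of the
  columns in \<open>X\<close>, that is, every extension of \<open>s\<close> can be forced into \<open>x\<close> without contradicting a prescribed
  condition on \<open>X\<close>.  \<open>gd X Y x q\<close>: this can be achieved by extending \<open>q\<close> on \<open>X\<close> only.  \<open>cap Y x p\<close>: below \<open>p\<close> the
  columns in \<open>Y\<close> suffice to decide \<open>x\<close>.\<close>

definition dx :: "nat => nat => nat => bool" where "dx x q s = (ALL z. z <: s --> F.Frc q (%G. F.memG G (F.chk z) x))"
definition good :: "nat => nat => nat => nat => nat => bool" where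
  "good X Y x q s = (ALL u s'. u <: FX X --> sb (rt q X) u --> sseq s' --> sb s s' -->
     (EX r. r <: FX Y & sb q r & sb u (rt r X) & dx x r s'))"
definition gd :: "nat => nat => nat => nat => bool" where
  "gd X Y x q = (EX u s. u <: FX X & sb (rt q X) u & sseq s & good X Y x (un q u) s)"
definition cap :: "nat => nat => nat => bool" where
  "cap Y x p = (ALL i q. i <: lam --> q <: FX Y --> sb p q -->
     (EX r. r <: FX Y & sb q r & (EX y. F.Frc r (%G. F.memG G (F.chk (pr i y)) x))))"

lemma D_dx [dfi]: "Dt a ==> Dt b ==> Dt c ==> D (%w. dx (a w) (b w) (c w))"
  by (rule D_comp3[of dx], unfold dx_def, intro dfi, assumption+)
lemma D_good [dfi]: "Dt a ==> Dt b ==> D (%w. good X Y x (a w) (b w))"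
  by (rule D_comp2[of "good X Y x"], unfold good_def, intro dfi, assumption+)
lemma D_gd [dfi]: "Dt a ==> D (%w. gd X Y x (a w))"
  by (rule D_comp[of "gd X Y x"], unfold gd_def, intro dfi)

lemma dx_le: "dx x q s ==> sb q r ==> r <: FF ==> dx x r s"
  unfolding dx_def using F.Frc_le[of q _ r] cond_sub[of r q] unfolding le FF by blast

definition isfn :: "nat set => nat => bool" where
  "isfn G x = ((ALL i. i <: lam --> (EX k. F.memG G (F.chk (pr i k)) x)) &
    (ALL i k k'. F.memG G (F.chk (pr i k)) x --> F.memG G (F.chk (pr i k')) x --> k = k'))"

text \<open>The generic function of column \<open>k\<close> has at \<open>pf u\<close> the value that \<open>c\<close> assigns to \<open>ps u\<close>.\<close>

definition gv :: "nat => nat => nat set => nat => bool" where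
  "gv k c G u = (sg (pr (pr k (pf u)) (ap c (ps u))) : G)"
lemma DG_gv [dfi]: "Dt a ==> F.DG (%G x. gv k c G (a x))" unfolding gv_def by (intro dfi)

lemma gv_unique: assumes "F.gen G" "gv k c G (pr i w)" "gv k c G (pr i w')" "w <: S" "w' <: S"
    "ALL x y. x <: S --> y <: S --> ap c x = ap c y --> x = y" shows "w = w'"
proof -
  have "isf (un (sg (pr (pr k i) (ap c w))) (sg (pr (pr k i) (ap c w'))))" using G_isf[OF assms(1)] assms(2,3) unfolding gv_def by simp
  thus ?thesis using isf_D[of _ "pr k i" "ap c w" "ap c w'"] assms(4-6) by auto
qed

text \<open>Fixing the second argument turns the injection of \<open>prd S (bb k)\<close> into
  \<open>bb k\<close> into a coding of \<open>S\<close> by values of column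
  \<open>k\<close>.\<close>

lemma column_for: assumes "bd mu Z" "bd mu S" "s0 <: S"
  shows "EX k c. k <: IX & ~ k <: Z & (ALL x. x <: S --> ap c x <: bb k) & (ALL x y. x <: S --> y <: S --> ap c x = ap c y --> x = y)"
proof -
  obtain k c where k: "k <: IX" "~ k <: Z" "ALL x v. x <: S --> v <: bb k --> ap c (pr x v) <: bb k"
     "ALL x v y w. x <: S --> v <: bb k --> y <: S --> w <: bb k --> ap c (pr x v) = ap c (pr y w) --> x = y & v = w"
    using many[OF assms] by blast
  obtain v where v: "v <: bb k" using bbne k(1) by blast
  have d: "Dt (%x. ap c (pr x v))" by (intro dfi)
  let ?L = "Lam S (%x. ap c (pr x v))"
  have "ALL x. x <: S --> ap ?L x <: bb k" using ap_Lam[OF d, of _ S] k(3) v by simp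
  moreover have "x = y" if "x <: S" "y <: S" "ap ?L x = ap ?L y" for x y
    using k(4)[rule_format, of x v y v] that ap_Lam[OF d, of _ S] v by simp
  ultimately show ?thesis using k(1,2) by blast
qed

lemma fresh: assumes "cond p" "a <: lam" shows "EX b. b <: lam & a <: b & (ALL i k v. i = b | b <: i --> ~ pr (pr k i) v <: p)"
proof -
  have d: "Dt (%u. ps (pf u))" by (intro dfi)
  obtain b where b: "b <: lam" "ALL u. u <: p --> ps (pf u) <: b"
    using bd_I[OF _ d, of lam p] cond_pr[OF assms(1)] assms(1) unfolding cond_def by fastforce
  define e where "e = (if a <: b then b else suc a)"
  have e: "e <: lam" "a <: e" "b = e | b <: e"
    using b(1) assms(2) lam_suc od_tri[OF oda[OF assms(2)] oda[OF b(1)]] unfolding e_def by auto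
  have "~ pr (pr k i) v <: p" if "i = e | e <: i" "i <: lam" for i k v
  proof
    assume "pr (pr k i) v <: p"
    hence "i <: b" using b(2) by fastforce
    thus False using that e(3) oda[OF b(1)] od_trans[OF oda[OF that(2)]] od_trans[OF oda[OF b(1)]] not_mem_self not_mem_2 by metis
  qed
  moreover have "i <: lam" if "pr (pr k i) v <: p" for i k v using cond_pr[OF assms(1) that] by auto
  ultimately show ?thesis using e by blast
qed

lemma cond_sg: "k <: IX ==> i <: lam ==> v <: bb k ==> cond (sg (pr (pr k i) v))"
  unfolding cond_def sg_def using bd_up[OF rcl] by (auto simp: isf_def)

lemma cond_add: assumes "cond p" "k <: IX" "i <: lam" "v <: bb k" "!!w. ~ pr (pr k i) w <: p"
  shows "cond (un p (sg (pr (pr k i) v)))"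
proof -
  have "isf (un p (sg (pr (pr k i) v)))" using assms unfolding cond_def by (intro isf_un) (auto simp: isf_def)
  thus ?thesis using cond_un cond_sg assms by blast
qed

text \<open>Beyond the length of a condition the column is free to take the value that codes
  \<open>w\<close>, and of two successive places at least one satisfies \<open>T\<close>.\<close>

lemma gv_ex: assumes "F.gen G" "k <: IX" "ap c w <: bb k" "D T" "!!a. T a | T (suc a)" "a <: lam"
  shows "EX i. i <: lam & a <: i & T i & gv k c G (pr i w)"
proof -
  let ?Q = "%r. EX i. i <: lam & a <: i & T i & pr (pr k i) (ap c w) <: r"
  have "D ?Q" by (intro dfi D_comp[OF assms(4)])
  moreover have "EX r. r <: FF & sb q r & ?Q r" if q: "q <: FF" for q
  proof -
    obtain b where b: "b <: lam" "a <: b" "ALL i k v. i = b | b <: i --> ~ pr (pr k i) v <: q"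
      using fresh[of q a] q assms(6) unfolding FF by blast
    have "EX i. (i = b | b <: i) & T i & i <: lam & a <: i" using assms(5)[of b] b lam_suc by (metis mem_suc)
    then obtain i where i: "i = b | b <: i" "T i" "i <: lam" "a <: i" by blast
    have "un q (sg (pr (pr k i) (ap c w))) <: FF" using q i b(3) assms unfolding FF by (intro cond_add) blast+
    thus ?thesis using i by (intro exI[of _ "un q (sg (pr (pr k i) (ap c w)))"]) auto
  qed
  moreover obtain p where "p : G" using F.gen_ne[OF assms(1)] by blast
  ultimately obtain r i where r: "r : G" "i <: lam" "a <: i" "T i" "pr (pr k i) (ap c w) <: r"
    using gen_dense_sb[OF assms(1), of ?Q p] by blast
  have "sg (pr (pr k i) (ap c w)) : G" by (rule G_sub[OF assms(1) r(1)]) (use r in simp)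
  thus ?thesis using r unfolding gv_def by auto
qed

text \<open>Restriction to \<open>Y\<close> is a projection: an extension of \<open>rt q Y\<close>
  on the columns in \<open>Y\<close> is compatible with \<open>q\<close>.\<close>

lemma FX_dense: assumes "F.gen G" "D Q" "p : G" "p <: FX Y" "!!q. q <: FX Y ==> sb p q ==> EX r. r <: FX Y & sb q r & Q r"
  shows "EX r. r : G & r <: FX Y & sb p r & Q r"
proof -
  let ?Q = "%r. EX r'. r' <: FX Y & sb r' r & sb p r' & Q r'"
  have "D ?Q" by (intro dfi D_comp[OF assms(2)])
  moreover have "EX r. r <: FF & sb q r & ?Q r" if q: "q <: FF" "sb p q" for q
  proof -
    have c: "cond q" using q FF by blast
    obtain r where r: "r <: FX Y" "sb (rt q Y) r" "Q r" using assms(5)[OF rt_FX[OF c]] sb_rt_FX[OF assms(4) q(2)] by blast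
    have "isf (un r (rt q Y))" using un_absorb[OF r(2)] r(1) exten unfolding FX cond_def
      by (metis mem_un)
    hence "isf (un r q)" using FX_isf r(1) c by blast
    hence "un r q <: FF" using cond_un FX_cond r(1) c FF by blast
    moreover have "sb p r" using sb_trans[OF sb_rt_FX[OF assms(4) q(2)] r(2)] .
    ultimately show ?thesis using r by (intro exI[of _ "un r q"]) auto
  qed
  ultimately obtain r where r: "r : G" "?Q r" using gen_dense_sb[OF assms(1) _ assms(3), of ?Q] by blast
  thus ?thesis using G_sub[OF assms(1)] by blast
qed

text \<open>For each place of \<open>s\<close> a condition in \<open>G\<close> on \<open>Y\<close>
  decides the value of \<open>x\<close>. \<open>F_dist\<close> selects these conditions within the
  ground model, and their union lies in \<open>G\<close> by \<open>G_Uu\<close>.\<close>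

lemma decide: assumes G: "F.gen G" and p: "p : G" "p <: FX Y" "cap Y x p" and x: "isfn G x"
    and s: "sseq s" "!!z. z <: s ==> F.memG G (F.chk z) x"
  shows "EX r. r : G & r <: FX Y & dx x r s"
proof -
  note sf = sseq_fto[OF s(1)]
  have fs: "fon s (dm s)" using sf fon_dm by blast
  let ?R = "%i r. r <: FX Y & F.Frc r (%G. F.memG G (F.chk (pr i (ap s i))) x)"
  have ex: "EX r. r : G & ?R i r" if i: "i <: dm s" for i
  proof -
    let ?Q = "%r. EX y. F.Frc r (%G. F.memG G (F.chk (pr i y)) x)"
    have "D ?Q" by (intro dfi)
    moreover have "i <: lam" using i sf lam_trans by blast
    ultimately obtain r where r: "r : G" "r <: FX Y" "?Q r"
      using FX_dense[OF G _ p(1,2), of ?Q] p(3) unfolding cap_def by blast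
    then obtain y where y: "F.Frc r (%G. F.memG G (F.chk (pr i y)) x)" by blast
    have "F.memG G (F.chk (pr i y)) x" using F.Frc_D[OF y G r(1)] .
    moreover have "F.memG G (F.chk (pr i (ap s i))) x" using s(2) fon_ap[OF fs i] by blast
    ultimately have "y = ap s i" using x unfolding isfn_def by blast
    thus ?thesis using r y by blast
  qed
  let ?S = "%G u. ps u : G & ?R (pf u) (ps u)"
  have dR: "D (%u. ?R (pf u) (ps u))" by (intro dfi)
  have "F.DG ?S" by (intro F.DG_and F.DG_in F.DG_D[OF dR] dfi)
  moreover have "EX r. r <: FF & ?S G (pr i r)" if "i <: dm s" for i using ex[OF that] G_FF[OF G] by auto
  ultimately obtain h where h: "fto h (dm s) FF" "ALL i. i <: dm s --> ?S G (pr i (ap h i))"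
    using F_dist[OF G, of ?S "dm s" FF] sf by blast
  have d: "Dt (ap h)" by (intro dfi)
  let ?r = "Uu (Im (dm s) (ap h))"
  have bd: "bd lam (Im (dm s) (ap h))" using bd_Im[OF rc_bd[OF rcl] d] sf by blast
  have r: "?r : G" using h(2) by (intro G_Uu[OF G _ bd]) (auto simp: mem_Im[OF d])
  hence rF: "?r <: FF" using G_FF[OF G] by blast
  have "?r <: FX Y" unfolding FX using rF h(2) FXD unfolding FF mem_Un mem_Im[OF d] by auto
  moreover have "dx x ?r s" unfolding dx_def
  proof (intro allI impI)
    fix z assume z: "z <: s"
    then obtain i where i: "z = pr i (ap s i)" "i <: dm s" using fon_iff[OF fs] sf unfolding isf_def by metis
    have "ap h i <: Im (dm s) (ap h)" using i(2) unfolding mem_Im[OF d] by blast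
    hence "F.le ?r (ap h i)" unfolding le using rF fto_ap[OF h(1) i(2)] sb_Uu by blast
    thus "F.Frc ?r (%G. F.memG G (F.chk z) x)" using h(2) i F.Frc_le by auto
  qed
  ultimately show ?thesis using r by blast
qed

lemma capture_name: assumes Phi: "F.DG Phi" "!!G x. F.gen G ==> Phi G x ==> isfn G x" and X: "bd mu X"
    and p: "cond p" "F.Frc p (%G. Phi G x)"
  shows "EX Y. bd mu Y & sb X Y & p <: FX Y & cap Y x p"
proof -
  let ?S = "%i r. EX y. F.Frc r (%G. F.memG G (F.chk (pr i y)) x)"
  have S: "D (%w. ?S (pf w) (ps w))" by (intro dfi)
  have ex: "EX r. cond r & sb q r & ?S i r" if q: "i <: lam" "cond q" "sb p q" for i q
  proof -
    obtain H where H: "F.gen H" "q : H" using gen_ex q by blast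
    have "p : H" using G_sub[OF H q(3)] .
    then obtain k where k: "F.memG H (F.chk (pr i k)) x" using F.Frc_D[OF p(2) H(1)] Phi(2)[OF H(1)] q(1) unfolding isfn_def by blast
    let ?Q = "%G w. F.memG G (F.chk w) x"
    have "F.DG ?Q" by (intro dfi)
    thus ?thesis using F_truth[OF H(1), of ?Q "pr i k" q] k H(2) G_FF[OF H(1)] FF by blast
  qed
  obtain Y where Y: "bd mu Y" "sb (un X (supp p)) Y" "ALL i q. i <: lam --> q <: FX Y --> sb p q --> (EX r. r <: FX Y & sb q r & ?S i r)"
    using capture[OF S bd_un[OF rcm X bd_supp[OF p(1)]] ex] by blast
  thus ?thesis using FX_supp[OF p(1)] unfolding cap_def by (intro exI[of _ Y]) auto
qed

end

context colgen begin

text \<open>At each of his moves player II chooses, if he can, a sequence \<open>s\<close> extending the position and an element \<open>u\<close> of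
  the generic filter with \<open>(s, u) \<in> B\<close>, where \<open>B\<close> is coded at the current stage in column \<open>k\<close>.  If the outcome had a
  name \<open>x\<close> and \<open>q\<close> were a condition in the filter without \<open>gd X Y x q\<close>, the set \<open>B\<close> of all pairs \<open>(s, u)\<close> such that
  \<open>u\<close> excludes \<open>s \<subseteq> x\<close> below \<open>q\<close> would come up at some stage.\<close>

lemma playerII: assumes X: "bd mu X" and Phi: "F.DG Phi" "!!G x. F.gen G ==> Phi G x ==> isfn G x"
    and A: "!!x. M (v x) A ==> Phi G x"
    and nc: "!!Y x p. bd mu Y ==> sb X Y ==> p : G ==> p <: FX Y ==> F.Frc p (%G. Phi G x) ==> cap Y x p ==>
      EX q. q <: FX Y & sb p q & ~ gd X Y x q"
  shows "sat M (PlayerIIWins (jj lam) A)"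
proof -
  \<comment> \<open>Column \<open>k\<close> codes pairs \<open>(s, B)\<close>. The second component
    at the place \<open>dm t\<close> is the set on which the move after \<open>t\<close> depends;
    the first components list candidates for the move, among which \<open>least\<close>
    selects.\<close>
  let ?S = "prd Sq (Pw (prd Sq (FX X)))"
  have "bd mu ?S" using bd_prd[OF rcm] pwm bd_Sq bd_FX[OF X] by blast
  moreover have "pr emp emp <: ?S" using sseq_emp Sq by simp
  moreover have "bd mu emp" using bd_sub[OF rc_emp[OF rcm] X, of emp] by simp
  ultimately obtain k c where kc: "k <: IX & ~ k <: emp & (ALL w. w <: ?S --> ap c w <: bb k) &
     (ALL w y. w <: ?S --> y <: ?S --> ap c w = ap c y --> w = y)"
    using column_for[of emp ?S "pr emp emp"] by blast
  have k: "k <: IX" "ALL w. w <: ?S --> ap c w <: bb k" and c: "ALL w y. w <: ?S --> y <: ?S --> ap c w = ap c y --> w = y"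
    using kc by blast+
  define T where "T a = (~ Ev a)" for a
  have DT: "D T" unfolding T_def by (intro dfi)
  have TT: "T a | T (suc a)" for a unfolding T_def using Ev_suc by blast
  define want where "want G w = (legal (pf w) (ps w) &
    (EX s B u. pr s B <: ?S & gv k c G (pr (dm (pf w)) (pr s B)) & u : G & pr (ps w) u <: B))" for G w
  have Dw: "F.DG want" unfolding want_def by (intro dfi D_legal[THEN F.DG_D])
  define C where "C G w = (EX B. pr (ps (ps w)) B <: ?S & gv k c G (pr (pf (ps w)) (pr (ps (ps w)) B)) & legal (pf w) (ps (ps w)) &
    (want G (pr (pf w) (ps (ps w))) | ~ (EX s. want G (pr (pf w) s))))" for G w
  have DC: "F.DG C" unfolding C_def by (intro dfi D_legal[THEN F.DG_D] F.DG_comp[OF Dw])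
  have uC: "s = s'" if cc: "C G (pr t (pr i s))" "C G (pr t (pr i s'))" for t i s s'
  proof -
    obtain B B' where "pr s B <: ?S" "gv k c G (pr i (pr s B))" "pr s' B' <: ?S" "gv k c G (pr i (pr s' B'))" using cc unfolding C_def pf_pr ps_pr by blast
    hence "pr s B = pr s' B'" using gv_unique[OF genG _ _ _ _ c] by blast
    thus ?thesis by simp
  qed
  show ?thesis
  proof (rule winsII[OF DT _ DG_least[OF DC]])
    show "T = (%a. ~ Ev a)" using T_def by blast
    show "s = s'" if "least C G (pr t s)" "least C G (pr t s')" for t s s' using least_unique[OF uC that] .
    fix a t assume a: "a <: lam" "T a" "play a t"
    \<comment> \<open>Any legal move serves as a default when the current set \<open>B\<close>
      offers none.\<close>
    have "legal t (snoc (Uu (rg t)) emp)" using legal_snoc[OF a(3,1)] play_Uu[OF a(3,1)] rc_emp[OF rcl] by simp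
    then obtain s where s: "legal t s" "want G (pr t s) | ~ (EX s. want G (pr t s))" unfolding want_def by (metis pf_pr ps_pr)
    have m: "pr s emp <: ?S" using s(1) Sq unfolding legal_def by simp
    have "D (%_::nat. True)" by (rule dfi)
    then obtain i where "i <: lam" "gv k c G (pr i (pr s emp))"
      using gv_ex[OF genG k(1), of c "pr s emp" "%_. True" a] k(2) m a(1) by blast
    hence "C G (pr t (pr i s))" unfolding C_def pf_pr ps_pr using s m by blast
    then obtain s' where "least C G (pr t s')" using least_ex[OF genG DC \<open>i <: lam\<close>] by blast
    thus "EX s. legal t s & least C G (pr t s)" unfolding least_def C_def by auto
  next
    fix n x assume r: "run T (least C) G n" and x: "N.fto (v x) (jj lam) (jj lam)" "!!y. M y (v x) = (EX z. outc G n z & y = jj z)"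
    show "~ M (v x) A"
    proof
      assume "M (v x) A"
      hence Px: "Phi G x" using A by blast
      then obtain p where p: "p : G" "F.Frc p (%G. Phi G x)" using F.truth[OF genG Phi(1)] by blast
      have cp: "cond p" using G_FF[OF genG p(1)] FF by blast
      obtain Y where Y: "bd mu Y" "sb X Y" "p <: FX Y" "cap Y x p" using capture_name[OF Phi X cp p(2)] by blast
      have capm: "cap Y x q" if "sb p q" for q using Y(4) sb_trans[OF that] unfolding cap_def by blast
      \<comment> \<open>By density the filter decides between the two cases, and the assumption
        \<open>nc\<close> rules out \<open>?ok\<close>.\<close>
      let ?bad = "%q. ~ gd X Y x q" let ?ok = "%q. ALL r. r <: FX Y --> sb q r --> gd X Y x r"
      have "D (%q. ?bad q | ?ok q)" by (intro dfi)
      moreover have "EX r. r <: FX Y & sb q r & (?bad r | ?ok r)" if "q <: FX Y" for q using that sb_refl by blast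
      ultimately obtain q where q: "q : G" "q <: FX Y" "sb p q" "?bad q | ?ok q"
        using FX_dense[OF genG _ p(1) Y(3), of "%q. ?bad q | ?ok q"] by blast
      have "F.Frc q (%G. Phi G x)" using F.Frc_le[OF p(2), of q] q FX_cond FF cp unfolding le by blast
      hence bad: "?bad q" using nc[OF Y(1,2) q(1,2) _ capm[OF q(3)]] q(4) by blast
      define B where "B = Sp (prd Sq (FX X)) (%w. sb (rt q X) (ps w) &
        ~ (EX r. r <: FX Y & sb q r & sb (ps w) (rt r X) & dx x r (pf w)))"
      have B: "w <: B = (w <: prd Sq (FX X) & sb (rt q X) (ps w) & ~ (EX r. r <: FX Y & sb q r & sb (ps w) (rt r X) & dx x r (pf w)))" for w
        unfolding B_def by (intro mem_Sp dfi)
      have "B <: Pw (prd Sq (FX X))" unfolding mem_Pw using B by blast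
      hence mB: "pr emp B <: ?S" using sseq_emp unfolding mem_prd[of _ Sq "Pw _"] Sq by blast
      \<comment> \<open>Genericity of column \<open>k\<close>: the set \<open>B\<close> comes up at
        a stage of player II. The first component \<open>emp\<close> is a dummy.\<close>
      obtain a where a: "a <: lam" "T a" "gv k c G (pr a (pr emp B))"
        using gv_ex[OF genG k(1) _ DT TT rc_emp[OF rcl], of c "pr emp B"] k(2) mB by blast
      obtain t where t: "play a t" "seg G n t" using r a(1) unfolding run_def by blast
      have dt: "dm t = a" using play_dm[OF t(1)] .
      obtain s where s: "F.memG G (F.chk (pr a s)) n" "least C G (pr t s)" using r t(2) a(2) dt unfolding run_def by metis
      have "EX s. want G (pr t s)"
      proof -
        let ?s1 = "snoc (Uu (rg t)) emp"
        have s1: "sseq ?s1" "sb (Uu (rg t)) ?s1" "?s1 ~= Uu (rg t)" using snoc[OF play_Uu(1)[OF t(1) a(1)] rc_emp[OF rcl]] by auto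
        \<comment> \<open>As \<open>gd X Y x q\<close> fails, no extension of \<open>q\<close> on
          \<open>X\<close> makes a sequence good, so those \<open>u\<close> for which
          \<open>B\<close> offers a move are dense below \<open>rt q X\<close>.\<close>
        let ?Q = "%u. EX s'. sseq s' & sb ?s1 s' & pr s' u <: B"
        have "D ?Q" by (intro dfi)
        moreover have "EX r. r <: FX X & sb u r & ?Q r" if u: "u <: FX X" "sb (rt q X) u" for u
        proof -
          have "rt (un q u) X = un (rt q X) u" using rt_un rt_id[OF u(1) sb_refl] by simp
          hence ru: "rt (un q u) X = u" using un_absorb[OF u(2)] by simp
          have "~ good X Y x (un q u) ?s1" using bad u s1(1) unfolding gd_def by blast
          then obtain u' s' where u': "u' <: FX X" "sb u u'" "sseq s'" "sb ?s1 s'"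
            "~ (EX r. r <: FX Y & sb (un q u) r & sb u' (rt r X) & dx x r s')" unfolding good_def ru by blast
          have "~ (EX r. r <: FX Y & sb q r & sb u' (rt r X) & dx x r s')"
            using u'(5) sb_trans[OF u'(2)] sb_trans[OF _ sb_rt] unfolding sb_un by blast
          hence "pr s' u' <: B" unfolding B using u' sb_trans[OF u(2)] Sq by auto
          thus ?thesis using u' by blast
        qed
        moreover have "rt q X : G" using G_sub[OF genG q(1) sb_rt] .
        ultimately obtain u s' where u: "u : G" "sseq s'" "sb ?s1 s'" "pr s' u <: B"
          using FX_dense[OF genG _ _ rt_cond[OF q(2)], of ?Q X] by blast
        have "legal t s'" unfolding legal_def dt using u(2) sb_trans[OF sb_trans[OF play_Uu(2)[OF t(1) a(1)] s1(2)] u(3)]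
            play_Uu(2)[OF t(1) a(1)] s1 u(3) sb_trans sb_antisym by metis
        thus ?thesis unfolding want_def using a(3) mB u dt by auto
      qed
      hence "want G (pr t s)" using s(2) unfolding least_def C_def by auto
      then obtain s1 B' u where w: "sseq s" "pr s1 B' <: ?S" "gv k c G (pr a (pr s1 B'))" "u : G" "pr s u <: B'"
        unfolding want_def legal_def using dt by auto
      have "B' = B" using gv_unique[OF genG w(3) a(3) w(2) mB c] by simp
      hence uB: "u <: FX X" "sb (rt q X) u" "~ (EX r. r <: FX Y & sb q r & sb u (rt r X) & dx x r s)" using w(5) B by auto
      have sx: "F.memG G (F.chk z) x" if z: "z <: s" for z
      proof -
        obtain t' where t': "play (suc a) t'" "seg G n t'" using r lam_suc[OF a(1)] unfolding run_def by blast
        hence "F.memG G (F.chk (pr a (ap t' a))) n" using play_dm unfolding seg_def by (metis mem_suc)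
        hence "ap t' a = s" using r s(1) unfolding run_def by blast
        hence "outc G n z" unfolding outc_def using t' z play_dm[OF t'(1)] mem_suc by metis
        thus ?thesis using x(2) EN by blast
      qed
      obtain e where e: "e : G" "e <: FX Y" "dx x e s" using decide[OF genG p(1) Y(3,4) Phi(2)[OF genG Px] w(1) sx] by blast
      \<comment> \<open>\<open>q\<close>, \<open>u\<close> and a condition that decides
        \<open>s\<close> to be part of \<open>x\<close> all lie in the filter; their union is of the
        kind that membership of \<open>(s, u)\<close> in \<open>B\<close> excludes.\<close>
      let ?r = "un (un q u) e"
      have rG: "?r : G" using G_un genG q(1) w(4) e(1) by blast
      have "?r <: FX Y" using FX_un[OF FX_un[OF q(2) FX_mono[OF uB(1) Y(2)]] e(2)] G_isf[OF genG] G_un[OF genG] q(1) w(4) e(1) by blast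
      moreover have "dx x ?r s" using dx_le[OF e(3)] G_FF[OF genG rG] by simp
      moreover have "sb u (rt ?r X)" using sb_rt_FX[OF uB(1)] by (simp add: sb_unI)
      ultimately show False using uB(3) by (metis sb_un1 sb_unI(1))
    qed
  qed
qed

end

section \<open>Absorption of small closed posets into the collapse\<close>

context zf begin

text \<open>Elements of a set of pairs \<open>(i, z)\<close> code several sets, the columns \<open>unt i b\<close>.\<close>

definition unt :: "'v => 'v => 'v" where "unt i b = Sp (rg b) (%z. pr i z <: b)"
lemma mem_unt [simp]: "z <: unt i b = (pr i z <: b)"
proof -
  have "D (%z. pr i z <: b)" by (intro dfi)
  thus ?thesis unfolding unt_def by (auto simp: mem_Sp)
qed
lemma Dt_unt [dfi]: "Dt a ==> Dt b ==> Dt (%x. unt (a x) (b x))"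
  by (rule Dt_comp2[of unt], unfold unt_def, intro dfi, assumption+)
lemma ap_sb: "isf y ==> sb x y ==> i <: dm x ==> ap y i = ap x i"
  unfolding sb_def using isf_ap isf_sb[unfolded sb_def] by (metis mem_dm)
lemma unt_mono: "sb a b ==> sb (unt i a) (unt i b)" unfolding sb_def by simp

end

text \<open>A node is an increasing sequence of elements of the \<open>lam\<close>-closed poset \<open>DD\<close>, each with a value for column \<open>k\<close>;
  \<open>bs w i\<close> is the element of \<open>DD\<close> reached before step \<open>i\<close>.\<close>

locale tree = columns +
  fixes DD c0 k :: nat
  assumes c0: "c0 <: DD" and DDc: "shc lam DD" and k: "k <: IX"
begin

definition bs :: "nat => nat => nat" where "bs w i = un c0 (Uu (Im i (%n. pf (ap w n))))"
lemma Dt_bs [dfi]: "Dt a ==> Dt b ==> Dt (%x. bs (a x) (b x))" by (rule Dt_comp2[of bs], unfold bs_def, intro dfi, assumption+)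
lemma mem_bs: "z <: bs w i = (z <: c0 | (EX n. n <: i & z <: pf (ap w n)))"
proof -
  have "Dt (%n. pf (ap w n))" by (intro dfi)
  thus ?thesis unfolding bs_def by (auto simp: mem_Im)
qed

definition isW :: "nat => bool" where
  "isW w = (isf w & dm w <: lam & (ALL i. i <: dm w --> (EX b v. ap w i = pr b v & b <: DD & v <: bb k & sb (bs w i) b)))"
lemma D_isW [dfi]: "Dt a ==> D (%x. isW (a x))" by (rule D_comp[of isW], unfold isW_def, intro dfi Dt_comp[OF Dbb])

definition W :: nat where "W = Sp (Pw (prd lam (prd DD (bb k)))) isW"
lemma W: "w <: W = isW w"
proof -
  have "u <: prd lam (prd DD (bb k))" if w: "isW w" "u <: w" for u w
  proof -
    have f: "fon w (dm w)" "isf w" using w(1) unfolding isW_def fon_dm by auto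
    obtain x y where u: "u = pr x y" using f(2) w(2) unfolding isf_def by blast
    hence x: "x <: dm w" "y = ap w x" using fon_iff[OF f(1), of x y] w(2) u by blast+
    obtain b v where "y = pr b v" "b <: DD" "v <: bb k" using w(1) x unfolding isW_def by metis
    moreover have "x <: lam" using x(1) lam_trans w(1) unfolding isW_def by blast
    ultimately show ?thesis using u by auto
  qed
  thus ?thesis unfolding W_def by (subst mem_Sp, intro dfi) auto
qed

lemma isW_od: "isW w ==> od (dm w)" unfolding isW_def using oda by blast

lemma isW_val: "isW w ==> i <: dm w ==> EX b v. ap w i = pr b v & b <: DD & v <: bb k & sb (bs w i) b"
  unfolding isW_def by blast

lemma bs_pf: "isW w ==> i <: dm w ==> sb (bs w i) (pf (ap w i)) & pf (ap w i) <: DD"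
  using isW_val by fastforce

lemma bs_mono: "(!!n. n <: i ==> n <: m) ==> sb (bs w i) (bs w m)" unfolding sb_def mem_bs by blast
lemma pf_bs: "n <: i ==> sb (pf (ap w n)) (bs w i)" unfolding sb_def mem_bs by blast

lemma bs_DD: assumes w: "isW w" and i: "i <: suc (dm w)" shows "bs w i <: DD"
proof -
  have d: "Dt (%n. pf (ap w n))" by (intro dfi)
  let ?C = "un (sg c0) (Im i (%n. pf (ap w n)))"
  have m: "x <: ?C = (x = c0 | (EX n. n <: i & x = pf (ap w n)))" for x by (auto simp: mem_Im[OF d])
  have ow: "od (dm w)" "dm w <: lam" using w oda unfolding isW_def by auto
  have oi: "od i" using od_mem[OF od_suc[OF ow(1)] i] .
  have sub: "n <: dm w" if "n <: i" for n using i that od_trans[OF ow(1)] by auto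
  have "bd lam i" using i ow(2) lam_trans[OF ow(2)] rc_bd[OF rcl] unfolding mem_suc by blast
  hence "bd lam ?C" unfolding sg_def by (intro bd_un bd_up bd_Im rcl d)
  moreover have c: "sb (pf (ap w n)) (pf (ap w m))" if "n <: m" "m <: i" for n m
    using sb_trans[OF pf_bs[OF that(1)]] bs_pf[OF w sub[OF that(2)]] by blast
  have c1: "sb c0 (pf (ap w n))" if "n <: i" for n
    using bs_pf[OF w sub[OF that]] unfolding sb_def mem_bs by blast
  have "sb x y | sb y x" if xy: "x <: ?C" "y <: ?C" for x y
    using xy c c1 od_tri[OF od_mem[OF oi] od_mem[OF oi]] sb_refl unfolding m by metis
  moreover have "x <: DD" if "x <: ?C" for x using that c0 bs_pf[OF w sub] unfolding m by blast
  ultimately have "Uu ?C <: DD" using DDc m unfolding shc_def by blast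
  moreover have "Uu ?C = bs w i" by (rule exten) (unfold mem_bs mem_Un m, blast)
  ultimately show ?thesis by simp
qed

lemma bs_sb: assumes "isW x" "isf y" "sb x y" "i <: suc (dm x)" shows "bs y i = bs x i"
proof (rule exten)
  have "n <: dm x" if "n <: i" for n using assms(4) that od_trans[OF isW_od[OF assms(1)]] by auto
  thus "z <: bs y i = (z <: bs x i)" for z unfolding mem_bs using ap_sb[OF assms(2,3)] by auto
qed

lemma isW_add: assumes x: "isW x" and b: "b <: DD" "u <: bb k" "sb (bs x (dm x)) b"
  defines "y == un x (sg (pr (dm x) (pr b u)))"
  shows "isW y" "sb x y" "dm y = suc (dm x)" "bs y (dm y) = b" "ap y (dm x) = pr b u"
proof -
  show s: "sb x y" unfolding y_def by simp
  have f: "isf y" unfolding y_def using x not_mem_self[of "dm x"] unfolding isW_def by (intro isf_un) (auto simp: isf_def)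
  show d: "dm y = suc (dm x)" unfolding y_def by (rule exten) auto
  show a: "ap y (dm x) = pr b u" by (rule isf_ap[OF f]) (simp add: y_def)
  have e: "bs y i = bs x i" if "i <: suc (dm x)" for i using bs_sb[OF x f s that] .
  have "EX b v. ap y i = pr b v & b <: DD & v <: bb k & sb (bs y i) b" if i: "i <: dm y" for i
  proof (cases "i = dm x")
    case True thus ?thesis using a b e by auto
  next
    case False
    hence i: "i <: dm x" using i d by auto
    thus ?thesis using isW_val[OF x i] ap_sb[OF f s i] e by auto
  qed
  thus "isW y" unfolding isW_def using f d x lam_suc unfolding isW_def by auto
  have "z <: bs y (dm y) = (z <: bs x (dm x) | z <: b)" for z
  proof -
    have "z <: bs y (dm y) = (z <: bs y (dm x) | z <: pf (ap y (dm x)))" unfolding d mem_bs by auto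
    thus ?thesis using e a by simp
  qed
  thus "bs y (dm y) = b" using b(3) unfolding sb_def by (intro exten) blast
qed

lemma isW_Uu: assumes C: "EX c. c <: C" "bd lam C" "!!c. c <: C ==> isW c" "!!c d. c <: C ==> d <: C ==> sb c d | sb d c"
  shows "isW (Uu C)" "bs (Uu C) (dm (Uu C)) = Uu (Im C (%w. bs w (dm w)))"
proof -
  have f: "isf (Uu C)" "dm (Uu C) <: lam" using seq_Uu[OF C(2) _ C(4)] C(3) unfolding isW_def by blast+
  have d: "i <: dm (Uu C) = (EX c. c <: C & i <: dm c)" for i by auto
  have e: "bs (Uu C) i = bs c i" "ap (Uu C) i = ap c i" if "c <: C" "i <: dm c" for c i
    using bs_sb[OF C(3)[OF that(1)] f(1) sb_Uu[OF that(1)]] ap_sb[OF f(1) sb_Uu[OF that(1)]] that by auto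
  show "isW (Uu C)" unfolding isW_def d using f isW_val[OF C(3)] e by metis
  have di: "Dt (%w. bs w (dm w))" by (intro dfi)
  have "z <: bs (Uu C) (dm (Uu C)) = (EX c. c <: C & z <: bs c (dm c))" for z
    unfolding mem_bs d using C(1) e(2) by metis
  thus "bs (Uu C) (dm (Uu C)) = Uu (Im C (%w. bs w (dm w)))" by (intro exten) (auto simp: mem_Im[OF di])
qed

lemma isW_eq: assumes "isW x" "isW y" "!!i. i <: dm x ==> i <: dm y ==> ap x i = ap y i" shows "sb x y | sb y x"
proof -
  have f: "fon x (dm x)" "fon y (dm y)" "isf x" "isf y" using assms unfolding isW_def fon_dm by auto
  have s: "sb x y" if "isf x" "fon x (dm x)" "fon y (dm y)" "!!i. i <: dm x ==> i <: dm y & ap x i = ap y i" for x y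
    unfolding sb_def using that(1) fon_iff[OF that(2)] fon_iff[OF that(3)] that(4) unfolding isf_def by metis
  have "dm x <: dm y | dm x = dm y | dm y <: dm x" using od_tri isW_od assms by blast
  hence "(ALL i. i <: dm x --> i <: dm y) | (ALL i. i <: dm y --> i <: dm x)"
    using od_trans isW_od assms by metis
  thus ?thesis using s[of x y] s[of y x] f assms(3) by metis
qed

end

text \<open>\<open>lift\<close> makes \<open>unt t\<close> a projection of \<open>DD\<close> to the
  conditions on \<open>Z\<close>, and \<open>c\<close> injects \<open>Pw DD\<close> times
  \<open>bb k\<close> into \<open>bb k\<close>. Column \<open>k\<close> is to absorb the quotient of
  \<open>DD\<close> by this projection; \<open>t\<close> is a parameter because two projections of
  one poset will be treated.\<close>

locale absorb = tree +
  fixes Z c t :: nat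
  assumes kZ: "~ k <: Z"
    and cc: "x <: Pw DD ==> u <: bb k ==> ap c (pr x u) <: bb k"
      "x <: Pw DD ==> u <: bb k ==> y <: Pw DD ==> w <: bb k ==> ap c (pr x u) = ap c (pr y w) ==> x = y & u = w"
    and proj: "d <: DD ==> unt t d <: FX Z"
    and lift: "d <: DD ==> z <: FX Z ==> sb (unt t d) z ==> EX e. e <: DD & sb d e & sb z (unt t e)"
begin

abbreviation pj :: "nat => nat" where "pj == unt t"

text \<open>\<open>N\<close> is, after projection, a maximal antichain below \<open>d\<close>.\<close>

definition Gd :: "nat => nat => bool" where
  "Gd d N = (N <: Pw DD & (ALL b. b <: N --> sb d b) & (ALL a b. a <: N --> b <: N --> isf (un (pj a) (pj b)) --> a = b) &
    (ALL z. z <: FX Z --> sb (pj d) z --> (EX b. b <: N & isf (un z (pj b)))))"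
lemma D_Gd [dfi]: "Dt a ==> Dt b ==> D (%x. Gd (a x) (b x))" by (rule D_comp2[of Gd], unfold Gd_def, intro dfi, assumption+)

text \<open>A greedy choice along a well-ordering of the extensions of \<open>d\<close>, started
  with \<open>b\<close>; incompatibility is that of the projections. By \<open>lift\<close>, each
  condition on \<open>Z\<close> below the projection of \<open>d\<close> is met.\<close>

lemma Gd_ex: assumes d: "d <: DD" and b: "b <: DD" "sb d b" shows "EX N. Gd d N & b <: N"
proof -
  let ?X = "Sp DD (sb d)"
  have X: "x <: ?X = (x <: DD & sb d x)" for x by (intro mem_Sp dfi)
  obtain f a where f: "od a" "bij f a ?X" using wellorder by blast
  define in' where "in' x y = (~ isf (un (pj x) (pj y)))" for x y
  have Din: "Dt p ==> Dt q ==> D (%x. in' (p x) (q x))" for p q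
    by (rule D_comp2[of in'], unfold in'_def, intro dfi, assumption+)
  let ?H = "%i g. if in' (ap f i) b & (ALL m. m <: i --> ap g m = suc emp --> in' (ap f i) (ap f m)) then suc emp else emp"
  define h where "h = Rec ?H"
  have dh: "Dt (%p. ?H (pf p) (ps p))" by (intro dfi Din)
  have Dh: "Dt h" unfolding h_def by (rule Dt_Rec[OF dh])
  have ne: "emp ~= suc emp" by (metis mem_emp mem_suc)
  have h: "(h i = suc emp) = (in' (ap f i) b & (ALL m. m <: i --> h m = suc emp --> in' (ap f i) (ap f m)))" for i
  proof -
    have "h i = ?H i (Lam i h)" unfolding h_def by (rule Rec_eq[OF dh])
    thus ?thesis using ne ap_Lam[OF Dh] by auto
  qed
  let ?N = "un (sg b) (Im (Sp a (%i. h i = suc emp)) (ap f))"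
  have Dap: "Dt (ap f)" by (intro dfi)
  have sp: "i <: Sp a (%i. h i = suc emp) = (i <: a & h i = suc emp)" for i by (intro mem_Sp dfi Dh)
  have N: "x <: ?N = (x = b | (EX i. i <: a & h i = suc emp & x = ap f i))" for x
    by (simp add: mem_Im[OF Dap] sp)
  have in_sym: "in' x y = in' y x" for x y
  proof -
    have "un (pj x) (pj y) = un (pj y) (pj x)" by (rule exten) auto
    thus ?thesis unfolding in'_def by simp
  qed
  have "x <: DD & sb d x" if "x <: ?N" for x using that b bijE(1)[OF f(2)] X unfolding N by blast
  moreover have "x = y" if "x <: ?N" "y <: ?N" "~ in' x y" for x y
  proof -
    have "i = m" if "i <: a" "m <: a" "h i = suc emp" "h m = suc emp" "~ in' (ap f i) (ap f m)" for i m
      using od_tri[OF od_mem[OF f(1) that(1)] od_mem[OF f(1) that(2)]] h[of i] h[of m] that in_sym by blast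
    thus ?thesis using that h in_sym unfolding N by metis
  qed
  moreover have "EX x. x <: ?N & isf (un z (pj x))" if z: "z <: FX Z" "sb (pj d) z" for z
  proof -
    obtain e where e: "e <: DD" "sb d e" "sb z (pj e)" using lift[OF d z] by blast
    then obtain i where i: "i <: a" "ap f i = e" using bijE(3)[OF f(2)] X by blast
    have s: "isf (un z (pj x))" if "~ in' e x" for x
    proof (rule isf_sb)
      show "isf (un (pj e) (pj x))" using that unfolding in'_def by blast
    qed (use e(3) in \<open>auto simp: sb_unI\<close>)
    show ?thesis
    proof (cases "h i = suc emp")
      case True
      have "~ in' e e" using proj[OF e(1)] un_absorb[OF sb_refl] unfolding in'_def FX cond_def by simp
      thus ?thesis using True i s N by blast
    next
      case False
      then obtain x where "x <: ?N" "~ in' e x" using h[of i] i od_trans[OF f(1) i(1)] unfolding N by blast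
      thus ?thesis using s by blast
    qed
  qed
  ultimately have "Gd d ?N" unfolding Gd_def in'_def mem_Pw by blast
  thus ?thesis using N by blast
qed

text \<open>Below every \<open>d\<close> the extensions of \<open>d\<close> are labelled by elements of \<open>bb k\<close> such that extensions with the same label form an
  antichain which is maximal.  Since \<open>bb k\<close> is large enough to number all subsets of \<open>DD\<close>, every extension lies
  in one of these antichains, so that reading the generic function of column \<open>k\<close> as a sequence of
  labels yields a generic path through the tree.\<close>

lemma labels: "EX l. Dt (%p. l (pf p) (ps p)) & (ALL d b u. d <: DD --> b <: DD --> sb d b --> u <: bb k --> l d (pr b u) <: bb k) &
    (ALL d b e u w. d <: DD --> b <: DD --> sb d b --> e <: DD --> sb d e --> u <: bb k --> w <: bb k --> l d (pr b u) = l d (pr e w) -->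
      isf (un (pj b) (pj e)) --> b = e & u = w) &
    (ALL d z y. d <: DD --> z <: FX Z --> sb (pj d) z --> y <: bb k -->
      (EX b u. b <: DD & sb d b & u <: bb k & l d (pr b u) = y & isf (un z (pj b))))"
proof -
  let ?V = "bb k"
  have "EX N. N <: Pw DD & Gd d N" if "d <: DD" for d using Gd_ex[OF that that sb_refl] unfolding Gd_def by blast
  moreover have "D (%p. Gd (pf p) (ps p))" by (intro dfi)
  ultimately obtain n0 where n0: "ALL d. d <: DD --> Gd d (ap n0 d)" using AC[of Gd DD "Pw DD"] by blast
  define dc where "dc y = Uu (Sp (Pw DD) (%N. EX u. u <: ?V & y = ap c (pr N u)))" for y
  have Ddc: "Dt a ==> Dt (%x. dc (a x))" for a by (rule Dt_comp[of dc], unfold dc_def, intro dfi)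
  have dc: "dc (ap c (pr N u)) = N" if "N <: Pw DD" "u <: ?V" for N u
  proof -
    have "K <: Sp (Pw DD) (%N'. EX w. w <: ?V & ap c (pr N u) = ap c (pr N' w)) = (K = N)" for K
    proof -
      have "K <: Sp (Pw DD) (%N'. EX w. w <: ?V & ap c (pr N u) = ap c (pr N' w)) = (K <: Pw DD & (EX w. w <: ?V & ap c (pr N u) = ap c (pr K w)))"
        by (intro mem_Sp dfi)
      thus ?thesis using cc(2) that by blast
    qed
    thus ?thesis unfolding dc_def by (intro exten) auto
  qed
  \<comment> \<open>The label \<open>y\<close> stands for the antichain that it decodes to, if this
    is a suitable one, and otherwise for a fixed antichain.\<close>
  define nn where "nn d y = (if Gd d (dc y) then dc y else ap n0 d)" for d y
  have Dnn: "Dt a ==> Dt b ==> Dt (%x. nn (a x) (b x))" for a b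
    by (rule Dt_comp2[of nn], unfold nn_def, intro dfi Ddc, assumption+)
  have nn: "Gd d (nn d y)" if "d <: DD" for d y using n0 that unfolding nn_def by simp
  let ?Q = "%u h. pf u <: DD & ps u <: DD & sb (pf u) (ps u) --> bij h ?V (Sp ?V (%y. ps u <: nn (pf u) y))"
  have mS: "y <: Sp ?V (%y. b <: nn d y) = (y <: ?V & b <: nn d y)" for y b d by (intro mem_Sp dfi Dnn)
  have "EX h. h <: Pw (prd ?V ?V) & ?Q u h" if u: "u <: prd DD DD" for u
  proof (cases "sb (pf u) (ps u)")
    case True
    define d b where "d = pf u" and "b = ps u"
    have db: "d <: DD" "b <: DD" "sb d b" using u True unfolding d_def b_def by auto
    obtain N where N: "Gd d N" "b <: N" using Gd_ex[OF db] by blast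
    have NP: "N <: Pw DD" using N(1) unfolding Gd_def by blast
    have e: "b <: nn d (ap c (pr N v))" if "v <: ?V" for v unfolding nn_def dc[OF NP that] using N by simp
    \<comment> \<open>If \<open>b\<close> belongs to \<open>N\<close>, it belongs to the antichain
      of \<open>ap c (pr N v)\<close> for all \<open>v\<close>. So the labels whose antichain
      contains \<open>b\<close> are equinumerous with \<open>bb k\<close>, and the pairs
      \<open>(b, u)\<close> can be matched bijectively with them.\<close>
    have "EX h. bij h ?V (Sp ?V (%y. b <: nn d y))"
    proof (rule CB[of "%v. ap c (pr N v)" "%y. y"])
      show "Dt (%v. ap c (pr N v))" "Dt (%y::nat. y)" by (intro dfi)+
      show "ap c (pr N x) <: Sp ?V (%y. b <: nn d y)" if "x <: ?V" for x unfolding mS using e that cc(1)[OF NP] by blast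
      show "x = y" if "x <: ?V" "y <: ?V" "ap c (pr N x) = ap c (pr N y)" for x y using cc(2)[OF NP that(1) NP that(2,3)] by blast
    qed (use mS in blast)+
    then obtain h where h: "bij h ?V (Sp ?V (%y. b <: nn d y))" by blast
    hence "h <: Pw (prd ?V ?V)" unfolding bij_def fto_def fon_def isf_def mem_Pw mS mem_prd by metis
    thus ?thesis using h unfolding d_def b_def by blast
  qed (auto intro: exI[of _ emp])
  moreover have "D (%p. ?Q (pf p) (ps p))" by (intro dfi Dnn)
  ultimately obtain L where L: "ALL u. u <: prd DD DD --> ?Q u (ap L u)" using AC[of ?Q "prd DD DD" "Pw (prd ?V ?V)"] by blast
  have bj: "bij (ap L (pr d b)) ?V (Sp ?V (%y. b <: nn d y))" if "d <: DD" "b <: DD" "sb d b" for d b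
    using L[rule_format, of "pr d b"] that by simp
  define l where "l d x = ap (ap L (pr d (pf x))) (ps x)" for d x
  have Dl: "Dt (%p. l (pf p) (ps p))" unfolding l_def by (intro dfi)
  have l1: "l d (pr b u) <: ?V & b <: nn d (l d (pr b u))" if "d <: DD" "b <: DD" "sb d b" "u <: ?V" for d b u
    using bijE(1)[OF bj[OF that(1-3)] that(4)] unfolding mS l_def by simp
  have l2: "b = e & u = w" if a: "d <: DD" "b <: DD" "sb d b" "e <: DD" "sb d e" "u <: ?V" "w <: ?V"
    "l d (pr b u) = l d (pr e w)" "isf (un (pj b) (pj e))" for d b e u w
  proof -
    have "b <: nn d (l d (pr b u))" "e <: nn d (l d (pr b u))" using l1 a by metis+
    hence "b = e" using nn[OF a(1)] a(9) unfolding Gd_def by blast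
    thus ?thesis using bijE(2)[OF bj[OF a(1-3)] a(6,7)] a(8) unfolding l_def by simp
  qed
  have l3: "EX b u. b <: DD & sb d b & u <: ?V & l d (pr b u) = y & isf (un z (pj b))" if a: "d <: DD" "z <: FX Z" "sb (pj d) z" "y <: ?V" for d z y
  proof -
    obtain b where b: "b <: nn d y" "isf (un z (pj b))" using nn[OF a(1), of y] a unfolding Gd_def by blast
    have bD: "b <: DD" "sb d b" using nn[OF a(1), of y] b(1) unfolding Gd_def mem_Pw by blast+
    obtain u where "u <: ?V" "ap (ap L (pr d b)) u = y" using bijE(3)[OF bj[OF a(1) bD], of y] b(1) a(4) unfolding mS by blast
    thus ?thesis using b(2) bD unfolding l_def by auto
  qed
  show ?thesis using Dl l1 l2 l3 by (intro exI[of _ l] conjI allI impI) blast+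
qed

definition rest :: nat where "rest = Sp IX (%m. ~ m <: Z & m ~= k)"
lemma rest: "m <: rest = (m <: IX & ~ m <: Z & m ~= k)" unfolding rest_def by (intro mem_Sp dfi)

definition wl :: "nat => nat => bool" where
  "wl x y = (x <: prd W (FX rest) & y <: prd W (FX rest) & sb (pf y) (pf x) & sb (ps y) (ps x))"
lemma D_wl: "Dt a ==> Dt b ==> D (%x. wl (a x) (b x))" by (rule D_comp2[of wl], unfold wl_def, intro dfi, assumption+)

lemma split: assumes p: "cond p" "cond q" "sb (rt q Z) p" "sb (rt q (sg k)) p" "sb (rt q rest) p" shows "sb q p"
  unfolding sb_def
proof (intro allI impI)
  fix u assume u: "u <: q"
  then obtain m x y where m: "u = pr (pr m x) y" "m <: IX" using cond_pr[OF p(2)] by blast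
  hence "u <: rt q Z | u <: rt q (sg k) | u <: rt q rest" using u by (auto simp: mem_rt rest)
  thus "u <: p" using p sbD by blast
qed

text \<open>A node together with a condition on the other columns is sent to the projection of the
  element of \<open>DD\<close> it has reached, its sequence of labels in column \<open>k\<close>,
  and that condition. For density, a node is prolonged step by step in agreement with the labels
  that \<open>p\<close> prescribes, and past the end of \<open>p\<close> a last step takes in the
  part of \<open>p\<close> on \<open>Z\<close>.\<close>

lemma embedding: "EX e. Dt e & (ALL x. x <: prd W (FX rest) --> sb (pj (bs (pf x) (dm (pf x)))) (e x)) &
    (ALL x q. x <: prd W (FX rest) --> q <: FX Z --> sb q (e x) --> sb q (pj (bs (pf x) (dm (pf x))))) &
    (ALL x y. wl x y --> F.le (e x) (e y)) &
    (ALL x p. x <: prd W (FX rest) --> F.le p (e x) --> (EX y. wl y x & F.le (e y) p)) &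
    (ALL x y. x <: prd W (FX rest) --> y <: prd W (FX rest) --> F.comp (e x) (e y) --> (EX u. wl u x & wl u y))"
proof -
  let ?V = "bb k"
  obtain l where Dl: "Dt (%p. l (pf p) (ps p))" and L1: "ALL d b u. d <: DD --> b <: DD --> sb d b --> u <: ?V --> l d (pr b u) <: ?V"
    and L2: "ALL d b e u w. d <: DD --> b <: DD --> sb d b --> e <: DD --> sb d e --> u <: ?V --> w <: ?V --> l d (pr b u) = l d (pr e w) -->
      isf (un (pj b) (pj e)) --> b = e & u = w"
    and L3: "ALL d z y. d <: DD --> z <: FX Z --> sb (pj d) z --> y <: ?V -->
      (EX b u. b <: DD & sb d b & u <: ?V & l d (pr b u) = y & isf (un z (pj b)))" using labels by (elim exE conjE)
  note Dl = Dt_comp2[of l, OF Dl]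
  define lb where "lb w = Im (dm w) (%i. pr (pr k i) (l (bs w i) (ap w i)))" for w
  have Dlb: "Dt a ==> Dt (%x. lb (a x))" for a by (rule Dt_comp[of lb], unfold lb_def, intro dfi Dl)
  have Dli: "Dt (%i. pr (pr k i) (l (bs w i) (ap w i)))" for w by (intro dfi Dl)
  have mlb: "u <: lb w = (EX i. i <: dm w & u = pr (pr k i) (l (bs w i) (ap w i)))" for u w
    unfolding lb_def mem_Im[OF Dli] ..
  define bas where "bas w = bs w (dm w)" for w
  define e where "e x = un (un (pj (bas (pf x))) (lb (pf x))) (ps x)" for x
  have De: "Dt e" unfolding e_def bas_def by (intro dfi Dlb)
  have bD: "bas w <: DD" if "isW w" for w unfolding bas_def using bs_DD[OF that] by simp
  have lV: "l (bs w i) (ap w i) <: ?V" if "isW w" "i <: dm w" for w i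
    using isW_val[OF that] L1 bs_DD[OF that(1), of i] that(2) by fastforce
  have lbF: "lb w <: FX (sg k)" if w: "isW w" for w
  proof -
    have "isf (lb w)" unfolding isf_def mlb by auto
    moreover have "bd lam (lb w)" unfolding lb_def using w rc_bd[OF rcl] unfolding isW_def by (intro bd_Im Dli) blast
    moreover have "EX m x. y = pr m x & m <: IX & x <: lam & r <: bb m" if yr: "pr y r <: lb w" for y r
    proof -
      obtain i where i: "i <: dm w" "y = pr k i" "r = l (bs w i) (ap w i)" using yr unfolding mlb pr_eq by blast
      have "dm w <: lam" using w unfolding isW_def by blast
      thus ?thesis using i lV[OF w i(1)] k lam_trans i(1) by blast
    qed
    ultimately have "cond (lb w)" unfolding cond_def by blast
    thus ?thesis unfolding FX mlb by auto
  qed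
  have dis: "isf (un p q)" if "p <: FX X" "q <: FX Y" "!!m. m <: X ==> ~ m <: Y" for p q X Y
  proof (rule FX_isf[OF that(1)])
    have "rt q X = emp" by (rule rt_emp[OF that(2)]) (use that(3) in blast)
    moreover have "un p emp = p" by (rule exten) simp
    ultimately show "isf (un p (rt q X))" using FX_cond[OF that(1)] unfolding cond_def by simp
  qed (rule FX_cond[OF that(2)])
  have eZ: "un (pj (bas w)) (lb w) <: FX (un Z (sg k))" if w: "isW w" for w
    using FX_un[OF FX_mono[OF proj[OF bD[OF w]], of "un Z (sg k)"] FX_mono[OF lbF[OF w], of "un Z (sg k)"]]
      dis[OF proj[OF bD[OF w]] lbF[OF w]] kZ by auto
  have eF: "e (pr w u) <: FF" if w: "isW w" "u <: FX rest" for w u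
    using cond_un[OF FX_cond[OF eZ[OF w(1)]] FX_cond[OF w(2)] dis[OF eZ[OF w(1)] w(2)]] unfolding e_def FF by (auto simp: rest)
  have eX: "x <: prd W (FX rest) ==> EX w u. x = pr w u & isW w & u <: FX rest" for x by (auto simp: W)
  have bmono: "sb (bas x) (bas y)" and lmono: "sb (lb x) (lb y)" if xy: "isW x" "isW y" "sb x y" for x y
  proof -
    have f: "isf y" using xy unfolding isW_def by blast
    have d: "i <: dm y" if "i <: dm x" for i using that xy(3) unfolding sb_def by auto
    have "bas x = bs y (dm x)" unfolding bas_def using bs_sb[OF xy(1) f xy(3)] by simp
    thus "sb (bas x) (bas y)" unfolding bas_def[of y] using bs_mono[of "dm x" "dm y" y] d by simp
    show "sb (lb x) (lb y)" unfolding sb_def mlb using d bs_sb[OF xy(1) f xy(3)] ap_sb[OF f xy(3)] by (metis mem_suc)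
  qed
  have mono: "F.le (e x) (e y)" if xy: "wl x y" for x y
  proof -
    obtain w u w' u' where w: "x = pr w u" "isW w" "u <: FX rest" "y = pr w' u'" "isW w'" "u' <: FX rest"
      using xy eX unfolding wl_def by blast
    have s: "sb w' w" "sb u' u" using xy w unfolding wl_def by auto
    show ?thesis unfolding le using eF w(2,3,5,6) unfolding w(1,4) e_def pf_pr ps_pr
      using unt_mono[OF bmono[OF w(5,2) s(1)], of t] lmono[OF w(5,2) s(1)] s(2) by (simp add: sb_unI)
  qed
  have cm: "EX u. wl u x & wl u y" if xy: "x <: prd W (FX rest)" "y <: prd W (FX rest)" "F.comp (e x) (e y)" for x y
  proof -
    obtain w u w' u' where w: "x = pr w u" "isW w" "u <: FX rest" "y = pr w' u'" "isW w'" "u' <: FX rest"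
      using xy eX by metis
    have f: "isf (un (e x) (e y))" using xy(3) comp eF w by simp
    have uu: "isf (un u u')" by (rule isf_sb[OF f]) (simp add: w e_def sb_unI)
    have "ap w i = ap w' i" if i: "i <: dm w & i <: dm w'" for i
    proof (rule ccontr)
      \<comment> \<open>At the first difference both nodes have reached the same element of
        \<open>DD\<close>. There equal labels with compatible projections come from equal entries,
        by \<open>L2\<close>.\<close>
      let ?Q = "%i. i <: dm w & i <: dm w' & ap w i ~= ap w' i"
      assume "ap w i ~= ap w' i"
      moreover have "D ?Q" by (intro dfi)
      ultimately obtain m where m: "?Q m" "ALL i. i <: m --> ~ ?Q i" using eps_min[of ?Q i] i by blast
      have "i <: dm w & i <: dm w'" if "i <: m" for i using that m(1) od_trans[OF isW_od] w(2,5) by blast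
      hence b: "bs w m = bs w' m" using m(2) by (intro exten) (auto simp: mem_bs)
      have "pr (pr k m) (l (bs w m) (ap w m)) <: un (e x) (e y)" "pr (pr k m) (l (bs w' m) (ap w' m)) <: un (e x) (e y)"
        unfolding w(1,4) e_def pf_pr ps_pr mem_un mlb using m(1) by blast+
      hence q: "l (bs w m) (ap w m) = l (bs w m) (ap w' m)" using isf_D[OF f] b by metis
      obtain b1 v1 where v1: "ap w m = pr b1 v1" "b1 <: DD" "v1 <: ?V" "sb (bs w m) b1" using isW_val[OF w(2)] m(1) by blast
      obtain b2 v2 where v2: "ap w' m = pr b2 v2" "b2 <: DD" "v2 <: ?V" "sb (bs w m) b2" using isW_val[OF w(5)] m(1) b by metis
      have sb12: "sb b1 (bas w)" "sb b2 (bas w')" unfolding bas_def using pf_bs[of m "dm w" w] pf_bs[of m "dm w'" w'] m(1) v1(1) v2(1) by simp_all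
      have "sb (pj b1) (e x)" "sb (pj b2) (e y)" unfolding w e_def pf_pr by (intro sb_unI(1) unt_mono sb12)+
      hence "isf (un (pj b1) (pj b2))" by (intro isf_sb[OF f]) (simp add: sb_unI)
      moreover have "bs w m <: DD" using bs_DD[OF w(2)] m(1) by simp
      ultimately have "b1 = b2 & v1 = v2" using L2 q v1 v2 by metis
      thus False using m(1) v1(1) v2(1) by simp
    qed
    hence s: "sb w w' | sb w' w" using isW_eq[OF w(2,5)] by blast
    have u2: "un u u' <: FX rest" using FX_un[OF w(3,6) uu] .
    show ?thesis
    proof (rule disjE[OF s])
      assume "sb w w'" thus ?thesis using w u2 by (intro exI[of _ "pr w' (un u u')"]) (simp add: wl_def W)
    next
      assume "sb w' w" thus ?thesis using w u2 by (intro exI[of _ "pr w (un u u')"]) (simp add: wl_def W)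
    qed
  qed
  have dense: "EX y. wl y x & F.le (e y) p" if xp: "x <: prd W (FX rest)" "F.le p (e x)" for x p
  proof -
    obtain w u where w: "x = pr w u" "isW w" "u <: FX rest" using xp eX by metis
    have cp: "cond p" and ep: "sb (e x) p" using xp(2) unfolding le FF by auto
    define z where "z = rt p Z"
    have z: "z <: FX Z" unfolding z_def using rt_FX[OF cp] .
    have wz: "sb (pj (bas w)) z" "sb (lb w) p" "sb u p" using ep sb_rt_FX[OF proj[OF bD[OF w(2)]], of p]
      unfolding w e_def z_def by auto
    \<comment> \<open>The nodes above \<open>w\<close> that do not conflict with \<open>p\<close>.
      They are closed under short unions, so chains of length \<open>a\<close> exist by
      \<open>short_chain\<close>.\<close>
    define W' where "W' = Sp W (%y. sb w y & isf (un z (pj (bas y))) & isf (un p (lb y)))"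
    have mW': "y <: W' = (isW y & sb w y & isf (un z (pj (bas y))) & isf (un p (lb y)))" for y
      unfolding W'_def W[symmetric] bas_def by (intro mem_Sp dfi Dlb)
    have fp: "isf p" "isf z" using cp z unfolding FX cond_def by auto
    have w0: "w <: W'" unfolding mW' using w(2) un_absorb2[OF wz(1)] un_absorb2[OF wz(2)] fp by simp
    have cl: "shc lam W'" unfolding shc_def
    proof (intro allI impI)
      fix C assume C: "EX x. x <: C" "ALL c. c <: C --> c <: W'" "ALL c d. c <: C --> d <: C --> sb c d | sb d c" "bd lam C"
      have U: "isW (Uu C)" "bs (Uu C) (dm (Uu C)) = Uu (Im C (%w. bs w (dm w)))"
        using isW_Uu[OF C(1,4)] C(2,3) mW' by blast+
      have di: "Dt (%w. bs w (dm w))" by (intro dfi)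
      have b: "y <: bas (Uu C) = (EX c. c <: C & y <: bas c)" for y unfolding bas_def U(2) mem_Un mem_Im[OF di] by blast
      have l: "y <: lb (Uu C) ==> EX c. c <: C & y <: lb c" for y
      proof -
        assume "y <: lb (Uu C)"
        then obtain i where i: "i <: dm (Uu C)" "y = pr (pr k i) (l (bs (Uu C) i) (ap (Uu C) i))" unfolding mlb by blast
        then obtain c where c: "c <: C" "i <: dm c" by auto
        have "isW c" "isf (Uu C)" using C(2) c mW' U(1) unfolding isW_def by blast+
        hence "y <: lb c" unfolding mlb using i c bs_sb[of c "Uu C" i] ap_sb[of "Uu C" c i] sb_Uu[OF c(1)] by auto
        thus ?thesis using c by blast
      qed
      have "sb w (Uu C)" using C(1,2) mW' sb_Uu sb_trans by blast
      moreover have "isf (un z (pj (bas (Uu C))))"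
      proof (rule isf_un[OF fp(2)])
        show "isf (pj (bas (Uu C)))" using proj[OF bD[OF U(1)]] unfolding FX cond_def by blast
        fix i y y' assume a: "pr i y <: z" "pr i y' <: pj (bas (Uu C))"
        then obtain c where c: "c <: C" "pr i y' <: pj (bas c)" using b by auto
        hence "isf (un z (pj (bas c)))" using C(2) mW' by blast
        thus "y = y'" using isf_D[of _ i y y'] a(1) c(2) by simp
      qed
      moreover have "isf (un p (lb (Uu C)))"
      proof (rule isf_un[OF fp(1)])
        show "isf (lb (Uu C))" using lbF[OF U(1)] unfolding FX cond_def by blast
        fix i y y' assume a: "pr i y <: p" "pr i y' <: lb (Uu C)"
        then obtain c where c: "c <: C" "pr i y' <: lb c" using l by blast
        hence "isf (un p (lb c))" using C(2) mW' by blast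
        thus "y = y'" using isf_D[of _ i y y'] a(1) c(2) by simp
      qed
      ultimately show "Uu C <: W'" unfolding mW' using U(1) by blast
    qed
    have lab: "un y (sg (pr (dm y) (pr b q))) <: W' & dm y <: dm (un y (sg (pr (dm y) (pr b q))))" if y: "y <: W'" and b: "b <: DD" "q <: ?V" "sb (bas y) b"
      and c: "isf (un z (pj b))" "!!r. pr (pr k (dm y)) r <: p ==> r = l (bas y) (pr b q)" for y b q
    proof -
      have yW: "isW y" "sb w y" "isf (un p (lb y))" using y mW' by auto
      note A = isW_add[OF yW(1) b(1,2) b(3)[unfolded bas_def]]
      let ?y = "un y (sg (pr (dm y) (pr b q)))"
      have l: "r <: lb ?y = (r <: lb y | r = pr (pr k (dm y)) (l (bas y) (pr b q)))" for r
      proof -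
        have f: "isf ?y" using A(1) unfolding isW_def by blast
        have "bs ?y i = bs y i" if "i <: suc (dm y)" for i using bs_sb[OF yW(1) f A(2) that] .
        moreover have "ap ?y i = ap y i" if "i <: dm y" for i using ap_sb[OF f A(2) that] .
        ultimately show ?thesis unfolding mlb A(3) mem_suc using A(5) unfolding bas_def by (metis mem_suc)
      qed
      have "isf (un p (lb ?y))"
      proof (rule isf_un[OF fp(1)])
        show "isf (lb ?y)" using lbF[OF A(1)] unfolding FX cond_def by blast
        fix i r r' assume "pr i r <: p" "pr i r' <: lb ?y"
        thus "r = r'" using c(2) isf_D[OF yW(3), of i r r'] unfolding l by auto
      qed
      thus ?thesis unfolding mW' using A sb_trans[OF yW(2) A(2)] c(1) unfolding bas_def by simp
    qed
    have step: "EX y'. y' <: W' & sb y y' & dm y <: dm y'" if y: "y <: W'" for y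
    proof -
      have yW: "isW y" "isf (un z (pj (bas y)))" using y mW' by auto
      have zy: "un z (pj (bas y)) <: FX Z" using FX_un[OF z proj[OF bD[OF yW(1)]] yW(2)] .
      obtain r where r: "r <: ?V" "!!r'. pr (pr k (dm y)) r' <: p ==> r' = r"
      proof (cases "EX r. pr (pr k (dm y)) r <: p")
        case True
        then obtain r where r: "pr (pr k (dm y)) r <: p" by blast
        have "r <: ?V" using cond_pr[OF cp r] by (metis pr_eq)
        thus thesis using that[of r] isf_D[OF fp(1) _ r] by blast
      next
        case False
        then show thesis using that bbne[OF k] by blast
      qed
      obtain b q where b: "b <: DD" "sb (bas y) b" "q <: ?V" "l (bas y) (pr b q) = r" "isf (un (un z (pj (bas y))) (pj b))"
        using L3 bD[OF yW(1)] zy r(1) sb_un2 by metis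
      have "isf (un z (pj b))" by (rule isf_sb[OF b(5)]) (simp add: sb_unI)
      thus ?thesis using lab[OF y b(1,3,2)] r(2) b(4) by (intro exI[of _ "un y (sg (pr (dm y) (pr b q)))"]) simp
    qed
    \<comment> \<open>A length beyond all places mentioned by \<open>p\<close>; a node of this
      length has passed all the labels that \<open>p\<close> prescribes.\<close>
    obtain a where a: "a <: lam" "emp <: a" "ALL i m r. i = a | a <: i --> ~ pr (pr m i) r <: p" using fresh[OF cp rc_emp[OF rcl]] by blast
    let ?S = "%i y y'. dm y <: dm y'"
    have dS: "D (%p. ?S (pf p) (pf (ps p)) (ps (ps p)))" by (intro dfi)
    obtain h where h: "Dt h" "ALL i. i <: a --> Lim h w i <: W' & h i <: W' & sb (Lim h w i) (h i) & dm (Lim h w i) <: dm (h i)" "Lim h w a <: W'"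
      using short_chain[OF rcl cl w0 a(1) dS] step by blast
    define y where "y = Lim h w a"
    have yW: "isW y" "sb w y" "isf (un z (pj (bas y)))" "y <: W'" using h(3) mW' unfolding y_def by auto
    have "i <: a --> i <: dm (h i)" (is "?R i") for i
    proof (rule eps_induct[of ?R])
      show "D ?R" by (intro dfi Dt_comp[OF h(1)])
      fix i assume IH: "!!m. m <: i ==> ?R m"
      show "?R i"
      proof
        assume i: "i <: a"
        have W: "isW (Lim h w i)" "isW (h i)" "dm (Lim h w i) <: dm (h i)" using h(2) i mW' by auto
        have "m <: dm (Lim h w i)" if "m <: i" for m
        proof -
          have "m <: a" using od_trans[OF oda[OF a(1)] i that] .
          hence "m <: dm (h m)" using IH that by blast
          thus ?thesis using sb_Lim(1)[OF h(1) that] unfolding sb_def by auto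
        qed
        hence "i <: dm (Lim h w i) | i = dm (Lim h w i)"
          using od_sub[OF od_mem[OF oda[OF a(1)] i] isW_od[OF W(1)]] by blast
        thus "i <: dm (h i)" using W(3) od_trans[OF isW_od[OF W(2)] W(3)] by auto
      qed
    qed
    hence hd: "i <: dm (h i)" if "i <: a" for i using that by blast
    have "i <: dm y" if ia: "i <: a" for i
    proof -
      obtain q where "pr i q <: h i" using hd[OF ia] by auto
      hence "pr i q <: y" using sb_Lim(1)[OF h(1) ia, of w] unfolding y_def by (rule sbD[rotated])
      thus ?thesis by auto
    qed
    hence ay: "a <: dm y | a = dm y" using od_sub[OF oda[OF a(1)] isW_od[OF yW(1)]] by blast
    have nf: "~ pr (pr k (dm y)) r <: p" for r using a(3) ay by blast
    have zy: "un z (pj (bas y)) <: FX Z" using FX_un[OF z proj[OF bD[OF yW(1)]] yW(3)] .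
    \<comment> \<open>From here on \<open>p\<close> prescribes no label, so \<open>b\<close> may be
      any extension, in particular one whose projection contains the part of \<open>p\<close> on
      \<open>Z\<close>.\<close>
    obtain b where b: "b <: DD" "sb (bas y) b" "sb (un z (pj (bas y))) (pj b)" using lift[OF bD[OF yW(1)] zy] by auto
    obtain q where q: "q <: ?V" using bbne[OF k] by blast
    let ?y = "un y (sg (pr (dm y) (pr b q)))"
    have "isf (un z (pj b))" using un_absorb[of z "pj b"] b(3) proj[OF b(1)] unfolding FX cond_def by simp
    hence y': "?y <: W'" using lab[OF yW(4) b(1) q b(2)] nf by blast
    hence yW': "isW ?y" "sb w ?y" "isf (un p (lb ?y))" using mW' by auto
    have A: "bas ?y = b" "dm ?y = suc (dm y)" unfolding bas_def using isW_add(3,4)[OF yW(1) b(1) q b(2)[unfolded bas_def]] by auto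
    have "sb (rt p (sg k)) (lb ?y)" unfolding sb_def
    proof (intro allI impI)
      fix s assume s: "s <: rt p (sg k)"
      then obtain i r where s': "s = pr (pr k i) r" "s <: p" "i <: lam" using cond_pr[OF cp] unfolding mem_rt by fastforce
      hence "i ~= a & ~ a <: i" using a(3) by blast
      hence "i <: a" using od_tri[OF oda[OF a(1)] oda[OF s'(3)]] by blast
      hence "i <: dm ?y" unfolding A(2) using ay od_trans[OF isW_od[OF yW(1)]] by auto
      hence "pr (pr k i) (l (bs ?y i) (ap ?y i)) <: lb ?y" unfolding mlb by blast
      moreover have "r = l (bs ?y i) (ap ?y i)" using isf_D[OF yW'(3), of "pr k i"] s' calculation by simp
      ultimately show "s <: lb ?y" using s'(1) by simp
    qed
    moreover have "sb z (pj (bas ?y))" using b(3) A(1) by simp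
    ultimately have "sb (rt p Z) (e (pr ?y (rt p rest)))" "sb (rt p (sg k)) (e (pr ?y (rt p rest)))" "sb (rt p rest) (e (pr ?y (rt p rest)))"
      unfolding e_def pf_pr ps_pr z_def by (simp_all add: sb_unI)
    hence s: "sb p (e (pr ?y (rt p rest)))" using split[OF _ cp] eF[OF yW'(1) rt_FX[OF cp]] unfolding FF by blast
    have "sb u (rt p rest)" using sb_rt_FX[OF w(3) wz(3)] .
    hence "wl (pr ?y (rt p rest)) x" unfolding wl_def w using yW' w rt_FX[OF cp] by (simp add: W)
    moreover have "F.le (e (pr ?y (rt p rest))) p" unfolding le using s eF[OF yW'(1) rt_FX[OF cp]] cp FF by blast
    ultimately show ?thesis by blast
  qed
  have "sb q (pj (bs (pf x) (dm (pf x))))" if x: "x <: prd W (FX rest)" "q <: FX Z" "sb q (e x)" for x q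
    unfolding sb_def
  proof (intro allI impI)
    fix s assume s: "s <: q"
    obtain w u where w: "x = pr w u" "isW w" "u <: FX rest" using x eX by metis
    obtain m i r where m: "s = pr (pr m i) r" using cond_pr[OF FX_cond[OF x(2)] s] by blast
    hence mZ: "m <: Z" using FXD[OF x(2)] s by blast
    hence "~ s <: lb w" "~ s <: u" using FXD[OF lbF[OF w(2)]] FXD[OF w(3)] kZ m rest by auto
    moreover have "s <: e x" using x(3) s sbD by blast
    ultimately show "s <: pj (bs (pf x) (dm (pf x)))" unfolding e_def bas_def w pf_pr ps_pr by auto
  qed
  moreover have "sb (pj (bs (pf x) (dm (pf x)))) (e x)" for x unfolding e_def bas_def by (simp add: sb_unI)
  ultimately show ?thesis using De mono dense cm by (intro exI[of _ e]) blast
qed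

end

section \<open>The strategy of player I\<close>

context columns begin

lemma good_mono: "good X Y x q s ==> sb s s' ==> good X Y x q s'" unfolding good_def using sb_trans by meson

lemma rt_Uu: "rt (Uu C) X = Uu (Im C (%q. rt q X))"
proof (rule exten)
  have d: "Dt (%q. rt q X)" by (intro dfi)
  show "z <: rt (Uu C) X = (z <: Uu (Im C (%q. rt q X)))" for z unfolding mem_rt mem_Un mem_Im[OF d] by (auto simp: mem_rt)
qed

lemma sseq_long: assumes "sseq s" "a <: lam" shows "EX s'. sseq s' & sb s s' & sb a (dm s')"
proof -
  note s = sseq_fto[OF assms(1)]
  have fs: "fon s (dm s)" using s fon_dm by blast
  show ?thesis
  proof (cases "dm s <: a")
    case True
    let ?T = "%i. if i <: dm s then ap s i else emp"
    have T: "Dt ?T" by (intro dfi)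
    have "fto (Lam a ?T) a lam"
      by (rule fto_Lam[OF T]) (use fto_ap[of s "dm s" lam] s rc_emp[OF rcl] in \<open>simp del: mem_dm\<close>)
    moreover have "sb s (Lam a ?T)" unfolding sb_def
    proof (intro allI impI)
      fix z assume z: "z <: s"
      then obtain i where "z = pr i (ap s i)" "i <: dm s" using fon_iff[OF fs] s unfolding isf_def by metis
      thus "z <: Lam a ?T" using od_trans[OF oda[OF assms(2)] True] by (simp add: pr_Lam[OF T] del: mem_dm)
    qed
    moreover have "dm (Lam a ?T) = a" using fon_Lam[OF T, of a] fon_dm by blast
    ultimately show ?thesis unfolding sseq_def using assms(2) by (intro exI[of _ "Lam a ?T"]) auto
  next
    case False
    hence "sb a (dm s)" using od_tri[OF oda[OF assms(2)] oda, of "dm s"] s od_trans[OF oda, of "dm s" a] unfolding sb_def by blast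
    thus ?thesis using assms(1) by (intro exI[of _ s]) simp
  qed
qed

lemma play_rs: assumes "play a t" "b <: a" "a <: lam" shows "play b (rs t b)" "n <: b ==> ap (rs t b) n = ap t n"
proof -
  have f: "fon t a" using assms(1) unfolding play_def by blast
  have sub: "n <: a" if "n <: b" for n using od_trans[OF oda[OF assms(3)] assms(2) that] .
  have e: "ap (rs t b) n = ap t n" if "n <: b" for n
    using ap_rs[OF _ fon_ap[OF f sub[OF that]] that] f unfolding fon_def by blast
  thus "n <: b ==> ap (rs t b) n = ap t n" .
  have "m <: b ==> n <: m ==> n <: b" for m n using od_trans[OF oda[OF lam_trans[OF assms(3,2)]]] .
  thus "play b (rs t b)" using assms(1) sub e fon_rs[OF f sub] unfolding play_def by simp
qed

lemma seg_rs: "seg G n t ==> b <: dm t ==> seg G n (rs t b) & dm (rs t b) = b"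
proof -
  assume a: "seg G n t" "b <: dm t"
  then obtain a where a': "a <: lam" "play a t" "dm t = a" "ALL b. b <: a --> F.memG G (F.chk (pr b (ap t b))) n"
    using play_dm unfolding seg_def by blast
  have b: "b <: a" using a(2) a'(3) by blast
  note p = play_rs(1)[OF a'(2) b a'(1)]
  have "F.memG G (F.chk (pr c (ap (rs t b) c))) n" if "c <: b" for c
    using play_rs(2)[OF a'(2) b a'(1) that] a'(4) od_trans[OF oda[OF a'(1)] b that] by simp
  thus ?thesis using p play_dm[OF p] lam_trans[OF a'(1) b] unfolding seg_def by blast
qed

lemma even_cases: assumes "Ev a" shows "(EX d. a = suc (suc d) & Ev d) | (ALL d. a ~= suc d)"
  using Ev[of a] Ev[of "suc d" for d] assms suc_eq Ev by metis

lemma limit_suc: assumes "od a" "ALL d. a ~= suc d" "b <: a" shows "EX c. c <: a & b <: c & Ev c"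
proof -
  have "suc b <: a" using od_suc_le[OF assms(1,3)] assms(2) by blast
  moreover hence "suc (suc b) <: a" using od_suc_le[OF assms(1)] assms(2) by blast
  ultimately show ?thesis using Ev_suc[of "suc b"] by (metis mem_suc)
qed

end

locale playI = columns +
  fixes X Y x p k c :: nat
  assumes XY: "sb X Y" and pY: "p <: FX Y"
    and pfn: "F.Frc p (%G. isfn G x)"
    and gda: "q <: FX Y ==> sb p q ==> gd X Y x q"
    and kI: "k <: IX" and kY: "~ k <: Y"
    and cV: "w <: prd Sq (FX Y) ==> ap c w <: bb k"
    and ci: "w <: prd Sq (FX Y) ==> y <: prd Sq (FX Y) ==> ap c w = ap c y ==> w = y"
begin

definition ut :: "nat => nat" where "ut t = Uu (rg t)"
lemma Dt_ut [dfi]: "Dt a ==> Dt (%x. ut (a x))" by (rule Dt_comp[of ut], unfold ut_def, intro dfi)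

text \<open>A move \<open>s\<close> of player I ends with the place in column \<open>k\<close> at which a pair \<open>(s0, q)\<close> is coded, where \<open>s0\<close> is the rest of \<open>s\<close>.
  The play thus carries an increasing sequence of conditions \<open>q\<close> forcing its moves to be initial segments
  of \<open>x\<close>, and \<open>vd\<close> says how it can be continued.\<close>

definition DQ :: "nat set => nat => nat => bool" where
  "DQ G s q = (EX s0 i. s = snoc s0 i & i <: lam & s0 <: Sq & q <: FX Y & gv k c G (pr i (pr s0 q)))"
lemma DG_DQ [dfi]: assumes "Dt a" "Dt b" shows "F.DG (%G x. DQ G (a x) (b x))"
  unfolding DQ_def by (intro dfi Dt_comp[OF assms(1)] Dt_comp[OF assms(2)])

definition vd :: "nat set => nat => nat => nat => bool" where
  "vd G t s0 q = (s0 <: Sq & q <: FX Y & sb (ut t) s0 & sb p q & rt q X : G &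
    (ALL b q'. b <: dm t --> Ev b --> DQ G (ap t b) q' --> sb q' q) & dx x q (ut t) & good X Y x q s0)"
lemma DG_vd: assumes "Dt a" "Dt b" "Dt d" shows "F.DG (%G x. vd G (a x) (b x) (d x))"
  unfolding vd_def by (intro dfi Dt_comp[OF assms(1)] Dt_comp[OF assms(2)] Dt_comp[OF assms(3)] assms D_Ev[THEN F.DG_D] D_sb[THEN F.DG_D]
     D_dx[THEN F.DG_D] D_good[THEN F.DG_D])

text \<open>Only places from the length of the position on are inspected. So a code written at the
  first of them, while column \<open>k\<close> is still undecided there, dictates the move;
  \<open>lift0\<close> depends on this.\<close>

definition CI :: "nat set => nat => bool" where
  "CI G w = (~ pf (ps w) <: dm (ut (pf w)) & (EX s0 q. pr s0 q <: prd Sq (FX Y) & gv k c G (pr (pf (ps w)) (pr s0 q)) & sb (ut (pf w)) s0 &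
     ps (ps w) = snoc s0 (pf (ps w)) & (vd G (pf w) s0 q | ~ (EX s0 q. vd G (pf w) s0 q))))"
lemma DG_CI: "F.DG CI" unfolding CI_def by (intro dfi DG_vd D_sb[THEN F.DG_D])

definition sI :: "nat set => nat => bool" where "sI = least CI"
lemma DG_sI: "F.DG sI" unfolding sI_def by (rule DG_least[OF DG_CI])

lemma gvu: assumes "F.gen G" "gv k c G (pr i (pr s q))" "gv k c G (pr i (pr s' q'))" "pr s q <: prd Sq (FX Y)" "pr s' q' <: prd Sq (FX Y)"
  shows "s = s' & q = q'"
  using gv_unique[OF assms, of] ci pr_eq by blast

lemma snoc_inj: assumes "snoc s i = snoc s' i'" "sseq s" "sseq s'" "i <: lam" "i' <: lam" shows "i = i'"
proof -
  have "suc (dm s) = suc (dm s')" using snoc(4)[OF assms(2,4)] snoc(4)[OF assms(3,5)] assms(1) by simp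
  hence "dm s = dm s'" by (rule suc_eq)
  thus ?thesis using snoc(5)[OF assms(2,4)] snoc(5)[OF assms(3,5)] assms(1) by simp
qed

text \<open>The last entry of a move tells where its code is to be read, and the column has one
  value there.\<close>

lemma DQ_unique: assumes "F.gen G" "DQ G s q" "DQ G s q'" shows "q = q'"
proof -
  obtain s0 i s0' i' where s: "s = snoc s0 i" "i <: lam" "s0 <: Sq" "q <: FX Y" "gv k c G (pr i (pr s0 q))"
    "s = snoc s0' i'" "i' <: lam" "s0' <: Sq" "q' <: FX Y" "gv k c G (pr i' (pr s0' q'))" using assms(2,3) unfolding DQ_def by blast
  have "i = i'" using snoc_inj[of s0 i s0' i'] s Sq by simp
  thus ?thesis using gvu[OF assms(1), of i s0 q s0' q'] s by simp
qed

lemma CI_unique: assumes "F.gen G" "CI G (pr t (pr i s))" "CI G (pr t (pr i s'))" shows "s = s'"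
proof -
  obtain s0 q s0' q' where "pr s0 q <: prd Sq (FX Y)" "gv k c G (pr i (pr s0 q))" "s = snoc s0 i"
    "pr s0' q' <: prd Sq (FX Y)" "gv k c G (pr i (pr s0' q'))" "s' = snoc s0' i"
    using assms(2,3) unfolding CI_def pf_pr ps_pr by blast
  thus ?thesis using gvu[OF assms(1)] by blast
qed

lemma sI_total: assumes G: "F.gen G" and a: "a <: lam" "play a t" shows "EX s. legal t s & sI G (pr t s)"
proof -
  have u: "sseq (ut t)" unfolding ut_def using play_Uu(1)[OF a(2,1)] .
  have "EX s0 q. pr s0 q <: prd Sq (FX Y) & sb (ut t) s0 & (vd G t s0 q | ~ (EX s0 q. vd G t s0 q))"
  proof (cases "EX s0 q. vd G t s0 q")
    case True thus ?thesis unfolding vd_def by auto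
  next
    case False
    have "pr (ut t) p <: prd Sq (FX Y)" using u pY Sq by simp
    thus ?thesis using False sb_refl by blast
  qed
  then obtain s0 q where s0: "pr s0 q <: prd Sq (FX Y)" "sb (ut t) s0" "vd G t s0 q | ~ (EX s0 q. vd G t s0 q)" by blast
  have "D (%_::nat. True)" by (rule dfi)
  then obtain i where i: "i <: lam" "dm (ut t) <: i" "gv k c G (pr i (pr s0 q))"
    using gv_ex[OF G kI cV[OF s0(1)], of "%_. True" "dm (ut t)"] sseq_fto[OF u] by blast
  have "~ i <: dm (ut t)" using not_mem_2[OF i(2)] .
  hence "CI G (pr t (pr i (snoc s0 i)))" unfolding CI_def pf_pr ps_pr using s0 i(3) by blast
  then obtain s where s: "sI G (pr t s)" unfolding sI_def using least_ex[OF G DG_CI i(1)] by blast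
  then obtain s0 i q where "s = snoc s0 i" "i <: lam" "s0 <: Sq" "sb (ut t) s0" unfolding sI_def least_def CI_def by auto
  hence "legal t s" using legal_snoc[OF a(2,1)] Sq unfolding ut_def by simp
  thus ?thesis using s by blast
qed

definition HH :: "nat set => nat => nat => bool" where
  "HH G t b = (EX s0 i q. ap t b = snoc s0 i & i <: lam & gv k c G (pr i (pr s0 q)) & vd G (rs t b) s0 q)"
lemma DG_HH: assumes "Dt a" "Dt b" shows "F.DG (%G x. HH G (a x) (b x))"
  unfolding HH_def by (intro dfi DG_vd Dt_comp[OF assms(1)] Dt_comp[OF assms(2)])

lemma HH_DQ: "HH G t b ==> EX s0 q. DQ G (ap t b) q & vd G (rs t b) s0 q & sb s0 (ap t b)"
  unfolding HH_def DQ_def vd_def using snoc(2) Sq by metis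

lemma dx_Un: "(!!z. z <: s ==> EX q s'. z <: s' & sb q r & dx x q s') ==> r <: FF ==> dx x r s"
  unfolding dx_def using F.Frc_le cond_sub unfolding le FF by metis

text \<open>Take an extension \<open>s2\<close> of \<open>s1\<close> at least as long as
  \<open>s\<close>. Goodness gives an extension of \<open>q\<close> that forces \<open>s2\<close>
  into \<open>x\<close>; as \<open>s\<close> is forced into \<open>x\<close> too, \<open>s2\<close>
  extends \<open>s\<close>.\<close>

lemma dx_sub: assumes "q <: FX Y" "sb p q" "dx x q s" "sseq s" "good X Y x q s1" "sseq s1"
  shows "EX s2. sseq s2 & sb s s2 & sb s1 s2 & good X Y x q s2"
proof -
  have cq: "cond q" using FX_cond assms(1) by blast
  obtain s2 where s2: "sseq s2" "sb s1 s2" "sb (dm s) (dm s2)" using sseq_long[OF assms(6), of "dm s"] sseq_fto[OF assms(4)] by blast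
  obtain r where r: "r <: FX Y" "sb q r" "dx x r s2" using assms(5) s2 rt_cond[OF assms(1), of X] sb_refl unfolding good_def by meson
  obtain H where H: "F.gen H" "r : H" using gen_ex FX_cond r(1) by blast
  have m: "F.memG H (F.chk z) x" if "z <: s | z <: s2" for z
    using that assms(3) r(3) F.Frc_D[OF _ H(1)] H(2) G_sub[OF H r(2)] unfolding dx_def by blast
  have fn: "isfn H x" using F.Frc_D[OF pfn H(1)] G_sub[OF H sb_trans[OF assms(2) r(2)]] by blast
  have "sb s s2" unfolding sb_def
  proof (intro allI impI)
    fix z assume z: "z <: s"
    then obtain i y where zi: "z = pr i y" using sseq_fto[OF assms(4)] unfolding isf_def by blast
    hence "i <: dm s2" using s2(3) z unfolding sb_def by auto
    then obtain y' where y': "pr i y' <: s2" by auto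
    hence "y' = y" using m z zi fn unfolding isfn_def by blast
    thus "z <: s2" using y' zi by simp
  qed
  thus ?thesis using s2 good_mono[OF assms(5)] by blast
qed

lemma un_FX: assumes "q <: FX Y" "u <: FX X" "sb (rt q X) u" shows "un q u <: FX Y" "rt (un q u) X = u"
proof -
  have "isf (un u (rt q X))" using un_absorb2[OF assms(3)] FX_cond[OF assms(2)] unfolding cond_def by simp
  hence "isf (un u q)" using FX_isf[OF assms(2) FX_cond[OF assms(1)]] by blast
  moreover have "un u q = un q u" by (rule exten) auto
  ultimately show "un q u <: FX Y" using FX_un[OF assms(1) FX_mono[OF assms(2) XY]] by simp
  show "rt (un q u) X = u" using rt_un rt_id[OF assms(2) sb_refl] un_absorb[OF assms(3)] by simp
qed

text \<open>After an answer of player II, goodness of the previous pair gives a condition that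
  forces this answer into \<open>x\<close>; at limits, and at the start, the earlier conditions are
  united with \<open>p\<close>. Then \<open>gda\<close> and \<open>dx_sub\<close> provide the next
  good pair.\<close>

lemma valid_ex: assumes G: "F.gen G" "p : G" and t: "play a t" "a <: lam" "Ev a"
    and H: "!!b. b <: a ==> Ev b ==> HH G t b"
  shows "EX s0 q. vd G t s0 q"
proof -
  have oa: "od a" using oda t(2) .
  have dt: "dm t = a" using play_dm[OF t(1)] .
  have su: "sseq (ut t)" unfolding ut_def using play_Uu(1)[OF t(1,2)] .
  let ?Q = "%G u. Ev (pf u) --> DQ G (ap t (pf u)) (ps u)"
  have "F.DG ?Q" by (intro dfi D_Ev[THEN F.DG_D])
  moreover have "EX q. q <: FX Y & ?Q G (pr b q)" if "b <: a" for b
    using HH_DQ[OF H[OF that]] pY unfolding DQ_def by (cases "Ev b") auto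
  ultimately obtain h where h0: "fto h a (FX Y)" "ALL b. b <: a --> ?Q G (pr b (ap h b))"
    using F_dist[OF G(1), of ?Q a "FX Y"] t(2) by blast
  have hq: "DQ G (ap t b) (ap h b)" if "b <: a" "Ev b" for b using h0(2) that by simp
  have hv: "EX s0. vd G (rs t b) s0 (ap h b) & sb s0 (ap t b)" if "b <: a" "Ev b" for b
    using HH_DQ[OF H[OF that]] DQ_unique[OF G(1) hq[OF that]] by blast
  have hm: "sb (ap h b) (ap h d)" if "b <: d" "d <: a" "Ev b" "Ev d" for b d
  proof -
    have "b <: a" using od_trans[OF oa that(2,1)] .
    moreover have "dm (rs t d) = d" "ap (rs t d) b = ap t b" using play_rs[OF t(1) that(2) t(2)] play_dm that(1) by auto
    ultimately show ?thesis using hv[OF that(2,4)] hq[of b] that(1,3) unfolding vd_def by metis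
  qed
  have "EX q. q <: FX Y & sb p q & rt q X : G & (ALL b. b <: a --> Ev b --> sb (ap h b) q) & dx x q (ut t)"
  proof (rule disjE[OF even_cases[OF t(3)]])
    assume "EX d. a = suc (suc d) & Ev d"
    then obtain d where d: "a = suc (suc d)" "Ev d" by blast
    hence da: "d <: a" "suc d <: a" by auto
    obtain s0 where s0: "vd G (rs t d) s0 (ap h d)" "sb s0 (ap t d)" using hv[OF da(1) d(2)] by blast
    let ?q = "ap h d" let ?s = "ap t (suc d)"
    have ts: "sb (ap t b) ?s" if "b <: a" for b using t(1) that d(1) da unfolding play_def by (metis mem_suc sb_refl)
    have ss: "sseq ?s" "sb s0 ?s" using t(1) da(2) sb_trans[OF s0(2) ts[OF da(1)]] unfolding play_def by blast+
    have q: "?q <: FX Y" "sb p ?q" "rt ?q X : G" "good X Y x ?q s0" using s0(1) unfolding vd_def by blast+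
    \<comment> \<open>Goodness makes the parts on \<open>X\<close> of the suitable conditions
      \<open>r\<close> dense below \<open>rt ?q X\<close>. One of these parts therefore lies in
      \<open>G\<close>, although \<open>r\<close> itself need not.\<close>
    let ?R = "%u. EX r. r <: FX Y & sb ?q r & rt r X = u & dx x r ?s"
    have "D ?R" by (intro dfi)
    moreover have "EX u'. u' <: FX X & sb u u' & ?R u'" if u: "u <: FX X" "sb (rt ?q X) u" for u
    proof -
      obtain r where "r <: FX Y" "sb ?q r" "sb u (rt r X)" "dx x r ?s" using q(4) u ss unfolding good_def by blast
      thus ?thesis using rt_cond by blast
    qed
    ultimately obtain r where r: "rt r X : G" "r <: FX Y" "sb ?q r" "dx x r ?s"
      using FX_dense[OF G(1) _ q(3) rt_cond[OF q(1)], of ?R] by blast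
    have "sb (ap h b) r" if "b <: a" "Ev b" for b
    proof -
      have "b <: d | b = d" using that d(1,2) Ev_suc[of d] by auto
      thus ?thesis using hm[of b d] that d(2) da(1) sb_trans r(3) by blast
    qed
    moreover have "sb (ut t) ?s" unfolding ut_def
    proof (rule Uu_sb)
      have f: "fon t a" using t(1) unfolding play_def by blast
      show "sb e ?s" if "e <: rg t" for e using that ts unfolding mem_rg fon_iff[OF f] by blast
    qed
    hence "dx x r (ut t)" using r(4) unfolding dx_def sb_def by blast
    ultimately show ?thesis using r sb_trans[OF q(2) r(3)] by blast
  next
    assume lim: "ALL d. a ~= suc d"
    have d: "Dt (ap h)" "Dt (%q. rt q X)" by (intro dfi)+
    let ?C = "un (sg p) (Im (Sp a Ev) (ap h))"
    have C: "q <: ?C = (q = p | (EX b. b <: a & Ev b & q = ap h b))" for q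
    proof -
      have "b <: Sp a Ev = (b <: a & Ev b)" for b by (intro mem_Sp dfi)
      thus ?thesis by (auto simp: mem_Im[OF d(1)])
    qed
    have CY: "q <: FX Y" "sb p q" "rt q X : G" if "q <: ?C" for q
      using that hv pY sb_refl G_sub[OF G sb_rt] unfolding C vd_def by blast+
    have ch: "sb q q' | sb q' q" if q: "q <: ?C" "q' <: ?C" for q q'
    proof (cases "q = p | q' = p")
      case False
      then obtain b b' where b: "b <: a" "Ev b" "q = ap h b" "b' <: a" "Ev b'" "q' = ap h b'" using q unfolding C by blast
      thus ?thesis using hm[of b b'] hm[of b' b] od_tri[OF od_mem[OF oa b(1)] od_mem[OF oa b(4)]] sb_refl by metis
    qed (use CY q in blast)
    have fC: "isf (un q q')" if q: "q <: ?C" "q' <: ?C" for q q'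
      using ch[OF q] un_absorb[of q q'] un_absorb2[of q' q] CY(1)[OF q(1)] CY(1)[OF q(2)] unfolding FX cond_def by metis
    have "b <: Sp a Ev ==> b <: a" for b using mem_Sp[of Ev b a] D_Ev[OF Dt_id] by blast
    hence "bd lam (Sp a Ev)" using bd_sub[OF rc_emp[OF rcl] rc_bd[OF rcl t(2)]] by blast
    hence bC: "bd lam ?C" unfolding sg_def by (intro bd_un bd_up bd_Im rcl d)
    let ?q = "Uu ?C"
    have cq: "cond ?q" using CY(1) FX_cond fC by (intro cond_Uu[OF _ _ bC]) blast+
    hence qY: "?q <: FX Y" using CY(1) FXD unfolding FX[of ?q] mem_Un by blast
    have hsb: "sb (ap h b) ?q" if "b <: a" "Ev b" for b using that C by (intro sb_Uu) blast
    have "rt ?q X : G" unfolding rt_Uu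
      by (rule G_Uu[OF G(1) _ bd_Im[OF bC d(2)]]) (use CY(3) in \<open>auto simp: mem_Im[OF d(2)]\<close>)
    moreover have "dx x ?q (ut t)"
    proof (rule dx_Un)
      show "?q <: FF" using cq FF by blast
      fix z assume "z <: ut t"
      then obtain b s where b: "pr b s <: t" "z <: s" unfolding ut_def by auto
      have f: "fon t a" using t(1) unfolding play_def by blast
      have ba: "b <: a" "s = ap t b" using b(1) unfolding fon_iff[OF f] by auto
      obtain e where e: "e <: a" "b <: e" "Ev e" using limit_suc[OF oa lim ba(1)] by blast
      have "z <: ut (rs t e)" unfolding ut_def mem_Un mem_rg mem_rs using b e(2) by blast
      moreover have "dx x (ap h e) (ut (rs t e))" using hv[OF e(1,3)] unfolding vd_def by blast
      ultimately show "EX q s'. z <: s' & sb q ?q & dx x q s'" using hsb[OF e(1,3)] by blast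
    qed
    moreover have "sb p ?q" using C by (intro sb_Uu) blast
    ultimately show ?thesis using qY hsb by blast
  qed
  then obtain q where q: "q <: FX Y" "sb p q" "rt q X : G" "ALL b. b <: a --> Ev b --> sb (ap h b) q" "dx x q (ut t)" by blast
  let ?R = "%u. EX s. sseq s & good X Y x (un q u) s"
  have "D ?R" by (intro dfi)
  moreover have "EX u'. u' <: FX X & sb u u' & ?R u'" if u: "u <: FX X" "sb (rt q X) u" for u
  proof -
    note quru = un_FX[OF q(1) u]
    obtain u' s where u': "u' <: FX X" "sb u u'" "sseq s" "good X Y x (un (un q u) u') s"
      using gda[OF quru(1)] q(2) unfolding gd_def quru(2) by (metis sb_unI(1))
    moreover have "un (un q u) u' = un q u'" using u'(2) by (intro exten) (auto simp: sb_def)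
    ultimately show ?thesis by metis
  qed
  ultimately obtain u where u: "u : G" "u <: FX X" "sb (rt q X) u" "?R u" using FX_dense[OF G(1) _ q(3) rt_cond[OF q(1)], of ?R] by blast
  let ?q = "un q u"
  note qu = un_FX(1)[OF q(1) u(2,3)] note ru = un_FX(2)[OF q(1) u(2,3)]
  have dq: "dx x ?q (ut t)" using dx_le[OF q(5)] qu FX_cond FF by simp
  obtain s where s: "sseq s" "good X Y x ?q s" using u(4) by blast
  obtain s2 where s2: "sseq s2" "sb (ut t) s2" "good X Y x ?q s2"
    using dx_sub[OF qu _ dq su s(2,1)] q(2) by (auto simp: sb_unI)
  have "sb q' ?q" if "b <: a" "Ev b" "DQ G (ap t b) q'" for b q'
    using DQ_unique[OF G(1) hq[OF that(1,2)] that(3)] q(4) that(1,2) sb_unI(1) by blast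
  hence "vd G t s2 ?q" unfolding vd_def dt using s2 qu q(2) ru u(1) dq Sq by (auto simp: sb_unI)
  thus ?thesis by blast
qed

text \<open>At a least stage where this fails all earlier moves are valid, so that a valid pair
  exists and the strategy was bound to encode one.\<close>

lemma run_valid: assumes G: "F.gen G" "p : G" and r: "run Ev sI G n" and t: "seg G n t" "b <: dm t" "Ev b"
  shows "HH G t b"
proof (rule ccontr)
  assume n: "~ ?thesis"
  let ?Q = "%G b. EX t. seg G n t & b <: dm t & Ev b & ~ HH G t b"
  have "F.DG ?Q" by (intro dfi DG_HH D_Ev[THEN F.DG_D])
  then obtain e where e: "?Q G e" "ALL d. d <: e --> ~ ?Q G d" using F.DG_min[OF G(1), of ?Q b] t n by blast
  then obtain t where t: "seg G n t" "e <: dm t" "Ev e" "~ HH G t e" by blast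
  obtain a where a: "a <: lam" "play a t" "dm t = a" using t(1) play_dm unfolding seg_def by blast
  let ?t = "rs t e"
  have rt': "seg G n ?t" "dm ?t = e" "play e ?t" "e <: lam" using seg_rs[OF t(1,2)] play_rs(1)[OF a(2)] a t(2) lam_trans by auto
  have "HH G ?t d" if d: "d <: e" "Ev d" for d
  proof -
    have "d <: dm ?t" using d(1) unfolding rt'(2) .
    thus ?thesis using e(2)[rule_format, OF d(1)] d(2) rt'(1) by blast
  qed
  then obtain s1 q1 where v: "vd G ?t s1 q1" using valid_ex[OF G rt'(3,4) t(3)] by blast
  obtain s where s: "F.memG G (F.chk (pr e s)) n" "sI G (pr ?t s)" using r rt'(1,2) t(3) unfolding run_def by metis
  have "F.memG G (F.chk (pr e (ap t e))) n" using t(1,2) play_dm unfolding seg_def by metis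
  hence se: "ap t e = s" using r s(1) unfolding run_def by blast
  obtain i s0 q where "i <: lam" "gv k c G (pr i (pr s0 q))" "s = snoc s0 i" "vd G ?t s0 q | ~ (EX s0 q. vd G ?t s0 q)"
    using s(2) unfolding sI_def least_def CI_def by auto
  hence "HH G t e" unfolding HH_def se using v by blast
  thus False using t(4) by blast
qed

end

section \<open>The conditions deciding a run of player I's strategy\<close>

lemma (in columns) shc_FX: "shc lam (FX Z)"
proof -
  have "Uu C <: FX Z" if C: "EX c. c <: C" "ALL c. c <: C --> c <: FX Z" "ALL c d. c <: C --> d <: C --> sb c d | sb d c" "bd lam C" for C
  proof -
    have "Uu C <: FF" using shc_FF C FX_cond FF unfolding shc_def by blast
    thus ?thesis unfolding FX[of "Uu C"] mem_Un FF using FXD C(2) by blast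
  qed
  thus ?thesis unfolding shc_def by blast
qed

text \<open>An element \<open>b\<close> of the poset \<open>DD\<close> codes three objects: \<open>unt T1 b\<close> forces the play \<open>unt T2 b\<close> to be an initial segment of
  the run with name \<open>n\<close>, while \<open>unt T0 b\<close> forces \<open>x\<close> to extend the moves of this play, and both agree on \<open>X\<close>.  In \<open>lift0\<close>
  and \<open>lift1\<close> either of the two conditions is extended arbitrarily; for \<open>T0\<close> the new part is encoded into
  column \<open>k\<close> at the earliest place that the strategy looks at.\<close>

locale playR = playI +
  fixes n p2 Z :: nat
  assumes bZ: "bd mu Z" and YZ: "sb Y Z" and kZ: "k <: Z" and p2: "p2 <: FX Z" "sb p p2" "F.Frc p2 (%G. run Ev sI G n)"
    and capn: "b <: lam ==> q <: FX Z ==> sb p2 q ==> EX r. r <: FX Z & sb q r & (EX s. F.Frc r (%G. F.memG G (F.chk (pr b s)) n))"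
begin

text \<open>The counterpart of \<open>DQ\<close> in which a condition \<open>d\<close> takes the
  place of the filter.\<close>

definition QC :: "nat => nat => nat => nat => bool" where
  "QC d t b q = (EX s0 i. ap t b = snoc s0 i & i <: lam & s0 <: Sq & q <: FX Y & pr (pr k i) (ap c (pr s0 q)) <: d)"
lemma D_QC [dfi]: "Dt a ==> Dt b ==> Dt d ==> Dt e ==> D (%x. QC (a x) (b x) (d x) (e x))"
proof -
  assume d: "Dt a" "Dt b" "Dt d" "Dt e"
  show "D (%x. QC (a x) (b x) (d x) (e x))" unfolding QC_def by (intro dfi Dt_comp[OF d(1)] Dt_comp[OF d(2)] Dt_comp[OF d(3)] Dt_comp[OF d(4)])
qed

text \<open>The last two clauses tie the conditions together: on \<open>Y\<close>, \<open>a\<close>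
  has nothing but the part of \<open>d\<close> on \<open>X\<close> and what is encoded in the moves
  of \<open>t\<close>. Agreement on \<open>X\<close> follows in \<open>DD_agree\<close>.\<close>

definition wd :: "nat => nat => nat => bool" where
  "wd a d t = (a <: FX Z & d <: FX Z & sb p2 d & dm t <: lam & play (dm t) t &
    (ALL b. b <: dm t --> F.Frc d (%G. F.memG G (F.chk (pr b (ap t b))) n)) &
    (ALL b. b <: dm t --> Ev b --> (EX q. QC d t b q & sb (rt q X) d & sb q a)) & sb (rt d X) a &
    (ALL u. u <: rt a Y --> u <: rt d X | (EX b q. b <: dm t & Ev b & QC d t b q & u <: q)))"
lemma D_wd [dfi]: "Dt a ==> Dt b ==> Dt d ==> D (%x. wd (a x) (b x) (d x))"
proof -
  assume d: "Dt a" "Dt b" "Dt d"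
  show "D (%x. wd (a x) (b x) (d x))" unfolding wd_def by (intro dfi Dt_comp[OF d(1)] Dt_comp[OF d(2)] Dt_comp[OF d(3)])
qed

lemma QC_DQ: "F.gen H ==> d : H ==> QC d t b q ==> DQ H (ap t b) q"
  unfolding QC_def DQ_def gv_def using G_sub[of H d "sg _"] by fastforce

lemma run_p2: assumes "F.gen H" "d : H" "sb p2 d" shows "run Ev sI H n" "p : H"
  using F.Frc_D[OF p2(3) assms(1)] G_sub[OF assms] G_sub[OF assms(1)] p2(2) by blast+

lemma seg_play: "seg H n t ==> dm t <: lam & play (dm t) t & (ALL b. b <: dm t --> F.memG H (F.chk (pr b (ap t b))) n)"
  unfolding seg_def using play_dm by blast

lemma wd_seg: assumes "wd a d t" "F.gen H" "d : H" shows "seg H n t"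
  using assms(1) F.Frc_D[OF _ assms(2,3)] unfolding wd_def seg_def by blast

lemma seg_sb: assumes "run Ev sI H n" "seg H n t" "seg H n t'" "!!i. i <: dm t ==> i <: dm t'"
  shows "sb t t'" "i <: dm t ==> ap t' i = ap t i"
proof -
  have e: "ap t' i = ap t i" if "i <: dm t" for i
    using seg_play[OF assms(2)] seg_play[OF assms(3)] assms(4)[OF that] that assms(1) unfolding run_def by blast
  thus "i <: dm t ==> ap t' i = ap t i" .
  have f: "fon t (dm t)" "fon t' (dm t')" using seg_play[OF assms(2)] seg_play[OF assms(3)] unfolding play_def by blast+
  have "z <: t'" if z: "z <: t" for z
  proof -
    obtain i y where i: "z = pr i y" using z f(1) unfolding fon_def isf_def by blast
    hence "i <: dm t" "y = ap t i" using z fon_iff[OF f(1), of i y] by blast+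
    thus ?thesis using fon_ap[OF f(2) assms(4)] e i by simp
  qed
  thus "sb t t'" unfolding sb_def by blast
qed

lemma seg_valid: assumes H: "F.gen H" "p : H" "run Ev sI H n" and t: "seg H n t" "b <: dm t" "Ev b"
  shows "EX s0 q. DQ H (ap t b) q & vd H (rs t b) s0 q"
  using HH_DQ[OF run_valid[OF H t]] by blast

lemma seg_q: assumes H: "F.gen H" "p : H" "run Ev sI H n" and t: "seg H n t" "b <: dm t" "Ev b" and q: "DQ H (ap t b) q"
  shows "EX s0. vd H (rs t b) s0 q"
  using seg_valid[OF H t] DQ_unique[OF H(1) q] by blast

lemma seg_chain: assumes H: "F.gen H" "p : H" "run Ev sI H n" and t: "seg H n t" "d <: dm t" "b <: d" "Ev b" "Ev d"
    and q: "DQ H (ap t b) q" "DQ H (ap t d) q'" shows "sb q q'"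
proof -
  have s: "dm t <: lam" "play (dm t) t" using seg_play[OF t(1)] by blast+
  note r = play_rs[OF s(2) t(2) s(1)]
  obtain s0 where "vd H (rs t d) s0 q'" using seg_q[OF H t(1,2,5) q(2)] by blast
  moreover have "DQ H (ap (rs t d) b) q" using q(1) r(2)[OF t(3)] by simp
  moreover have "b <: dm (rs t d)" using t(3) play_dm[OF r(1)] by simp
  ultimately show ?thesis using t(4) unfolding vd_def by blast
qed

lemma wd_q: assumes w: "wd a d t" and b: "b <: dm t" "Ev b" "QC d t b q"
  shows "q <: FX Y" "sb p q" "dx x q (ut (rs t b))" "sb q a"
proof -
  obtain H where H: "F.gen H" "d : H" using gen_ex w FX_cond unfolding wd_def by blast
  note R = run_p2[OF H, of] note s = wd_seg[OF w H]
  have p2d: "sb p2 d" using w unfolding wd_def by blast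
  obtain s0 where "vd H (rs t b) s0 q" using seg_q[OF H(1) R(2,1)[OF p2d] s b(1,2) QC_DQ[OF H b(3)]] by blast
  thus "q <: FX Y" "sb p q" "dx x q (ut (rs t b))" unfolding vd_def by blast+
  obtain q' where q': "QC d t b q'" "sb q' a" using w b unfolding wd_def by blast
  show "sb q a" using DQ_unique[OF H(1) QC_DQ[OF H q'(1)] QC_DQ[OF H b(3)]] q'(2) by blast
qed

lemma cond_isf: "cond a ==> isf a" unfolding cond_def by blast

lemma isf_comm: "isf (un a b) ==> isf (un b a)"
proof -
  have "un a b = un b a" by (rule exten) auto
  thus "isf (un a b) ==> isf (un b a)" by simp
qed

lemma code_F: assumes "F.gen H" "sg (pr (pr k i) v) : H" shows "sg (pr (pr k i) v) <: FX Z"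
  using G_FF[OF assms] kZ unfolding FX FF by auto

text \<open>The filter contains conditions that decide the moves of \<open>t\<close> and include
  their codes; \<open>d\<close> unites them with \<open>d0\<close>. Then \<open>a\<close> adds to
  \<open>a0\<close> the part of \<open>d\<close> on \<open>X\<close> and all encoded conditions, and
  \<open>cov\<close> excludes conflicts on \<open>Y\<close>.\<close>

lemma core: assumes H: "F.gen H" "d0 : H" and d0: "d0 <: FX Z" "sb p2 d0" and a0: "a0 <: FX Z" and t: "seg H n t"
    and cov: "!!u. u <: rt a0 Y ==> u <: rt d0 X | (EX b q. b <: dm t & Ev b & DQ H (ap t b) q & u <: q)"
  shows "EX a d. wd a d t & d : H & sb a0 a & sb d0 d"
proof -
  note R = run_p2[OF H d0(2)]
  have s: "dm t <: lam" "play (dm t) t" "ALL b. b <: dm t --> F.memG H (F.chk (pr b (ap t b))) n" using seg_play[OF t] by blast+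
  let ?F = "%r b. F.Frc r (%G. F.memG G (F.chk (pr b (ap t b))) n)"
  let ?Q = "%G u. pf (ps u) : G & pf (ps u) <: FX Z & ?F (pf (ps u)) (pf u) &
     (Ev (pf u) --> QC (pf (ps u)) t (pf u) (ps (ps u)) & sb (rt (ps (ps u)) X) (pf (ps u)))"
  have dQ: "D (%u. ?F (pf (ps u)) (pf u))" "D (%u. Ev (pf u) --> QC (pf (ps u)) t (pf u) (ps (ps u)) & sb (rt (ps (ps u)) X) (pf (ps u)))" "D (%u. pf (ps u) <: FX Z)"
    by (intro dfi)+
  have "F.DG ?Q" by (intro F.DG_and F.DG_in dQ[THEN F.DG_D] dfi)
  moreover have "EX y. y <: prd FF (FX Y) & ?Q H (pr b y)" if b: "b <: dm t" for b
  proof -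
    have bl: "b <: lam" using lam_trans[OF s(1) b] .
    let ?R = "%r. EX s. F.Frc r (%G. F.memG G (F.chk (pr b s)) n)"
    have "D ?R" by (intro dfi)
    then obtain r where r: "r : H" "r <: FX Z" "?R r"
      using FX_dense[OF H(1) _ H(2) d0(1), of ?R] capn[OF bl _ sb_trans[OF d0(2)]] by blast
    then obtain s' where s': "F.Frc r (%G. F.memG G (F.chk (pr b s')) n)" by blast
    have "F.memG H (F.chk (pr b s')) n" using F.Frc_D[OF s' H(1) r(1)] .
    hence "s' = ap t b" using s(3) b R(1) unfolding run_def by blast
    hence r': "?F r b" using s' by simp
    show ?thesis
    proof (cases "Ev b")
      case False
      thus ?thesis using r r' pY G_FF[OF H(1)] by (intro exI[of _ "pr r p"]) simp
    next
      case True
      obtain s0 q where q: "DQ H (ap t b) q" "vd H (rs t b) s0 q" using seg_valid[OF H(1) R(2,1) t b True] by blast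
      obtain s1 i where i: "ap t b = snoc s1 i" "i <: lam" "s1 <: Sq" "q <: FX Y" "sg (pr (pr k i) (ap c (pr s1 q))) : H"
        using q(1) unfolding DQ_def gv_def by auto
      let ?e = "sg (pr (pr k i) (ap c (pr s1 q)))"
      have rX: "rt q X : H" "rt q X <: FX Z" using q(2) rt_cond[OF i(4)] FX_mono XY YZ sb_trans unfolding vd_def by blast+
      let ?r = "un (un r ?e) (rt q X)"
      have g: "un r ?e : H" "?r : H" using G_un[OF H(1)] r(1) i(5) rX(1) by blast+
      have "un r ?e <: FX Z" using FX_un[OF r(2) code_F[OF H(1) i(5)] G_isf[OF H(1) r(1) i(5)]] .
      hence "?r <: FX Z" using FX_un[OF _ rX(2) G_isf[OF H(1) g(1) rX(1)]] by blast
      moreover have "?F ?r b" by (rule F.Frc_le[OF r']) (use G_FF[OF H(1)] g(2) r(1) in \<open>auto simp: le sb_unI\<close>)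
      moreover have "QC ?r t b q" unfolding QC_def using i(1-4) by (intro exI[of _ s1] exI[of _ i]) simp
      ultimately show ?thesis using g(2) G_FF[OF H(1) g(2)] i(4) by (intro exI[of _ "pr ?r q"]) simp
    qed
  qed
  ultimately obtain h where h: "fto h (dm t) (prd FF (FX Y))" "ALL b. b <: dm t --> ?Q H (pr b (ap h b))"
    using F_dist[OF H(1), of ?Q "dm t"] s(1) by blast
  have hb: "pf (ap h b) : H & pf (ap h b) <: FX Z & ?F (pf (ap h b)) b" "Ev b ==> QC (pf (ap h b)) t b (ps (ap h b)) & sb (rt (ps (ap h b)) X) (pf (ap h b))"
    if "b <: dm t" for b using h(2) that by simp_all
  have di: "Dt (%b. pf (ap h b))" "Dt (%b. ps (ap h b))" by (intro dfi)+
  have bt: "bd lam (dm t)" using rc_bd[OF rcl s(1)] .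
  let ?C = "un (sg d0) (Im (dm t) (%b. pf (ap h b)))"
  have C: "z <: ?C = (z = d0 | (EX b. b <: dm t & z = pf (ap h b)))" for z by (simp add: mem_Im[OF di(1)])
  have bC: "bd lam ?C" unfolding sg_def by (intro bd_un bd_up bd_Im rcl di bt)
  define d1 where "d1 = Uu ?C"
  have d1: "d1 : H" unfolding d1_def 
  proof (rule G_Uu[OF H(1) _ bC])
    show "z : H" if "z <: ?C" for z using that H(2) hb(1) unfolding C by blast
  qed
  have CZ: "z <: FX Z" if "z <: ?C" for z using that d0(1) hb(1) unfolding C by blast
  have "cond d1" using G_FF[OF H(1) d1] FF by blast
  hence d1Z: "d1 <: FX Z" unfolding FX[of d1] using FXD[OF CZ] unfolding d1_def mem_Un by blast
  have s0: "sb d0 d1" unfolding d1_def using C by (intro sb_Uu) blast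
  have sh: "sb (pf (ap h b)) d1" if "b <: dm t" for b unfolding d1_def using C that by (intro sb_Uu) blast
  have qc: "QC d1 t b (ps (ap h b))" if "b <: dm t" "Ev b" for b using hb(2)[OF that] sbD[OF sh[OF that(1)]] unfolding QC_def by blast
  have rq: "sb (rt (ps (ap h b)) X) d1" if "b <: dm t" "Ev b" for b using hb(2)[OF that] sb_trans[OF _ sh[OF that(1)]] by blast
  have qY: "ps (ap h b) <: FX Y" if "b <: dm t" "Ev b" for b using qc[OF that] unfolding QC_def by blast
  let ?B = "un (sg (rt d1 X)) (Im (Sp (dm t) Ev) (%b. ps (ap h b)))"
  have sp: "b <: Sp (dm t) Ev = (b <: dm t & Ev b)" for b by (intro mem_Sp dfi)
  have B: "z <: ?B = (z = rt d1 X | (EX b. b <: dm t & Ev b & z = ps (ap h b)))" for z by (auto simp add: mem_Im[OF di(2)] sp simp del: mem_dm)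
  have "bd lam (Sp (dm t) Ev)" using bd_sub[OF rc_emp[OF rcl] bt] sp by blast
  hence bB: "bd lam ?B" unfolding sg_def by (intro bd_un bd_up bd_Im rcl di)
  have rX: "rt d1 X <: FX Y" using FX_mono[OF rt_cond[OF d1Z] XY] .
  have BY: "z <: FX Y" if "z <: ?B" for z using that rX qY unfolding B by blast
  have od: "od (dm t)" using oda s(1) by blast
  have i1: "isf (un (ps (ap h b)) (ps (ap h e)))" if b: "b <: dm t" "Ev b" "e <: dm t" "Ev e" for b e
  proof -
    have m: "DQ H (ap t b) (ps (ap h b))" if "b <: dm t" "Ev b" for b using QC_DQ[OF H(1) d1 qc[OF that]] .
    have "sb (ps (ap h b)) (ps (ap h e)) | sb (ps (ap h e)) (ps (ap h b))"
    proof (cases "b = e")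
      case False
      hence "b <: e | e <: b" using od_tri[OF od_mem[OF od b(1)] od_mem[OF od b(3)]] by blast
      thus ?thesis using seg_chain[OF H(1) R(2,1) t] m b by metis
    qed simp
    hence "un (ps (ap h b)) (ps (ap h e)) = ps (ap h e) | un (ps (ap h b)) (ps (ap h e)) = ps (ap h b)" using un_absorb un_absorb2 by blast
    thus ?thesis using qY[THEN FX_cond, THEN cond_isf] b by metis
  qed
  have i2: "isf (un (rt d1 X) (ps (ap h b)))" if b: "b <: dm t" "Ev b" for b
  proof -
    have "sb (rt (ps (ap h b)) X) (rt d1 X)" using sb_rt_FX[OF rt_cond[OF qY[OF b]] rq[OF b]] .
    hence "isf (un (rt d1 X) (rt (ps (ap h b)) X))" using un_absorb2 FX_cond[OF rX] cond_isf by metis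
    thus ?thesis using FX_isf[OF rt_cond[OF d1Z] FX_cond[OF qY[OF b]]] by blast
  qed
  have ii: "isf (un u v)" if u: "u <: ?B" "v <: ?B" for u v
  proof (cases "u = rt d1 X")
    case True
    have "isf (un (rt d1 X) (rt d1 X))" using un_absorb[OF sb_refl] FX_cond[OF rX] cond_isf by metis
    moreover have "v = rt d1 X | (EX b. b <: dm t & Ev b & v = ps (ap h b))" using u(2) unfolding B .
    ultimately show ?thesis using i2 unfolding True by blast
  next
    case False
    then obtain b where b: "b <: dm t" "Ev b" "u = ps (ap h b)" using u unfolding B by blast
    thus ?thesis using u(2) i1 isf_comm[OF i2[OF b(1,2)]] unfolding B by blast
  qed
  have cB: "cond (Uu ?B)" using BY[THEN FX_cond] ii by (intro cond_Uu[OF _ _ bB])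
  have UB: "Uu ?B <: FX Y" unfolding FX using cB FXD[OF BY] unfolding mem_Un by blast
  have ca: "cond a0" using FX_cond[OF a0] .
  have Bsub: "sb (rt d1 X) (Uu ?B)" "b <: dm t ==> Ev b ==> sb (ps (ap h b)) (Uu ?B)" for b using B by (intro sb_Uu; blast)+
  have "sb (rt a0 Y) (Uu ?B)" unfolding sb_def
  proof (intro allI impI)
    fix u assume "u <: rt a0 Y"
    then consider "u <: rt d0 X" | b q where "b <: dm t" "Ev b" "DQ H (ap t b) q" "u <: q" using cov by blast
    thus "u <: Uu ?B"
    proof cases
      case 1 thus ?thesis using sbD[OF Bsub(1)] sbD[OF rt_mono[OF s0]] by blast
    next
      case 2
      have "q = ps (ap h b)" using DQ_unique[OF H(1) 2(3) QC_DQ[OF H(1) d1 qc[OF 2(1,2)]]] .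
      thus ?thesis using sbD[OF Bsub(2)[OF 2(1,2)]] 2(4) by blast
    qed
  qed
  note aB = this
  have "isf (un (Uu ?B) (rt a0 Y))" using un_absorb2[OF aB] cond_isf[OF cB] by simp
  hence fi: "isf (un (Uu ?B) a0)" using FX_isf[OF UB ca] by blast
  let ?a = "un (Uu ?B) a0"
  have aZ: "?a <: FX Z" using FX_un[OF FX_mono[OF UB YZ] a0 fi] .
  have ra: "rt ?a Y = Uu ?B" using rt_un rt_id[OF UB sb_refl] un_absorb2[OF aB] by simp
  have cv: "u <: rt d1 X | (EX b q. b <: dm t & Ev b & QC d1 t b q & u <: q)" if u: "u <: rt ?a Y" for u
  proof -
    have "EX z. z <: ?B & u <: z" using u unfolding ra mem_Un by blast
    thus ?thesis unfolding B using qc by blast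
  qed
  have "?F d1 b" if b: "b <: dm t" for b
    by (rule F.Frc_le[OF conjunct2[OF conjunct2[OF hb(1)[OF b]]]]) (use G_FF[OF H(1)] d1 hb(1)[OF b] sh[OF b] in \<open>auto simp: le\<close>)
  moreover have "EX q. QC d1 t b q & sb (rt q X) d1 & sb q ?a" if b: "b <: dm t" "Ev b" for b
    using qc[OF b] rq[OF b] sb_unI(1)[OF Bsub(2)[OF b]] by blast
  ultimately have "wd ?a d1 t" unfolding wd_def using aZ d1Z sb_trans[OF d0(2) s0] s(1,2) sb_unI(1)[OF Bsub(1)] cv by blast
  thus ?thesis using d1 s0 by (intro exI[of _ ?a] exI[of _ d1]) simp
qed

section \<open>The poset of decided run segments and its projections\<close>

definition T0 :: nat where "T0 = emp"
definition T1 :: nat where "T1 = suc emp"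
definition T2 :: nat where "T2 = suc (suc emp)"
lemma T_ne [simp]: "T0 ~= T1" "T1 ~= T0" "T0 ~= T2" "T2 ~= T0" "T1 ~= T2" "T2 ~= T1"
  unfolding T0_def T1_def T2_def using suc_eq mem_suc[of emp] mem_emp by metis+
definition TT :: nat where "TT = un (sg T0) (un (sg T1) (sg T2))"
lemma TT [simp]: "i <: TT = (i = T0 | i = T1 | i = T2)" unfolding TT_def by auto
definition Big :: nat where "Big = un (Uu (FX Z)) (prd lam Sq)"
definition WS :: nat where "WS = Sp (Pw (prd TT Big)) (%b. wd (unt T0 b) (unt T1 b) (unt T2 b))"
lemma WS: "b <: WS = (sb b (prd TT Big) & wd (unt T0 b) (unt T1 b) (unt T2 b))"
  unfolding WS_def sb_def by (subst mem_Sp, intro dfi) simp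
text \<open>Restriction to plays of limit length, so that player I is to move, for which
  \<open>unt T1 b\<close> is still silent about all places of column \<open>k\<close> that he will
  inspect. This leaves room for writing a code in \<open>lift0\<close>.\<close>

definition DD :: nat where "DD = Sp WS (%b. emp <: dm (unt T2 b) & (ALL i. i <: dm (unt T2 b) --> suc i <: dm (unt T2 b)) &
  (ALL i v. pr (pr k i) v <: unt T1 b --> i <: dm (ut (unt T2 b))))"
lemma DD: "b <: DD = (b <: WS & emp <: dm (unt T2 b) & (ALL i. i <: dm (unt T2 b) --> suc i <: dm (unt T2 b)) &
  (ALL i v. pr (pr k i) v <: unt T1 b --> i <: dm (ut (unt T2 b))))"
  unfolding DD_def by (intro mem_Sp dfi)
definition mk :: "nat => nat => nat => nat" where "mk a d t = un (Im a (pr T0)) (un (Im d (pr T1)) (Im t (pr T2)))"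
lemma mem_mk: "z <: mk a d t = ((EX y. y <: a & z = pr T0 y) | (EX y. y <: d & z = pr T1 y) | (EX y. y <: t & z = pr T2 y))"
proof -
  have "Dt (pr i)" for i by (intro dfi)
  thus ?thesis unfolding mk_def by (simp add: mem_Im)
qed
lemma unt_mk [simp]: "unt T0 (mk a d t) = a" "unt T1 (mk a d t) = d" "unt T2 (mk a d t) = t"
  by (rule exten; simp add: mem_mk)+

lemma mk_WS: assumes "wd a d t" shows "mk a d t <: WS"
proof -
  have "a <: FX Z" "d <: FX Z" "fon t (dm t)" "dm t <: lam" "ALL b. b <: dm t --> ap t b <: Sq" using assms Sq unfolding wd_def play_def by auto
  moreover have "y <: prd lam Sq" if y: "y <: t" for y
  proof -
    obtain u v where "y = pr u v" using y calculation(3) unfolding fon_def isf_def by blast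
    thus ?thesis using y fon_iff[OF calculation(3)] calculation(4,5) lam_trans by (simp del: mem_dm)
  qed
  ultimately have "sb (mk a d t) (prd TT Big)" unfolding sb_def mem_mk Big_def by auto
  thus ?thesis unfolding WS using assms by simp
qed

lemma sb_mk: assumes "sb b (prd TT Big)" "sb (unt T0 b) a" "sb (unt T1 b) d" "sb (unt T2 b) t" shows "sb b (mk a d t)"
  unfolding sb_def mem_mk
proof (intro allI impI)
  fix z assume z: "z <: b"
  then obtain i w where i: "z = pr i w" "i <: TT" using assms(1) unfolding sb_def by auto
  hence "w <: unt i b" using z by simp
  thus "(EX y. y <: a & z = pr T0 y) | (EX y. y <: d & z = pr T1 y) | (EX y. y <: t & z = pr T2 y)"
    using i sbD[OF assms(2)] sbD[OF assms(3)] sbD[OF assms(4)] unfolding TT by blast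
qed

lemma shc_WS: "shc lam WS"
  unfolding shc_def
proof (intro allI impI)
  fix C assume C: "EX b. b <: C" "ALL b. b <: C --> b <: WS" "ALL b e. b <: C --> e <: C --> sb b e | sb e b" "bd lam C"
  have W: "sb b (prd TT Big)" "wd (unt T0 b) (unt T1 b) (unt T2 b)" if "b <: C" for b using C(2) that unfolding WS by blast+
  let ?I = "%i. Im C (unt i)"
  have di: "Dt (unt i)" for i by (intro dfi)
  have U: "unt i (Uu C) = Uu (?I i)" for i by (rule exten) (auto simp: mem_Im[OF di])
  have I: "z <: ?I i = (EX b. b <: C & z = unt i b)" for i z unfolding mem_Im[OF di] by blast
  have ch: "sb u v | sb v u" if "u <: ?I i" "v <: ?I i" for i u v using that C(3) unt_mono unfolding I by blast
  have bI: "bd lam (?I i)" for i using bd_Im[OF C(4) di] .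
  have FZ: "unt i (Uu C) <: FX Z" if i: "i = T0 | i = T1" for i
  proof -
    have "u <: FX Z" if "u <: ?I i" for u using that i W(2) unfolding I wd_def by blast
    moreover have "EX u. u <: ?I i" using C(1) unfolding I by blast
    ultimately show ?thesis unfolding U using shc_FX[of Z] ch bI unfolding shc_def by blast
  qed
  have sU: "sb (unt i b) (unt i (Uu C))" if "b <: C" for i b using unt_mono[OF sb_Uu[OF that]] .
  let ?a = "unt T0 (Uu C)" let ?d = "unt T1 (Uu C)" let ?t = "unt T2 (Uu C)"
  have pl: "play (dm (unt T2 b)) (unt T2 b)" "dm (unt T2 b) <: lam" "isf (unt T2 b)" if "b <: C" for b
    using W(2)[OF that] unfolding wd_def play_def fon_def by blast+
  have it: "isf (unt T2 (Uu C))" "dm (unt T2 (Uu C)) <: lam"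
  proof -
    have q: "isf u & dm u <: lam" if "u <: ?I T2" for u using that pl unfolding I by blast
    show "isf (unt T2 (Uu C))" "dm (unt T2 (Uu C)) <: lam" unfolding U by (rule seq_Uu[OF bI q ch], assumption+)+
  qed
  have dt: "i <: dm ?t = (EX b. b <: C & i <: dm (unt T2 b))" for i by auto
  have at: "ap ?t i = ap (unt T2 b) i" if "b <: C" "i <: dm (unt T2 b)" for b i
    using ap_sb[OF it(1) sU[OF that(1)] that(2)] .
  have "play (dm ?t) ?t" unfolding play_def
  proof (intro conjI allI impI)
    show "fon ?t (dm ?t)" using it(1) fon_dm by blast
    show "sseq (ap ?t b)" if "b <: dm ?t" for b using that at pl unfolding dt play_def by metis
    fix i m assume "i <: dm ?t" "m <: i"
    then obtain b where b: "b <: C" "i <: dm (unt T2 b)" "m <: i" unfolding dt by blast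
    have m: "m <: dm (unt T2 b)" using od_trans[OF oda[OF pl(2)[OF b(1)]] b(2,3)] .
    have "sb (ap (unt T2 b) m) (ap (unt T2 b) i) & ap (unt T2 b) m ~= ap (unt T2 b) i" using pl(1)[OF b(1)] b unfolding play_def by blast
    thus "sb (ap ?t m) (ap ?t i)" "ap ?t m ~= ap ?t i" using at[OF b(1,2)] at[OF b(1) m] by simp_all
  qed
  moreover have "sb p2 ?d" using C(1) W(2) sb_trans[OF _ sU] unfolding wd_def by blast
  moreover have "F.Frc ?d (%G. F.memG G (F.chk (pr i (ap ?t i))) n)" if i: "i <: dm ?t" for i
  proof -
    obtain b where b: "b <: C" "i <: dm (unt T2 b)" using i unfolding dt by blast
    have "F.Frc (unt T1 b) (%G. F.memG G (F.chk (pr i (ap (unt T2 b) i))) n)" "unt T1 b <: FX Z" using W(2)[OF b(1)] b(2) unfolding wd_def by blast+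
    moreover have "F.le ?d (unt T1 b)" unfolding le FF using FZ[of T1] calculation(2) FX_cond sU[OF b(1)] by blast
    ultimately show ?thesis unfolding at[OF b] using F.Frc_le by blast
  qed
  moreover have qc: "QC ?d ?t i q" if "b <: C" "i <: dm (unt T2 b)" "QC (unt T1 b) (unt T2 b) i q" for b i q
    using that(3) sbD[OF sU[OF that(1)]] unfolding QC_def at[OF that(1,2)] by blast
  have "EX q. QC ?d ?t i q & sb (rt q X) ?d & sb q ?a" if i: "i <: dm ?t" "Ev i" for i
  proof -
    obtain b where b: "b <: C" "i <: dm (unt T2 b)" using i unfolding dt by blast
    then obtain q where "QC (unt T1 b) (unt T2 b) i q" "sb (rt q X) (unt T1 b)" "sb q (unt T0 b)" using W(2)[OF b(1)] i(2) unfolding wd_def by blast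
    thus ?thesis using qc[OF b] sb_trans[OF _ sU[OF b(1)]] by blast
  qed
  moreover have "sb (rt ?d X) ?a" unfolding sb_def
  proof (intro allI impI)
    fix z assume "z <: rt ?d X"
    then obtain b where b: "b <: C" "z <: rt (unt T1 b) X" unfolding mem_rt by auto
    have "sb (rt (unt T1 b) X) (unt T0 b)" using W(2)[OF b(1)] unfolding wd_def by blast
    thus "z <: ?a" using sbD[OF sU[OF b(1)]] sbD b(2) by blast
  qed
  moreover have "u <: rt ?d X | (EX i q. i <: dm ?t & Ev i & QC ?d ?t i q & u <: q)" if u: "u <: rt ?a Y" for u
  proof -
    obtain b where b: "b <: C" "u <: rt (unt T0 b) Y" using u unfolding mem_rt by auto
    hence "u <: rt (unt T1 b) X | (EX i q. i <: dm (unt T2 b) & Ev i & QC (unt T1 b) (unt T2 b) i q & u <: q)" using W(2)[OF b(1)] unfolding wd_def by blast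
    thus ?thesis using qc[OF b(1)] b(1) sbD[OF rt_mono[OF sU[OF b(1)]]] unfolding dt by blast
  qed
  ultimately have "wd ?a ?d ?t" unfolding wd_def using FZ it(2) by blast
  moreover have "sb (Uu C) (prd TT Big)" using W(1) by (rule Uu_sb)
  ultimately show "Uu C <: WS" unfolding WS by blast
qed

lemma ut_mono: "sb s t ==> sb (ut s) (ut t)" unfolding ut_def sb_def by auto
lemma dm_mono: "sb s t ==> i <: dm s ==> i <: dm t" unfolding sb_def by auto

text \<open>The play is prolonged past a place \<open>g\<close> beyond everything in
  \<open>unt T1 b\<close>; by \<open>play_length\<close> the position is then longer than all places
  that occur in column \<open>k\<close> of that condition.\<close>

lemma step: assumes w: "b <: WS" and e: "e <: lam"
  shows "EX b'. b' <: WS & sb b b' & e <: dm (unt T2 b') & dm (unt T2 b) <: dm (unt T2 b') &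
    (ALL i v. pr (pr k i) v <: unt T1 b --> i <: dm (ut (unt T2 b')))"
proof -
  let ?a = "unt T0 b" let ?d = "unt T1 b" let ?t = "unt T2 b"
  have W: "sb b (prd TT Big)" "wd ?a ?d ?t" using w unfolding WS by blast+
  have V: "?a <: FX Z" "?d <: FX Z" "sb p2 ?d" "dm ?t <: lam" "play (dm ?t) ?t"
    "ALL u. u <: rt ?a Y --> u <: rt ?d X | (EX b q. b <: dm ?t & Ev b & QC ?d ?t b q & u <: q)" using W(2) unfolding wd_def by blast+
  obtain H where H: "F.gen H" "?d : H" using gen_ex FX_cond V(2) by blast
  note R = run_p2[OF H V(3)]
  obtain m where m: "m <: lam" "dm ?t <: suc m" "e <: suc m"
  proof -
    have "dm ?t <: e | dm ?t = e | e <: dm ?t" using od_tri[OF oda[OF V(4)] oda[OF e]] .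
    thus thesis using that[of e] that[of "dm ?t"] e V(4) by auto
  qed
  obtain g where g: "g <: lam" "suc m <: g" "ALL i l v. i = g | g <: i --> ~ pr (pr l i) v <: ?d" using fresh[OF FX_cond[OF V(2)] lam_suc[OF m(1)]] by blast
  have gl: "suc g <: lam" using lam_suc[OF g(1)] .
  obtain t' where t': "play (suc g) t'" "seg H n t'" using R(1) gl unfolding run_def by blast
  have dt': "dm t' = suc g" using play_dm[OF t'(1)] .
  have lt: "z <: suc g" if "z <: suc m" for z using od_trans[OF oda[OF g(1)] g(2) that] by simp
  have st: "seg H n ?t" using wd_seg[OF W(2) H] .
  have sub: "i <: dm t'" if "i <: dm ?t" for i using od_trans[OF oda[OF gl] lt[OF m(2)] that] unfolding dt' .
  note tt = seg_sb[OF R(1) st t'(2) sub]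
  have "EX a d. wd a d t' & d : H & sb ?a a & sb ?d d"
  proof (rule core[OF H V(2,3,1) t'(2)])
    fix u assume "u <: rt ?a Y"
    hence "u <: rt ?d X | (EX b q. b <: dm ?t & Ev b & QC ?d ?t b q & u <: q)" using V(6) by blast
    thus "u <: rt ?d X | (EX b q. b <: dm t' & Ev b & DQ H (ap t' b) q & u <: q)" using sub tt(2) QC_DQ[OF H] by metis
  qed
  then obtain a d where ad: "wd a d t'" "sb ?a a" "sb ?d d" by blast
  have "i <: dm (ut t')" if "pr (pr k i) v <: ?d" for i v
  proof -
    have "i <: lam" using cond_pr[OF FX_cond[OF V(2)] that] pr_eq by metis
    hence "i <: g" using g(3) that od_tri[OF oda oda[OF g(1)]] by blast
    moreover have "colgen E lam mu IX bb H" by unfold_locales (rule H(1))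
    note pl = colgen.play_length[OF this]
    have "g <: suc g" by simp
    hence "sb g (dm (ap t' g))" "sb (ap t' g) (ut t')" using pl[OF t'(1) _ gl] play_Uu(2)[OF t'(1) gl] unfolding ut_def by blast+
    ultimately show ?thesis using dm_mono sbD by blast
  qed
  thus ?thesis using mk_WS[OF ad(1)] sb_mk[OF W(1) ad(2,3) tt(1)] lt[OF m(2)] lt[OF m(3)] dt' by (intro exI[of _ "mk a d t'"]) simp
qed

text \<open>The union of \<open>om\<close> many applications of \<open>step\<close> satisfies the
  closure requirements of \<open>DD\<close>; it exists because \<open>lam\<close> is
  uncountable.\<close>

lemma ext: assumes w: "b <: WS" and e: "e <: lam" shows "EX b'. b' <: DD & sb b b' & e <: dm (unt T2 b')"
proof -
  obtain b0 where b0: "b0 <: WS" "sb b b0" "e <: dm (unt T2 b0)" using step[OF w e] by blast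
  let ?S = "%i b b'. dm (unt T2 b) <: dm (unt T2 b') & (ALL i v. pr (pr k i) v <: unt T1 b --> i <: dm (ut (unt T2 b')))"
  have "D (%p. ?S (pf p) (pf (ps p)) (ps (ps p)))" by (intro dfi)
  moreover have "EX y. y <: WS & sb x y & ?S i x y" if "x <: WS" for i x using step[OF that e] by blast
  ultimately obtain h where h: "Dt h" "ALL i. i <: om --> Lim h b0 i <: WS & h i <: WS & sb (Lim h b0 i) (h i) & ?S i (Lim h b0 i) (h i)"
    "Lim h b0 om <: WS" using short_chain[OF rcl shc_WS b0(1) oml, of ?S] by blast
  let ?L = "Lim h b0 om"
  have emp_om: "emp <: om" using om0 .
  have m: "z <: ?L = (EX i. i <: om & z <: h i)" for z
  proof -
    have "sb b0 (h emp)" using sb_trans[OF sb_Lim(2)[OF h(1)]] h(2) emp_om by blast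
    thus ?thesis unfolding mem_Lim[OF h(1)] using sbD emp_om by blast
  qed
  have mt: "i <: dm (unt T2 ?L) = (EX l. l <: om & i <: dm (unt T2 (h l)))" for i using m by auto
  have hs: "h i <: WS & sb (h i) (h (suc i)) & ?S i (h i) (h (suc i))" if "i <: om" for i
  proof -
    have s: "suc i <: om" using om_suc[OF that] .
    have l: "h i <: WS" "sb (h i) (Lim h b0 (suc i))" using h(2) that sb_Lim(1)[OF h(1), of i "suc i"] by auto
    have q: "Lim h b0 (suc i) <: WS" "sb (Lim h b0 (suc i)) (h (suc i))" "?S i (Lim h b0 (suc i)) (h (suc i))" using h(2) s by blast+
    have ww: "play (dm (unt T2 b)) (unt T2 b) & dm (unt T2 b) <: lam" if "b <: WS" for b using that unfolding WS wd_def by blast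
    have "dm (unt T2 (h i)) <: dm (unt T2 (h (suc i)))"
    proof -
      have "j <: dm (unt T2 (Lim h b0 (suc i)))" if "j <: dm (unt T2 (h i))" for j using dm_mono[OF unt_mono[OF l(2)] that] .
      hence "dm (unt T2 (h i)) <: dm (unt T2 (Lim h b0 (suc i))) | dm (unt T2 (h i)) = dm (unt T2 (Lim h b0 (suc i)))"
        using od_sub[OF oda oda] ww[OF l(1)] ww[OF q(1)] by blast
      moreover have "h (suc i) <: WS" using h(2) s by blast
      ultimately show ?thesis using q(3) od_trans[OF oda] ww by metis
    qed
    moreover have "i' <: dm (ut (unt T2 (h (suc i))))" if "pr (pr k i') v <: unt T1 (h i)" for i' v
      using q(3) sbD[OF unt_mono[OF l(2)] that] by blast
    ultimately show ?thesis using l q sb_trans by blast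
  qed
  have sL: "sb (h i) ?L" if "i <: om" for i using sb_Lim(1)[OF h(1) that] .
  have "emp <: dm (unt T2 ?L)"
  proof -
    have l: "dm (unt T2 (h emp)) <: dm (unt T2 (h (suc emp)))" "dm (unt T2 (h (suc emp))) <: lam" using hs[OF emp_om] hs[OF om_suc[OF emp_om]] unfolding WS wd_def by blast+
    have "emp <: dm (unt T2 (h (suc emp)))"
    proof -
      have "emp <: dm (unt T2 (h (suc emp))) | emp = dm (unt T2 (h (suc emp)))"
        using od_sub[of emp] oda[OF l(2)] oda[OF rc_emp[OF rcl]] mem_emp by blast
      thus ?thesis using l(1) mem_emp by metis
    qed
    thus ?thesis unfolding mt using om_suc[OF emp_om] by blast
  qed
  moreover have "suc i <: dm (unt T2 ?L)" if i: "i <: dm (unt T2 ?L)" for i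
  proof -
    obtain l where l: "l <: om" "i <: dm (unt T2 (h l))" using i unfolding mt by blast
    have o: "dm (unt T2 (h l)) <: lam" "dm (unt T2 (h (suc l))) <: lam" using hs[OF l(1)] hs[OF om_suc[OF l(1)]] unfolding WS wd_def by blast+
    have "suc i <: suc (dm (unt T2 (h l)))" using suc_sub[OF od_mem[OF oda[OF o(1)] l(2)] oda[OF o(1)] l(2)] .
    hence "suc i <: dm (unt T2 (h (suc l)))" using hs[OF l(1)] od_trans[OF oda[OF o(2)]] unfolding mem_suc by metis
    thus ?thesis unfolding mt using om_suc[OF l(1)] by blast
  qed
  moreover have "i <: dm (ut (unt T2 ?L))" if i: "pr (pr k i) v <: unt T1 ?L" for i v
  proof -
    obtain l where l: "l <: om" "pr (pr k i) v <: unt T1 (h l)" using i m by auto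
    hence "i <: dm (ut (unt T2 (h (suc l))))" using hs by blast
    thus ?thesis using dm_mono[OF ut_mono[OF unt_mono[OF sL[OF om_suc[OF l(1)]]]]] by blast
  qed
  ultimately have "?L <: DD" unfolding DD using h(3) by blast
  moreover have "sb b0 ?L" using sb_Lim(2)[OF h(1)] .
  ultimately show ?thesis using sb_trans[OF b0(2)] dm_mono[OF unt_mono] b0(3) by blast
qed

lemma fin: assumes "b <: WS" "wd a d t" "sb (unt T0 b) a" "sb (unt T1 b) d" "sb (unt T2 b) t"
  shows "EX e. e <: DD & sb b e & sb a (unt T0 e) & sb d (unt T1 e)"
proof -
  obtain e where "e <: DD" "sb (mk a d t) e" using ext[OF mk_WS[OF assms(2)] rc_emp[OF rcl]] by blast
  moreover have "sb b (mk a d t)" using sb_mk assms unfolding WS by blast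
  ultimately show ?thesis using sb_trans unt_mono[of "mk a d t" e T0] unt_mono[of "mk a d t" e T1] by auto
qed

lemma DD_D: assumes "b <: DD"
  shows "b <: WS" "wd (unt T0 b) (unt T1 b) (unt T2 b)" "unt T0 b <: FX Z" "unt T1 b <: FX Z" "sb p2 (unt T1 b)"
    "dm (unt T2 b) <: lam" "play (dm (unt T2 b)) (unt T2 b)" "sb (rt (unt T1 b) X) (unt T0 b)"
    "u <: rt (unt T0 b) Y ==> u <: rt (unt T1 b) X | (EX e q. e <: dm (unt T2 b) & Ev e & QC (unt T1 b) (unt T2 b) e q & u <: q)"
  using assms unfolding DD WS wd_def by blast+

lemma lift1: assumes b: "b <: DD" and d: "d <: FX Z" "sb (unt T1 b) d"
  shows "EX e. e <: DD & sb b e & sb d (unt T1 e)"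
proof -
  note W = DD_D[OF b]
  obtain H where H: "F.gen H" "d : H" using gen_ex FX_cond d(1) by blast
  have H1: "unt T1 b : H" using G_sub[OF H d(2)] .
  have "EX a d'. wd a d' (unt T2 b) & d' : H & sb (unt T0 b) a & sb d d'"
  proof (rule core[OF H d(1) sb_trans[OF W(5) d(2)] W(3) wd_seg[OF W(2) H(1) H1]])
    fix u assume "u <: rt (unt T0 b) Y"
    thus "u <: rt d X | (EX e q. e <: dm (unt T2 b) & Ev e & DQ H (ap (unt T2 b) e) q & u <: q)"
      using W(9) sbD[OF rt_mono[OF d(2)]] QC_DQ[OF H(1) H1] by blast
  qed
  thus ?thesis using fin[OF W(1)] sb_trans[OF d(2)] sb_trans sb_refl by metis
qed

lemma Ev_emp: "Ev emp" using Ev[of emp] mem_suc mem_emp by metis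

lemma DD_even: assumes b: "b <: DD" and i: "i <: dm (unt T2 b)" shows "EX e. e <: dm (unt T2 b) & i <: e & Ev e"
proof -
  have s: "suc i <: dm (unt T2 b)" "suc (suc i) <: dm (unt T2 b)" using b i unfolding DD by blast+
  have "Ev (suc i) | Ev (suc (suc i))" using Ev_suc by blast
  thus ?thesis using s by (metis mem_suc)
qed

lemma DD_dx: assumes b: "b <: DD" and q: "sb (unt T0 b) q" "cond q" shows "dx x q (ut (unt T2 b))"
proof (rule dx_Un)
  note W = DD_D[OF b]
  show "q <: FF" using q(2) FF by blast
  fix z assume "z <: ut (unt T2 b)"
  then obtain i s where i: "pr i s <: unt T2 b" "z <: s" unfolding ut_def by auto
  hence "i <: dm (unt T2 b)" unfolding mem_dm by blast
  then obtain e where e: "e <: dm (unt T2 b)" "i <: e" "Ev e" using DD_even[OF b] by blast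
  then obtain r where r: "QC (unt T1 b) (unt T2 b) e r" using W(2) unfolding wd_def by blast
  have "z <: ut (rs (unt T2 b) e)" unfolding ut_def mem_Un mem_rg mem_rs using i e(2) by blast
  thus "EX q' s'. z <: s' & sb q' q & dx x q' s'" using wd_q[OF W(2) e(1,3) r] sb_trans[OF _ q(1)] by blast
qed

lemma lift0: assumes b: "b <: DD" and a: "a' <: FX Z" "sb (unt T0 b) a'"
  shows "EX e. e <: DD & sb b e & sb a' (unt T0 e)"
proof -
  let ?a = "unt T0 b" let ?d = "unt T1 b" let ?t = "unt T2 b" let ?q = "rt a' Y" let ?l = "dm (ut (unt T2 b))"
  note W = DD_D[OF b]
  have lim: "emp <: dm ?t" "i <: dm ?t ==> suc i <: dm ?t" "pr (pr k i) v <: ?d ==> i <: ?l" for i v using b unfolding DD by blast+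
  have qY: "?q <: FX Y" using rt_cond[OF a(1)] .
  have qb: "sb q ?q" if q: "e <: dm ?t" "Ev e" "QC ?d ?t e q" for e q
    using sb_rt_FX[OF wd_q(1)[OF W(2) q] sb_trans[OF wd_q(4)[OF W(2) q] a(2)]] .
  obtain q0 where q0: "QC ?d ?t emp q0" using W(2) lim(1) Ev_emp unfolding wd_def by blast
  have pq: "sb p ?q" using sb_trans[OF wd_q(2)[OF W(2) lim(1) Ev_emp q0] qb[OF lim(1) Ev_emp q0]] .
  \<comment> \<open>The part of \<open>a'\<close> on \<open>Y\<close> need not be good yet; a
    further extension \<open>u\<close> on \<open>X\<close> makes it so, and \<open>u\<close> is
    added on the side of \<open>unt T1 b\<close> as well.\<close>
  obtain u s where u: "u <: FX X" "sb (rt ?q X) u" "sseq s" "good X Y x (un ?q u) s" using gda[OF qY pq] unfolding gd_def by blast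
  note qu = un_FX[OF qY u(1,2)]
  have aq: "rt a' X = rt ?q X" using rt_rt[OF XY] by simp
  have "dx x ?q (ut ?t)"
  proof (rule dx_Un)
    show "?q <: FF" using FX_cond[OF qY] FF by blast
    fix z assume "z <: ut ?t"
    then obtain i s where i: "pr i s <: ?t" "z <: s" unfolding ut_def by auto
    hence "i <: dm ?t" unfolding mem_dm by blast
    then obtain e where e: "e <: dm ?t" "i <: e" "Ev e" using DD_even[OF b] by blast
    then obtain r where r: "QC ?d ?t e r" using W(2) unfolding wd_def by blast
    have "z <: ut (rs ?t e)" unfolding ut_def mem_Un mem_rg mem_rs using i e(2) by blast
    thus "EX q' s'. z <: s' & sb q' ?q & dx x q' s'" using wd_q(3)[OF W(2) e(1,3) r] qb[OF e(1,3) r] by blast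
  qed
  hence dq: "dx x (un ?q u) (ut ?t)" using dx_le FX_cond[OF qu(1)] FF sb_un1 by blast
  have su: "sseq (ut ?t)" unfolding ut_def using play_Uu(1)[OF W(7,6)] .
  obtain s2 where s2: "sseq s2" "sb (ut ?t) s2" "good X Y x (un ?q u) s2"
    using dx_sub[OF qu(1) sb_unI(1)[OF pq] dq su u(4,3)] by blast
  have l: "?l <: lam" using sseq_fto[OF su] by blast
  \<comment> \<open>The code of the pair that player I is to use for his next move, to be written at
    the place \<open>?l\<close>.\<close>
  let ?v = "ap c (pr s2 (un ?q u))"
  have w: "pr s2 (un ?q u) <: prd Sq (FX Y)" using s2(1) Sq qu(1) by simp
  have dX: "sb (rt ?d X) u" using sb_trans[OF sb_rt_FX[OF rt_cond[OF W(4)] sb_trans[OF W(8) a(2)]]] u(2) unfolding aq by blast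
  have "isf (un u (rt ?d X))" using un_absorb2[OF dX] cond_isf[OF FX_cond[OF u(1)]] by simp
  hence "isf (un ?d u)" using isf_comm FX_isf[OF u(1) FX_cond[OF W(4)]] by blast
  hence du: "un ?d u <: FX Z" using FX_un[OF W(4)] FX_mono[OF u(1) sb_trans[OF XY YZ]] by blast
  let ?e = "sg (pr (pr k ?l) ?v)"
  define d1 where "d1 = un (un ?d u) ?e"
  \<comment> \<open>The place is free by the definition of \<open>DD\<close>, and \<open>u\<close>
    does not touch column \<open>k\<close>, which lies outside of \<open>Y\<close>.\<close>
  have "~ pr (pr k ?l) w <: un ?d u" for w using lim(3) not_mem_self[of ?l] FXD[OF u(1)] kY sbD[OF XY] unfolding mem_un by blast
  hence c1: "cond d1" unfolding d1_def using cond_add[OF FX_cond[OF du] kI l cV[OF w]] by blast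
  have d1: "d1 <: FX Z" unfolding FX using c1 FXD[OF du] kZ unfolding d1_def by auto
  have sd: "sb ?d d1" "sb u d1" "sb ?e d1" unfolding d1_def by (simp_all add: sb_unI)
  obtain H where H: "F.gen H" "d1 : H" using gen_ex c1 by blast
  have Hd: "?d : H" "u : H" "?e : H" using G_sub[OF H] sd by blast+
  note R = run_p2[OF H sb_trans[OF W(5) sd(1)]]
  note st = wd_seg[OF W(2) H(1) Hd(1)]
  \<comment> \<open>The length is a limit, hence even: player I is to move.\<close>
  have "dm ?t ~= suc i" for i using lim(2)[of i] mem_suc[of i i] not_mem_self[of "suc i"] by metis
  hence Ed: "Ev (dm ?t)" using Ev[of "dm ?t"] by blast
  then obtain s' where s': "F.memG H (F.chk (pr (dm ?t) s')) n" "sI H (pr ?t s')" using R(1) st unfolding run_def by blast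
  have gvl: "gv k c H (pr ?l (pr s2 (un ?q u)))" unfolding gv_def using Hd(3) by simp
  have "vd H ?t s2 (un ?q u)" unfolding vd_def qu(2)
  proof (intro conjI allI impI)
    fix e q' assume e: "e <: dm ?t" "Ev e" "DQ H (ap ?t e) q'"
    obtain r where r: "QC ?d ?t e r" using e W(2) unfolding wd_def by blast
    have "q' = r" using DQ_unique[OF H(1) e(3) QC_DQ[OF H(1) Hd(1) r]] .
    thus "sb q' (un ?q u)" using qb[OF e(1,2) r] sb_unI(1) by blast
  qed (use s2 Sq qu(1) sb_unI(1)[OF pq] Hd(2) dq in blast)+
  hence cl: "CI H (pr ?t (pr ?l (snoc s2 ?l)))" unfolding CI_def pf_pr ps_pr using w gvl s2(2) not_mem_self[of ?l] by blast
  obtain i where i: "CI H (pr ?t (pr i s'))" "i <: lam" "ALL j. j <: i --> (ALL s. ~ CI H (pr ?t (pr j s)))"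
    using s'(2) unfolding sI_def least_def by auto
  have "~ i <: ?l" using i(1) unfolding CI_def by simp
  \<comment> \<open>The strategy does not look below \<open>?l\<close>, and at \<open>?l\<close> it
    finds a valid pair.\<close>
  hence "i = ?l" using od_tri[OF oda[OF i(2)] oda[OF l]] i(3) cl by blast
  hence ss: "s' = snoc s2 ?l" using CI_unique[OF H(1)] i(1) cl by blast
  obtain t' where t': "play (suc (dm ?t)) t'" "seg H n t'" using R(1) lam_suc[OF W(6)] unfolding run_def by blast
  have dt: "dm t' = suc (dm ?t)" using play_dm[OF t'(1)] .
  have "F.memG H (F.chk (pr (dm ?t) (ap t' (dm ?t)))) n" using seg_play[OF t'(2)] unfolding dt by simp
  hence as: "ap t' (dm ?t) = snoc s2 ?l" using s'(1) R(1) unfolding run_def ss by blast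
  have sub: "i <: dm t'" if "i <: dm ?t" for i using that unfolding dt by simp
  \<comment> \<open>The assumption of \<open>core\<close> on the part of \<open>a'\<close> on
    \<open>Y\<close> holds because all of it is encoded in the move just made.\<close>
  have "EX a d'. wd a d' t' & d' : H & sb a' a & sb d1 d'"
  proof (rule core[OF H d1 sb_trans[OF W(5) sd(1)] a(1) t'(2)])
    fix z assume "z <: ?q"
    hence "z <: un ?q u" by simp
    moreover have "DQ H (ap t' (dm ?t)) (un ?q u)" unfolding DQ_def as using l w gvl by (intro exI[of _ s2] exI[of _ ?l]) simp
    moreover have "dm ?t <: dm t'" unfolding dt by simp
    ultimately show "z <: rt d1 X | (EX e q. e <: dm t' & Ev e & DQ H (ap t' e) q & z <: q)" using Ed by blast
  qed
  then obtain a d' where "wd a d' t'" "sb a' a" "sb d1 d'" by blast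
  thus ?thesis using fin[OF W(1) _ sb_trans[OF a(2)] sb_trans[OF sd(1)] seg_sb(1)[OF R(1) st t'(2) sub]] sb_trans by blast
qed

lemma DD_ex: "EX b. b <: DD"
proof -
  obtain H where H: "F.gen H" "p2 : H" using gen_ex FX_cond p2(1) by blast
  have d: "dm emp = emp" by (rule exten) simp
  have "play emp emp" unfolding play_def fon_def isf_def by simp
  hence s: "seg H n emp" unfolding seg_def using rc_emp[OF rcl] by (intro exI[of _ emp]) simp
  have e: "emp <: FX Z" unfolding FX using cond_emp by simp
  have "EX a d. wd a d emp & d : H & sb emp a & sb p2 d" by (rule core[OF H p2(1) sb_refl e s]) (simp add: mem_rt)
  thus ?thesis using mk_WS ext rc_emp[OF rcl] by blast
qed

lemma shc_DD: "shc lam DD"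
proof -
  have "Uu C <: DD" if C: "EX b. b <: C" "ALL b. b <: C --> b <: DD" "ALL b e. b <: C --> e <: C --> sb b e | sb e b" "bd lam C" for C
  proof -
    have "Uu C <: WS" using shc_WS C DD_D(1) unfolding shc_def by blast
    moreover have s: "i <: dm (unt T2 b) ==> i <: dm (unt T2 (Uu C))" "i <: dm (ut (unt T2 b)) ==> i <: dm (ut (unt T2 (Uu C)))" if "b <: C" for b i
      using dm_mono[OF unt_mono[OF sb_Uu[OF that]]] dm_mono[OF ut_mono[OF unt_mono[OF sb_Uu[OF that]]]] by blast+
    have "suc i <: dm (unt T2 (Uu C))" if i: "i <: dm (unt T2 (Uu C))" for i
    proof -
      obtain b where "b <: C" "i <: dm (unt T2 b)" using i by auto
      thus ?thesis using s(1) C(2) unfolding DD by blast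
    qed
    moreover have "i <: dm (ut (unt T2 (Uu C)))" if i: "pr (pr k i) v <: unt T1 (Uu C)" for i v
    proof -
      obtain b where "b <: C" "pr (pr k i) v <: unt T1 b" using i by auto
      thus ?thesis using s(2) C(2) unfolding DD by blast
    qed
    ultimately show ?thesis using C(1,2) s(1) unfolding DD by blast
  qed
  thus ?thesis unfolding shc_def by blast
qed

lemma bd_DD: "bd mu DD"
proof (rule bd_sub[OF rc_emp[OF rcm]])
  have "bd mu u" if "u <: FX Z" for u using FX_cond[OF that] bd_mono[OF rcl rcm lm] unfolding cond_def by blast
  hence "bd mu Big" unfolding Big_def using bd_Uu[OF rc_od[OF rcm] bd_FX[OF bZ]] bd_un[OF rcm] bd_prd[OF rcm rc_bd[OF rcm lm] bd_Sq] by blast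
  moreover have "bd mu TT" unfolding TT_def sg_def by (intro bd_un bd_up rcm)
  ultimately show "bd mu (Pw (prd TT Big))" using pwm bd_prd[OF rcm] by blast
  show "b <: Pw (prd TT Big)" if "b <: DD" for b using DD_D(1)[OF that] unfolding WS sb_def mem_Pw by blast
qed

end

section \<open>When player I wins\<close>

text \<open>Both names denote sets of ground model elements, so it suffices to compare them on
  canonical names, which \<open>tr\<close> respects.\<close>

lemma (in transfer) eq_tr_ground: assumes w0: "w0 <: W" and G: "B.gen G" "e2 w0 : G"
    and x: "!!z. A.memG (G1 G) z x ==> EX a. A.eqG (G1 G) z (A.chk a)" and y: "!!z. B.memG G z y ==> EX a. B.eqG G z (B.chk a)"
    and e: "!!a. A.memG (G1 G) (A.chk a) x = B.memG G (B.chk a) y"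
  shows "B.eqG G (tr x) y"
proof (rule B.eqG_ext[OF G(1)])
  have g: "A.gen (G1 G)" using gen_G1[OF G(1)] G(2) w0 unfolding GW_def by blast
  note c = tr_chk[OF w0 G] note s = B.eqG_sym[OF G(1)] and m1 = B.memG_eq1[OF G(1)]
  show "B.memG G z (tr x) = B.memG G z y" for z
  proof
    assume z: "B.memG G z (tr x)"
    obtain z' where z': "B.eqG G (tr z') z" using tr_surj[OF w0 G] by blast
    hence "A.memG (G1 G) z' x" using mem_tr_G[OF w0 G] m1[OF s[OF z'] z] by blast
    moreover then obtain a where a: "A.eqG (G1 G) z' (A.chk a)" using x by blast
    ultimately have "B.memG G (B.chk a) y" using A.memG_eq1[OF g a] e by blast
    moreover have "B.eqG G (tr z') (tr (A.chk a))" using a eq_tr[OF w0 G] by blast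
    ultimately show "B.memG G z y" using m1 s z' c by blast
  next
    assume z: "B.memG G z y"
    then obtain a where a: "B.eqG G z (B.chk a)" using y by blast
    hence "A.memG (G1 G) (A.chk a) x" using e m1[OF a z] by blast
    hence "B.memG G (tr (A.chk a)) (tr x)" using mem_tr_G[OF w0 G] by blast
    thus "B.memG G z (tr x)" using m1 s a c by blast
  qed
qed

context columns begin

text \<open>By \<open>cap\<close> the value at \<open>i\<close> is decided by a condition on
  \<open>X\<close> in \<open>G\<close>, and this condition belongs to \<open>H\<close> as
  well.\<close>

lemma agree: assumes G: "F.gen G" "F.gen H" "p : G" "p <: FX X" "cap X f p" "isfn G f" and s: "!!r. r <: FX X ==> r : G ==> r : H"
    and i: "i <: lam" "F.memG G (F.chk (pr i y)) f"
  shows "F.memG H (F.chk (pr i y)) f"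
proof -
  let ?Q = "%r. EX y. F.Frc r (%G. F.memG G (F.chk (pr i y)) f)"
  have "D ?Q" by (intro dfi)
  then obtain r where r: "r : G" "r <: FX X" "?Q r"
    using FX_dense[OF G(1) _ G(3,4), of ?Q] G(5) i(1) unfolding cap_def by blast
  then obtain y' where y': "F.Frc r (%G. F.memG G (F.chk (pr i y')) f)" by blast
  have "y' = y" using F.Frc_D[OF y' G(1) r(1)] i(2) G(6) unfolding isfn_def by blast
  thus ?thesis using F.Frc_D[OF y' G(2) s[OF r(2,1)]] by blast
qed

end

context playR begin

lemma DD_agree: assumes "b <: DD" shows "rt (unt T0 b) X = rt (unt T1 b) X"
proof (rule sb_antisym)
  show "sb (rt (unt T1 b) X) (rt (unt T0 b) X)" using sb_rt_FX[OF rt_cond[OF DD_D(4)[OF assms]] DD_D(8)[OF assms]] .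
  show "sb (rt (unt T0 b) X) (rt (unt T1 b) X)" unfolding sb_def
  proof (intro allI impI)
    fix u assume u: "u <: rt (unt T0 b) X"
    hence "u <: rt (unt T0 b) Y" using XY unfolding mem_rt sb_def by blast
    then consider "u <: rt (unt T1 b) X" | e q where "e <: dm (unt T2 b)" "Ev e" "QC (unt T1 b) (unt T2 b) e q" "u <: q"
      using DD_D(9)[OF assms] by blast
    thus "u <: rt (unt T1 b) X"
    proof cases
      case 2
      note W = DD_D(2)[OF assms]
      obtain H where H: "F.gen H" "unt T1 b : H" using gen_ex FX_cond DD_D(4)[OF assms] by blast
      obtain q' where q': "QC (unt T1 b) (unt T2 b) e q'" "sb (rt q' X) (unt T1 b)" using W 2(1,2) unfolding wd_def by blast
      have "q' = q" using DQ_unique[OF H(1) QC_DQ[OF H q'(1)] QC_DQ[OF H 2(3)]] .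
      thus ?thesis using q'(2) 2(4) u unfolding mem_rt sb_def by blast
    qed
  qed
qed

lemma DD_p: assumes "b <: DD" shows "sb p (unt T0 b)"
proof -
  note W = DD_D(2)[OF assms]
  have e: "emp <: dm (unt T2 b)" using assms unfolding DD by blast
  then obtain q where q: "QC (unt T1 b) (unt T2 b) emp q" using W Ev_emp unfolding wd_def by blast
  show ?thesis using sb_trans[OF wd_q(2)[OF W e Ev_emp q] wd_q(4)[OF W e Ev_emp q]] .
qed

text \<open>The tree and the order do not depend on the projection, so the embeddings for
  \<open>T0\<close> and \<open>T1\<close> have a common domain and \<open>transfer\<close> applies.
  The filter through \<open>e2\<close> contains conditions \<open>unt T1\<close>, which fix the run;
  the induced one contains conditions \<open>unt T0\<close>, which force the moves into
  \<open>x\<close>.\<close>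

lemma twins: "EX tr G1 G2. F.gen G1 & F.gen G2 & (ALL q e. F.TG G1 (inst q e) = F.TG G2 (inst q (%i. tr (e i)))) &
    (ALL x y. (ALL z. F.memG G1 z x --> (EX a. F.eqG G1 z (F.chk a))) --> (ALL z. F.memG G2 z y --> (EX a. F.eqG G2 z (F.chk a))) -->
      (ALL a. F.memG G1 (F.chk a) x = F.memG G2 (F.chk a) y) --> F.eqG G2 (tr x) y) &
    p : G1 & p2 : G2 & (ALL u. u <: FX X --> (u : G1) = (u : G2)) & (ALL z. outc G2 n z --> F.memG G1 (F.chk z) x)"
proof -
  obtain c0 where c0: "c0 <: DD" using DD_ex by blast
  have "emp <: Pw DD" by simp
  then obtain k' c' where k': "k' <: IX" "~ k' <: Z" "ALL x v. x <: Pw DD --> v <: bb k' --> ap c' (pr x v) <: bb k'"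
    "ALL x v y w. x <: Pw DD --> v <: bb k' --> y <: Pw DD --> w <: bb k' --> ap c' (pr x v) = ap c' (pr y w) --> x = y & v = w"
    using many[OF bZ pwm[OF bd_DD]] by blast
  interpret T: tree E lam mu IX bb DD c0 k' by unfold_locales (rule c0 shc_DD k'(1))+
  interpret A0: absorb E lam mu IX bb DD c0 k' Z c' T0
    by unfold_locales (use k' DD_D(3) lift0 in blast)+
  interpret A1: absorb E lam mu IX bb DD c0 k' Z c' T1
    by unfold_locales (use k' DD_D(4) lift1 in blast)+
  let ?P = "prd T.W (FX A0.rest)" let ?b = "%w. T.bs (pf w) (dm (pf w))"
  obtain e1 where De1: "Dt e1" and e1: "ALL x. x <: ?P --> sb (unt T0 (?b x)) (e1 x)"
    "ALL x q. x <: ?P --> q <: FX Z --> sb q (e1 x) --> sb q (unt T0 (?b x))" and m1: "ALL x y. A0.wl x y --> F.le (e1 x) (e1 y)"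
    and d1: "ALL x p. x <: ?P --> F.le p (e1 x) --> (EX y. A0.wl y x & F.le (e1 y) p)"
    and c1: "ALL x y. x <: ?P --> y <: ?P --> F.comp (e1 x) (e1 y) --> (EX u. A0.wl u x & A0.wl u y)"
    using A0.embedding by (elim exE conjE)
  obtain e2 where De2: "Dt e2" and e2: "ALL x. x <: ?P --> sb (unt T1 (?b x)) (e2 x)"
    "ALL x q. x <: ?P --> q <: FX Z --> sb q (e2 x) --> sb q (unt T1 (?b x))" and m2: "ALL x y. A0.wl x y --> F.le (e2 x) (e2 y)"
    and d2: "ALL x p. x <: ?P --> F.le p (e2 x) --> (EX y. A0.wl y x & F.le (e2 y) p)"
    and c2: "ALL x y. x <: ?P --> y <: ?P --> F.comp (e2 x) (e2 y) --> (EX u. A0.wl u x & A0.wl u y)"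
    using A1.embedding by (elim exE conjE)
  interpret TR: transfer E FF RF FF RF ?P A0.wl e1 e2
  proof
    show "D (%p. A0.wl (pf p) (ps p))" by (rule A0.D_wl; intro dfi)
    show "A0.wl w w' ==> w <: ?P & w' <: ?P" for w w' unfolding A0.wl_def by blast
    show "w <: ?P ==> A0.wl w w" for w unfolding A0.wl_def by simp
    show "A0.wl u w ==> A0.wl w x ==> A0.wl u x" for u w x unfolding A0.wl_def using sb_trans by blast
  qed (use De1 De2 m1 d1 c1 m2 d2 c2 in blast)+
  let ?w0 = "pr emp emp"
  have "T.isW emp"
  proof -
    have "dm emp = emp" by (rule exten) simp
    thus ?thesis unfolding T.isW_def isf_def using rc_emp[OF rcl] by simp
  qed
  moreover have "emp <: FX A0.rest" unfolding FX using cond_emp by simp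
  ultimately have w0: "?w0 <: ?P" using T.W by simp
  have PW: "T.isW (pf w) & ps w <: FX A0.rest & w = pr (pf w) (ps w)" if "w <: ?P" for w using that unfolding mem_prd T.W by auto
  have bD: "?b w <: DD" if "w <: ?P" for w using T.bs_DD[of "pf w" "dm (pf w)"] PW[OF that] by simp
  have ce: "cond (e1 w) & cond (e2 w)" if "w <: ?P" for w
    using m1 m2 TR.wl_refl[OF that] unfolding le FF by blast
  obtain G where G: "F.gen G" "e2 ?w0 : G" using gen_ex ce[OF w0] by blast
  define H where "H = TR.G1 G"
  have g0: "?w0 : TR.GW G" unfolding TR.GW_def using w0 G(2) by blast
  have H: "F.gen H" unfolding H_def by (rule TR.gen_G1[OF G(1) g0])
  have gw: "w <: ?P" "e2 w : G" "e1 w : H" if "w : TR.GW G" for w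
  proof -
    show w: "w <: ?P" "e2 w : G" using that unfolding TR.GW_def by blast+
    have "F.le (e1 w) (e1 w)" unfolding le FF using ce[OF w(1)] by simp
    thus "e1 w : H" unfolding H_def TR.G1_def using that by blast
  qed
  have pH: "p : H" using G_sub[OF H gw(3)[OF g0]] sb_trans[OF DD_p[OF bD[OF w0]]] e1(1) w0 by blast
  have pG: "p2 : G" using G_sub[OF G] sb_trans[OF DD_D(5)[OF bD[OF w0]]] e2(1) w0 by blast
  have pG': "p : G" using G_sub[OF G(1) pG p2(2)] .
  have ag: "(u : H) = (u : G)" if u: "u <: FX X" for u
  proof
    have uZ: "u <: FX Z" using FX_mono[OF u sb_trans[OF XY YZ]] .
    {
      assume "u : H"
      then obtain w where w: "w : TR.GW G" "sb u (e1 w)" unfolding H_def TR.G1_def le by blast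
      have "sb u (unt T0 (?b w))" using e1(2) gw(1)[OF w(1)] uZ w(2) by blast
      hence "sb u (rt (unt T0 (?b w)) X)" by (rule sb_rt_FX[OF u])
      hence "sb u (unt T1 (?b w))" unfolding DD_agree[OF bD[OF gw(1)[OF w(1)]]] using sb_trans sb_rt by blast
      hence "sb u (e2 w)" using e2(1) gw(1)[OF w(1)] sb_trans by blast
      thus "u : G" using G_sub[OF G(1) gw(2)[OF w(1)]] by blast
    }
    {
      assume "u : G"
      then obtain w where w: "w : TR.GW G" "sb u (e2 w)" using TR.GW_below[OF G(1) g0, of u] unfolding le by blast
      have "sb u (unt T1 (?b w))" using e2(2) gw(1)[OF w(1)] uZ w(2) by blast
      hence "sb u (rt (unt T1 (?b w)) X)" by (rule sb_rt_FX[OF u])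
      hence "sb u (unt T0 (?b w))" unfolding DD_agree[OF bD[OF gw(1)[OF w(1)]], symmetric] using sb_trans sb_rt by blast
      hence "sb u (e1 w)" using e1(1) gw(1)[OF w(1)] sb_trans by blast
      thus "u : H" using G_sub[OF H gw(3)[OF w(1)]] by blast
    }
  qed
  have oc: "F.memG H (F.chk z) x" if z: "outc G n z" for z
  proof -
    obtain t b where t: "seg G n t" "b <: dm t" "z <: ap t b" using z unfolding outc_def by blast
    have bl: "b <: lam" using t(1,2) seg_play lam_trans by blast
    \<comment> \<open>By \<open>ext\<close>, nodes whose element of \<open>DD\<close> carries a play
      longer than \<open>b\<close> are dense; one of them in the filter shows move \<open>b\<close>
      of the run.\<close>
    let ?Q = "%w. b <: dm (unt T2 (?b w))"
    have "D ?Q" by (intro dfi)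
    moreover have "EX y. A0.wl y u & ?Q y" if u: "A0.wl u ?w0" for u
    proof -
      have uP: "u <: ?P" using u unfolding A0.wl_def by blast
      obtain e where e: "e <: DD" "sb (?b u) e" "b <: dm (unt T2 e)" using ext[OF DD_D(1)[OF bD[OF uP]] bl] by blast
      obtain v where v: "v <: bb k'" using bbne k'(1) by blast
      have uW: "T.isW (pf u)" using PW[OF uP] by blast
      let ?y = "un (pf u) (sg (pr (dm (pf u)) (pr e v)))"
      note A = T.isW_add[OF uW e(1) v e(2)]
      have "A0.wl (pr ?y (ps u)) u" unfolding A0.wl_def using A(1,2) PW[OF uP] uP T.W by simp
      moreover have "?Q (pr ?y (ps u))" using A(4) e(3) by simp
      ultimately show ?thesis by blast
    qed
    ultimately obtain w where w: "w : TR.GW G" "?Q w" using TR.GW_dense[OF G(1) g0, of ?Q] by blast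
    note wP = gw[OF w(1)] note B = bD[OF wP(1)]
    let ?t = "unt T2 (?b w)"
    have "unt T1 (?b w) : G" using G_sub[OF G(1) wP(2)] e2(1) wP(1) by blast
    hence st: "seg G n ?t" using wd_seg[OF DD_D(2)[OF B] G(1)] by blast
    have "run Ev sI G n" using F.Frc_D[OF p2(3) G(1) pG] .
    hence "ap t b = ap ?t b" using seg_play[OF t(1)] seg_play[OF st] t(2) w(2) unfolding run_def by blast
    moreover have "fon ?t (dm ?t)" using DD_D(7)[OF B] unfolding play_def by blast
    hence "ap ?t b <: rg ?t" using fon_ap w(2) unfolding mem_rg by blast
    ultimately have "z <: ut ?t" unfolding ut_def mem_Un using t(3) by metis
    moreover have "dx x (e1 w) (ut ?t)" using DD_dx[OF B] e1(1) ce wP(1) by blast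
    ultimately show ?thesis using F.Frc_D[OF _ H wP(3)] unfolding dx_def by blast
  qed
  have i: "F.TG H (inst q e) = F.TG G (inst q (%i. TR.tr (e i)))" for q e unfolding H_def by (rule TR.TG_tr_inst[OF w0 G])
  have eq: "F.eqG G (TR.tr x) y" if "ALL z. F.memG H z x --> (EX a. F.eqG H z (F.chk a))" "ALL z. F.memG G z y --> (EX a. F.eqG G z (F.chk a))"
    "ALL a. F.memG H (F.chk a) x = F.memG G (F.chk a) y" for x y
    using TR.eq_tr_ground[OF w0 G, of x y] that unfolding H_def by blast
  show ?thesis using H G(1) i eq pH pG ag oc by (intro exI[of _ TR.tr] exI[of _ H] exI[of _ G]) blast
qed

end

context columns begin

definition Ph :: "fm => nat => nat set => nat => bool" where
  "Ph q f G x = (F.TG G (FunctionTo x (F.chk lam) (F.chk lam)) & F.TG G (inst q (case_nat x (%_. f))))"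
lemma DG_FunctionTo: "F.DG (%G x. F.TG G (FunctionTo x (F.chk lam) (F.chk lam)))"
  unfolding Imp_def Or_def Iff_def Ex_def IsUnorderedPair_def IsPair_def PairIn_def IsFunction_def FunctionOn_def FunctionTo_def
  by (intro F.DF_DG F.DFs dfi)
lemma DG_FunctionToGround: "F.DG (%G x. F.TG G (FunctionToGround x (F.chk lam)))"
  unfolding Imp_def Or_def Iff_def Ex_def IsUnorderedPair_def IsPair_def PairIn_def IsFunction_def FunctionOn_def FunctionToGround_def
  by (intro F.DF_DG F.DFs dfi)
lemma DG_Ph: "F.DG (Ph q f)"
proof -
  have "Dt (%x. case_nat x (%_. f) i)" for i by (cases i) (simp_all, (intro dfi)+)
  hence "F.DF (%x. inst q (%i. case_nat x (%_. f) i))" by (rule F.DF_inst)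
  thus ?thesis unfolding Ph_def by (intro dfi DG_FunctionTo F.DF_DG)
qed

lemma ground_fn: assumes G: "F.gen G" and f: "F.TG G (FunctionToGround f (F.chk lam))"
  shows "isfn G f" "F.memG G z f ==> EX i y. i <: lam & F.eqG G z (F.chk (pr i y))"
proof -
  interpret g: colgen E lam mu IX bb G by unfold_locales (rule G)
  have f': "g.N.fon (g.v f) (g.jj lam)" "ALL x y. g.M (g.N.pr x y) (g.v f) --> (EX a. y = g.jj a)" using f unfolding g.TG_FunctionToGround by blast+
  have m: "F.memG G (F.chk (pr i k)) f = g.M (g.N.pr (g.jj i) (g.jj k)) (g.v f)" for i k by (simp add: g.EN)
  show "isfn G f" unfolding isfn_def m
  proof (intro conjI allI impI)
    fix i assume "i <: lam"
    hence "g.M (g.jj i) (g.jj lam)" by simp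
    then obtain y where y: "g.M (g.N.pr (g.jj i) y) (g.v f)" using f'(1) unfolding g.N.fon_def by blast
    moreover then obtain a where "y = g.jj a" using f'(2) by blast
    ultimately show "EX k. g.M (g.N.pr (g.jj i) (g.jj k)) (g.v f)" by blast
  next
    fix i k k' assume "g.M (g.N.pr (g.jj i) (g.jj k)) (g.v f)" "g.M (g.N.pr (g.jj i) (g.jj k')) (g.v f)"
    hence "g.jj k = g.jj k'" using f'(1) unfolding g.N.fon_def g.N.isf_def by blast
    thus "k = k'" by simp
  qed
  assume "F.memG G z f"
  hence "g.M (g.v z) (g.v f)" using g.EN by blast
  moreover then obtain x y where xy: "g.v z = g.N.pr x y" using f'(1) unfolding g.N.fon_def g.N.isf_def by blast
  moreover then obtain a where "y = g.jj a" using f'(2) calculation by metis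
  moreover obtain i where "i <: lam" "x = g.jj i" using f'(1) calculation g.M_j unfolding g.N.fon_def by metis
  ultimately have "g.v z = g.jj (pr i a)" "i <: lam" by simp_all
  thus "EX i y. i <: lam & F.eqG G z (F.chk (pr i y))" using g.v_eq by blast
qed

lemma FunctionTo_Ground: assumes G: "F.gen G" and f: "F.TG G (FunctionTo f (F.chk lam) (F.chk lam))"
  shows "F.TG G (FunctionToGround f (F.chk lam))"
proof -
  interpret g: colgen E lam mu IX bb G by unfold_locales (rule G)
  show ?thesis using f unfolding g.TG_FunctionToGround g.TG_FunctionTo g.N.fto_def g.M_j by blast
qed

end

context colgen begin

lemma playerI: assumes X: "bd mu X" "p0 : G" "p0 <: FX X" "F.Frc p0 (%G. F.TG G (FunctionToGround f (F.chk lam)))" "cap X f p0"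
    and A: "!!x. Ph q f G x ==> M (v x) A"
    and Y: "bd mu Y" "sb X Y" "p : G" "p <: FX Y" "F.Frc p (%G. Ph q f G x)"
    and gd: "!!q. q <: FX Y ==> sb p q ==> gd X Y x q"
  shows "sat M (PlayerIWins (jj lam) A)"
proof -
  have PF: "F.TG H (FunctionToGround x (F.chk lam))" if "F.gen H" "Ph q f H x" for H x using FunctionTo_Ground that unfolding Ph_def by blast
  have "pr emp p <: prd Sq (FX Y)" using sseq_emp Sq Y(4) by simp
  moreover have "bd mu (prd Sq (FX Y))" using bd_prd[OF rcm bd_Sq bd_FX[OF Y(1)]] .
  ultimately obtain k c where kc: "k <: IX & ~ k <: Y & (ALL w. w <: prd Sq (FX Y) --> ap c w <: bb k) &
     (ALL w y. w <: prd Sq (FX Y) --> y <: prd Sq (FX Y) --> ap c w = ap c y --> w = y)" using column_for[OF Y(1)] by blast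
  interpret I: playI E lam mu IX bb X Y x p k c
  proof
    show "F.Frc p (%G. isfn G x)" using Y(5) ground_fn(1) PF unfolding F.Frc_def by blast
  qed (use X(1) Y gd kc in blast)+
  show ?thesis
  proof (rule winsI[of Ev, OF _ refl I.DG_sI])
    show "D Ev" by (intro dfi)
    show "EX s. legal t s & I.sI G (pr t s)" if "a <: lam" "Ev a" "play a t" for a t using I.sI_total[OF genG that(1,3)] .
    show "s = s'" if "I.sI G (pr t s)" "I.sI G (pr t s')" for t s s'
      using that unfolding I.sI_def by (rule least_unique[rotated, of I.CI]) (rule I.CI_unique[OF genG])
    fix n x' assume r: "run Ev I.sI G n" and x': "N.fto (v x') (jj lam) (jj lam)" "!!y. M y (v x') = (EX z. outc G n z & y = jj z)"
    show "M (v x') A"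
    proof (rule ccontr)
      assume "~ M (v x') A"
      hence np: "~ Ph q f G x'" using A by blast
      \<comment> \<open>All that is assumed about the bad run, as one statement of the extension, so
        that a single condition \<open>p2\<close> forces it and it holds again in the second of the
        twin filters.\<close>
      let ?S = "%G _. run Ev I.sI G n & F.TG G (FunctionTo x' (F.chk lam) (F.chk lam)) & (ALL z. F.memG G (F.chk z) x' = outc G n z) & ~ Ph q f G x'"
      have dc: "Dt (%_. x')" "Dt (%_. n)" "D Ev" by (intro dfi)+
      have dg: "F.DG (%G _. run Ev I.sI G n)" "F.DG (%G _. F.TG G (FunctionTo x' (F.chk lam) (F.chk lam)))" "F.DG (%G _. Ph q f G x')"
        using DG_run[OF dc(3) I.DG_sI dc(2)] F.DG_comp[OF DG_FunctionTo dc(1)] F.DG_comp[OF DG_Ph dc(1)] by blast+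
      have dS: "F.DG ?S" by (intro dfi dg)
      have "M (jj z) (v x') = outc G n z" for z unfolding x'(2) by simp
      hence "?S G emp" using r np x'(1) TG_FunctionTo EN by simp
      then obtain p2 where p2: "p2 : G" "sb (un p p0) p2" "F.Frc p2 (%G. ?S G emp)"
        using F_truth[OF genG dS _ G_un[OF genG Y(3) X(2)]] by blast
      have c2: "cond p2" using G_FF[OF genG p2(1)] FF by blast
      let ?R = "%i r. EX s. F.Frc r (%G. F.memG G (F.chk (pr i s)) n)"
      have dR: "D (%w. ?R (pf w) (ps w))" by (intro dfi)
      have ex: "EX r. cond r & sb q r & ?R i r" if q: "i <: lam" "cond q" "sb p2 q" for i q
      proof -
        obtain H where H: "F.gen H" "q : H" using gen_ex q by blast
        have "run Ev I.sI H n" using F.Frc_D[OF p2(3) H(1) G_sub[OF H q(3)]] by blast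
        then obtain t where t: "play (suc i) t" "seg H n t" using lam_suc[OF q(1)] unfolding run_def by blast
        hence m: "F.memG H (F.chk (pr i (ap t i))) n" using play_dm unfolding seg_def by (metis mem_suc)
        let ?Q = "%G w. F.memG G (F.chk w) n"
        have "F.DG ?Q" by (intro dfi)
        thus ?thesis using F_truth[OF H(1), of ?Q "pr i (ap t i)" q] m H(2) G_FF[OF H(1)] FF by blast
      qed
      \<comment> \<open>\<open>Z\<close> must contain the supports used so far and the coding
        column, and must be large enough for conditions on it to decide every move of the
        run.\<close>
      have "bd mu (un Y (un (sg k) (supp p2)))" unfolding sg_def by (intro bd_un bd_up rcm Y(1) bd_supp[OF c2])
      then obtain Z where Z: "bd mu Z" "sb (un Y (un (sg k) (supp p2))) Z" "ALL i q. i <: lam --> q <: FX Z --> sb p2 q --> (EX r. r <: FX Z & sb q r & ?R i r)"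
        using capture[OF dR _ ex] by blast
      have Z': "sb Y Z" "k <: Z" "p2 <: FX Z" "sb p p2" "sb p0 p2" using Z(2) p2(2) FX_supp[OF c2] by simp_all
      interpret R: playR E lam mu IX bb X Y x p k c n p2 Z
      proof
        show "F.Frc p2 (%G. run Ev I.sI G n)" using p2(3) unfolding F.Frc_def by blast
      qed (use Z Z' in blast)+
      obtain tr G1 G2 where g: "F.gen G1" "F.gen G2" and ti: "ALL q e. F.TG G1 (inst q e) = F.TG G2 (inst q (%i. tr (e i)))" and
        te: "ALL x y. (ALL z. F.memG G1 z x --> (EX a. F.eqG G1 z (F.chk a))) --> (ALL z. F.memG G2 z y --> (EX a. F.eqG G2 z (F.chk a))) -->
          (ALL a. F.memG G1 (F.chk a) x = F.memG G2 (F.chk a) y) --> F.eqG G2 (tr x) y" and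
        pG: "p : G1" "p2 : G2" and ag: "ALL u. u <: FX X --> (u : G1) = (u : G2)" and oc: "ALL z. outc G2 n z --> F.memG G1 (F.chk z) x"
        using R.twins by (elim exE conjE)
      have S2: "?S G2 emp" using F.Frc_D[OF p2(3) g(2) pG(2)] .
      have P1: "Ph q f G1 x" using F.Frc_D[OF Y(5) g(1) pG(1)] .
      have p0: "p0 : G2" "p0 : G1" using G_sub[OF g(2) pG(2) Z'(5)] ag X(3) by blast+
      have F12: "F.TG G1 (FunctionToGround f (F.chk lam))" "F.TG G2 (FunctionToGround f (F.chk lam))"
        using F.Frc_D[OF X(4)] g p0 by blast+
      note fx = ground_fn[OF g(1) PF[OF g(1) P1]]
      have TG2: "F.TG G2 (FunctionToGround x' (F.chk lam))" using FunctionTo_Ground[OF g(2)] S2 by blast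
      note fx' = ground_fn[OF g(2) TG2] note f1 = ground_fn[OF g(1) F12(1)] note f2 = ground_fn[OF g(2) F12(2)]
      have pe: "EX i y. a = pr i y & i <: lam" if "EX i y. i <: lam & F.eqG H (F.chk a) (F.chk (pr i y))" "F.gen H" for a H
        using that(1) F.eqG_chk[OF that(2)] by blast
      have "F.memG G1 (F.chk a) x = F.memG G2 (F.chk a) x'" for a
      proof
        assume "F.memG G2 (F.chk a) x'" thus "F.memG G1 (F.chk a) x" using oc S2 by blast
      next
        assume m: "F.memG G1 (F.chk a) x"
        then obtain i y where i: "a = pr i y" "i <: lam" using pe[OF fx(2) g(1)] by blast
        \<comment> \<open>Both are functions on \<open>lam\<close>, so that the inclusion
          \<open>oc\<close> already gives equality.\<close>
        obtain y' where y': "F.memG G2 (F.chk (pr i y')) x'" using fx'(1) i(2) unfolding isfn_def by blast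
        hence "F.memG G1 (F.chk (pr i y')) x" using oc S2 by blast
        hence "y' = y" using m fx(1) unfolding i(1) isfn_def by blast
        thus "F.memG G2 (F.chk a) x'" using y' i(1) by blast
      qed
      hence e1: "F.eqG G2 (tr x) x'" using te fx(2) fx'(2) by blast
      have "F.memG G1 (F.chk a) f = F.memG G2 (F.chk a) f" for a
      proof
        assume m: "F.memG G1 (F.chk a) f"
        then obtain i y where i: "a = pr i y" "i <: lam" using pe[OF f1(2) g(1)] by blast
        show "F.memG G2 (F.chk a) f" using agree[OF g p0(2) X(3,5) f1(1) _ i(2)] ag m unfolding i(1) by blast
      next
        assume m: "F.memG G2 (F.chk a) f"
        then obtain i y where i: "a = pr i y" "i <: lam" using pe[OF f2(2) g(2)] by blast
        show "F.memG G1 (F.chk a) f" using agree[OF g(2,1) p0(1) X(3,5) f2(1) _ i(2)] ag m unfolding i(1) by blast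
      qed
      hence e2: "F.eqG G2 (tr f) f" using te f1(2) f2(2) by blast
      interpret g2: colgen E lam mu IX bb G2 by unfold_locales (rule g(2))
      have v: "g2.v (tr x) = g2.v x'" "g2.v (tr f) = g2.v f" using e1 e2 g2.v_eq by blast+
      have c: "(%i. g2.v (tr (case_nat x (%_. f) i))) = (%i. g2.v (case_nat x' (%_. f) i))" by (rule ext) (simp add: v split: nat.split)
      have "F.TG G1 (inst q (case_nat x (%_. f)))" using P1 unfolding Ph_def by blast
      hence "F.TG G2 (inst q (%i. tr (case_nat x (%_. f) i)))" using ti by blast
      hence "F.TG G2 (inst q (case_nat x' (%_. f)))" unfolding g2.TG_inst c .
      thus False using S2 unfolding Ph_def by blast
    qed
  qed
qed

end

context columns begin

lemma determined: assumes G: "F.gen G"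
  shows "F.TG G (All (%f. All (%A. Imp (And (FunctionToGround f (F.chk lam)) (DefinedBy q f (F.chk lam) A)) (Determined (F.chk lam) A))))"
proof -
  interpret g: colgen E lam mu IX bb G by unfold_locales (rule G)
  have "sat g.M (Determined (g.jj lam) (g.v A))"
    if f: "F.TG G (FunctionToGround f (F.chk lam))" "F.TG G (DefinedBy q f (F.chk lam) A)" for f A
  proof -
    have c: "(%i. g.v (case_nat x (%_. f) i)) = case_nat (g.v x) (%_. g.v f)" for x by (rule ext) (simp split: nat.split)
    have A: "g.M (g.v x) (g.v A) = Ph q f G x" for x
      using f(2) unfolding g.TG_DefinedBy Ph_def g.TG_FunctionTo g.TG_inst c by blast
    obtain p where p: "p : G" "F.Frc p (%G. F.TG G (FunctionToGround f (F.chk lam)))" using F.truth[OF G DG_FunctionToGround f(1)] by blast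
    have "bd mu emp" using bd_Uu[OF rc_od[OF rcm], of emp] bd_sub[OF rc_emp[OF rcm] rc_bd[OF rcm lm]] mem_emp by blast
    then obtain X where X: "bd mu X" "p <: FX X" "cap X f p"
      using capture_name[OF DG_FunctionToGround ground_fn(1), of emp p f] p G_FF[OF G p(1)] FF by blast
    show ?thesis
    \<comment> \<open>The failure of this case is exactly the last assumption of
      \<open>playerII\<close>.\<close>
    proof (cases "EX Y x p. bd mu Y & sb X Y & p : G & p <: FX Y & F.Frc p (%G. Ph q f G x) & cap Y x p & (ALL r. r <: FX Y --> sb p r --> gd X Y x r)")
      case True
      then obtain Y x p' where Y: "bd mu Y" "sb X Y" "p' : G" "p' <: FX Y" "F.Frc p' (%G. Ph q f G x)" "ALL r. r <: FX Y --> sb p' r --> gd X Y x r" by blast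
      have "sat g.M (PlayerIWins (g.jj lam) (g.v A))"
        by (rule g.playerI[OF X(1) p(1) X(2) p(2) X(3) A[THEN iffD2] Y(1-5)]) (use Y(6) in blast)+
      thus ?thesis unfolding Determined_def by simp
    next
      case False
      have "sat g.M (PlayerIIWins (g.jj lam) (g.v A))"
      proof (rule g.playerII[OF X(1) DG_Ph _ A[THEN iffD1]])
        show "F.gen H ==> Ph q f H x ==> isfn H x" for H x using ground_fn(1) FunctionTo_Ground unfolding Ph_def by blast
      qed (use False in blast)+
      thus ?thesis unfolding Determined_def by simp
    qed
  qed
  thus ?thesis unfolding Imp_def by (simp add: g.TG_Determined)
qed

end

section \<open>The product of the collapse and the Cohen poset\<close>

locale notion = zf E for E :: "nat => nat => bool" (infix "<:" 50) +
  fixes lam mu nu Col RCol Add RAdd P R :: nat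
  assumes sl: "sat E (RegularCardinal lam)" and su: "sat E (Uncountable lam)" and sm: "sat E (Inaccessible mu)" and lm: "lam <: mu"
    and sC: "sat E (IsLevyCollapse lam mu Col RCol)" and sA: "sat E (IsAdd lam nu Add RAdd)"
    and sP: "sat E (IsProductForcing Col RCol Add RAdd P R)"
begin

text \<open>Columns tagged \<open>emp\<close> come from the collapse, and column \<open>a\<close>
  has values in \<open>a\<close>; columns tagged \<open>suc emp\<close> come from \<open>Add\<close>
  and have values in \<open>lam\<close>. Zero is left out, as it would be a column without
  values.\<close>

definition IX :: nat where "IX = un (Im (Sp mu (%a. emp <: a)) (pr emp)) (Im nu (pr (suc emp)))"
definition bb :: "nat => nat" where "bb k = (if pf k = emp then ps k else lam)"

lemma ne: "emp ~= suc emp" "suc emp ~= emp" by (metis mem_emp mem_suc)+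

lemma IX: "k <: IX = ((EX a. k = pr emp a & a <: mu & emp <: a) | (EX i. k = pr (suc emp) i & i <: nu))"
proof -
  have d: "Dt (pr a)" for a by (intro dfi)
  have "a <: Sp mu (%a. emp <: a) = (a <: mu & emp <: a)" for a by (intro mem_Sp dfi)
  thus ?thesis unfolding IX_def by (auto simp: mem_Im[OF d])
qed

lemma bb [simp]: "bb (pr emp a) = a" "bb (pr (suc emp) i) = lam" unfolding bb_def using ne by simp_all

lemma rc_lam: "rc lam" and rc_mu: "rc mu"
  using rc_RegularCardinal sl sm unfolding Inaccessible_def by simp_all

lemma om_lam: "om <: lam"
proof -
  obtain w where w: "sat E (LimitOrdinal w)" "w <: lam" using su unfolding Uncountable_def IsOmega_def by auto
  have W: "od w" "EX y. y <: w" "ALL y. y <: w --> (EX z. z <: w & y <: z)" using w(1) unfolding LimitOrdinal_def by auto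
  have e: "emp <: w" using od_emp[OF W(1)] W(2) mem_emp by blast
  have s: "suc y <: w" if y: "y <: w" for y
  proof -
    obtain z where z: "z <: w" "y <: z" using W(3) y by blast
    thus ?thesis using od_suc_le[OF od_mem[OF W(1) z(1)] z(2)] od_trans[OF W(1)] by metis
  qed
  have "D (%n. n <: w)" by (intro dfi)
  hence o: "n <: w" if "n <: om" for n using om_induct[of "%n. n <: w"] that e s by blast
  have "od om" unfolding od_def trs_def using om_trans om_trs unfolding trs_def by blast
  hence "om <: w | om = w" using od_sub[OF _ W(1)] o by blast
  thus ?thesis using w(2) od_trans[OF rc_od[OF rc_lam]] by blast
qed

text \<open>The column is that of an ordinal \<open>a\<close> equinumerous with the set
  \<open>V\<close> of functions from \<open>om\<close> to \<open>A\<close>. Prepending an element of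
  \<open>S\<close> to such a function injects \<open>prd S V\<close> into \<open>V\<close>. As
  \<open>A\<close> includes the power set of a bound \<open>b\<close> for the columns in
  \<open>Z\<close>, Cantor's theorem keeps \<open>a\<close> from being below
  \<open>b\<close>.\<close>

lemma many: assumes Z: "bd mu Z" and S: "bd mu S" "s <: S"
  shows "EX k c. k <: IX & ~ k <: Z &
      (ALL x v. x <: S --> v <: bb k --> ap c (pr x v) <: bb k) &
      (ALL x v y w. x <: S --> v <: bb k --> y <: S --> w <: bb k --> ap c (pr x v) = ap c (pr y w) --> x = y & v = w)"
proof -
  let ?T = "%k. if ps k <: mu then ps k else emp"
  have "Dt ?T" by (intro dfi)
  moreover have "?T k <: mu" for k using rc_emp[OF rc_mu] by simp
  ultimately obtain b where b: "b <: mu" "ALL k. k <: Z --> ?T k <: b" using bd_I[OF Z, of ?T] by blast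
  define A where "A = un S (Pw b)"
  define V where "V = Sp (Pw (prd om A)) (%f. fto f om A)"
  have V: "f <: V = fto f om A" for f
  proof -
    have "f <: Pw (prd om A)" if "fto f om A"
      using that unfolding fto_def fon_def isf_def mem_Pw mem_prd by metis
    thus ?thesis unfolding V_def by (subst mem_Sp, intro dfi) blast
  qed
  have "om <: mu" using od_trans[OF rc_od[OF rc_mu] lm om_lam] .
  hence "bd mu (Pw (prd om A))" unfolding A_def using bd_un[OF rc_mu S(1)] bd_Pw[OF sm] rc_bd[OF rc_mu] b(1) bd_prd[OF rc_mu] by blast
  hence "bd mu V" by (rule bd_sub[OF rc_emp[OF rc_mu]]) (simp add: V_def, subst (asm) mem_Sp, (intro dfi | simp)+)
  then obtain a g where g: "a <: mu" "bij g a V" using sat_SizeLess[OF rc_mu, of V] unfolding SizeLess_def by auto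
  have oa: "od a" "od b" using od_mem[OF rc_od[OF rc_mu]] g(1) b(1) by blast+
  have na: "~ a <: b"
  proof
    assume ab: "a <: b"
    \<comment> \<open>Cantor's diagonal set, for the first values of the enumerated
      functions.\<close>
    let ?D = "Sp a (%x. ~ x <: ap (ap g x) emp)"
    have D: "x <: ?D = (x <: a & ~ x <: ap (ap g x) emp)" for x by (intro mem_Sp dfi)
    have "?D <: Pw b" unfolding mem_Pw D using od_trans[OF oa(2) ab] by blast
    hence DA: "?D <: A" unfolding A_def by simp
    have d: "Dt (%_. ?D)" by (intro dfi)
    have "Lam om (%_. ?D) <: V" unfolding V using fto_Lam[OF d] DA by blast
    then obtain x where x: "x <: a" "ap g x = Lam om (%_. ?D)" using bijE(3)[OF g(2)] by blast
    have "ap (ap g x) emp = ?D" unfolding x(2) using ap_Lam[OF d om0] .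
    thus False using D[of x] x(1) by metis
  qed
  \<comment> \<open>\<open>cs x f\<close> is \<open>f\<close> preceded by \<open>x\<close>; for a
    successor \<open>n\<close> in \<open>om\<close>, \<open>Uu n\<close> is the predecessor.\<close>
  define cs where "cs x f = Lam om (%n. if n = emp then x else ap f (Uu n))" for x f
  have dc: "Dt (%n. if n = emp then x else ap f (Uu n))" for x f by (intro dfi)
  have Dcs: "Dt p ==> Dt q ==> Dt (%x. cs (p x) (q x))" for p q by (rule Dt_comp2[of cs], unfold cs_def, intro dfi, assumption+)
  have csV: "cs x f <: V" if "x <: S" "f <: V" for x f
  proof -
    have "Uu n <: om" if "n <: om" for n
    proof -
      have d: "D (%n. Uu n <: om)" by (intro dfi)
      have u: "Uu (suc m) = m" if "m <: om" for m using om_trs[OF that] unfolding trs_def by (intro exten) auto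
      have "Uu emp = emp" by (rule exten) simp
      thus ?thesis using om_induct[OF d that] om0 u by simp
    qed
    hence "ap f (Uu n) <: A" if "n <: om" for n using that \<open>f <: V\<close> fto_ap[of f om A] unfolding V by blast
    thus ?thesis unfolding V cs_def by (intro fto_Lam[OF dc]) (use \<open>x <: S\<close> in \<open>simp add: A_def\<close>)
  qed
  have csi: "x = y & f = h" if c: "cs x f = cs y h" "f <: V" "h <: V" for x y f h
  proof
    have e: "ap (cs x f) emp = x" "ap (cs y h) emp = y" unfolding cs_def using ap_Lam[OF dc om0] by simp_all
    thus "x = y" using c(1) by simp
    have "ap f n = ap h n" if n: "n <: om" for n
    proof -
      have "Uu (suc n) = n" using om_trs[OF n] unfolding trs_def by (intro exten) auto
      moreover have "suc n ~= emp" by (metis mem_emp mem_suc)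
      ultimately have e: "ap (cs x f) (suc n) = ap f n" "ap (cs y h) (suc n) = ap h n" unfolding cs_def using ap_Lam[OF dc om_suc[OF n]] by simp_all
      show ?thesis using e c(1) by simp
    qed
    thus "f = h" using fon_eq[of f om h] c(2,3) unfolding V fto_def by blast
  qed
  have "D (%p. ap g (ps p) = pf p)" by (intro dfi)
  then obtain h where h: "fto h V a" "ALL y. y <: V --> ap g (ap h y) = y"
    using AC[of "%y x. ap g x = y" V a] bijE(3)[OF g(2)] by blast
  let ?F = "%w. ap h (cs (pf w) (ap g (ps w)))"
  have DF: "Dt ?F" by (intro dfi Dcs)
  let ?c = "Lam (prd S a) ?F"
  have c: "ap ?c (pr x v) = ap h (cs x (ap g v))" if "x <: S" "v <: a" for x v using ap_Lam[OF DF, of "pr x v"] that by simp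
  have gV: "ap g v <: V" if "v <: a" for v using bijE(1)[OF g(2) that] .
  have c1: "ap ?c (pr x v) <: a" if "x <: S" "v <: a" for x v unfolding c[OF that] using fto_ap[OF h(1) csV[OF that(1) gV[OF that(2)]]] .
  have c2: "x = y & v = w" if m: "x <: S" "v <: a" "y <: S" "w <: a" "ap ?c (pr x v) = ap ?c (pr y w)" for x v y w
  proof -
    have "ap h (cs x (ap g v)) = ap h (cs y (ap g w))" using m(5) unfolding c[OF m(1,2)] c[OF m(3,4)] .
    hence "cs x (ap g v) = cs y (ap g w)" using h(2) csV m(1,3) gV[OF m(2)] gV[OF m(4)] by metis
    hence "x = y & ap g v = ap g w" using csi gV m by blast
    thus ?thesis using bijE(2)[OF g(2)] m(2,4) by blast
  qed
  have "EX v. v <: V"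
  proof -
    have d: "Dt (%_. s)" by (intro dfi)
    show ?thesis unfolding V using fto_Lam[OF d, of om A] S(2) unfolding A_def by auto
  qed
  hence "a ~= emp" using bijE(3)[OF g(2)] mem_emp by blast
  hence "pr emp a <: IX" unfolding IX using g(1) od_emp[OF oa(1)] by blast
  moreover have "~ pr emp a <: Z" using b(2) g(1) na by fastforce
  moreover have "ALL x v. x <: S --> v <: bb (pr emp a) --> ap ?c (pr x v) <: bb (pr emp a)" unfolding bb using c1 by blast
  moreover have "ALL x v y w. x <: S --> v <: bb (pr emp a) --> y <: S --> w <: bb (pr emp a) --> ap ?c (pr x v) = ap ?c (pr y w) --> x = y & v = w"
    unfolding bb using c2 by blast
  ultimately show ?thesis by blast
qed

sublocale columns E lam mu IX bb
proof
  show "Dt bb" unfolding bb_def by (intro dfi)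
  show "bd mu (bb k)" if "k <: IX" for k using that rc_bd[OF rc_mu] lm unfolding IX by auto
  show "EX v. v <: bb k" if "k <: IX" for k using that rc_emp[OF rc_lam] unfolding IX by auto
  show "bd mu x ==> bd mu (Pw x)" for x by (rule bd_Pw[OF sm])
qed (fact rc_lam rc_mu om_lam lm many)+

lemma Col: "p <: Col = (isf p & (ALL z b. pr z b <: p --> (EX a x. z = pr a x & a <: mu & x <: lam & b <: a)) & bd lam p)"
proof -
  have "p <: Col = (isf p & (ALL z b. pr z b <: p --> b <: mu & (EX a x. z = pr a x & a <: mu & x <: lam & b <: a)) & bd lam p)"
    using sC unfolding IsLevyCollapse_def LevyCondition_def by (simp add: sat_SizeLess[OF rcl])
  thus ?thesis using od_trans[OF rc_od[OF rcm]] by blast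
qed

lemma Add: "p <: Add = (fon p nu & (ALL i. i <: nu --> sseq (ap p i)) & bd lam (Sp nu (%i. ap p i ~= emp)))"
proof (cases "fon p nu")
  case True
  have s: "(EX a. a <: lam & fto s a lam) = sseq s" for s unfolding sseq_def ..
  have m: "i <: Sp nu (%i. ap p i ~= emp) = (i <: nu & ap p i ~= emp)" for i by (intro mem_Sp dfi)
  have p: "p <: Add = (fon p nu & (ALL i s. pr i s <: p --> sseq s) &
      (EX S. (ALL i. i <: S = (EX s. pr i s <: p & (EX y. y <: s))) & bd lam S))"
    using sA unfolding IsAdd_def AddCondition_def ShortSequence_def NonEmpty_def by (simp add: sat_SizeLess[OF rcl] s)
  have "(EX s. pr i s <: p & (EX y. y <: s)) = (i <: Sp nu (%i. ap p i ~= emp))" for i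
    unfolding m fon_iff[OF True] using emp_eq[of "ap p i"] by blast
  hence e: "(ALL i. i <: S = (EX s. pr i s <: p & (EX y. y <: s))) = (S = Sp nu (%i. ap p i ~= emp))" for S
    using exten[of S "Sp nu (%i. ap p i ~= emp)"] by auto
  have "(ALL i s. pr i s <: p --> sseq s) = (ALL i. i <: nu --> sseq (ap p i))" unfolding fon_iff[OF True] by simp
  moreover have "(EX S. S = Sp nu (%i. ap p i ~= emp) & bd lam S) = bd lam (Sp nu (%i. ap p i ~= emp))" by simp
  ultimately show ?thesis unfolding p e by argo
next
  case False
  thus ?thesis using sA unfolding IsAdd_def AddCondition_def by simp
qed

lemma P: "p <: P = (EX p1 p2. p = pr p1 p2 & p1 <: Col & p2 <: Add)"
  using sP unfolding IsProductForcing_def by simp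

lemma P_D: assumes "p <: P"
  shows "isf (pf p)" "pr z b <: pf p ==> EX a x. z = pr a x & a <: mu & x <: lam & b <: a" "bd lam (pf p)"
    "i <: nu ==> sseq (ap (ps p) i)" "bd lam (Sp nu (%i. ap (ps p) i ~= emp))"
proof -
  obtain p1 p2 where p: "p = pr p1 p2" "p1 <: Col" "p2 <: Add" using assms P by blast
  show "isf (pf p)" "bd lam (pf p)" "bd lam (Sp nu (%i. ap (ps p) i ~= emp))" "i <: nu ==> sseq (ap (ps p) i)"
    using p(2,3) unfolding p(1) pf_pr ps_pr Col Add by blast+
  show "pr z b <: pf p ==> EX a x. z = pr a x & a <: mu & x <: lam & b <: a" using p(2) unfolding p(1) pf_pr Col by blast
qed

lemma R: "pr q p <: R = (q <: P & p <: P & sb (pf p) (pf q) & (ALL i. i <: nu --> sb (ap (ps p) i) (ap (ps q) i)))"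
proof -
  have RC: "pr q p <: RCol = (q <: Col & p <: Col & sb p q)" for q p
    using sC unfolding IsLevyCollapse_def IsOrderOn_def Subset_def sb_def by auto
  have RA: "pr q p <: RAdd = (q <: Add & p <: Add & (ALL i. i <: nu --> sb (ap p i) (ap q i)))" for q p
  proof -
    have 1: "pr q p <: RAdd = (q <: Add & p <: Add & (ALL i t s. pr i t <: q & pr i s <: p --> sb s t))"
      using sA unfolding IsAdd_def IsOrderOn_def Subset_def sb_def by auto
    show ?thesis
    proof (cases "q <: Add & p <: Add")
      case True
      hence f: "fon q nu" "fon p nu" unfolding Add by blast+
      show ?thesis unfolding 1 fon_iff[OF f(1)] fon_iff[OF f(2)] by blast
    qed (use 1 in blast)
  qed
  have "pr q p <: R = (q <: P & p <: P & (EX q1 q2 p1 p2. q = pr q1 q2 & p = pr p1 p2 & pr q1 p1 <: RCol & pr q2 p2 <: RAdd))"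
    using sP unfolding IsProductForcing_def IsOrderOn_def by auto
  thus ?thesis unfolding RC RA P by auto
qed

text \<open>Flattens a pair of conditions into one partial function on columns. Only the nonempty
  coordinates of the Cohen part are united, which keeps the result small.\<close>

definition fl :: "nat => nat" where
  "fl p = un (Im (pf p) (%u. pr (pr (pr emp (pf (pf u))) (ps (pf u))) (ps u)))
     (Uu (Im (Sp nu (%i. ap (ps p) i ~= emp)) (%i. Im (ap (ps p) i) (%w. pr (pr (pr (suc emp) i) (pf w)) (ps w)))))"
lemma Dt_fl: "Dt a ==> Dt (%x. fl (a x))" by (rule Dt_comp[of fl], unfold fl_def, intro dfi)

lemma fl: assumes "p <: P"
  shows "w <: fl p = ((EX a x y. w = pr (pr (pr emp a) x) y & pr (pr a x) y <: pf p) | (EX i x y. w = pr (pr (pr (suc emp) i) x) y & i <: nu & pr x y <: ap (ps p) i))"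
proof -
  have c: "isf (pf p)" "ALL z b. pr z b <: pf p --> (EX a x. z = pr a x)" and s: "i <: nu ==> isf (ap (ps p) i)" for i
    using P_D[OF assms] sseq_fto by blast+
  have d: "Dt (%u. pr (pr (pr emp (pf (pf u))) (ps (pf u))) (ps u))" "Dt (%i. Im (ap (ps p) i) (%w. pr (pr (pr (suc emp) i) (pf w)) (ps w)))"
    and d': "Dt (%w. pr (pr (pr (suc emp) i) (pf w)) (ps w))" for i by (intro dfi)+
  have m: "i <: Sp nu (%i. ap (ps p) i ~= emp) = (i <: nu & (EX y. y <: ap (ps p) i))" for i
    unfolding emp_eq[of "ap _ _"] by (subst mem_Sp, intro dfi) blast
  have 1: "(EX u. u <: pf p & w = pr (pr (pr emp (pf (pf u))) (ps (pf u))) (ps u)) = (EX a x y. w = pr (pr (pr emp a) x) y & pr (pr a x) y <: pf p)"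
  proof
    assume "EX u. u <: pf p & w = pr (pr (pr emp (pf (pf u))) (ps (pf u))) (ps u)"
    then obtain u where u: "u <: pf p" "w = pr (pr (pr emp (pf (pf u))) (ps (pf u))) (ps u)" by blast
    obtain z b where z: "u = pr z b" using c(1) u(1) unfolding isf_def by blast
    then obtain a x where "z = pr a x" using c(2) u(1) by blast
    thus "EX a x y. w = pr (pr (pr emp a) x) y & pr (pr a x) y <: pf p" using u z by auto
  next
    assume "EX a x y. w = pr (pr (pr emp a) x) y & pr (pr a x) y <: pf p"
    then obtain a x y where "w = pr (pr (pr emp a) x) y" "pr (pr a x) y <: pf p" by blast
    thus "EX u. u <: pf p & w = pr (pr (pr emp (pf (pf u))) (ps (pf u))) (ps u)" by (intro exI[of _ "pr (pr a x) y"]) simp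
  qed
  have 2: "(EX i u. i <: nu & u <: ap (ps p) i & w = pr (pr (pr (suc emp) i) (pf u)) (ps u)) =
      (EX i x y. w = pr (pr (pr (suc emp) i) x) y & i <: nu & pr x y <: ap (ps p) i)"
  proof
    assume "EX i u. i <: nu & u <: ap (ps p) i & w = pr (pr (pr (suc emp) i) (pf u)) (ps u)"
    then obtain i u where u: "i <: nu" "u <: ap (ps p) i" "w = pr (pr (pr (suc emp) i) (pf u)) (ps u)" by blast
    obtain z b where z: "u = pr z b" using s u(1,2) unfolding isf_def by blast
    show "EX i x y. w = pr (pr (pr (suc emp) i) x) y & i <: nu & pr x y <: ap (ps p) i"
      using u unfolding z pf_pr ps_pr by blast
  next
    assume "EX i x y. w = pr (pr (pr (suc emp) i) x) y & i <: nu & pr x y <: ap (ps p) i"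
    then obtain i x y where "w = pr (pr (pr (suc emp) i) x) y" "i <: nu" "pr x y <: ap (ps p) i" by blast
    thus "EX i u. i <: nu & u <: ap (ps p) i & w = pr (pr (pr (suc emp) i) (pf u)) (ps u)" by (intro exI[of _ i] exI[of _ "pr x y"]) simp
  qed
  have "w <: fl p = ((EX u. u <: pf p & w = pr (pr (pr emp (pf (pf u))) (ps (pf u))) (ps u)) |
    (EX i u. i <: nu & u <: ap (ps p) i & w = pr (pr (pr (suc emp) i) (pf u)) (ps u)))"
  proof -
    have "w <: Uu (Im (Sp nu (%i. ap (ps p) i ~= emp)) (%i. Im (ap (ps p) i) (%w. pr (pr (pr (suc emp) i) (pf w)) (ps w)))) =
      (EX i. i <: nu & w <: Im (ap (ps p) i) (%w. pr (pr (pr (suc emp) i) (pf w)) (ps w)))"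
    proof
      assume "EX i. i <: nu & w <: Im (ap (ps p) i) (%w. pr (pr (pr (suc emp) i) (pf w)) (ps w))"
      then obtain i where i: "i <: nu" "w <: Im (ap (ps p) i) (%w. pr (pr (pr (suc emp) i) (pf w)) (ps w))" by blast
      hence "EX y. y <: ap (ps p) i" unfolding mem_Im[OF d'] by blast
      thus "w <: Uu (Im (Sp nu (%i. ap (ps p) i ~= emp)) (%i. Im (ap (ps p) i) (%w. pr (pr (pr (suc emp) i) (pf w)) (ps w))))"
        unfolding mem_Un mem_Im[OF d(2)] m using i by blast
    qed (unfold mem_Un mem_Im[OF d(2)] m, blast)
    thus ?thesis unfolding fl_def mem_un mem_Im[OF d(1)] mem_Im[OF d'] by blast
  qed
  thus ?thesis unfolding 1 2 .
qed

lemma fl0: "p <: P ==> pr (pr (pr emp a) x) y <: fl p = (pr (pr a x) y <: pf p)"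
  and fl1: "p <: P ==> pr (pr (pr (suc emp) i) x) y <: fl p = (i <: nu & pr x y <: ap (ps p) i)"
  unfolding fl using ne by simp_all

lemma fl_cond: assumes p: "p <: P" shows "cond (fl p)"
proof -
  have C: "isf (pf p)" "ALL z b. pr z b <: pf p --> (EX a x. z = pr a x & a <: mu & x <: lam & b <: a)" "bd lam (pf p)"
    and A: "ALL i. i <: nu --> sseq (ap (ps p) i)" "bd lam (Sp nu (%i. ap (ps p) i ~= emp))"
    using P_D[OF p] by blast+
  have "isf (fl p)" unfolding isf_def
  proof (intro conjI allI impI)
    show "w <: fl p ==> EX x y. w = pr x y" for w unfolding fl[OF p] by blast
    fix z v v' assume z: "pr z v <: fl p" "pr z v' <: fl p"
    then consider a x where "z = pr (pr emp a) x" | i x where "z = pr (pr (suc emp) i) x" unfolding fl[OF p] by auto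
    thus "v = v'"
    proof cases
      case 1 thus ?thesis using z isf_D[OF C(1)] unfolding 1 fl0[OF p] by blast
    next
      case 2 thus ?thesis using z isf_D sseq_fto A(1) unfolding 2 fl1[OF p] by blast
    qed
  qed
  moreover have "EX k x. z = pr k x & k <: IX & x <: lam & v <: bb k" if zv: "pr z v <: fl p" for z v
  proof -
    from zv consider a x where "z = pr (pr emp a) x" "pr (pr a x) v <: pf p" | i x where "z = pr (pr (suc emp) i) x" "i <: nu" "pr x v <: ap (ps p) i"
      unfolding fl[OF p] by auto
    thus ?thesis
    proof cases
      case 1
      hence a: "a <: mu" "x <: lam" "v <: a" using C(2) by (metis pr_eq)+
      hence "emp <: a" using od_emp[OF od_mem[OF rc_od[OF rcm] a(1)]] mem_emp by blast
      thus ?thesis using 1 a unfolding IX by (intro exI[of _ "pr emp a"] exI[of _ x]) simp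
    next
      case 2
      have "ap (ps p) i <: Sq" using A(1) 2(2) Sq by blast
      hence "pr x v <: prd lam lam" using 2(3) unfolding Sq_def by (subst (asm) mem_Sp) ((intro dfi)?, auto)
      thus ?thesis using 2 unfolding IX by (intro exI[of _ "pr (suc emp) i"] exI[of _ x]) simp
    qed
  qed
  moreover have "bd lam (fl p)"
  proof -
    have d: "Dt (%u. pr (pr (pr emp (pf (pf u))) (ps (pf u))) (ps u))" "Dt (%i. Im (ap (ps p) i) (%w. pr (pr (pr (suc emp) i) (pf w)) (ps w)))"
      and d': "Dt (%w. pr (pr (pr (suc emp) i) (pf w)) (ps w))" for i by (intro dfi)+
    have m: "i <: Sp nu (%i. ap (ps p) i ~= emp) = (i <: nu & ap (ps p) i ~= emp)" for i by (intro mem_Sp dfi)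
    have "bd lam s" if s: "sseq s" for s
    proof -
      have f: "fon s (dm s)" "dm s <: lam" "isf s" using sseq_fto[OF s] fon_dm by blast+
      have e: "Dt (%x. pr x (ap s x))" by (intro dfi)
      have "s = Im (dm s) (%x. pr x (ap s x))"
      proof (rule exten)
        show "z <: s = (z <: Im (dm s) (%x. pr x (ap s x)))" for z
          unfolding mem_Im[OF e] using fon_iff[OF f(1)] f(3) unfolding isf_def by metis
      qed
      thus ?thesis using bd_Im[OF rc_bd[OF rcl f(2)] e] by simp
    qed
    hence b: "bd lam (Im (ap (ps p) i) (%w. pr (pr (pr (suc emp) i) (pf w)) (ps w)))" if "i <: nu" for i using A(1) that by (intro bd_Im d') blast
    have "bd lam y" if "y <: Im (Sp nu (%i. ap (ps p) i ~= emp)) (%i. Im (ap (ps p) i) (%w. pr (pr (pr (suc emp) i) (pf w)) (ps w)))" for y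
      using that b unfolding mem_Im[OF d(2)] m by blast
    thus ?thesis unfolding fl_def by (intro bd_un bd_Uu rcl rc_od bd_Im d C(3) A(2))
  qed
  ultimately show ?thesis unfolding cond_def by blast
qed

lemma fl_le: assumes "p <: P" "q <: P" shows "pr q p <: R = sb (fl p) (fl q)"
proof
  assume "pr q p <: R"
  thus "sb (fl p) (fl q)" unfolding R sb_def fl[OF assms(1)] fl[OF assms(2)] by blast
next
  assume s: "sb (fl p) (fl q)"
  have "w <: pf q" if w: "w <: pf p" for w
  proof -
    have "isf (pf p)" "ALL z b. pr z b <: pf p --> (EX a x. z = pr a x)" using P_D[OF assms(1)] by blast+
    then obtain a x y where "w = pr (pr a x) y" using w unfolding isf_def by metis
    thus ?thesis using w sbD[OF s, of "pr (pr (pr emp a) x) y"] unfolding fl0[OF assms(1)] fl0[OF assms(2)] by blast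
  qed
  moreover have "w <: ap (ps q) i" if i: "i <: nu" "w <: ap (ps p) i" for w i
  proof -
    have "sseq (ap (ps p) i)" using P_D(4)[OF assms(1) i(1)] .
    then obtain x y where "w = pr x y" using i(2) sseq_fto unfolding isf_def by blast
    thus ?thesis using i sbD[OF s, of "pr (pr (pr (suc emp) i) x) y"] unfolding fl1[OF assms(1)] fl1[OF assms(2)] by blast
  qed
  ultimately show "pr q p <: R" unfolding R sb_def using assms by blast
qed

text \<open>A condition on columns may have gaps in a Cohen column, whereas elements of
  \<open>Add\<close> consist of functions on ordinals. So \<open>fl\<close> is not onto, but the
  gaps can be filled.\<close>

lemma fl_dense: assumes r: "cond r" shows "EX u. u <: P & sb r (fl u)"
proof -
  let ?f = "%w. pr (pr (ps (pf (pf w))) (ps (pf w))) (ps w)"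
  have d: "Dt ?f" by (intro dfi)
  let ?S = "Sp r (%w. pf (pf (pf w)) = emp)"
  have mS: "w <: ?S = (w <: r & pf (pf (pf w)) = emp)" for w by (intro mem_Sp dfi)
  let ?u = "Im ?S ?f"
  have u: "z <: ?u = (EX a x b. z = pr (pr a x) b & pr (pr (pr emp a) x) b <: r)" for z
  proof
    assume "z <: ?u"
    then obtain w where w: "w <: r" "pf (pf (pf w)) = emp" "z = ?f w" unfolding mem_Im[OF d] mS by blast
    obtain k x v where k: "w = pr (pr k x) v" "k <: IX" using cond_pr[OF r w(1)] by blast
    then obtain a where "k = pr emp a" using w(2) ne unfolding IX by auto
    thus "EX a x b. z = pr (pr a x) b & pr (pr (pr emp a) x) b <: r" using w k by auto
  next
    assume "EX a x b. z = pr (pr a x) b & pr (pr (pr emp a) x) b <: r"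
    then obtain a x b where "z = pr (pr a x) b" "pr (pr (pr emp a) x) b <: r" by blast
    thus "z <: ?u" unfolding mem_Im[OF d] mS by (intro exI[of _ "pr (pr (pr emp a) x) b"]) simp
  qed
  have fr: "isf r" "bd lam r" using r unfolding cond_def by blast+
  have uC: "?u <: Col" unfolding Col
  proof (intro conjI allI impI)
    show "isf ?u" unfolding isf_def
    proof (intro conjI allI impI)
      show "z <: ?u ==> EX x y. z = pr x y" for z unfolding u by blast
      fix z v v' assume "pr z v <: ?u" "pr z v' <: ?u"
      then obtain a x where "z = pr a x" "pr (pr (pr emp a) x) v <: r" "pr (pr (pr emp a) x) v' <: r" unfolding u by auto
      thus "v = v'" using isf_D[OF fr(1)] by blast
    qed
    show "bd lam ?u" using bd_Im[OF bd_sub[OF rc_emp[OF rcl] fr(2)] d] mS by blast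
    fix z b assume "pr z b <: ?u"
    then obtain a x where a: "z = pr a x" "pr (pr (pr emp a) x) b <: r" unfolding u by auto
    have "pr emp a <: IX" "x <: lam" "b <: a" using cond_pr[OF r a(2)] by auto
    thus "EX a x. z = pr a x & a <: mu & x <: lam & b <: a" using a ne unfolding IX by auto
  qed
  obtain b where b: "b <: lam" "ALL i k v. i = b | b <: i --> ~ pr (pr k i) v <: r" using fresh[OF r rc_emp[OF rcl]] by blast
  let ?e = "%i. EX x y. pr (pr (pr (suc emp) i) x) y <: r"
  \<comment> \<open>All nonempty coordinates are prolonged to the common length \<open>b\<close>,
    with \<open>emp\<close> at the missing places; the other coordinates stay empty, so that the
    support remains small.\<close>
  define t where "t i = (if ?e i then Lam b (%x. if EX y. pr (pr (pr (suc emp) i) x) y <: r then ap r (pr (pr (suc emp) i) x) else emp) else emp)" for i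
  have dt: "Dt (%x. if EX y. pr (pr (pr (suc emp) i) x) y <: r then ap r (pr (pr (suc emp) i) x) else emp)" for i by (intro dfi)
  have Dtt: "Dt t" unfolding t_def by (intro dfi)
  have ent: "i <: nu & x <: b & y <: lam & ap r (pr (pr (suc emp) i) x) = y" if "pr (pr (pr (suc emp) i) x) y <: r" for i x y
  proof -
    have "pr (suc emp) i <: IX" "x <: lam" "y <: lam" using cond_pr[OF r that] by auto
    moreover hence "x <: b" using b(2) that od_tri[OF oda oda[OF b(1)]] by blast
    moreover have "ap r (pr (pr (suc emp) i) x) = y" using isf_ap[OF fr(1) that] .
    ultimately show ?thesis using ne unfolding IX by auto
  qed
  let ?v = "Lam nu t"
  have st: "sseq (t i)" for i
  proof (cases "?e i")
    case True
    hence "t i = Lam b (%x. if EX y. pr (pr (pr (suc emp) i) x) y <: r then ap r (pr (pr (suc emp) i) x) else emp)" unfolding t_def by simp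
    moreover have "(if EX y. pr (pr (pr (suc emp) i) x) y <: r then ap r (pr (pr (suc emp) i) x) else emp) <: lam" for x
      using ent[of i x] rc_emp[OF rcl] by auto
    ultimately have "fto (t i) b lam" using fto_Lam[OF dt, of b i lam] by simp
    thus ?thesis unfolding sseq_def using b(1) by blast
  qed (simp add: t_def sseq_emp)
  have av: "ap ?v i = t i" if "i <: nu" for i using ap_Lam[OF Dtt that] .
  have vA: "?v <: Add" unfolding Add
  proof (intro conjI allI impI)
    show "fon ?v nu" using fon_Lam[OF Dtt] .
    show "sseq (ap ?v i)" if "i <: nu" for i unfolding av[OF that] by (rule st)
    have di: "Dt (%w. ps (pf (pf w)))" by (intro dfi)
    have m: "i <: Sp nu (%i. ap ?v i ~= emp) = (i <: nu & ap ?v i ~= emp)" for i by (intro mem_Sp dfi)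
    have "i <: Im r (%w. ps (pf (pf w)))" if "i <: Sp nu (%i. ap ?v i ~= emp)" for i
    proof -
      have "t i ~= emp" using that av unfolding m by auto
      then obtain x y where "pr (pr (pr (suc emp) i) x) y <: r" unfolding t_def by meson
      thus ?thesis unfolding mem_Im[OF di] by (intro exI[of _ "pr (pr (pr (suc emp) i) x) y"]) simp
    qed
    thus "bd lam (Sp nu (%i. ap ?v i ~= emp))" using bd_sub[OF rc_emp[OF rcl] bd_Im[OF fr(2) di]] by blast
  qed
  have uP: "pr ?u ?v <: P" unfolding P using uC vA by blast
  have "w <: fl (pr ?u ?v)" if w: "w <: r" for w
  proof -
    obtain k x y where k: "w = pr (pr k x) y" "k <: IX" using cond_pr[OF r w] by blast
    then consider a where "k = pr emp a" | i where "k = pr (suc emp) i" unfolding IX by blast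
    thus ?thesis
    proof cases
      case 1 thus ?thesis using w unfolding k 1 fl0[OF uP] pf_pr u by blast
    next
      case 2
      note e = ent[OF w[unfolded k(1) 2]]
      have "pr x y <: t i" unfolding t_def using e w[unfolded k(1) 2] by (auto simp: pr_Lam[OF dt])
      thus ?thesis unfolding k 2 fl1[OF uP] using e av by simp
    qed
  qed
  thus ?thesis using uP unfolding sb_def by blast
qed

sublocale B: forcing E P R
proof
  show "EX p. p <: P" using fl_dense[OF cond_emp] by blast
  show "p <: P ==> pr p p <: R" for p using fl_le by simp
  show "pr p q <: R ==> pr q r <: R ==> p <: P ==> q <: P ==> r <: P ==> pr p r <: R" for p q r using fl_le sb_trans by simp
qed

lemma B_le: "B.le q p = (q <: P & p <: P & sb (fl p) (fl q))" unfolding B.le_def using fl_le by blast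

lemma B_dense: "p <: P ==> F.le r (fl p) ==> EX u. B.le u p & F.le (fl u) r"
  using fl_dense[of r] sb_trans fl_cond unfolding le B_le FF by meson

text \<open>The given product itself serves as \<open>W\<close>: \<open>fl\<close> is a dense
  embedding of it into the conditions on columns.\<close>

sublocale TR: transfer E FF RF P R P B.le fl "%x. x"
proof
  show "D (%p. B.le (pf p) (ps p))" by (intro dfi)
  show "Dt fl" by (rule Dt_fl) (intro dfi)
  show "Dt (%x. x)" by (intro dfi)
  show "B.le w w' ==> w <: P & w' <: P" for w w' unfolding B_le by blast
  show "w <: P ==> B.le w w" for w by (rule B.le_refl)
  show "B.le u w ==> B.le w x ==> B.le u x" for u w x by (rule B.le_trans)
  show "B.le w w' ==> F.le (fl w) (fl w')" for w w' unfolding B_le le FF using fl_cond by blast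
  show "w <: P ==> F.le r (fl w) ==> EX u. B.le u w & F.le (fl u) r" for w r by (rule B_dense)
  show "w <: P ==> B.le p w ==> EX u. B.le u w & B.le u p" for w p using B.le_refl B.le_P by blast
  show "EX x. B.le x w & B.le x u" if w: "w <: P" "u <: P" "F.comp (fl w) (fl u)" for w u
  proof -
    obtain r where r: "F.le r (fl w)" "F.le r (fl u)" using w(3) unfolding F.comp_def by blast
    then obtain x where x: "B.le x w" "F.le (fl x) r" using B_dense w(1) by blast
    have "B.le x u" unfolding B_le using x r(2) w(2) sb_trans unfolding le B_le by blast
    thus ?thesis using x(1) by blast
  qed
  show "w <: P ==> u <: P ==> B.comp w u ==> EX x. B.le x w & B.le x u" for w u unfolding B.comp_def .
qed

lemma DF_defined: assumes "Dt a" "Dt b" shows "B.DF (%x. inst q (case_nat (a x) (%_. b x)))"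
proof -
  have "Dt (%x. case_nat (a x) (%_. b x) i)" for i using assms by (cases i) simp_all
  hence "B.DF (%x. inst q (%i. case_nat (a x) (%_. b x) i))" by (rule B.DF_inst)
  thus ?thesis by simp
qed

lemma forced: assumes p: "p <: P" and m: "sat E (IsCheckName P m lam)"
  shows "forces E P R (All (%f. All (%A. Imp (And (FunctionToGround f m) (DefinedBy q f m A)) (Determined m A)))) p"
proof -
  have m: "m = B.chk lam" using m B.sat_IsCheckName by blast
  let ?S = "%c::nat. All (%f. All (%A. Imp (And (FunctionToGround f c) (DefinedBy q f c A)) (Determined c A)))"
  have "B.DF ?S"
    unfolding Imp_def Or_def Iff_def Ex_def Subset_def StrictSubset_def NonEmpty_def IsUnorderedPair_def IsPair_def
      PairIn_def IsFunction_def FunctionOn_def FunctionTo_def IsSuccessorOf_def ShortSequence_def Even_def Odd_def Play_def LegalMove_def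
      Strategy_def IsRestriction_def RunAccordingTo_def OutcomeIn_def PlayerIWins_def PlayerIIWins_def Determined_def
      FunctionToGround_def DefinedBy_def
    by (intro B.DFs DF_defined dfi)
  thus ?thesis unfolding m
  proof (rule B.DF_forces[of ?S, OF _ _ p])
    fix G assume G: "B.gen G" "p : G"
    have g: "p : TR.GW G" unfolding TR.GW_def using G p by blast
    show "B.TG G (?S (B.chk lam))" using TR.TG_tr_statement[OF p G determined[OF TR.gen_G1[OF G(1) g]]] .
  qed
qed

end

section \<open>Reduction to countable models\<close>

text \<open>A crude bound on the free variables: the shift of indices under \<open>FAll\<close> is
  ignored, which can only enlarge it.\<close>

primrec vbound :: "fm => nat" where
  "vbound (FMem i j) = Suc (i + j)" | "vbound (FEq i j) = Suc (i + j)" | "vbound (FNeg p) = vbound p"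
| "vbound (FAnd p q) = vbound p + vbound q" | "vbound (FAll p) = vbound p"

lemma inst_vbound: "(!!i. i < vbound p ==> e i = e' i) ==> inst p e = inst p e'"
proof (induction p arbitrary: e e')
  case (FAll p)
  have "inst p (case_nat x e) = inst p (case_nat x e')" for x by (rule FAll.IH) (use FAll.prems in \<open>auto split: nat.split\<close>)
  thus ?case by simp
next
  case (FNeg p) thus ?case by (metis inst.simps(3) vbound.simps(3))
next
  case (FAnd p q) thus ?case by (metis inst.simps(4) trans_less_add1 trans_less_add2 vbound.simps(4))
qed simp_all

text \<open>Skolem terms over the parameters; a countable datatype, whence the hull is
  countable.\<close>

datatype sk = Par nat | Sk fm "sk list"

instance fm :: countable by countable_datatype
instance sk :: countable by countable_datatype

primrec skv :: "('v => 'v => bool) => (nat => 'v) => sk => 'v" where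
  "skv E par (Par i) = par i"
| "skv E par (Sk p ts) = (SOME x. sat E (inst p (case_nat x (%i. if i < length ts then map (skv E par) ts ! i else par 0))))"

text \<open>The Skolem hull is infinite, because forming singletons maps it injectively into itself
  and misses the empty set; hence it can be enumerated bijectively by \<open>nat\<close>.\<close>

lemma (in zf) elementary_submodel: fixes par :: "nat => 'v"
  shows "EX (E' :: nat => nat => bool) h c. (ALL p e. sat E' (inst p e) = sat E (inst p (%i. h (e i)))) & (ALL i. h (c i) = par i)"
proof -
  let ?C = "range (skv E par)"
  have ex: "EX x:?C. sat E (inst p (case_nat x e))" if e: "range e <= ?C" and s: "EX x. sat E (inst p (case_nat x e))" for p e
  proof -
    obtain t where t: "skv E par (t i) = e i" for i
    proof -
      have "ALL i. EX t. skv E par t = e i" using e by (metis imageE range_subsetD)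
      thus thesis using that by metis
    qed
    let ?l = "map t [0..<vbound p]" let ?e = "%i. if i < length ?l then map (skv E par) ?l ! i else par 0"
    have i: "inst p (case_nat x ?e) = inst p (case_nat x e)" for x
      by (rule inst_vbound) (auto simp: t split: nat.split)
    have "sat E (inst p (case_nat (skv E par (Sk p ?l)) ?e))" unfolding skv.simps by (rule someI_ex) (use s i in metis)
    thus ?thesis unfolding i by blast
  qed
  have "infinite ?C"
  proof
    assume fin: "finite ?C"
    have c: "range (%_::nat. x) <= ?C" if "x : ?C" for x using that by blast
    have "sg x : ?C" if x: "x : ?C" for x
    proof -
      let ?p = "FAll (FNeg (FAnd (FNeg (FAnd (FMem 0 1) (FNeg (FEq 0 2)))) (FNeg (FAnd (FEq 0 2) (FNeg (FMem 0 1))))))"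
      let ?q = "FAll (FAnd (FNeg (FAnd (FMem 0 1) (FNeg (FEq 0 2)))) (FNeg (FAnd (FEq 0 2) (FNeg (FMem 0 1)))))"
      have q: "sat E (inst ?q (case_nat y (%_. x))) = (ALL z. z <: y = (z = x))" for y by (auto simp: numeral_2_eq_2)
      obtain y where "y : ?C" "ALL z. z <: y = (z = x)" using ex[OF c[OF x], of ?q] unfolding q by (metis mem_sg)
      hence "y = sg x" by (intro exten) simp
      thus ?thesis using \<open>y : ?C\<close> by simp
    qed
    hence "sg ` ?C <= ?C" by blast
    moreover have "inj_on sg ?C" by (rule inj_onI) (metis mem_sg)
    ultimately have s: "sg ` ?C = ?C" using endo_inj_surj[OF fin] by blast
    let ?p = "FAll (FNeg (FMem 0 1))"
    have q: "sat E (inst ?p (case_nat y (%_. par 0))) = (y = emp)" for y by (auto simp: emp_eq)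
    have "par 0 : ?C" using rangeI[of "skv E par" "Par 0"] by simp
    then obtain y where "y : ?C" "y = emp" using ex[OF c, of "par 0" ?p] unfolding q by blast
    hence "emp : ?C" by simp
    then obtain x where "emp = sg x" using s by (metis imageE)
    thus False by (metis mem_emp mem_sg)
  qed
  hence b: "bij_betw (from_nat_into ?C) UNIV ?C" by (intro bij_betw_from_nat_into) auto
  define h where "h = from_nat_into ?C"
  have h: "inj h" "range h = ?C" using b unfolding h_def bij_betw_def by blast+
  have "sat (%a b. h a <: h b) (inst p e) = sat E (inst p (%i. h (e i)))" for p e
  proof (induction p arbitrary: e)
    case (FEq i j) thus ?case using h(1) by (simp add: inj_eq)
  next
    case (FAll p)
    have c: "(%i. h (case_nat n e i)) = case_nat (h n) (%i. h (e i))" for n by (rule ext) (simp split: nat.split)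
    have "sat E (inst p (case_nat x (%i. h (e i))))" if a: "ALL n. sat E (inst p (case_nat (h n) (%i. h (e i))))" for x
    proof (rule ccontr)
      assume "~ ?thesis"
      hence "EX x. sat E (inst (FNeg p) (case_nat x (%i. h (e i))))" by auto
      moreover have "range (%i. h (e i)) <= ?C" using h(2) by blast
      ultimately obtain y where "y : ?C" "sat E (inst (FNeg p) (case_nat y (%i. h (e i))))" using ex by blast
      moreover then obtain n where "y = h n" using h(2) by (metis imageE)
      ultimately show False using a by simp
    qed
    thus ?case unfolding inst.simps sat.simps FAll.IH c by blast
  qed simp_all
  moreover have "EX c. ALL i. h (c i) = par i"
  proof -
    have "ALL i. EX n. h n = par i" using h(2) rangeI[of "skv E par" "Par _"] by (metis imageE skv.simps(1))
    thus ?thesis by metis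
  qed
  ultimately show ?thesis by blast
qed

text \<open>\<open>U\<close> relates two predicates on environments that are defined by the same formula in \<open>E\<close> and in \<open>E'\<close>.\<close>

locale elementary = zfc_model E for E :: "'v => 'v => bool" +
  fixes E' :: "nat => nat => bool" and h :: "nat => 'v"
  assumes el: "sat E' (inst p e) = sat E (inst p (%i. h (e i)))"
begin

definition U :: "((nat => 'v) => bool) => ((nat => nat) => bool) => bool" where
  "U Q Q' = (EX p. (ALL e. Q e = sat E (inst p e)) & (ALL e. Q' e = sat E' (inst p e)))"

lemma U_I: "(!!e. Q e = sat E (inst p e)) ==> (!!e. Q' e = sat E' (inst p e)) ==> U Q Q'" unfolding U_def by blast
lemma U: "U Q Q' ==> Q' e = Q (%i. h (e i))" unfolding U_def using el by metis

lemma U_mem: "U (%e. E (e i) (e k)) (%e. E' (e i) (e k))" by (rule U_I[of _ "FMem i k"]) simp_all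
lemma U_eq: "U (%e. e i = e k) (%e. e i = e k)" by (rule U_I[of _ "FEq i k"]) simp_all
lemma U_not: "U Q Q' ==> U (%e. ~ Q e) (%e. ~ Q' e)"
  unfolding U_def by (elim exE, rule_tac x = "FNeg p" in exI) simp
lemma U_and: "U Q Q' ==> U S S' ==> U (%e. Q e & S e) (%e. Q' e & S' e)"
  unfolding U_def by (elim exE, rule_tac x = "FAnd p pa" in exI) simp
lemma U_all: assumes "U (%e. Q (e 0) (%i. e (Suc i))) (%e. Q' (e 0) (%i. e (Suc i)))" shows "U (%e. ALL x. Q x e) (%e. ALL x. Q' x e)"
proof -
  obtain p where p: "ALL e. Q (e 0) (%i. e (Suc i)) = sat E (inst p e)" "ALL e. Q' (e 0) (%i. e (Suc i)) = sat E' (inst p e)"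
    using assms unfolding U_def by blast
  have "Q x e = sat E (inst p (case_nat x e))" for x e using p(1)[rule_format, of "case_nat x e"] by simp
  moreover have "Q' x e = sat E' (inst p (case_nat x e))" for x e using p(2)[rule_format, of "case_nat x e"] by simp
  ultimately show ?thesis by (intro U_I[of _ "FAll p"]) simp_all
qed
lemma U_true: "U (%_. True) (%_. True)" using U_all[OF U_eq[of 0 0]] by simp
lemma U_or: "U Q Q' ==> U S S' ==> U (%e. Q e | S e) (%e. Q' e | S' e)"
  using U_not[OF U_and[OF U_not[of Q Q'] U_not[of S S']]] by simp
lemma U_imp: "U Q Q' ==> U S S' ==> U (%e. Q e --> S e) (%e. Q' e --> S' e)"
  using U_or[OF U_not[of Q Q'], of S S'] by (simp only: imp_conv_disj)
lemma U_iff: "U Q Q' ==> U S S' ==> U (%e. Q e = S e) (%e. Q' e = S' e)"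
  using U_and[OF U_imp[of Q Q' S S'] U_imp[of S S' Q Q']] by (simp add: iff_conv_conj_imp)
lemma U_ex: "U (%e. Q (e 0) (%i. e (Suc i))) (%e. Q' (e 0) (%i. e (Suc i))) ==> U (%e. EX x. Q x e) (%e. EX x. Q' x e)"
  using U_not[OF U_all[of "%x e. ~ Q x e" "%x e. ~ Q' x e"]] U_not[of "%e. Q (e 0) (%i. e (Suc i))" "%e. Q' (e 0) (%i. e (Suc i))"] by simp
lemma U_inst: "U (%e. sat E (inst p (%i. e (f i)))) (%e. sat E' (inst p (%i. e (f i))))"
  by (rule U_I[of _ "ren f p"]) (simp_all add: inst_ren)
lemma U_inst2: "U (%e. sat E (inst p (case_nat (e k) (%i. e (f i))))) (%e. sat E' (inst p (case_nat (e k) (%i. e (f i)))))"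
proof -
  have "(%i. e (case_nat k f i)) = case_nat (e k) (%i. e (f i))" for e :: "nat => 'x" by (rule ext) (simp split: nat.split)
  from U_inst[of p "case_nat k f", unfolded this] show ?thesis .
qed
lemma U_inst3: "U (%e. sat E (inst p (case_nat (e k) (case_nat (e m) (%i. e (f i)))))) (%e. sat E' (inst p (case_nat (e k) (case_nat (e m) (%i. e (f i))))))"
proof -
  have "(%i. e (case_nat m f i)) = case_nat (e m) (%i. e (f i))" for e :: "nat => 'x" by (rule ext) (simp split: nat.split)
  from U_inst2[of p k "case_nat m f", unfolded this] show ?thesis .
qed

lemmas Us = U_mem U_eq U_not U_and U_or U_imp U_iff U_all U_ex U_inst2 U_inst3 U_true

lemma zfc_submodel: "zfc_model E'"
proof
  have c: "Q' (%_. 0)" if "U Q Q'" "Q (%_. h 0)" for Q Q' using U[OF that(1), of "%_. 0"] that(2) by simp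
  show "ALL x y. (ALL z. E' z x = E' z y) --> x = y" by (rule c[OF _ extensionality]) (intro Us)
  show "ALL x. (EX y. E' y x) --> (EX y. E' y x & (ALL z. E' z y --> ~ E' z x))" by (rule c[OF _ foundation]) (intro Us)
  show "ALL x y. EX u. ALL z. E' z u = (z = x | z = y)" by (rule c[OF _ pairing]) (intro Us)
  show "ALL x. EX u. ALL z. E' z u = (EX y. E' y x & E' z y)" by (rule c[OF _ union]) (intro Us)
  show "ALL x. EX u. ALL z. E' z u = (ALL w. E' w z --> E' w x)" by (rule c[OF _ power_set]) (intro Us)
  show "EX x. (EX y. E' y x & (ALL z. ~ E' z y)) & (ALL y. E' y x --> (EX u. E' u x & (ALL z. E' z u = (E' z y | z = y))))"
    by (rule c[OF _ infinity]) (intro Us)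
  show "ALL x. (ALL y. E' y x --> (EX z. E' z y)) & (ALL y y' z. E' y x & E' y' x & E' z y & E' z y' --> y = y') -->
      (EX c. ALL y. E' y x --> (EX! z. E' z y & E' z c))"
    unfolding Ex1_def by (rule c[OF _ choice[unfolded Ex1_def]]) (intro Us)
  show "ALL p e x. EX u. ALL z. E' z u = (E' z x & sat E' (inst p (case_nat z e)))"
  proof (intro allI)
    fix p e x
    have "U (%e. EX u. ALL z. E z u = (E z (e 0) & sat E (inst p (case_nat z (%i. e (Suc i))))))
       (%e. EX u. ALL z. E' z u = (E' z (e 0) & sat E' (inst p (case_nat z (%i. e (Suc i))))))" by (intro Us)
    from U[OF this, of "case_nat x e"] show "EX u. ALL z. E' z u = (E' z x & sat E' (inst p (case_nat z e)))"
      using separation by simp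
  qed
  show "ALL p e x. (ALL z. E' z x --> (EX! w. sat E' (inst p (case_nat z (case_nat w e))))) -->
      (EX u. ALL w. E' w u = (EX z. E' z x & sat E' (inst p (case_nat z (case_nat w e)))))"
  proof (intro allI)
    fix p e x
    let ?Q = "%E e. (ALL z. E z (e 0) --> (EX w. sat E (inst p (case_nat z (case_nat w (%i. e (Suc i))))) &
         (ALL y. sat E (inst p (case_nat z (case_nat y (%i. e (Suc i))))) --> y = w))) -->
      (EX u. ALL w. E w u = (EX z. E z (e 0) & sat E (inst p (case_nat z (case_nat w (%i. e (Suc i)))))))"
    have "U (%e. (ALL z. E z (e 0) --> (EX w. sat E (inst p (case_nat z (case_nat w (%i. e (Suc i))))) &
         (ALL y. sat E (inst p (case_nat z (case_nat y (%i. e (Suc i))))) --> y = w))) -->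
      (EX u. ALL w. E w u = (EX z. E z (e 0) & sat E (inst p (case_nat z (case_nat w (%i. e (Suc i))))))))
      (%e. (ALL z. E' z (e 0) --> (EX w. sat E' (inst p (case_nat z (case_nat w (%i. e (Suc i))))) &
         (ALL y. sat E' (inst p (case_nat z (case_nat y (%i. e (Suc i))))) --> y = w))) -->
      (EX u. ALL w. E' w u = (EX z. E' z (e 0) & sat E' (inst p (case_nat z (case_nat w (%i. e (Suc i))))))))" by (intro Us)
    from U[OF this, of "case_nat x e"] show "(ALL z. E' z x --> (EX! w. sat E' (inst p (case_nat z (case_nat w e))))) -->
      (EX u. ALL w. E' w u = (EX z. E' z x & sat E' (inst p (case_nat z (case_nat w e)))))"
      using replacement[unfolded Ex1_def] unfolding Ex1_def by simp
  qed
qed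

text \<open>Forcing a statement of fixed shape is a first-order property of the conditions and
  names, given by the same formula in both models. The renaming \<open>f\<close> makes the relation
  stable under binders.\<close>

definition W :: "((nat => 'v) => 'v form) => ((nat => nat) => nat form) => bool" where
  "W F F' = (ALL i j k f. U (%e. forces E (e i) (e j) (F (%n. e (f n))) (e k)) (%e. forces E' (e i) (e j) (F' (%n. e (f n))) (e k)))"

lemmas forcing_defs = forces.simps forces_mem_def forces_eq_def eq_step_def subset_step_def mem_step_def below_def Transitive_def Subset_def
  TripleIn_def IsCheckName_def FunctionOn_def IsFunction_def IsUnorderedPair_def IsPair_def PairIn_def sat_connectives sat.simps

lemma W_Mem: "W (%e. Mem (e a) (e b)) (%e. Mem (e a) (e b))" and W_Eq: "W (%e. Eq (e a) (e b)) (%e. Eq (e a) (e b))"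
  and W_Ground: "W (%e. Ground (e a)) (%e. Ground (e a))"
  unfolding W_def forcing_defs by (intro allI Us)+

lemma W_Neg: assumes "W F F'" shows "W (%e. Neg (F e)) (%e. Neg (F' e))"
  unfolding W_def forces.simps
proof (intro allI Us)
  fix i j k f
  show "U (%e. below E (e (Suc i)) (e (Suc j)) (e 0) (e (Suc k))) (%e. below E' (e (Suc i)) (e (Suc j)) (e 0) (e (Suc k)))"
    unfolding forcing_defs by (intro Us)
  show "U (%e. forces E (e (Suc i)) (e (Suc j)) (F (%n. e (Suc (f n)))) (e 0)) (%e. forces E' (e (Suc i)) (e (Suc j)) (F' (%n. e (Suc (f n)))) (e 0))"
    using assms[unfolded W_def, rule_format, of "Suc i" "Suc j" "%n. Suc (f n)" 0] .
qed

lemma W_And: assumes "W F F'" "W H H'" shows "W (%e. And (F e) (H e)) (%e. And (F' e) (H' e))"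
  using assms unfolding W_def forces.simps by (intro allI U_and) blast+

lemma W_All: assumes "W (%e. F (e 0) (%i. e (Suc i))) (%e. F' (e 0) (%i. e (Suc i)))" shows "W (%e. All (%x. F x e)) (%e. All (%x. F' x e))"
  unfolding W_def forces.simps
proof (intro allI U_all)
  fix i j k and f :: "nat => nat"
  show "U (%e. forces E (e (Suc i)) (e (Suc j)) (F (e 0) (%n. e (Suc (f n)))) (e (Suc k)))
      (%e. forces E' (e (Suc i)) (e (Suc j)) (F' (e 0) (%n. e (Suc (f n)))) (e (Suc k)))"
    using assms[unfolded W_def, rule_format, of "Suc i" "Suc j" "case_nat 0 (%n. Suc (f n))" "Suc k"] by simp
qed

lemma W_inst: "W (%e. inst p (%i. e (f i))) (%e. inst p (%i. e (f i)))"
proof (induction p arbitrary: f)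
  case (FAll p)
  have c: "(%i. e (case_nat 0 (%i. Suc (f i)) i)) = case_nat (e 0) (%i. e (Suc (f i)))" for e :: "nat => 'x"
    by (rule ext) (simp split: nat.split)
  show ?case unfolding inst.simps by (rule W_All) (use FAll.IH[of "case_nat 0 (%i. Suc (f i))", unfolded c] in simp)
qed (auto intro: W_Mem W_Eq W_Neg W_And)

lemma W_inst2: "W (%e. inst p (case_nat (e k) (%_. e m))) (%e. inst p (case_nat (e k) (%_. e m)))"
proof -
  have "(%i. e (case_nat k (%_. m) i)) = case_nat (e k) (%_. e m)" for e :: "nat => 'x" by (rule ext) (simp split: nat.split)
  from W_inst[of p "case_nat k (%_. m)", unfolded this] show ?thesis .
qed

lemmas Ws = W_Mem W_Eq W_Ground W_Neg W_And W_All W_inst2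

lemmas sat_defs = RegularCardinal_def Uncountable_def Inaccessible_def StrongLimit_def Cardinal_def LimitOrdinal_def IsOmega_def Ordinal_def
  Transitive_def Subset_def StrictSubset_def NonEmpty_def SizeLess_def Bijection_def FunctionTo_def FunctionOn_def IsFunction_def PairIn_def
  IsPair_def IsUnorderedPair_def IsLevyCollapse_def LevyCondition_def IsAdd_def AddCondition_def ShortSequence_def IsProductForcing_def
  IsOrderOn_def IsCheckName_def sat_connectives sat.simps

lemma sat_transfer:
  shows "E' a b = E (h a) (h b)" "sat E' (RegularCardinal a) = sat E (RegularCardinal (h a))" "sat E' (Uncountable a) = sat E (Uncountable (h a))"
    "sat E' (Inaccessible a) = sat E (Inaccessible (h a))" "sat E' (IsLevyCollapse a b d k) = sat E (IsLevyCollapse (h a) (h b) (h d) (h k))"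
    "sat E' (IsAdd a b d k) = sat E (IsAdd (h a) (h b) (h d) (h k))" "sat E' (IsCheckName a b d) = sat E (IsCheckName (h a) (h b) (h d))"
    "sat E' (IsProductForcing a b d k m n) = sat E (IsProductForcing (h a) (h b) (h d) (h k) (h m) (h n))"
proof -
  let ?e = "%i. [a, b, d, k, m, n] ! i"
  have 1: "U (%e. E (e 0) (e 1)) (%e. E' (e 0) (e 1))" by (rule U_mem)
  have 2: "U (%e. sat E (RegularCardinal (e 0))) (%e. sat E' (RegularCardinal (e 0)))" unfolding sat_defs by (intro Us)
  have 3: "U (%e. sat E (Uncountable (e 0))) (%e. sat E' (Uncountable (e 0)))" unfolding sat_defs by (intro Us)
  have 4: "U (%e. sat E (Inaccessible (e 0))) (%e. sat E' (Inaccessible (e 0)))" unfolding sat_defs by (intro Us)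
  have 5: "U (%e. sat E (IsLevyCollapse (e 0) (e 1) (e 2) (e 3))) (%e. sat E' (IsLevyCollapse (e 0) (e 1) (e 2) (e 3)))" unfolding sat_defs by (intro Us)
  have 6: "U (%e. sat E (IsAdd (e 0) (e 1) (e 2) (e 3))) (%e. sat E' (IsAdd (e 0) (e 1) (e 2) (e 3)))" unfolding sat_defs by (intro Us)
  have 7: "U (%e. sat E (IsCheckName (e 0) (e 1) (e 2))) (%e. sat E' (IsCheckName (e 0) (e 1) (e 2)))" unfolding sat_defs by (intro Us)
  have 8: "U (%e. sat E (IsProductForcing (e 0) (e 1) (e 2) (e 3) (e 4) (e 5))) (%e. sat E' (IsProductForcing (e 0) (e 1) (e 2) (e 3) (e 4) (e 5)))"
    unfolding sat_defs by (intro Us)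
  show "E' a b = E (h a) (h b)" "sat E' (RegularCardinal a) = sat E (RegularCardinal (h a))" "sat E' (Uncountable a) = sat E (Uncountable (h a))"
    "sat E' (Inaccessible a) = sat E (Inaccessible (h a))" "sat E' (IsLevyCollapse a b d k) = sat E (IsLevyCollapse (h a) (h b) (h d) (h k))"
    "sat E' (IsAdd a b d k) = sat E (IsAdd (h a) (h b) (h d) (h k))" "sat E' (IsCheckName a b d) = sat E (IsCheckName (h a) (h b) (h d))"
    "sat E' (IsProductForcing a b d k m n) = sat E (IsProductForcing (h a) (h b) (h d) (h k) (h m) (h n))"
    using U[OF 1, of ?e] U[OF 2, of ?e] U[OF 3, of ?e] U[OF 4, of ?e] U[OF 5, of ?e] U[OF 6, of ?e] U[OF 7, of ?e] U[OF 8, of ?e]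
    by (simp_all add: eval_nat_numeral)
qed

lemma forces_transfer: "U (%e. forces E (e i) (e j) (All (%f. All (%A. Imp (And (FunctionToGround f (e m)) (DefinedBy q f (e m) A)) (Determined (e m) A)))) (e k))
    (%e. forces E' (e i) (e j) (All (%f. All (%A. Imp (And (FunctionToGround f (e m)) (DefinedBy q f (e m) A)) (Determined (e m) A)))) (e k))"
proof -
  have "W (%e. All (%f. All (%A. Imp (And (FunctionToGround f (e m)) (DefinedBy q f (e m) A)) (Determined (e m) A))))
    (%e. All (%f. All (%A. Imp (And (FunctionToGround f (e m)) (DefinedBy q f (e m) A)) (Determined (e m) A))))"
    unfolding Imp_def Or_def Iff_def Ex_def Subset_def StrictSubset_def NonEmpty_def IsUnorderedPair_def IsPair_def
      PairIn_def IsFunction_def FunctionOn_def FunctionTo_def IsSuccessorOf_def ShortSequence_def Even_def Odd_def Play_def LegalMove_def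
      Strategy_def IsRestriction_def RunAccordingTo_def OutcomeIn_def PlayerIWins_def PlayerIIWins_def Determined_def
      FunctionToGround_def DefinedBy_def
    by (intro Ws)
  from this[unfolded W_def, rule_format, of i j "%n. n" k] show ?thesis .
qed

end

theorem theorem3p28:
  fixes E :: "'v \<Rightarrow> 'v \<Rightarrow> bool"
    and lam mu nu Col RCol Add RAdd P R lam_name :: 'v
    and \<phi> :: fm
  assumes "zfc_model E"
    and "sat E (RegularCardinal lam)" and "sat E (Uncountable lam)"
    and "sat E (Inaccessible mu)" and "sat E (lam \<^bold>\<in> mu)"
    and "sat E (Cardinal nu)"
    and "sat E (IsLevyCollapse lam mu Col RCol)"
    and "sat E (IsAdd lam nu Add RAdd)"
    and "sat E (IsProductForcing Col RCol Add RAdd P R)"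
    and "sat E (IsCheckName P lam_name lam)"
  shows "notion_forces E P R (\<^bold>\<forall>f A. FunctionToGround f lam_name \<^bold>\<and> DefinedBy \<phi> f lam_name A
           \<^bold>\<longrightarrow> Determined lam_name A)"
  unfolding notion_forces_def
proof (intro allI impI)
  fix p assume p: "E p P"
  interpret V: zf E using assms(1) by (rule zf.intro)
  \<comment> \<open>The condition \<open>p\<close> is among the parameters, since the forcing
    statement is pulled back at \<open>p\<close>; it also fills the remaining places.\<close>
  let ?l = "[lam, mu, nu, Col, RCol, Add, RAdd, P, R, lam_name, p]" let ?par = "%i. if i < 11 then ?l ! i else p"
  obtain E' :: "nat => nat => bool" and h c where el: "ALL p e. sat E' (inst p e) = sat E (inst p (%i. h (e i)))" and c: "ALL i. h (c i) = ?par i"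
    using V.elementary_submodel[of ?par] by blast
  interpret elementary E E' h by (intro elementary.intro assms(1) elementary_axioms.intro) (use el in blast)
  have S: "sat E' (RegularCardinal (c 0))" "sat E' (Uncountable (c 0))" "sat E' (Inaccessible (c 1))" "E' (c 0) (c 1)"
    "sat E' (IsLevyCollapse (c 0) (c 1) (c 3) (c 4))" "sat E' (IsAdd (c 0) (c 2) (c 5) (c 6))"
    "sat E' (IsProductForcing (c 3) (c 4) (c 5) (c 6) (c 7) (c 8))" "sat E' (IsCheckName (c 7) (c 9) (c 0))" "E' (c 10) (c 7)"
    unfolding sat_transfer using assms p c by simp_all
  interpret N: notion E' "c 0" "c 1" "c 2" "c 3" "c 4" "c 5" "c 6" "c 7" "c 8"
    by (intro notion.intro zf.intro zfc_submodel notion_axioms.intro) (use S in simp_all)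
  have "forces E' (c 7) (c 8) (\<^bold>\<forall>f A. FunctionToGround f (c 9) \<^bold>\<and> DefinedBy \<phi> f (c 9) A \<^bold>\<longrightarrow> Determined (c 9) A) (c 10)"
    by (rule N.forced) (use S in simp_all)
  hence "forces E (h (c 7)) (h (c 8)) (\<^bold>\<forall>f A. FunctionToGround f (h (c 9)) \<^bold>\<and> DefinedBy \<phi> f (h (c 9)) A \<^bold>\<longrightarrow> Determined (h (c 9)) A) (h (c 10))"
    using U[OF forces_transfer[of 7 8 9 \<phi> 10], of c] by blast
  thus "forces E P R (\<^bold>\<forall>f A. FunctionToGround f lam_name \<^bold>\<and> DefinedBy \<phi> f lam_name A \<^bold>\<longrightarrow> Determined lam_name A) p"
    using c by simp
qed

end
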